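(* Let $\alpha=1$ and assume (in addition to the standing assumptions of the context) that $V_0$ is not almost everywhere zero and satisfies $(1+|\cdot|)V_0\in L^1(\mathbb{R})$. Let $N$ be the number of negative eigenvalues of $D_x^2+V_0$ on $L^2(\mathbb{R})$ and, for $n=1,\dots,N$, denote by $\lambda_{n,V_0}$ the $n$-th negative eigenvalue (in increasing order) of $D_x^2+V_0$ and by $\varphi_{n,V_0}$ its corresponding $L^2$-normalized eigenfunction. Then there exists $\varepsilon_0>0$ such that for any $\varepsilon\in(0,\varepsilon_0)$, $\mathcal{L}_{\varepsilon,1}$ has at least $N$ negative eigenvalues $\lambda_{n,\varepsilon}$, $n=1,\dots,N$, satisfying $$\lambda_{n,\varepsilon}=\varepsilon^2\lambda_{n,V_0}+\mathcal{O}(\varepsilon^4),$$ with corresponding $L^2$-normalized eigenfunctions $\psi_{n,\varepsilon}$ (with suitably chosen signs) satisfying $$\big\|\psi_{n,\varepsilon}(x)-\varepsilon^{1/2}\varphi_{n,V_0}(\varepsilon x)\big\|_{L^2(\mathbb{R})}=\mathcal{O}(\varepsilon^2).$$ If it exists, any other negative eigenvalue $\tilde\lambda_\varepsilon$ of $\mathcal{L}_{\varepsilon,1}$ satisfies $\tilde\lambda_\varepsilon=\mathcal{O}(\varepsilon^4)$.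
   Context: Notation: $\mathbb{T}=\mathbb{R}/\mathbb{Z}$, $D_x=\frac1i\frac{d}{dx}$ (similarly $D_y,D_X$), $\langle X\rangle=(1+|X|^2)^{1/2}$. $W^{\ell,\infty}(\mathbb{R}\times\mathbb{T}):=W^{\ell,\infty}(\mathbb{R};L^\infty(\mathbb{T}))$, with norm $\sup_{0\le l\le \ell}\|\partial_X^l q\|_{L^\infty(\mathbb{R}\times\mathbb{T})}$. The potential $q=q(X,y)$ is real-valued, $1$-periodic in $y$. For fixed $X$, $Q(X,\cdot)$ is the unique solution of $D_y^2Q(X,y)=-q(X,y)$ on $\mathbb{T}$ with $\int_{\mathbb{T}}Q(X,y)\,dy=0$, and $$V_0(X)=-\int_{\mathbb{T}}|\partial_yQ|^2(X,y)\,dy,\qquad V_1(X)=2\int_{\mathbb{T}}(\partial_XQ)(\partial_yQ)(X,y)\,dy .$$ Standing assumptions: $q\in W^{5,\infty}(\mathbb{R}\times\mathbb{T})$, $\int_{\mathbb{T}}q(X,y)\,dy=0$ for all $X$, $\langle\cdot\rangle V_0'\in L^\infty(\mathbb{R})$, $\langle\cdot\rangle V_1'\in L^\infty(\mathbb{R})$, and $V_0(X),V_1(X)\to0$ as $|X|\to\infty$. Operator on $L^2(\mathbb{R})$ (with domain $H^2(\mathbb{R})$): $\mathcal{L}_{\varepsilon,\alpha}=D_x^2+q(\varepsilon^\alpha x,x/\varepsilon)$; here $\alpha=1$. Negative eigenvalues are simple. The $\mathcal{O}(\cdot)$ are as $\varepsilon\to0$, with constants depending on $q$ but not on $\varepsilon$.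 *)

theory Defs
  imports "HOL-Analysis.Analysis"
begin

(* Functions on the torus R/Z are represented by 1-periodic functions on R, and classes of
   functions modulo null sets by Borel representatives. *)

definition periodic1 :: "(real \<Rightarrow> 'a) \<Rightarrow> bool" where
  "periodic1 f \<longleftrightarrow> (\<forall>y. f (y + 1) = f y)"

definition torus_integral :: "(real \<Rightarrow> real) \<Rightarrow> real" where
  "torus_integral f = set_lebesgue_integral lborel {0..1} f"

definition L_infty :: "('b::euclidean_space \<Rightarrow> real) \<Rightarrow> bool" where
  "L_infty f \<longleftrightarrow> f \<in> borel_measurable borel \<and> (\<exists>C. AE z in lborel. \<bar>f z\<bar> \<le> C)"

definition L2 :: "(real \<Rightarrow> complex) \<Rightarrow> bool" where
  "L2 u \<longleftrightarrow> u \<in> borel_measurable borel \<and> integrable lborel (\<lambda>x. (cmod (u x))\<^sup>2)"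

definition L2_norm :: "(real \<Rightarrow> complex) \<Rightarrow> real" where
  "L2_norm u = sqrt (LINT x|lborel. (cmod (u x))\<^sup>2)"

definition japanese_bracket :: "real \<Rightarrow> real" where
  "japanese_bracket X = sqrt (1 + \<bar>X\<bar>\<^sup>2)"

(* Weak derivatives are tested against compactly supported C^1 functions, as in the definition
   of one-dimensional Sobolev spaces in Brezis' textbook; smooth test functions give the same
   notion. *)

definition test_function :: "(real \<Rightarrow> real) \<Rightarrow> bool" where
  "test_function \<phi> \<longleftrightarrow> \<phi> C1_differentiable_on UNIV \<and> compact (closure {x. \<phi> x \<noteq> 0})"

definition locally_integrable :: "(real \<Rightarrow> 'a::euclidean_space) \<Rightarrow> bool" where
  "locally_integrable u \<longleftrightarrow> (\<forall>a b. set_integrable lborel {a..b} u)"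

definition weak_deriv :: "(real \<Rightarrow> 'a::euclidean_space) \<Rightarrow> (real \<Rightarrow> 'a) \<Rightarrow> bool" where
  "weak_deriv u v \<longleftrightarrow> locally_integrable u \<and> locally_integrable v \<and>
     (\<forall>\<phi>. test_function \<phi> \<longrightarrow>
        (LINT x|lborel. deriv \<phi> x *\<^sub>R u x) = - (LINT x|lborel. \<phi> x *\<^sub>R v x))"

(* The space W^{m,infinity}(R; L^infinity(T)): the identity defining the weak X-derivative holds
   in L^infinity(T), that is, for each test function it holds for almost every y. *)

definition weak_deriv_X :: "(real \<Rightarrow> real \<Rightarrow> real) \<Rightarrow> (real \<Rightarrow> real \<Rightarrow> real) \<Rightarrow> bool" where
  "weak_deriv_X g h \<longleftrightarrow> (\<forall>\<phi>. test_function \<phi> \<longrightarrow>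
     (AE y in lborel. (LINT X|lborel. deriv \<phi> X * g X y) = - (LINT X|lborel. \<phi> X * h X y)))"

definition W_infty :: "nat \<Rightarrow> (real \<Rightarrow> real \<Rightarrow> real) \<Rightarrow> bool" where
  "W_infty m q \<longleftrightarrow> (\<exists>g. g 0 = q \<and>
     (\<forall>l\<le>m. (\<forall>X. periodic1 (g l X)) \<and> L_infty (\<lambda>(X, y). g l X y)) \<and>
     (\<forall>l<m. weak_deriv_X (g l) (g (Suc l))))"

(* Elements of W^{1,infinity}(R; L^infinity(T)) are identified with their representative that is
   continuous in X for almost every y.  This gives q(X,.) a meaning for each single X, and makes
   x |-> q(eps^alpha x, x/eps) well defined up to a null set although it is the restriction of q
   to a curve. *)

definition continuous_in_X :: "(real \<Rightarrow> real \<Rightarrow> real) \<Rightarrow> bool" where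
  "continuous_in_X q \<longleftrightarrow> (AE y in lborel. continuous_on UNIV (\<lambda>X. q X y))"

(* D_y^2 u = -f on the torus with mean zero, in the weak sense; since D_y^2 = -(d/dy)^2, the
   equation is -w = -f for the weak second derivative w of u.  Continuity selects the
   representative of u. *)

definition cell_solution :: "(real \<Rightarrow> real) \<Rightarrow> (real \<Rightarrow> real) \<Rightarrow> bool" where
  "cell_solution f u \<longleftrightarrow> periodic1 u \<and> continuous_on UNIV u \<and>
     (\<exists>p w. weak_deriv u p \<and> weak_deriv p w \<and> (AE y in lborel. - w y = - f y)) \<and>
     torus_integral u = 0"

definition corrector :: "(real \<Rightarrow> real \<Rightarrow> real) \<Rightarrow> real \<Rightarrow> real \<Rightarrow> real" where
  "corrector q X = (THE u. cell_solution (q X) u)"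

(* For q in W^{2,infinity}(R; L^infinity(T)) with mean zero, the partial derivatives of the
   corrector exist everywhere in the classical sense, so deriv is applicable. *)

definition V0 :: "(real \<Rightarrow> real \<Rightarrow> real) \<Rightarrow> real \<Rightarrow> real" where
  "V0 q X = - torus_integral (\<lambda>y. \<bar>deriv (\<lambda>y'. corrector q X y') y\<bar>\<^sup>2)"

definition V1 :: "(real \<Rightarrow> real \<Rightarrow> real) \<Rightarrow> real \<Rightarrow> real" where
  "V1 q X = 2 * torus_integral
     (\<lambda>y. deriv (\<lambda>X'. corrector q X' y) X * deriv (\<lambda>y'. corrector q X y') y)"

(* Graph of the operator D_x^2 + V on L^2(R) with domain H^2(R), for a bounded real V:
   u is in H^2(R) with weak derivatives u', u'' and f = -u'' + V u. *)

definition schroedinger :: "(real \<Rightarrow> real) \<Rightarrow> (real \<Rightarrow> complex) \<Rightarrow> (real \<Rightarrow> complex) \<Rightarrow> bool" where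
  "schroedinger V u f \<longleftrightarrow> (\<exists>u' u''. L2 u \<and> L2 u' \<and> L2 u'' \<and> weak_deriv u u' \<and> weak_deriv u' u'' \<and>
     L2 f \<and> (AE x in lborel. f x = - u'' x + of_real (V x) * u x))"

definition eigenfunction :: "(real \<Rightarrow> real) \<Rightarrow> real \<Rightarrow> (real \<Rightarrow> complex) \<Rightarrow> bool" where
  "eigenfunction V \<mu> u \<longleftrightarrow> schroedinger V u (\<lambda>x. of_real \<mu> * u x) \<and> \<not> (AE x in lborel. u x = 0)"

definition normalized_eigenfunction :: "(real \<Rightarrow> real) \<Rightarrow> real \<Rightarrow> (real \<Rightarrow> complex) \<Rightarrow> bool" where
  "normalized_eigenfunction V \<mu> u \<longleftrightarrow> eigenfunction V \<mu> u \<and> L2_norm u = 1"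

definition negative_eigenvalues :: "(real \<Rightarrow> real) \<Rightarrow> real set" where
  "negative_eigenvalues V = {\<mu>. \<mu> < 0 \<and> (\<exists>u. eigenfunction V \<mu> u)}"

(* n = 1, 2, ...; meaningful only when the set of negative eigenvalues is finite. *)
definition nth_negative_eigenvalue :: "(real \<Rightarrow> real) \<Rightarrow> nat \<Rightarrow> real" where
  "nth_negative_eigenvalue V n = sorted_list_of_set (negative_eigenvalues V) ! (n - 1)"

definition oscillating_potential ::
    "(real \<Rightarrow> real \<Rightarrow> real) \<Rightarrow> real \<Rightarrow> real \<Rightarrow> real \<Rightarrow> real" where
  "oscillating_potential q \<epsilon> \<alpha> x = q (\<epsilon> powr \<alpha> * x) (x / \<epsilon>)"

end

theory Submission
  imports Defs
begin

text \<open>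
With \<open>X = \<epsilon> x\<close> and \<open>\<delta> = \<epsilon>\<^sup>2\<close>, unitary rescaling turns the oscillating operator into
\<open>\<epsilon>\<^sup>2\<close> times \<open>H = D\<^sup>2 + q (X, X / \<delta>) / \<delta>\<close>. So it is enough that the negative eigenvalues
and eigenfunctions of \<open>H\<close> differ by \<open>O(\<delta>)\<close> from those of \<open>D\<^sup>2 + V0\<close>, up to eigenvalues of
size \<open>O(\<delta>)\<close>.

The potential of \<open>H\<close> has size \<open>1 / \<delta>\<close>, but its quadratic form becomes \<open>O(\<delta>)\<close>-close to the
effective one, uniformly in the norm of the Sobolev space \<open>H\<^sup>1\<close>, after the substitution
\<open>u = m v\<close> with \<open>m = 1 + \<delta> Q (X, X / \<delta>)\<close>, where \<open>Q\<close> is the corrector. Put \<open>p = \<partial>\<^sub>y Q\<close>, so that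
\<open>\<partial>\<^sub>y p = q\<close>. By the chain rule \<open>q / \<delta>\<close> is, on the curve \<open>y = X / \<delta>\<close>, the total derivative of
\<open>p\<close> minus \<open>\<partial>\<^sub>X p\<close>. Integrating by parts removes the large term; since \<open>m' = p + O(\<delta>)\<close>, the terms
\<open>p (v w)'\<close> cancel to leading order and the potential \<open>- (p\<^sup>2 + \<partial>\<^sub>X p)\<close> remains.
The mean of this over \<open>y\<close> is \<open>V0\<close>, so the difference \<open>p\<^sup>2 + \<partial>\<^sub>X p + V0\<close> has a periodic
antiderivative \<open>Z\<close> in \<open>y\<close>, and a second integration by parts shows that it contributes \<open>O(\<delta>)\<close>
only. This is \<open>form_comparison\<close>.

Nearby forms have nearby negative eigenpairs. This is the abstract theorem \<open>perturbation\<close>: an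
eigenvector of the perturbed pair of forms, tested against the unperturbed eigenvectors and against
their complement, is either attached to an eigenvalue of size \<open>O(\<delta>)\<close> or close to one
unperturbed eigenvector; \<open>N\<close> orthogonal eigenvectors exist by minimization, and orthogonal ones
cannot be close to the same unperturbed eigenvector.

Compactness enters through finitely many point evaluations. If \<open>(1 + \<bar>x\<bar>) V\<close> is integrable, then
\<open>\<integral> \<bar>V\<bar> v\<^sup>2\<close> is at most half of \<open>\<integral> v'\<^sup>2\<close> plus a multiple of \<open>\<Sum> (v x)\<^sup>2\<close> over a finite set of
points (\<open>bargmann\<close>). Hence there are finitely many negative eigenvalues, and minimizing sequences
along which these finitely many numbers converge are Cauchy. Together with the simplicity of the
eigenvalues this verifies the hypotheses of the perturbation theorem for \<open>D\<^sup>2 + V0\<close>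
(\<open>spectral_decomposition\<close>).

Finally, \<open>q\<close> is merely measurable in \<open>y\<close> and weakly differentiable in \<open>X\<close>. Testing with a countable
family of test functions shows that for almost every \<open>y\<close> it is twice differentiable in \<open>X\<close> with
Lipschitz second derivative (\<open>slow_families\<close>); two antiderivatives in \<open>y\<close> with mean zero keep these
bounds for every \<open>y\<close>, and \<open>primitive_along_curve\<close> gives the chain rule on the curve \<open>y = X / \<delta>\<close>.
\<close>

section \<open>Symmetric forms on a Hilbert space and their eigenvectors\<close>

text \<open>
A homogeneous linear system with more unknowns than equations has a nontrivial solution; Gaussian
elimination of one equation at a time. It supplies test vectors annihilated by given functionals.
\<close>
lemma exists_nontrivial_coeffs:
  fixes a :: "'i \<Rightarrow> 'j \<Rightarrow> real"
  assumes "finite I" "finite J" "card I < card J"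
  shows "\<exists>c. (\<exists>j\<in>J. c j \<noteq> 0) \<and> (\<forall>i\<in>I. (\<Sum>j\<in>J. c j * a i j) = 0)"
  using assms
proof (induction I arbitrary: J a rule: finite_induct)
  case empty
  then obtain j where "j \<in> J" by (metis card.empty card_gt_0_iff ex_in_conv)
  then show ?case by (intro exI[of _ "\<lambda>_. 1"]) auto
next
  case (insert i0 I)
  show ?case
  proof (cases "\<forall>j\<in>J. a i0 j = 0")
    case True
    have "card I < card J" using insert by auto
    from insert.IH[OF insert.prems(1) this, of a] obtain c
      where "\<exists>j\<in>J. c j \<noteq> 0" "\<forall>i\<in>I. (\<Sum>j\<in>J. c j * a i j) = 0" by auto
    with True show ?thesis by (intro exI[of _ c]) auto
  next
    case False
    then obtain j0 where j0: "j0 \<in> J" "a i0 j0 \<noteq> 0" by auto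
    define J' where "J' = J - {j0}"
    have fin: "finite J'" and cd: "card I < card J'"
      using insert j0 by (auto simp: J'_def)
    \<comment> \<open>the system after the unknown \<open>j0\<close> has been eliminated by means of equation \<open>i0\<close>\<close>
    define a' where "a' i j = a i j - a i j0 * a i0 j / a i0 j0" for i j
    from insert.IH[OF fin cd, of a'] obtain c
      where c: "\<exists>j\<in>J'. c j \<noteq> 0" "\<forall>i\<in>I. (\<Sum>j\<in>J'. c j * a' i j) = 0" by auto
    define c0 where "c0 = - (\<Sum>j\<in>J'. c j * a i0 j) / a i0 j0"
    define d where "d = c(j0 := c0)"
    have sumd: "(\<Sum>j\<in>J. d j * a i j) = c0 * a i j0 + (\<Sum>j\<in>J'. c j * a i j)" for i
    proof -
      have "(\<Sum>j\<in>J. d j * a i j) = d j0 * a i j0 + (\<Sum>j\<in>J'. d j * a i j)"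
        unfolding J'_def using insert.prems(1) j0(1) by (rule sum.remove)
      also have "(\<Sum>j\<in>J'. d j * a i j) = (\<Sum>j\<in>J'. c j * a i j)"
        by (rule sum.cong) (auto simp: d_def J'_def)
      finally show ?thesis by (simp add: d_def)
    qed
    have "(\<Sum>j\<in>J. d j * a i j) = 0" if "i \<in> I" for i
    proof -
      have "0 = (\<Sum>j\<in>J'. c j * a' i j)" using c(2) that by simp
      also have "\<dots> = (\<Sum>j\<in>J'. c j * a i j) - (\<Sum>j\<in>J'. c j * a i0 j) * (a i j0 / a i0 j0)"
        unfolding a'_def right_diff_distrib sum_subtractf sum_distrib_right
        by (simp add: mult_ac)
      finally show ?thesis by (simp add: sumd c0_def)
    qed
    moreover have "(\<Sum>j\<in>J. d j * a i0 j) = 0"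
      using j0 by (simp add: sumd c0_def)
    moreover have "\<exists>j\<in>J. d j \<noteq> 0" using c(1) by (auto simp: d_def J'_def)
    ultimately show ?thesis by (intro exI[of _ d]) auto
  qed
qed

text \<open>
Operators are represented by their forms: the eigenvalue equation of a pair of forms \<open>h\<close>, \<open>b\<close> is
\<open>h v w = \<mu> * b v w\<close> for all \<open>w\<close>, where \<open>b\<close> plays the role of the inner product of \<open>L\<^sup>2\<close>.
\<close>
definition sym_form :: "('a::real_normed_vector \<Rightarrow> 'a \<Rightarrow> real) \<Rightarrow> bool" where
  "sym_form B \<longleftrightarrow> bounded_bilinear B \<and> (\<forall>v w. B v w = B w v)"

lemma sym_form_bilinear: "sym_form B \<Longrightarrow> bounded_bilinear B"
  by (simp add: sym_form_def)

lemma sym_form_commute: "sym_form B \<Longrightarrow> B v w = B w v"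
  by (simp add: sym_form_def)

lemmas sym_form_simps =
  bounded_bilinear.add_left[OF sym_form_bilinear] bounded_bilinear.add_right[OF sym_form_bilinear]
  bounded_bilinear.diff_left[OF sym_form_bilinear] bounded_bilinear.diff_right[OF sym_form_bilinear]
  bounded_bilinear.minus_left[OF sym_form_bilinear] bounded_bilinear.minus_right[OF sym_form_bilinear]
  bounded_bilinear.scaleR_left[OF sym_form_bilinear] bounded_bilinear.scaleR_right[OF sym_form_bilinear]
  bounded_bilinear.sum_left[OF sym_form_bilinear] bounded_bilinear.sum_right[OF sym_form_bilinear]
  bounded_bilinear.zero_left[OF sym_form_bilinear] bounded_bilinear.zero_right[OF sym_form_bilinear]

lemma sym_form_bound:
  assumes "sym_form B"
  obtains M where "0 < M" "\<And>v w. \<bar>B v w\<bar> \<le> M * norm v * norm w"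
  using bounded_bilinear.pos_bounded[OF sym_form_bilinear[OF assms]]
  by (metis mult.commute mult.left_commute real_norm_def)

lemma sym_form_shift:
  assumes h: "sym_form h" and b: "sym_form b"
  shows "sym_form (\<lambda>v w. h v w - m * b v w)"
proof -
  obtain M where M: "\<And>v w. \<bar>h v w\<bar> \<le> M * norm v * norm w" using sym_form_bound[OF h] by metis
  obtain M' where M': "\<And>v w. \<bar>b v w\<bar> \<le> M' * norm v * norm w" using sym_form_bound[OF b] by metis
  show ?thesis
    unfolding sym_form_def
  proof (intro conjI allI bounded_bilinear.intro exI)
    fix v w
    have "\<bar>m * b v w\<bar> \<le> \<bar>m\<bar> * (M' * norm v * norm w)"
      using M'[of v w] by (simp add: abs_mult mult_left_mono)
    then show "norm (h v w - m * b v w) \<le> norm v * norm w * (M + \<bar>m\<bar> * M')"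
      using M[of v w] by (simp add: algebra_simps)
    show "h v w - m * b v w = h w v - m * b w v"
      using sym_form_commute[OF h] sym_form_commute[OF b] by metis
  qed (simp_all add: sym_form_simps[OF h] sym_form_simps[OF b] algebra_simps)
qed

lemma finite_family_convergent_subseq:
  fixes f :: "'i \<Rightarrow> nat \<Rightarrow> real"
  assumes "finite I" "\<And>i. i \<in> I \<Longrightarrow> bounded (range (f i))"
  shows "\<exists>r. strict_mono r \<and> (\<forall>i\<in>I. convergent (\<lambda>n. f i (r n)))"
  using assms
proof (induction I rule: finite_induct)
  case empty
  show ?case by (intro exI[of _ id]) (auto simp: strict_mono_def)
next
  case (insert j I)
  then obtain r where r: "strict_mono r" "\<forall>i\<in>I. convergent (\<lambda>n. f i (r n))" by auto
  have "bounded (range (\<lambda>n. f j (r n)))"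
    using insert.prems[of j] by (rule bounded_subset) auto
  from bounded_imp_convergent_subsequence[OF this] obtain l s
    where s: "strict_mono s" "((\<lambda>n. f j (r n)) \<circ> s) \<longlonglongrightarrow> l" by auto
  have "convergent (\<lambda>n. f i (r (s n)))" if "i \<in> I" for i
    using convergent_subseq_convergent[OF r(2)[rule_format, OF that] s(1)] by (simp add: o_def)
  moreover have "convergent (\<lambda>n. f j (r (s n)))"
    using s(2) by (auto simp: convergent_def o_def)
  ultimately show ?case
    using strict_mono_o[OF r(1) s(1)] by (intro exI[of _ "\<lambda>n. r (s n)"]) (auto simp: o_def)
qed

lemma Cauchy_of_square_bound:
  fixes x :: "nat \<Rightarrow> 'a::real_normed_vector"
  assumes "\<And>m n. (norm (x m - x n))\<^sup>2 \<le> g m + g n" "g \<longlonglongrightarrow> 0"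
  shows "Cauchy x"
proof (rule CauchyI)
  fix e :: real assume e: "0 < e"
  then have "eventually (\<lambda>n. g n < e\<^sup>2 / 2) sequentially"
    using order_tendstoD(2)[OF assms(2), of "e\<^sup>2 / 2"] by simp
  then obtain M where M: "\<And>n. n \<ge> M \<Longrightarrow> g n < e\<^sup>2 / 2"
    by (auto simp: eventually_sequentially)
  have "norm (x m - x n) < e" if "m \<ge> M" "n \<ge> M" for m n
  proof -
    have "(norm (x m - x n))\<^sup>2 < e\<^sup>2"
      using assms(1)[of m n] M[OF that(1)] M[OF that(2)] by simp
    then show ?thesis using e by (simp add: power_less_imp_less_base)
  qed
  then show "\<exists>M. \<forall>m\<ge>M. \<forall>n\<ge>M. norm (x m - x n) < e" by blast
qed

text \<open>
The first-order condition at the minimum of a quadratic polynomial.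
\<close>
lemma linear_term_zero_of_nonneg:
  fixes \<alpha> \<beta> :: real
  assumes "\<And>t. 0 \<le> 2 * t * \<alpha> + t\<^sup>2 * \<beta>"
  shows "\<alpha> = 0"
proof -
  have b: "0 \<le> \<beta>" using assms[of 1] assms[of "-1"] by simp
  let ?t = "- \<alpha> / (\<beta> + 1)"
  have "2 * ?t * \<alpha> + ?t\<^sup>2 * \<beta> = - (\<alpha>\<^sup>2 * (\<beta> + 2) / (\<beta> + 1)\<^sup>2)"
    using b by (simp add: field_simps power2_eq_square add_nonneg_eq_0_iff)
  with assms[of ?t] have "\<alpha>\<^sup>2 * (\<beta> + 2) / (\<beta> + 1)\<^sup>2 \<le> 0" by simp
  moreover have "0 < (\<beta> + 2) / (\<beta> + 1)\<^sup>2" using b by simp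
  ultimately have "\<alpha>\<^sup>2 \<le> 0"
    by (metis mult_le_0_iff not_le times_divide_eq_right)
  then show ?thesis by simp
qed

text \<open>
Existence of an eigenvector below \<open>E\<close>, \<open>b\<close>-orthogonal to given ones, as soon as the Rayleigh quotient
takes a value below \<open>E\<close> on their orthogonal complement. The infimum \<open>m\<close> of the quotient is attained:
the coercivity hypothesis bounds the norm by the form \<open>h - E * b\<close>, up to the finitely many functionals
\<open>L i\<close>. After passing to a subsequence along which these converge, a minimizing sequence is Cauchy in
norm, because \<open>h - m * b\<close> is nonnegative and satisfies a parallelogram inequality. The minimizer
satisfies the eigenvalue equation against the complement by the first-order condition, and against the
given eigenvectors by symmetry.
\<close>
lemma eigenvector_by_minimization:
  fixes h b :: "'a::{real_inner,complete_space} \<Rightarrow> 'a \<Rightarrow> real"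
  assumes h: "sym_form h" and b: "sym_form b"
    and pos: "\<And>v. v \<noteq> 0 \<Longrightarrow> 0 < b v v"
    and below: "\<And>v. - K * b v v \<le> h v v"
    and I: "finite I" "\<And>i. i \<in> I \<Longrightarrow> bounded_linear (L i)"
    and c: "0 < c" and coer: "\<And>v. c * (norm v)\<^sup>2 - D * (\<Sum>i\<in>I. (L i v)\<^sup>2) \<le> h v v - E * b v v"
    and J: "finite J" and eig: "\<And>j w. j \<in> J \<Longrightarrow> h (\<psi> j) w = lam j * b (\<psi> j) w"
    and orth: "\<And>i j. i \<in> J \<Longrightarrow> j \<in> J \<Longrightarrow> b (\<psi> i) (\<psi> j) = of_bool (i = j)"
    and v0: "\<And>j. j \<in> J \<Longrightarrow> b v0 (\<psi> j) = 0" "h v0 v0 < E * b v0 v0"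
  shows "\<exists>m v. m < E \<and> v \<noteq> 0 \<and> (\<forall>j\<in>J. b v (\<psi> j) = 0) \<and> (\<forall>w. h v w = m * b v w)"
proof -
  note hs = sym_form_simps[OF h] and bs = sym_form_simps[OF b]
  define S where "S = {v. \<forall>j\<in>J. b v (\<psi> j) = 0}"
  define R where "R = (\<lambda>v. h v v / b v v) ` {v \<in> S. v \<noteq> 0}"
  define m where "m = Inf R"
  have v00: "v0 \<noteq> 0" using v0(2) by (auto simp: hs bs)
  have v0S: "v0 \<in> S" using v0 by (simp add: S_def)
  have bdd: "bdd_below R"
    unfolding R_def using below pos
    by (intro bdd_belowI[of _ "-K"]) (auto simp: pos_le_divide_eq)
  have "m \<le> h v0 v0 / b v0 v0"
    unfolding m_def using v00 v0S by (intro cInf_lower[OF _ bdd]) (auto simp: R_def)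
  also have "\<dots> < E" using v0(2) pos[OF v00] by (simp add: divide_less_eq)
  finally have mE: "m < E" .
  define a where "a v w = h v w - m * b v w" for v w
  have a: "sym_form a" using sym_form_shift[OF h b, of m] by (simp add: a_def[abs_def])
  note as = sym_form_simps[OF a]
  have a_nn: "0 \<le> a v v" if "v \<in> S" for v
  proof (cases "v = 0")
    case False
    then have "m \<le> h v v / b v v"
      unfolding m_def using that by (intro cInf_lower[OF _ bdd]) (auto simp: R_def)
    then show ?thesis using pos[OF False] by (simp add: a_def pos_le_divide_eq)
  qed (simp add: as)
  have a_coer: "c * (norm v)\<^sup>2 - D * (\<Sum>i\<in>I. (L i v)\<^sup>2) \<le> a v v" for v
  proof -
    have "0 \<le> (E - m) * b v v"
      using mE pos[of v] by (cases "v = 0") (auto simp: bs)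
    then show ?thesis using coer[of v] by (simp add: a_def algebra_simps)
  qed
  obtain Bb where Bb: "0 < Bb" "\<And>v w. \<bar>b v w\<bar> \<le> Bb * norm v * norm w"
    using sym_form_bound[OF b] by blast
  have S_scale: "t *\<^sub>R v \<in> S" if "v \<in> S" for t v using that by (auto simp: S_def bs)
  have S_add: "v + w \<in> S" if "v \<in> S" "w \<in> S" for v w using that by (auto simp: S_def bs)
  have S_diff: "v - w \<in> S" if "v \<in> S" "w \<in> S" for v w using that by (auto simp: S_def bs)
  have "\<exists>v\<in>S. norm v = 1 \<and> a v v \<le> inverse (real (Suc n))" for n
  proof -
    have "Inf R < m + inverse (real (Suc n)) / Bb" using Bb(1) by (simp add: m_def)
    moreover have "R \<noteq> {}" using v00 v0S by (auto simp: R_def)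
    ultimately obtain r where "r \<in> R" "r < m + inverse (real (Suc n)) / Bb"
      by (meson cInf_lessD)
    then obtain v where v: "v \<in> S" "v \<noteq> 0" "h v v / b v v < m + inverse (real (Suc n)) / Bb"
      by (auto simp: R_def)
    define u where "u = (1 / norm v) *\<^sub>R v"
    have "norm u = 1" using v(2) by (simp add: u_def)
    have u0: "u \<noteq> 0" using v(2) by (simp add: u_def)
    have "a u u = (h v v / b v v - m) * b u u"
      using pos[OF v(2)] v(2) by (simp add: a_def u_def hs bs field_simps)
    also have "\<dots> \<le> (inverse (real (Suc n)) / Bb) * b u u"
      using v(3) pos[OF u0] by (intro mult_right_mono) auto
    also have "\<dots> \<le> (inverse (real (Suc n)) / Bb) * Bb"
      using Bb(2)[of u u] Bb(1) \<open>norm u = 1\<close> by (intro mult_left_mono) auto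
    finally have "a u u \<le> inverse (real (Suc n))" using Bb(1) by simp
    moreover have "u \<in> S" unfolding u_def by (rule S_scale[OF v(1)])
    ultimately show ?thesis using \<open>norm u = 1\<close> by blast
  qed
  then obtain u where u: "\<And>n. u n \<in> S" "\<And>n. norm (u n) = 1"
      "\<And>n. a (u n) (u n) \<le> inverse (real (Suc n))" by metis
  have Lbdd: "bounded (range (\<lambda>n. L i (u n)))" if i: "i \<in> I" for i
  proof -
    obtain B where "\<And>x. norm (L i x) \<le> norm x * B"
      using bounded_linear.pos_bounded[OF I(2)[OF i]] by auto
    then have "norm (L i (u n)) \<le> B" for n using u(2)[of n] by (metis mult_1)
    then show ?thesis by (intro boundedI) auto
  qed
  obtain r where r: "strict_mono r" "\<And>i. i \<in> I \<Longrightarrow> convergent (\<lambda>n. L i (u (r n)))"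
    using finite_family_convergent_subseq[OF I(1), of "\<lambda>i n. L i (u n)"] Lbdd by blast
  define x where "x n = u (r n)" for n
  have xS: "x n \<in> S" and xn: "norm (x n) = 1" for n using u by (auto simp: x_def)
  obtain l where l: "\<And>i. i \<in> I \<Longrightarrow> (\<lambda>n. L i (x n)) \<longlonglongrightarrow> l i"
    using r(2) unfolding x_def convergent_def by metis
  have ax: "(\<lambda>n. a (x n) (x n)) \<longlonglongrightarrow> 0"
  proof (rule tendsto_sandwich[OF _ _ tendsto_const LIMSEQ_inverse_real_of_nat])
    have "inverse (real (Suc (r n))) \<le> inverse (real (Suc n))" for n
      using seq_suble[OF r(1), of n] by (simp add: le_imp_inverse_le)
    then show "\<forall>\<^sub>F n in sequentially. a (x n) (x n) \<le> inverse (real (Suc n))"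
      using u(3) unfolding x_def by (intro always_eventually allI) (meson order_trans)
  qed (use a_nn xS in auto)
  \<comment> \<open>\<open>g p + g q\<close> bounds the squared distance of \<open>x p\<close> and \<open>x q\<close>\<close>
  define g where "g n = (2 * a (x n) (x n) + 2 * \<bar>D\<bar> * (\<Sum>i\<in>I. (L i (x n) - l i)\<^sup>2)) / c" for n
  have "g \<longlonglongrightarrow> (2 * 0 + 2 * \<bar>D\<bar> * (\<Sum>i\<in>I. (l i - l i)\<^sup>2)) / c"
    unfolding g_def using c by (intro tendsto_intros ax l) auto
  then have g0: "g \<longlonglongrightarrow> 0" by simp
  have "(norm (x p - x q))\<^sup>2 \<le> g p + g q" for p q
  proof -
    have sq: "(L i (x p - x q))\<^sup>2 \<le> 2 * (L i (x p) - l i)\<^sup>2 + 2 * (L i (x q) - l i)\<^sup>2"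
      if "i \<in> I" for i
    proof -
      have "L i (x p - x q) = (L i (x p) - l i) - (L i (x q) - l i)"
        using bounded_linear.linear[OF I(2)[OF that]] by (simp add: linear_diff)
      moreover have "(s - t)\<^sup>2 \<le> 2 * s\<^sup>2 + 2 * t\<^sup>2" for s t :: real
        using zero_le_power2[of "s + t"] by (simp add: power2_sum power2_diff)
      ultimately show ?thesis by metis
    qed
    have "D * (\<Sum>i\<in>I. (L i (x p - x q))\<^sup>2) \<le> \<bar>D\<bar> * (\<Sum>i\<in>I. (L i (x p - x q))\<^sup>2)"
      by (intro mult_right_mono) (auto intro: sum_nonneg)
    also have "\<dots> \<le> \<bar>D\<bar> * (\<Sum>i\<in>I. 2 * (L i (x p) - l i)\<^sup>2 + 2 * (L i (x q) - l i)\<^sup>2)"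
      using sq by (intro mult_left_mono sum_mono) auto
    also have "\<dots> = 2 * \<bar>D\<bar> * (\<Sum>i\<in>I. (L i (x p) - l i)\<^sup>2) + 2 * \<bar>D\<bar> * (\<Sum>i\<in>I. (L i (x q) - l i)\<^sup>2)"
      by (simp add: sum.distrib sum_distrib_left[symmetric] algebra_simps)
    finally have 1: "D * (\<Sum>i\<in>I. (L i (x p - x q))\<^sup>2) \<le> \<dots>" .
    have "a (x p - x q) (x p - x q) + a (x p + x q) (x p + x q)
        = 2 * a (x p) (x p) + 2 * a (x q) (x q)"
      by (simp add: as)
    moreover have "0 \<le> a (x p + x q) (x p + x q)" by (intro a_nn S_add xS)
    ultimately have 2: "a (x p - x q) (x p - x q) \<le> 2 * a (x p) (x p) + 2 * a (x q) (x q)"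
      by linarith
    have "c * (g p + g q) = (2 * a (x p) (x p) + 2 * \<bar>D\<bar> * (\<Sum>i\<in>I. (L i (x p) - l i)\<^sup>2))
        + (2 * a (x q) (x q) + 2 * \<bar>D\<bar> * (\<Sum>i\<in>I. (L i (x q) - l i)\<^sup>2))"
      using c unfolding g_def distrib_left by simp
    then have "c * (norm (x p - x q))\<^sup>2 \<le> c * (g p + g q)"
      using a_coer[of "x p - x q"] 1 2 by linarith
    then show ?thesis using c by simp
  qed
  from Cauchy_of_square_bound[OF this g0] obtain v where v: "x \<longlonglongrightarrow> v"
    using Cauchy_convergent_iff convergent_def by blast
  have "(\<lambda>n. norm (x n)) \<longlonglongrightarrow> norm v" using v by (rule tendsto_norm)
  then have vn: "norm v = 1" using xn by (simp add: LIMSEQ_const_iff)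
  have "(\<lambda>n. a (x n) (x n)) \<longlonglongrightarrow> a v v"
    using bounded_bilinear.tendsto[OF sym_form_bilinear[OF a] v v] .
  then have avv: "a v v = 0" using ax LIMSEQ_unique by blast
  have "b v (\<psi> j) = 0" if "j \<in> J" for j
  proof -
    have "(\<lambda>n. b (x n) (\<psi> j)) \<longlonglongrightarrow> b v (\<psi> j)"
      using bounded_bilinear.tendsto[OF sym_form_bilinear[OF b] v tendsto_const] .
    moreover have "b (x n) (\<psi> j) = 0" for n using xS[of n] that by (simp add: S_def)
    ultimately show ?thesis by (simp add: LIMSEQ_const_iff)
  qed
  then have vS: "v \<in> S" by (simp add: S_def)
  \<comment> \<open>\<open>v\<close> minimizes the nonnegative form \<open>a\<close> on \<open>S\<close>, with minimal value 0\<close>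
  have aS: "a v w = 0" if "w \<in> S" for w
  proof (rule linear_term_zero_of_nonneg)
    fix t
    have "0 \<le> a (v + t *\<^sub>R w) (v + t *\<^sub>R w)" by (intro a_nn S_add vS S_scale that)
    also have "\<dots> = 2 * t * a v w + t\<^sup>2 * a w w"
      using avv sym_form_commute[OF a, of w v] by (simp add: as power2_eq_square algebra_simps)
    finally show "0 \<le> 2 * t * a v w + t\<^sup>2 * a w w" .
  qed
  have a\<psi>: "a v (\<psi> j) = 0" if "j \<in> J" for j
    using eig[OF that, of v] vS that sym_form_commute[OF b] sym_form_commute[OF h, of v]
    by (simp add: a_def S_def)
  have "a v w = 0" for w
  proof -
    \<comment> \<open>split \<open>w\<close> into its component in \<open>S\<close> and a combination of the \<open>\<psi> j\<close>\<close>
    define s where "s = w - (\<Sum>j\<in>J. b w (\<psi> j) *\<^sub>R \<psi> j)"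
    have "b s (\<psi> i) = 0" if "i \<in> J" for i
      using that J by (simp add: s_def bs orth sum.delta' if_distrib of_bool_def cong: if_cong)
    then have "a v s = 0" by (intro aS) (simp add: S_def)
    moreover have "a v w = a v s + (\<Sum>j\<in>J. b w (\<psi> j) * a v (\<psi> j))"
      by (simp add: s_def as)
    ultimately show ?thesis by (simp add: a\<psi>)
  qed
  then have "h v w = m * b v w" for w by (simp add: a_def)
  moreover have "v \<noteq> 0" using vn by auto
  ultimately show ?thesis using mE vS by (auto simp: S_def)
qed

text \<open>
If the form is nonnegative on the common kernel of \<open>card I\<close> functionals, it has at most \<open>card I\<close>
negative eigenvalues: otherwise some nontrivial combination of eigenvectors lies in that kernel, while
the form is negative on it.
\<close>
lemma card_negative_eigenvalues_le:
  fixes h b :: "'a::real_normed_vector \<Rightarrow> 'a \<Rightarrow> real"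
  assumes h: "sym_form h" and b: "sym_form b" and pos: "\<And>v. v \<noteq> 0 \<Longrightarrow> 0 < b v v"
    and I: "finite I" "\<And>i. i \<in> I \<Longrightarrow> linear (L i)" and below: "\<And>v. - D * (\<Sum>i\<in>I. (L i v)\<^sup>2) \<le> h v v"
    and M: "finite M" "\<And>\<mu>. \<mu> \<in> M \<Longrightarrow> \<mu> < 0 \<and> (\<exists>v. v \<noteq> 0 \<and> (\<forall>w. h v w = \<mu> * b v w))"
  shows "card M \<le> card I"
proof (rule ccontr)
  assume "\<not> ?thesis"
  then have lt: "card I < card M" by simp
  note hs = sym_form_simps[OF h] and bs = sym_form_simps[OF b]
  obtain v where v: "\<And>\<mu>. \<mu> \<in> M \<Longrightarrow> v \<mu> \<noteq> 0" "\<And>\<mu> w. \<mu> \<in> M \<Longrightarrow> h (v \<mu>) w = \<mu> * b (v \<mu>) w"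
    using M(2) by metis
  have orth: "b (v \<mu>) (v \<nu>) = 0" if "\<mu> \<in> M" "\<nu> \<in> M" "\<mu> \<noteq> \<nu>" for \<mu> \<nu>
  proof -
    have "\<mu> * b (v \<mu>) (v \<nu>) = \<nu> * b (v \<mu>) (v \<nu>)"
      using v(2)[OF that(1), of "v \<nu>"] v(2)[OF that(2), of "v \<mu>"] sym_form_commute[OF h] sym_form_commute[OF b]
      by metis
    then show ?thesis using that(3) by simp
  qed
  obtain c where c: "\<exists>\<mu>\<in>M. c \<mu> \<noteq> 0" "\<forall>i\<in>I. (\<Sum>\<mu>\<in>M. c \<mu> * L i (v \<mu>)) = 0"
    using exists_nontrivial_coeffs[OF I(1) M(1) lt, of "\<lambda>i \<mu>. L i (v \<mu>)"] by blast
  define x where "x = (\<Sum>\<mu>\<in>M. c \<mu> *\<^sub>R v \<mu>)"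
  have Lx: "L i x = 0" if "i \<in> I" for i
    using c(2) that by (simp add: x_def linear_sum[OF I(2)[OF that]] linear_scale[OF I(2)[OF that]])
  have bx: "b (v \<mu>) x = c \<mu> * b (v \<mu>) (v \<mu>)" if \<mu>: "\<mu> \<in> M" for \<mu>
  proof -
    have "b (v \<mu>) x = (\<Sum>\<nu>\<in>M. c \<nu> * b (v \<mu>) (v \<nu>))" by (simp add: x_def bs)
    also have "\<dots> = c \<mu> * b (v \<mu>) (v \<mu>) + (\<Sum>\<nu>\<in>M - {\<mu>}. c \<nu> * b (v \<mu>) (v \<nu>))"
      using M(1) \<mu> by (rule sum.remove)
    also have "(\<Sum>\<nu>\<in>M - {\<mu>}. c \<nu> * b (v \<mu>) (v \<nu>)) = 0"
      using orth[OF \<mu>] by (intro sum.neutral) auto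
    finally show ?thesis by simp
  qed
  have "h x x = (\<Sum>\<mu>\<in>M. c \<mu> * h (v \<mu>) x)" by (subst (1) x_def) (simp add: hs)
  also have "\<dots> = (\<Sum>\<mu>\<in>M. \<mu> * ((c \<mu>)\<^sup>2 * b (v \<mu>) (v \<mu>)))"
    by (intro sum.cong) (auto simp: v(2) bx power2_eq_square)
  finally have hx: "h x x = (\<Sum>\<mu>\<in>M. \<mu> * ((c \<mu>)\<^sup>2 * b (v \<mu>) (v \<mu>)))" .
  obtain \<mu>0 where \<mu>0: "\<mu>0 \<in> M" "c \<mu>0 \<noteq> 0" using c(1) by blast
  have "0 < (\<Sum>\<mu>\<in>M. - (\<mu> * ((c \<mu>)\<^sup>2 * b (v \<mu>) (v \<mu>))))"
  proof (rule sum_pos2[OF M(1) \<mu>0(1)])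
    have "\<mu>0 < 0" "0 < b (v \<mu>0) (v \<mu>0)" using M(2)[OF \<mu>0(1)] pos[OF v(1)[OF \<mu>0(1)]] by auto
    then show "0 < - (\<mu>0 * ((c \<mu>0)\<^sup>2 * b (v \<mu>0) (v \<mu>0)))" using \<mu>0(2) by (simp add: mult_neg_pos)
    fix \<mu> assume \<mu>: "\<mu> \<in> M"
    have "\<mu> < 0" "0 < b (v \<mu>) (v \<mu>)" using M(2)[OF \<mu>] pos[OF v(1)[OF \<mu>]] by auto
    then show "0 \<le> - (\<mu> * ((c \<mu>)\<^sup>2 * b (v \<mu>) (v \<mu>)))" by (simp add: mult_nonpos_nonneg)
  qed
  then have "h x x < 0" unfolding hx sum_negf by simp
  moreover have "0 \<le> h x x" using below[of x] Lx by simp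
  ultimately show False by simp
qed

section \<open>Stability of negative eigenpairs\<close>

text \<open>
The unperturbed problem: a pair of forms with simple negative eigenvalues \<open>lam 1 < \<dots> < lam N\<close>, which
is nonnegative on the complement of the eigenvectors, so that there is no further negative spectrum.
The functionals \<open>L i\<close> measure the failure of coercivity below \<open>0\<close>.
\<close>
locale negative_eigenpairs =
  fixes h0 b0 :: "'a::{real_inner,complete_space} \<Rightarrow> 'a \<Rightarrow> real"
    and \<phi> :: "nat \<Rightarrow> 'a" and lam :: "nat \<Rightarrow> real" and N :: nat and K c :: real
    and I :: "'i set" and L :: "'i \<Rightarrow> 'a \<Rightarrow> real"
  assumes h0: "sym_form h0" and b0: "sym_form b0"
    and eig: "n \<in> {1..N} \<Longrightarrow> h0 (\<phi> n) w = lam n * b0 (\<phi> n) w"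
    and orth: "m \<in> {1..N} \<Longrightarrow> n \<in> {1..N} \<Longrightarrow> b0 (\<phi> m) (\<phi> n) = of_bool (m = n)"
    and lam_mono: "strict_mono_on {1..N} lam"
    and lam_neg: "n \<in> {1..N} \<Longrightarrow> lam n < 0"
    and nonneg: "(\<And>n. n \<in> {1..N} \<Longrightarrow> b0 v (\<phi> n) = 0) \<Longrightarrow> 0 \<le> h0 v v"
    and c: "0 < c" and K: "0 < K"
    and garding: "c * (norm v)\<^sup>2 - K * b0 v v \<le> h0 v v"
    and I: "finite I" "i \<in> I \<Longrightarrow> bounded_linear (L i)"
    and coercive: "E < 0 \<Longrightarrow>
      \<exists>k>0. \<exists>D. \<forall>v. k * (norm v)\<^sup>2 - D * (\<Sum>i\<in>I. (L i v)\<^sup>2) \<le> h0 v v - E * b0 v v"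
begin

definition near :: "real \<Rightarrow> ('a \<Rightarrow> 'a \<Rightarrow> real) \<Rightarrow> ('a \<Rightarrow> 'a \<Rightarrow> real) \<Rightarrow> bool" where
  "near \<delta> h b \<longleftrightarrow> sym_form h \<and> sym_form b \<and> (\<forall>v. v \<noteq> 0 \<longrightarrow> 0 < b v v) \<and>
    (\<forall>v w. \<bar>h v w - h0 v w\<bar> \<le> \<delta> * norm v * norm w) \<and>
    (\<forall>v w. \<bar>b v w - b0 v w\<bar> \<le> \<delta> * norm v * norm w)"

lemma nearD:
  assumes "near \<delta> h b"
  shows "sym_form h" "sym_form b" "v \<noteq> 0 \<Longrightarrow> 0 < b v v"
    "\<bar>h v w - h0 v w\<bar> \<le> \<delta> * norm v * norm w" "\<bar>b v w - b0 v w\<bar> \<le> \<delta> * norm v * norm w"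
    "\<bar>h v v - h0 v v\<bar> \<le> \<delta> * (norm v)\<^sup>2" "\<bar>b v v - b0 v v\<bar> \<le> \<delta> * (norm v)\<^sup>2"
  using assms unfolding near_def power2_eq_square mult.assoc[symmetric] by auto

definition \<Phi> :: real where "\<Phi> = 1 + (\<Sum>n\<in>{1..N}. norm (\<phi> n))"

lemma \<Phi>_ge: "1 \<le> \<Phi>" "n \<in> {1..N} \<Longrightarrow> norm (\<phi> n) \<le> \<Phi>"
proof -
  show "1 \<le> \<Phi>" by (simp add: \<Phi>_def sum_nonneg)
  assume "n \<in> {1..N}"
  then have "norm (\<phi> n) \<le> (\<Sum>n\<in>{1..N}. norm (\<phi> n))" by (intro member_le_sum) auto
  then show "norm (\<phi> n) \<le> \<Phi>" by (simp add: \<Phi>_def)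
qed

lemma spectral_gap:
  "\<exists>g>0. (\<forall>n\<in>{1..N}. lam n \<le> - g) \<and> (\<forall>m\<in>{1..N}. \<forall>n\<in>{1..N}. m < n \<longrightarrow> g \<le> lam n - lam m)"
proof -
  define A where "A = insert 1 ((\<lambda>n. - lam n) ` {1..N} \<union>
    (\<lambda>(m, n). lam n - lam m) ` {(m, n). m \<in> {1..N} \<and> n \<in> {1..N} \<and> m < n})"
  have fin: "finite A"
  proof -
    have "finite {(m, n). m \<in> {1..N} \<and> n \<in> {1..N} \<and> m < n}"
      by (rule finite_subset[of _ "{1..N} \<times> {1..N}"]) auto
    then show ?thesis by (simp add: A_def)
  qed
  have "0 < x" if "x \<in> A" for x
    using that lam_neg lam_mono by (auto simp: A_def strict_mono_on_def)
  then have "0 < Min A" using fin by (subst Min_gr_iff) (auto simp: A_def)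
  moreover have Mle: "Min A \<le> x" if "x \<in> A" for x using fin that by simp
  have "lam n \<le> - Min A" if "n \<in> {1..N}" for n
  proof -
    have "- lam n \<in> A" unfolding A_def using that by (intro insertI2 UnI1 imageI)
    from Mle[OF this] show ?thesis by linarith
  qed
  moreover have "Min A \<le> lam n - lam m" if "m \<in> {1..N}" "n \<in> {1..N}" "m < n" for m n
  proof (rule Mle)
    show "lam n - lam m \<in> A"
      unfolding A_def using that by (intro insertI2 UnI2 image_eqI[of _ _ "(m, n)"]) auto
  qed
  ultimately show ?thesis by blast
qed

text \<open>
An eigenvector \<open>v\<close> of the perturbed forms solves the unperturbed equation up to a residual of size
\<open>(1 + K) * \<delta>\<close>. Testing the residual against \<open>\<phi> n\<close> bounds the component of \<open>v\<close> along \<open>\<phi> n\<close> unless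
\<open>\<mu>\<close> is close to \<open>lam n\<close>; testing it against the remainder \<open>s\<close>, on which the unperturbed form is
nonnegative, bounds \<open>s\<close> unless \<open>\<mu>\<close> is close to \<open>0\<close>.
\<close>
lemma residual_bounds:
  assumes nr: "near \<delta> h b" and \<delta>: "0 < \<delta>" "\<delta> * (1 + K) \<le> c"
    and v: "norm v = 1" "\<And>w. h v w = \<mu> * b v w" and \<mu>: "\<mu> < 0"
  shows "- K \<le> \<mu>"
    and "n \<in> {1..N} \<Longrightarrow> \<bar>lam n - \<mu>\<bar> * \<bar>b0 v (\<phi> n)\<bar> \<le> (1 + K) * \<delta> * \<Phi>"
    and "\<bar>\<mu>\<bar> * norm (v - (\<Sum>n\<in>{1..N}. b0 v (\<phi> n) *\<^sub>R \<phi> n)) \<le> (1 + K) * \<delta> * K / c"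
proof -
  note bs = sym_form_simps[OF b0] and hs = sym_form_simps[OF h0]
  have bv: "0 < b v v" using nearD(3)[OF nr, of v] v(1) by force
  have "- K * b v v \<le> c - \<delta> - K * b v v - K * \<delta>" using \<delta> by (simp add: algebra_simps)
  also have "\<dots> \<le> c * (norm v)\<^sup>2 - K * b0 v v - \<delta>"
  proof -
    have "K * (b0 v v - b v v) \<le> K * \<delta>"
      using nearD(7)[OF nr, of v] v(1) K by (intro mult_left_mono) auto
    then show ?thesis using v(1) by (simp add: algebra_simps)
  qed
  also have "\<dots> \<le> h v v" using garding[of v] nearD(6)[OF nr, of v] v(1) by simp
  also have "\<dots> = \<mu> * b v v" using v(2) .
  finally show \<mu>K: "- K \<le> \<mu>" using bv by (simp only: mult_le_cancel_right_pos)
  have res: "\<bar>h0 v w - \<mu> * b0 v w\<bar> \<le> (1 + K) * \<delta> * norm w" for w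
  proof -
    have "h0 v w - \<mu> * b0 v w = \<mu> * (b v w - b0 v w) - (h v w - h0 v w)"
      using v(2)[of w] by (simp add: algebra_simps)
    then have "\<bar>h0 v w - \<mu> * b0 v w\<bar> \<le> \<bar>\<mu>\<bar> * \<bar>b v w - b0 v w\<bar> + \<bar>h v w - h0 v w\<bar>"
      by (metis abs_mult abs_triangle_ineq4)
    also have "\<dots> \<le> K * (\<delta> * norm w) + \<delta> * norm w"
      using nearD(4)[OF nr, of v w] nearD(5)[OF nr, of v w] v(1) \<mu>K \<mu> K
      by (intro add_mono mult_mono) auto
    finally show ?thesis by (simp add: algebra_simps)
  qed
  show "\<bar>lam n - \<mu>\<bar> * \<bar>b0 v (\<phi> n)\<bar> \<le> (1 + K) * \<delta> * \<Phi>" if n: "n \<in> {1..N}"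
  proof -
    have "(lam n - \<mu>) * b0 v (\<phi> n) = h0 v (\<phi> n) - \<mu> * b0 v (\<phi> n)"
      using eig[OF n, of v] sym_form_commute[OF h0, of v] sym_form_commute[OF b0, of v]
      by (simp add: algebra_simps)
    then have "\<bar>lam n - \<mu>\<bar> * \<bar>b0 v (\<phi> n)\<bar> \<le> (1 + K) * \<delta> * norm (\<phi> n)"
      using res[of "\<phi> n"] by (metis abs_mult)
    also have "\<dots> \<le> (1 + K) * \<delta> * \<Phi>" using \<Phi>_ge(2)[OF n] K \<delta> by (intro mult_left_mono) auto
    finally show ?thesis .
  qed
  define s where "s = v - (\<Sum>n\<in>{1..N}. b0 v (\<phi> n) *\<^sub>R \<phi> n)"
  have bs0: "b0 s (\<phi> n) = 0" if "n \<in> {1..N}" for n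
  proof -
    have "(\<Sum>i\<in>{1..N}. b0 v (\<phi> i) * b0 (\<phi> i) (\<phi> n)) = (\<Sum>i\<in>{1..N}. if i = n then b0 v (\<phi> i) else 0)"
      using that by (intro sum.cong) (auto simp: orth)
    then show ?thesis using that by (simp add: s_def bs)
  qed
  have "h0 s s - \<mu> * b0 s s = (h0 v s - \<mu> * b0 v s)
      - (\<Sum>n\<in>{1..N}. b0 v (\<phi> n) * (h0 (\<phi> n) s - \<mu> * b0 (\<phi> n) s))"
  proof -
    have "h0 s s - \<mu> * b0 s s = h0 (v - (\<Sum>n\<in>{1..N}. b0 v (\<phi> n) *\<^sub>R \<phi> n)) s
        - \<mu> * b0 (v - (\<Sum>n\<in>{1..N}. b0 v (\<phi> n) *\<^sub>R \<phi> n)) s" by (simp add: s_def)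
    then show ?thesis
      by (simp add: bs hs algebra_simps sum_distrib_left sum_subtractf)
  qed
  also have "(\<Sum>n\<in>{1..N}. b0 v (\<phi> n) * (h0 (\<phi> n) s - \<mu> * b0 (\<phi> n) s)) = 0"
    using bs0 sym_form_commute[OF b0, of s] by (intro sum.neutral) (auto simp: eig)
  finally have "h0 s s - \<mu> * b0 s s = h0 v s - \<mu> * b0 v s" by simp
  then have up: "h0 s s - \<mu> * b0 s s \<le> (1 + K) * \<delta> * norm s" using res[of s] by simp
  have hs0: "0 \<le> h0 s s" by (rule nonneg) (rule bs0)
  \<comment> \<open>since \<open>\<bar>\<mu>\<bar> \<le> K\<close> and \<open>h0 s s\<close> is nonnegative, the Garding inequality may be scaled by \<open>\<bar>\<mu>\<bar> / K\<close>\<close>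
  have "(\<bar>\<mu>\<bar> / K) * (c * (norm s)\<^sup>2 - K * b0 s s) \<le> (\<bar>\<mu>\<bar> / K) * h0 s s"
    using garding[of s] K by (intro mult_left_mono) auto
  also have "\<dots> \<le> 1 * h0 s s"
  proof (intro mult_right_mono hs0)
    show "\<bar>\<mu>\<bar> / K \<le> 1" unfolding pos_divide_le_eq[OF K] using \<mu>K \<mu> by simp
  qed
  finally have "(\<bar>\<mu>\<bar> / K) * c * (norm s)\<^sup>2 \<le> h0 s s - \<mu> * b0 s s"
    using K \<mu> by (simp add: algebra_simps)
  with up have "norm s * (\<bar>\<mu>\<bar> * norm s) * (c / K) \<le> norm s * ((1 + K) * \<delta>)"
    by (simp add: power2_eq_square algebra_simps)
  then have "norm s * (\<bar>\<mu>\<bar> * norm s) \<le> norm s * ((1 + K) * \<delta> * K / c)"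
    using K c by (simp add: field_simps)
  then have "\<bar>\<mu>\<bar> * norm s \<le> (1 + K) * \<delta> * K / c"
  proof (cases "s = 0")
    case True
    then show ?thesis using K c \<delta> by simp
  next
    case False
    then have "0 < norm s" by simp
    from mult_le_cancel_left_pos[OF this] \<open>norm s * (\<bar>\<mu>\<bar> * norm s) \<le> _\<close> show ?thesis by blast
  qed
  then show "\<bar>\<mu>\<bar> * norm (v - (\<Sum>n\<in>{1..N}. b0 v (\<phi> n) *\<^sub>R \<phi> n)) \<le> (1 + K) * \<delta> * K / c"
    by (simp add: s_def)
qed

text \<open>
If \<open>\<mu>\<close> were far both from \<open>0\<close> and from all \<open>lam n\<close>, then by \<open>residual_bounds\<close> all components of the
unit vector \<open>v\<close> would be small.
\<close>
lemma eigenvalue_localization: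
  "\<exists>C>0. \<forall>\<delta> h b \<mu> v. near \<delta> h b \<longrightarrow> 0 < \<delta> \<longrightarrow> \<delta> * (1 + K) \<le> c \<longrightarrow> norm v = 1 \<longrightarrow>
     (\<forall>w. h v w = \<mu> * b v w) \<longrightarrow> \<mu> < 0 \<longrightarrow>
     \<bar>\<mu>\<bar> \<le> C * \<delta> \<or> (\<exists>n\<in>{1..N}. \<bar>\<mu> - lam n\<bar> \<le> C * \<delta>)"
proof -
  define R where "R = 1 + K"
  have R: "0 < R" using K by (simp add: R_def)
  define C where "C = 2 * (real N * R * \<Phi>\<^sup>2 + R * K / c) + 1"
  have C: "0 < C" using R K c by (simp add: C_def add_nonneg_pos)
  show ?thesis
  proof (intro exI[of _ C] conjI allI impI C)
    fix \<delta> h b \<mu> v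
    assume nr: "near \<delta> h b" and \<delta>: "0 < \<delta>" "\<delta> * (1 + K) \<le> c" and v: "norm v = 1"
      and ev: "\<forall>w. h v w = \<mu> * b v w" and \<mu>: "\<mu> < 0"
    note rb = residual_bounds[OF nr \<delta> v ev[rule_format] \<mu>, folded R_def]
    show "\<bar>\<mu>\<bar> \<le> C * \<delta> \<or> (\<exists>n\<in>{1..N}. \<bar>\<mu> - lam n\<bar> \<le> C * \<delta>)"
    proof (rule ccontr)
      assume "\<not> ?thesis"
      then have far: "C * \<delta> < \<bar>\<mu>\<bar>" "\<And>n. n \<in> {1..N} \<Longrightarrow> C * \<delta> < \<bar>lam n - \<mu>\<bar>"
        by (auto simp: not_le abs_minus_commute)
      have cn: "\<bar>b0 v (\<phi> n)\<bar> \<le> R * \<Phi> / C" if "n \<in> {1..N}" for n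
      proof -
        have "C * \<delta> * \<bar>b0 v (\<phi> n)\<bar> \<le> R * \<delta> * \<Phi>"
          using rb(2)[OF that] mult_right_mono[OF less_imp_le[OF far(2)[OF that]], of "\<bar>b0 v (\<phi> n)\<bar>"]
          by simp
        then show ?thesis using \<delta> C by (simp add: field_simps)
      qed
      define s where "s = v - (\<Sum>n\<in>{1..N}. b0 v (\<phi> n) *\<^sub>R \<phi> n)"
      have "C * \<delta> * norm s \<le> R * \<delta> * K / c"
        using rb(3) mult_right_mono[OF less_imp_le[OF far(1)], of "norm s"] by (simp add: s_def)
      then have sn: "norm s \<le> R * K / c / C" using \<delta> C c by (simp add: field_simps)
      have "norm v \<le> norm s + norm (\<Sum>n\<in>{1..N}. b0 v (\<phi> n) *\<^sub>R \<phi> n)"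
        using norm_triangle_ineq[of s "\<Sum>n\<in>{1..N}. b0 v (\<phi> n) *\<^sub>R \<phi> n"] by (simp add: s_def)
      also have "norm (\<Sum>n\<in>{1..N}. b0 v (\<phi> n) *\<^sub>R \<phi> n) \<le> (\<Sum>n\<in>{1..N}. R * \<Phi> / C * \<Phi>)"
      proof (intro order_trans[OF norm_sum] sum_mono)
        fix n assume n: "n \<in> {1..N}"
        show "norm (b0 v (\<phi> n) *\<^sub>R \<phi> n) \<le> R * \<Phi> / C * \<Phi>"
          using cn[OF n] \<Phi>_ge(1) \<Phi>_ge(2)[OF n] R C unfolding norm_scaleR by (intro mult_mono) auto
      qed
      also have "\<dots> = real N * R * \<Phi>\<^sup>2 / C" by (simp add: power2_eq_square)
      finally have "1 \<le> R * K / c / C + real N * R * \<Phi>\<^sup>2 / C" using v sn by simp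
      then have "C \<le> R * K / c + real N * R * \<Phi>\<^sup>2"
        using C unfolding add_divide_distrib[symmetric] pos_le_divide_eq[OF C] by simp
      moreover have "0 \<le> R * K / c" "0 \<le> real N * R * \<Phi>\<^sup>2" using R K c by simp_all
      moreover have "C = 2 * (real N * R * \<Phi>\<^sup>2) + 2 * (R * K / c) + 1" by (simp add: C_def)
      moreover have "\<And>x y :: real. C \<le> x + y \<Longrightarrow> 0 \<le> x \<Longrightarrow> 0 \<le> y \<Longrightarrow> C \<noteq> 2 * y + 2 * x + 1"
        by linarith
      ultimately show False by blast
    qed
  qed
qed

text \<open>
Near \<open>lam n\<close> all components of the eigenvector except the one along \<open>\<phi> n\<close> are \<open>O(\<delta>)\<close>, by the
spectral gap. Dividing by that component and then normalizing for the perturbed form \<open>b\<close> changes the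
distance to \<open>\<phi> n\<close> by \<open>O(\<delta>)\<close> only.
\<close>
lemma eigenvector_localization:
  "\<exists>C>0. \<exists>\<delta>0>0. \<forall>\<delta> h b \<mu> v. near \<delta> h b \<longrightarrow> 0 < \<delta> \<longrightarrow> \<delta> < \<delta>0 \<longrightarrow> v \<noteq> 0 \<longrightarrow>
     (\<forall>w. h v w = \<mu> * b v w) \<longrightarrow> \<mu> < 0 \<longrightarrow>
     \<bar>\<mu>\<bar> \<le> C * \<delta> \<or> (\<exists>n\<in>{1..N}. \<bar>\<mu> - lam n\<bar> \<le> C * \<delta> \<and>
       (\<exists>t. b (t *\<^sub>R v) (t *\<^sub>R v) = 1 \<and> norm (t *\<^sub>R v - \<phi> n) \<le> C * \<delta>))"
proof -
  obtain C1 where C1: "0 < C1" and loc: "\<And>\<delta> h b \<mu> v. near \<delta> h b \<Longrightarrow> 0 < \<delta> \<Longrightarrow> \<delta> * (1 + K) \<le> c \<Longrightarrow>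
      norm v = 1 \<Longrightarrow> (\<forall>w. h v w = \<mu> * b v w) \<Longrightarrow> \<mu> < 0 \<Longrightarrow>
      \<bar>\<mu>\<bar> \<le> C1 * \<delta> \<or> (\<exists>n\<in>{1..N}. \<bar>\<mu> - lam n\<bar> \<le> C1 * \<delta>)"
    using eigenvalue_localization by metis
  obtain g where g: "0 < g" "\<And>n. n \<in> {1..N} \<Longrightarrow> lam n \<le> - g"
    "\<And>m n. m \<in> {1..N} \<Longrightarrow> n \<in> {1..N} \<Longrightarrow> m < n \<Longrightarrow> g \<le> lam n - lam m"
    using spectral_gap by blast
  obtain B where B: "0 < B" "\<And>v w. \<bar>b0 v w\<bar> \<le> B * norm v * norm w"
    using sym_form_bound[OF b0] by blast
  define R where "R = 1 + K"
  have R: "0 < R" using K by (simp add: R_def)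
  \<comment> \<open>distance between the unit eigenvector and its component along \<open>\<phi> n\<close>\<close>
  define C2 where "C2 = (2 / g) * (R * K / c + real N * (R * \<Phi>\<^sup>2))"
  have C2: "0 \<le> C2" using R K c g by (simp add: C2_def)
  \<comment> \<open>distance between the eigenvector, rescaled to have component \<open>1\<close> along \<open>\<phi> n\<close>, and \<open>\<phi> n\<close>\<close>
  define C3 where "C3 = 2 * \<Phi> * C2"
  have C3: "0 \<le> C3" using C2 \<Phi>_ge(1) by (simp add: C3_def)
  \<comment> \<open>deviation of the perturbed squared norm from \<open>1\<close>\<close>
  define C4 where "C4 = (\<Phi> + 1)\<^sup>2 + 2 * B * \<Phi> * C3 + B * C3"
  have C4: "1 \<le> C4"
  proof -
    have "1 \<le> (\<Phi> + 1)\<^sup>2" using \<Phi>_ge(1) by (intro one_le_power) simp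
    then show ?thesis using B C3 \<Phi>_ge(1) by (simp add: C4_def add_increasing2)
  qed
  define C where "C = C1 + C3 + 2 * C4 * (\<Phi> + 1)"
  have C: "0 < C" "C1 \<le> C" "C3 + 2 * C4 * (\<Phi> + 1) \<le> C"
    using C1 C3 C4 \<Phi>_ge(1) by (simp_all add: C_def add_pos_nonneg)
  \<comment> \<open>after the first, the entries make, in turn, \<open>residual_bounds\<close> applicable, \<open>C1 * \<delta>\<close> at most half the gap,
    the component along \<open>\<phi> n\<close> at least one half, and the last two deviations small\<close>
  define \<delta>0 where "\<delta>0 = Min {1, c / R, g / (2 * C1), 1 / (2 * C2 + 1), 1 / (C3 + 1), 1 / (2 * C4)}"
  have \<delta>0: "0 < \<delta>0" using c R g C1 C2 C3 C4 by (simp add: \<delta>0_def add_nonneg_pos)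
  show ?thesis
  proof (rule exI[of _ C], rule conjI, rule C(1), rule exI[of _ \<delta>0], intro conjI allI impI \<delta>0)
    fix \<delta> h b \<mu> v
    assume nr: "near \<delta> h b" and \<delta>: "0 < \<delta>" and small: "\<delta> < \<delta>0" and v0: "v \<noteq> 0"
      and ev: "\<forall>w. h v w = \<mu> * b v w" and \<mu>: "\<mu> < 0"
    have sm: "\<delta> < 1" "\<delta> < c / R" "\<delta> < g / (2 * C1)" "\<delta> < 1 / (2 * C2 + 1)" "\<delta> < 1 / (C3 + 1)"
      "\<delta> < 1 / (2 * C4)" using small by (simp_all add: \<delta>0_def)
    have \<delta>R: "\<delta> * (1 + K) \<le> c" using sm(2) R by (simp add: R_def[symmetric] pos_less_divide_eq)
    have gC1: "C1 * \<delta> \<le> g / 2" using sm(3) C1 by (simp add: field_simps)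
    have C2s: "C2 * \<delta> \<le> 1 / 2"
      using sm(4) C2 \<delta> by (simp add: pos_less_divide_eq field_simps add_nonneg_pos)
    have C3s: "C3 * \<delta> \<le> 1" using sm(5) C3 \<delta> by (simp add: pos_less_divide_eq field_simps add_nonneg_pos)
    have C4s: "C4 * \<delta> \<le> 1 / 2" using sm(6) C4 by (simp add: field_simps)
    note hs = sym_form_simps[OF nearD(1)[OF nr]] and bs = sym_form_simps[OF nearD(2)[OF nr]]
    define u where "u = (1 / norm v) *\<^sub>R v"
    have un: "norm u = 1" using v0 by (simp add: u_def)
    have ue: "\<forall>w. h u w = \<mu> * b u w" using ev by (simp add: u_def hs bs)
    note rb = residual_bounds[OF nr \<delta> \<delta>R un ue[rule_format] \<mu>, folded R_def]
    from loc[OF nr \<delta> \<delta>R un ue \<mu>]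
    show "\<bar>\<mu>\<bar> \<le> C * \<delta> \<or> (\<exists>n\<in>{1..N}. \<bar>\<mu> - lam n\<bar> \<le> C * \<delta> \<and>
       (\<exists>t. b (t *\<^sub>R v) (t *\<^sub>R v) = 1 \<and> norm (t *\<^sub>R v - \<phi> n) \<le> C * \<delta>))"
    proof
      assume "\<bar>\<mu>\<bar> \<le> C1 * \<delta>"
      also have "\<dots> \<le> C * \<delta>" using C \<delta> by (intro mult_right_mono) auto
      finally show ?thesis by blast
    next
      assume "\<exists>n\<in>{1..N}. \<bar>\<mu> - lam n\<bar> \<le> C1 * \<delta>"
      then obtain n where n: "n \<in> {1..N}" and ln: "\<bar>\<mu> - lam n\<bar> \<le> C1 * \<delta>" by blast
      have \<mu>g: "g / 2 \<le> \<bar>\<mu>\<bar>" using ln g(2)[OF n] gC1 by linarith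
      have others: "g / 2 \<le> \<bar>lam m - \<mu>\<bar>" if "m \<in> {1..N}" "m \<noteq> n" for m
      proof -
        have "g \<le> \<bar>lam m - lam n\<bar>"
          using g(3)[OF that(1) n] g(3)[OF n that(1)] that(2) by (cases "m < n") auto
        then show ?thesis using ln gC1 by linarith
      qed
      define \<alpha> where "\<alpha> = b0 u (\<phi> n)"
      define s where "s = u - (\<Sum>n\<in>{1..N}. b0 u (\<phi> n) *\<^sub>R \<phi> n)"
      have sn: "norm s \<le> (2 / g) * (R * K / c) * \<delta>"
      proof -
        have "(g / 2) * norm s \<le> \<bar>\<mu>\<bar> * norm s" using \<mu>g by (intro mult_right_mono) auto
        also have "\<dots> \<le> R * \<delta> * K / c" using rb(3) by (simp add: s_def)
        finally show ?thesis using g(1) c by (simp add: field_simps)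
      qed
      have cm: "norm (b0 u (\<phi> m) *\<^sub>R \<phi> m) \<le> (2 / g) * (R * \<Phi>\<^sup>2) * \<delta>"
        if m: "m \<in> {1..N}" "m \<noteq> n" for m
      proof -
        have "(g / 2) * \<bar>b0 u (\<phi> m)\<bar> \<le> \<bar>lam m - \<mu>\<bar> * \<bar>b0 u (\<phi> m)\<bar>"
          using others[OF m] by (intro mult_right_mono) auto
        also have "\<dots> \<le> R * \<delta> * \<Phi>" using rb(2)[OF m(1)] .
        finally have "\<bar>b0 u (\<phi> m)\<bar> \<le> (2 / g) * (R * \<Phi>) * \<delta>" using g(1) by (simp add: field_simps)
        then have "\<bar>b0 u (\<phi> m)\<bar> * norm (\<phi> m) \<le> (2 / g) * (R * \<Phi>) * \<delta> * \<Phi>"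
          using \<Phi>_ge(2)[OF m(1)] \<Phi>_ge(1) R g(1) \<delta> by (intro mult_mono) auto
        then show ?thesis by (simp add: power2_eq_square mult_ac)
      qed
      have "u - \<alpha> *\<^sub>R \<phi> n = s + (\<Sum>m\<in>{1..N} - {n}. b0 u (\<phi> m) *\<^sub>R \<phi> m)"
        using sum.remove[OF finite_atLeastAtMost n, of "\<lambda>n. b0 u (\<phi> n) *\<^sub>R \<phi> n"]
        by (simp add: s_def \<alpha>_def)
      then have "norm (u - \<alpha> *\<^sub>R \<phi> n) \<le> norm s + norm (\<Sum>m\<in>{1..N} - {n}. b0 u (\<phi> m) *\<^sub>R \<phi> m)"
        by (simp add: norm_triangle_ineq)
      also have "norm (\<Sum>m\<in>{1..N} - {n}. b0 u (\<phi> m) *\<^sub>R \<phi> m)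
          \<le> (\<Sum>m\<in>{1..N} - {n}. (2 / g) * (R * \<Phi>\<^sup>2) * \<delta>)"
        by (intro order_trans[OF norm_sum] sum_mono cm) auto
      also have "\<dots> \<le> real N * ((2 / g) * (R * \<Phi>\<^sup>2) * \<delta>)"
        using n g(1) R \<delta> by (auto intro!: divide_right_mono mult_right_mono)
      also have "norm s + real N * ((2 / g) * (R * \<Phi>\<^sup>2) * \<delta>) \<le> C2 * \<delta>"
        using sn by (simp add: C2_def algebra_simps)
      finally have dist: "norm (u - \<alpha> *\<^sub>R \<phi> n) \<le> C2 * \<delta>" by simp
      have "1 \<le> norm (\<alpha> *\<^sub>R \<phi> n) + norm (u - \<alpha> *\<^sub>R \<phi> n)"
        using un norm_triangle_ineq[of "\<alpha> *\<^sub>R \<phi> n" "u - \<alpha> *\<^sub>R \<phi> n"] by simp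
      then have "1 / 2 \<le> norm (\<alpha> *\<^sub>R \<phi> n)" using dist C2s by linarith
      also have "\<dots> \<le> \<bar>\<alpha>\<bar> * \<Phi>" using \<Phi>_ge(2)[OF n] by (simp add: mult_left_mono)
      finally have \<alpha>: "1 / (2 * \<Phi>) \<le> \<bar>\<alpha>\<bar>" using \<Phi>_ge(1) by (simp add: field_simps)
      have \<alpha>0: "\<alpha> \<noteq> 0" using \<alpha> \<Phi>_ge(1) by auto
      define y where "y = (1 / \<alpha>) *\<^sub>R u"
      have "norm (y - \<phi> n) = norm (u - \<alpha> *\<^sub>R \<phi> n) / \<bar>\<alpha>\<bar>"
      proof -
        have "y - \<phi> n = (1 / \<alpha>) *\<^sub>R (u - \<alpha> *\<^sub>R \<phi> n)"
          using \<alpha>0 by (simp add: y_def scaleR_diff_right)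
        then show ?thesis by simp
      qed
      also have "\<dots> \<le> C2 * \<delta> / (1 / (2 * \<Phi>))"
        using dist \<alpha> \<Phi>_ge(1) C2 \<delta> by (intro frac_le) auto
      finally have yd: "norm (y - \<phi> n) \<le> C3 * \<delta>" by (simp add: C3_def algebra_simps)
      have yn: "norm y \<le> \<Phi> + 1"
        using norm_triangle_ineq[of "\<phi> n" "y - \<phi> n"] \<Phi>_ge(2)[OF n] yd C3s by simp
      define \<beta> where "\<beta> = b y y"
      have \<beta>1: "\<bar>\<beta> - 1\<bar> \<le> C4 * \<delta>"
      proof -
        let ?r = "y - \<phi> n"
        have "b0 y y - 1 = 2 * b0 (\<phi> n) ?r + b0 ?r ?r"
          using orth[OF n n] sym_form_commute[OF b0, of y "\<phi> n"] by (simp add: sym_form_simps[OF b0])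
        then have "\<bar>b0 y y - 1\<bar> \<le> 2 * \<bar>b0 (\<phi> n) ?r\<bar> + \<bar>b0 ?r ?r\<bar>" by linarith
        also have "\<bar>b0 (\<phi> n) ?r\<bar> \<le> B * \<Phi> * (C3 * \<delta>)"
          using B \<Phi>_ge(2)[OF n] \<Phi>_ge(1) yd
          by (intro order_trans[OF B(2)] mult_mono) auto
        also have "\<bar>b0 ?r ?r\<bar> \<le> B * 1 * (C3 * \<delta>)"
          using B yd C3s by (intro order_trans[OF B(2)] mult_mono) auto
        finally have 1: "\<bar>b0 y y - 1\<bar> \<le> 2 * (B * \<Phi> * (C3 * \<delta>)) + B * 1 * (C3 * \<delta>)" by simp
        have "\<bar>b y y - b0 y y\<bar> \<le> \<delta> * (norm y)\<^sup>2" by (rule nearD(7)[OF nr])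
        also have "\<dots> \<le> \<delta> * (\<Phi> + 1)\<^sup>2" using yn \<delta> by (intro mult_left_mono power_mono) auto
        finally have "\<bar>\<beta> - 1\<bar> \<le> \<delta> * (\<Phi> + 1)\<^sup>2 + (2 * (B * \<Phi> * (C3 * \<delta>)) + B * 1 * (C3 * \<delta>))"
          using 1 unfolding \<beta>_def by linarith
        then show ?thesis by (simp add: C4_def algebra_simps)
      qed
      have \<beta>: "1 / 2 \<le> \<beta>" using \<beta>1 C4s by linarith
      define \<sigma> where "\<sigma> = sqrt \<beta>"
      have \<sigma>: "\<sigma>\<^sup>2 = \<beta>" "1 / 2 \<le> \<sigma>"
      proof -
        show "\<sigma>\<^sup>2 = \<beta>" using \<beta> by (simp add: \<sigma>_def)
        have "sqrt (1 / 4) \<le> \<sigma>" unfolding \<sigma>_def using \<beta> by (intro real_sqrt_le_mono) simp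
        then show "1 / 2 \<le> \<sigma>" by (simp add: real_sqrt_divide)
      qed
      have "\<bar>1 / \<sigma> - 1\<bar> \<le> 2 * \<bar>\<beta> - 1\<bar>"
      proof -
        have "\<bar>\<beta> - 1\<bar> = \<bar>\<sigma> - 1\<bar> * (\<sigma> + 1)"
        proof -
          have "\<beta> - 1 = (\<sigma> - 1) * (\<sigma> + 1)"
            by (simp add: \<sigma>(1)[symmetric] power2_eq_square algebra_simps)
          then show ?thesis using \<sigma>(2) by (simp only: abs_mult abs_of_nonneg)
        qed
        then have 1: "\<bar>\<sigma> - 1\<bar> \<le> \<bar>\<beta> - 1\<bar>" using \<sigma>(2) by (simp add: mult_le_cancel_left1)
        have "\<bar>1 / \<sigma> - 1\<bar> = \<bar>\<sigma> - 1\<bar> / \<sigma>"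
        proof -
          have "1 / \<sigma> - 1 = (1 - \<sigma>) / \<sigma>" using \<sigma>(2) by (simp add: diff_divide_distrib)
          then show ?thesis using \<sigma>(2) by (simp add: abs_minus_commute)
        qed
        also have "\<dots> \<le> \<bar>\<beta> - 1\<bar> / (1 / 2)" using 1 \<sigma>(2) by (intro frac_le) auto
        finally show ?thesis by simp
      qed
      then have \<sigma>1: "\<bar>1 / \<sigma> - 1\<bar> \<le> 2 * (C4 * \<delta>)"
        by (rule order_trans) (use \<beta>1 in simp)
      define t where "t = 1 / (\<sigma> * \<alpha> * norm v)"
      have tv: "t *\<^sub>R v = (1 / \<sigma>) *\<^sub>R y" by (simp add: t_def y_def u_def)
      have "b (t *\<^sub>R v) (t *\<^sub>R v) = \<beta> / \<sigma>\<^sup>2"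
        unfolding tv \<beta>_def by (simp add: bs power2_eq_square)
      then have 1: "b (t *\<^sub>R v) (t *\<^sub>R v) = 1" using \<sigma> \<beta> by simp
      have "t *\<^sub>R v - \<phi> n = (1 / \<sigma> - 1) *\<^sub>R y + (y - \<phi> n)"
        unfolding tv by (simp add: scaleR_diff_left)
      then have "norm (t *\<^sub>R v - \<phi> n) \<le> norm ((1 / \<sigma> - 1) *\<^sub>R y) + norm (y - \<phi> n)"
        using norm_triangle_ineq by metis
      also have "norm ((1 / \<sigma> - 1) *\<^sub>R y) \<le> 2 * (C4 * \<delta>) * (\<Phi> + 1)"
        unfolding norm_scaleR real_norm_def using \<sigma>1 yn by (intro mult_mono) auto
      also have "2 * (C4 * \<delta>) * (\<Phi> + 1) + norm (y - \<phi> n) \<le> (C3 + 2 * C4 * (\<Phi> + 1)) * \<delta>"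
        using yd by (simp add: algebra_simps)
      also have "\<dots> \<le> C * \<delta>" using C(3) \<delta> by (intro mult_right_mono) auto
      finally have 2: "norm (t *\<^sub>R v - \<phi> n) \<le> C * \<delta>" by simp
      have "\<bar>\<mu> - lam n\<bar> \<le> C * \<delta>"
        using ln C(2) \<delta> mult_right_mono[of C1 C \<delta>] by linarith
      with n 1 2 show ?thesis by blast
    qed
  qed
qed

text \<open>
The combinations of the \<open>\<phi> n\<close> form a space of dimension \<open>N\<close> on which the perturbed Rayleigh quotient
stays below minus half the distance from \<open>0\<close> to the spectrum. As long as fewer than \<open>N\<close> eigenvectors have been found, some such
combination is orthogonal to all of them, and minimization yields the next one.
\<close>
lemma eigenvectors_exist:
  "\<exists>\<kappa>>0. \<exists>\<delta>0>0. \<forall>\<delta> h b. near \<delta> h b \<longrightarrow> 0 < \<delta> \<longrightarrow> \<delta> < \<delta>0 \<longrightarrow>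
     (\<exists>\<psi> m. (\<forall>j\<in>{1..N}. m j < - \<kappa> \<and> (\<forall>w. h (\<psi> j) w = m j * b (\<psi> j) w)) \<and>
            (\<forall>i\<in>{1..N}. \<forall>j\<in>{1..N}. b (\<psi> i) (\<psi> j) = of_bool (i = j)))"
proof -
  obtain g where g: "0 < g" "\<And>n. n \<in> {1..N} \<Longrightarrow> lam n \<le> - g"
    using spectral_gap by blast
  define E where "E = - (g / 2)"
  have E: "E < 0" using g by (simp add: E_def)
  obtain k D where k: "0 < k"
    "\<And>v. k * (norm v)\<^sup>2 - D * (\<Sum>i\<in>I. (L i v)\<^sup>2) \<le> h0 v v - E * b0 v v"
    using coercive[OF E] by blast
  define \<delta>0 where "\<delta>0 = Min {c / (1 + K), k / (2 * (1 - E)), (g / 2) / ((K / c) * (1 + g / 2))}"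
  have \<delta>0: "0 < \<delta>0" using c K k E g by (simp add: \<delta>0_def divide_pos_pos add_pos_pos)
  have step: "\<exists>\<psi> m. (\<forall>j\<in>{1..n}. m j < E \<and> (\<forall>w. h (\<psi> j) w = m j * b (\<psi> j) w)) \<and>
            (\<forall>i\<in>{1..n}. \<forall>j\<in>{1..n}. b (\<psi> i) (\<psi> j) = of_bool (i = j))"
    if nr: "near \<delta> h b" and \<delta>: "0 < \<delta>" "\<delta> < \<delta>0" and "n \<le> N" for \<delta> h b n
    using \<open>n \<le> N\<close>
  proof (induction n)
    case 0
    show ?case by simp
  next
    case (Suc n)
    then have "n \<le> N" by simp
    from Suc.IH[OF this] obtain \<psi> m where
      P: "\<forall>j\<in>{1..n}. m j < E \<and> (\<forall>w. h (\<psi> j) w = m j * b (\<psi> j) w)"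
      "\<forall>i\<in>{1..n}. \<forall>j\<in>{1..n}. b (\<psi> i) (\<psi> j) = of_bool (i = j)" by blast
    have e\<psi>: "\<And>j w. j \<in> {1..n} \<Longrightarrow> h (\<psi> j) w = m j * b (\<psi> j) w"
      and m: "\<And>j. j \<in> {1..n} \<Longrightarrow> m j < E"
      and o\<psi>: "\<And>i j. i \<in> {1..n} \<Longrightarrow> j \<in> {1..n} \<Longrightarrow> b (\<psi> i) (\<psi> j) = of_bool (i = j)"
      using P by blast+
    have sm: "\<delta> < c / (1 + K)" "\<delta> < k / (2 * (1 - E))" "\<delta> < (g / 2) / ((K / c) * (1 + g / 2))"
      using \<delta>(2) by (simp_all add: \<delta>0_def)
    have \<delta>c: "\<delta> * (1 + K) < c" using sm(1) K by (simp add: pos_less_divide_eq)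
    have \<delta>k: "\<delta> * (1 - E) \<le> k / 2" using sm(2) E by (simp add: pos_less_divide_eq field_simps)
    have Kc: "0 < (K / c) * (1 + g / 2)" using K c g by simp
    have \<delta>g: "\<delta> * ((K / c) * (1 + g / 2)) < g / 2" using sm(3) unfolding pos_less_divide_eq[OF Kc] .
    note hb = nearD(1)[OF nr] nearD(2)[OF nr]
    note hs = sym_form_simps[OF hb(1)] and bs = sym_form_simps[OF hb(2)]
      and h0s = sym_form_simps[OF h0] and b0s = sym_form_simps[OF b0]
    have "card {1..n} < card {1..N}" using Suc.prems by simp
    from exists_nontrivial_coeffs[OF _ _ this, of "\<lambda>j i. b (\<phi> i) (\<psi> j)"] obtain d
      where d: "\<exists>i\<in>{1..N}. d i \<noteq> 0" "\<And>j. j \<in> {1..n} \<Longrightarrow> (\<Sum>i\<in>{1..N}. d i * b (\<phi> i) (\<psi> j)) = 0"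
      by blast
    define v where "v = (\<Sum>i\<in>{1..N}. d i *\<^sub>R \<phi> i)"
    have vo: "b v (\<psi> j) = 0" if "j \<in> {1..n}" for j using d(2)[OF that] by (simp add: v_def bs)
    have b0v: "b0 (\<phi> i) v = d i" if "i \<in> {1..N}" for i
    proof -
      have "b0 (\<phi> i) v = (\<Sum>j\<in>{1..N}. d j * of_bool (i = j))"
        using that by (simp add: v_def b0s orth)
      also have "\<dots> = (\<Sum>j\<in>{1..N}. if i = j then d j else 0)" by (intro sum.cong) auto
      finally show ?thesis using that by simp
    qed
    have b0vv: "b0 v v = (\<Sum>i\<in>{1..N}. (d i)\<^sup>2)"
    proof -
      have "b0 v v = (\<Sum>i\<in>{1..N}. d i * b0 (\<phi> i) v)"
        by (subst (1) v_def) (simp add: b0s)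
      then show ?thesis by (simp add: b0v power2_eq_square)
    qed
    have h0vv: "h0 v v = (\<Sum>i\<in>{1..N}. lam i * (d i)\<^sup>2)"
    proof -
      have "h0 v v = (\<Sum>i\<in>{1..N}. d i * h0 (\<phi> i) v)"
        by (subst (1) v_def) (simp add: h0s)
      also have "\<dots> = (\<Sum>i\<in>{1..N}. lam i * (d i)\<^sup>2)"
        by (intro sum.cong) (auto simp: eig b0v power2_eq_square)
      finally show ?thesis .
    qed
    have b0pos: "0 < b0 v v"
    proof -
      obtain i where "i \<in> {1..N}" "d i \<noteq> 0" using d(1) by blast
      then show ?thesis unfolding b0vv by (intro sum_pos2[of "{1..N}" i]) simp_all
    qed
    have "h0 v v \<le> (\<Sum>i\<in>{1..N}. - g * (d i)\<^sup>2)"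
      unfolding h0vv using g(2) by (intro sum_mono mult_right_mono) auto
    also have "\<dots> = - g * b0 v v" by (simp only: b0vv sum_distrib_left)
    finally have h0g: "h0 v v \<le> - g * b0 v v" .
    have "c * (norm v)\<^sup>2 \<le> K * b0 v v" using garding[of v] h0g b0pos g(1) by (smt (verit) mult_nonneg_nonneg mult_minus_left)
    then have nv: "(norm v)\<^sup>2 \<le> (K / c) * b0 v v" using c by (simp add: field_simps)
    have "h v v - E * b v v \<le> (h0 v v + \<delta> * (norm v)\<^sup>2) + (g / 2) * (b0 v v + \<delta> * (norm v)\<^sup>2)"
    proof -
      have "(g / 2) * b v v \<le> (g / 2) * (b0 v v + \<delta> * (norm v)\<^sup>2)"
        using nearD(7)[OF nr, of v] g(1) by (intro mult_left_mono) auto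
      then show ?thesis using nearD(6)[OF nr, of v] by (simp add: E_def)
    qed
    also have "\<dots> \<le> - (g / 2) * b0 v v + \<delta> * (1 + g / 2) * (norm v)\<^sup>2"
      using h0g by (simp add: algebra_simps)
    also have "\<dots> \<le> - (g / 2) * b0 v v + \<delta> * (1 + g / 2) * ((K / c) * b0 v v)"
      using nv \<delta> g by (intro add_left_mono mult_left_mono) auto
    also have "\<dots> = (\<delta> * ((K / c) * (1 + g / 2)) - g / 2) * b0 v v" by (simp add: algebra_simps)
    also have "\<dots> < 0" using \<delta>g b0pos by (intro mult_neg_pos) auto
    finally have hv: "h v v < E * b v v" by simp
    have below: "- K * b w w \<le> h w w" for w
    proof -
      have "\<delta> * (1 + K) * (norm w)\<^sup>2 \<le> c * (norm w)\<^sup>2" using \<delta>c by (intro mult_right_mono) auto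
      moreover have "K * b0 w w \<le> K * (b w w + \<delta> * (norm w)\<^sup>2)"
        using nearD(7)[OF nr, of w] K by (intro mult_left_mono) auto
      ultimately show ?thesis using garding[of w] nearD(6)[OF nr, of w] by (simp add: algebra_simps)
    qed
    have coer: "k / 2 * (norm w)\<^sup>2 - D * (\<Sum>i\<in>I. (L i w)\<^sup>2) \<le> h w w - E * b w w" for w
    proof -
      have "\<delta> * (1 - E) * (norm w)\<^sup>2 \<le> k / 2 * (norm w)\<^sup>2" using \<delta>k by (intro mult_right_mono) auto
      moreover have "- E * b0 w w \<le> - E * (b w w + \<delta> * (norm w)\<^sup>2)"
        using nearD(7)[OF nr, of w] E by (intro mult_left_mono) auto
      ultimately show ?thesis using k(2)[of w] nearD(6)[OF nr, of w] by (simp add: algebra_simps)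
    qed
    have "\<exists>m v. m < E \<and> v \<noteq> 0 \<and> (\<forall>j\<in>{1..n}. b v (\<psi> j) = 0) \<and> (\<forall>w. h v w = m * b v w)"
      by (rule eigenvector_by_minimization[OF hb nearD(3)[OF nr] below I half_gt_zero[OF k(1)] coer
            finite_atLeastAtMost e\<psi> o\<psi> vo hv])
    then obtain m' u where u: "m' < E" "u \<noteq> 0" "\<And>j. j \<in> {1..n} \<Longrightarrow> b u (\<psi> j) = 0"
      "\<And>w. h u w = m' * b u w" by blast
    define u' where "u' = (1 / sqrt (b u u)) *\<^sub>R u"
    have bu: "0 < b u u" using nearD(3)[OF nr u(2)] .
    have u': "b u' u' = 1" "\<And>j. j \<in> {1..n} \<Longrightarrow> b u' (\<psi> j) = 0" "\<And>w. h u' w = m' * b u' w"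
      using bu u(3,4) by (auto simp: u'_def bs hs)
    have u'2: "b (\<psi> j) u' = 0" if "j \<in> {1..n}" for j
      using u'(2)[OF that] sym_form_commute[OF hb(2)] by metis
    show ?case
    proof (intro exI[of _ "\<psi>(Suc n := u')"] exI[of _ "m(Suc n := m')"] conjI ballI allI)
      fix j w assume "j \<in> {1..Suc n}"
      then consider "j = Suc n" | "j \<in> {1..n}" by fastforce
      then show "h ((\<psi>(Suc n := u')) j) w = (m(Suc n := m')) j * b ((\<psi>(Suc n := u')) j) w"
        by cases (auto simp: u' e\<psi>)
    next
      fix j assume "j \<in> {1..Suc n}"
      then consider "j = Suc n" | "j \<in> {1..n}" by fastforce
      then show "(m(Suc n := m')) j < E" by cases (auto simp: m u)
    next
      fix i j assume "i \<in> {1..Suc n}" "j \<in> {1..Suc n}"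
      then consider "i = Suc n" "j = Suc n" | "i \<in> {1..n}" "j = Suc n"
        | "i = Suc n" "j \<in> {1..n}" | "i \<in> {1..n}" "j \<in> {1..n}" by fastforce
      then show "b ((\<psi>(Suc n := u')) i) ((\<psi>(Suc n := u')) j) = of_bool (i = j)"
        by cases (auto simp: u' u'2 o\<psi>)
    qed
  qed
  show ?thesis
  proof (rule exI[of _ "g / 2"], rule conjI, simp add: g(1), rule exI[of _ \<delta>0], intro conjI allI impI \<delta>0)
    fix \<delta> h b assume "near \<delta> h b" "0 < \<delta>" "\<delta> < \<delta>0"
    from step[OF this order_refl]
    show "\<exists>\<psi> m. (\<forall>j\<in>{1..N}. m j < - (g / 2) \<and> (\<forall>w. h (\<psi> j) w = m j * b (\<psi> j) w)) \<and>
            (\<forall>i\<in>{1..N}. \<forall>j\<in>{1..N}. b (\<psi> i) (\<psi> j) = of_bool (i = j))"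
      unfolding E_def .
  qed
qed

text \<open>
The \<open>N\<close> perturbed eigenvectors are assigned to the \<open>\<phi> n\<close> near which they lie. The assignment is a
bijection because two vectors near the same \<open>\<phi> n\<close> have perturbed inner product close to \<open>1\<close>. For the
same reason an eigenvector of any further eigenvalue, which is orthogonal to all of the \<open>N\<close>, lies near
none of the \<open>\<phi> n\<close>, so that its eigenvalue is \<open>O(\<delta>)\<close>.
\<close>
theorem perturbation:
  "\<exists>C>0. \<exists>\<delta>0>0. \<forall>\<delta> h b. near \<delta> h b \<longrightarrow> 0 < \<delta> \<longrightarrow> \<delta> < \<delta>0 \<longrightarrow>
     (\<exists>l \<psi>. strict_mono_on {1..N} l \<and>
        (\<forall>n\<in>{1..N}. l n < 0 \<and> \<bar>l n - lam n\<bar> \<le> C * \<delta> \<and> (\<forall>w. h (\<psi> n) w = l n * b (\<psi> n) w) \<and>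
           b (\<psi> n) (\<psi> n) = 1 \<and> norm (\<psi> n - \<phi> n) \<le> C * \<delta>) \<and>
        (\<forall>\<mu> v. \<mu> < 0 \<longrightarrow> v \<noteq> 0 \<longrightarrow> (\<forall>w. h v w = \<mu> * b v w) \<longrightarrow> \<mu> \<notin> l ` {1..N} \<longrightarrow> \<bar>\<mu>\<bar> \<le> C * \<delta>))"
proof -
  obtain C \<delta>1 where C: "0 < C" and \<delta>1: "0 < \<delta>1" and loc: "\<And>\<delta> h b \<mu> v. near \<delta> h b \<Longrightarrow> 0 < \<delta> \<Longrightarrow> \<delta> < \<delta>1 \<Longrightarrow>
     v \<noteq> 0 \<Longrightarrow> (\<forall>w. h v w = \<mu> * b v w) \<Longrightarrow> \<mu> < 0 \<Longrightarrow>
     \<bar>\<mu>\<bar> \<le> C * \<delta> \<or> (\<exists>n\<in>{1..N}. \<bar>\<mu> - lam n\<bar> \<le> C * \<delta> \<and>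
       (\<exists>t. b (t *\<^sub>R v) (t *\<^sub>R v) = 1 \<and> norm (t *\<^sub>R v - \<phi> n) \<le> C * \<delta>))"
    using eigenvector_localization by metis
  obtain \<kappa> \<delta>2 where \<kappa>: "0 < \<kappa>" and \<delta>2: "0 < \<delta>2" and ex: "\<And>\<delta> h b. near \<delta> h b \<Longrightarrow> 0 < \<delta> \<Longrightarrow> \<delta> < \<delta>2 \<Longrightarrow>
     \<exists>\<psi> m. (\<forall>j\<in>{1..N}. m j < - \<kappa> \<and> (\<forall>w. h (\<psi> j) w = m j * b (\<psi> j) w)) \<and>
            (\<forall>i\<in>{1..N}. \<forall>j\<in>{1..N}. b (\<psi> i) (\<psi> j) = of_bool (i = j))"
    using eigenvectors_exist by metis
  obtain g where g: "0 < g" "\<And>m n. m \<in> {1..N} \<Longrightarrow> n \<in> {1..N} \<Longrightarrow> m < n \<Longrightarrow> g \<le> lam n - lam m"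
    using spectral_gap by blast
  obtain B where B: "0 < B" "\<And>v w. \<bar>b0 v w\<bar> \<le> B * norm v * norm w"
    using sym_form_bound[OF b0] by blast
  define G where "G = 2 * B * \<Phi> * C + B * C + (\<Phi> + 1)\<^sup>2"
  have G: "0 < G" using B C \<Phi>_ge(1) by (simp add: G_def add_nonneg_pos)
  define \<delta>0 where "\<delta>0 = Min {\<delta>1, \<delta>2, \<kappa> / C, g / (2 * C), 1 / C, 1 / G}"
  have \<delta>0: "0 < \<delta>0" using \<delta>1 \<delta>2 \<kappa> C g G by (simp add: \<delta>0_def)
  show ?thesis
  proof (rule exI[of _ C], rule conjI, rule C, rule exI[of _ \<delta>0], intro conjI allI impI \<delta>0)
    fix \<delta> h b assume nr: "near \<delta> h b" and \<delta>: "0 < \<delta>" "\<delta> < \<delta>0"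
    have sm: "\<delta> < \<delta>1" "\<delta> < \<delta>2" "C * \<delta> < \<kappa>" "C * \<delta> < g / 2" "C * \<delta> < 1" "G * \<delta> < 1"
      using \<delta>(2) C G by (simp_all add: \<delta>0_def field_simps)
    note hb = nearD(1)[OF nr] nearD(2)[OF nr]
    note hs = sym_form_simps[OF hb(1)] and bs = sym_form_simps[OF hb(2)] and b0s = sym_form_simps[OF b0]
    have not_orth: "b x y \<noteq> 0" if n: "n \<in> {1..N}" and x: "norm (x - \<phi> n) \<le> C * \<delta>"
      and y: "norm (y - \<phi> n) \<le> C * \<delta>" for n x y
    proof -
      define r where "r = x - \<phi> n"
      define s where "s = y - \<phi> n"
      have r: "norm r \<le> C * \<delta>" and s: "norm s \<le> C * \<delta>" using x y by (simp_all add: r_def s_def)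
      have xn: "norm x \<le> \<Phi> + 1" and yn: "norm y \<le> \<Phi> + 1"
        using norm_triangle_ineq[of r "\<phi> n"] norm_triangle_ineq[of s "\<phi> n"] \<Phi>_ge(2)[OF n] r s sm(5)
        by (simp_all add: r_def s_def)
      have "b0 x y = 1 + b0 (\<phi> n) s + b0 r (\<phi> n) + b0 r s"
        using orth[OF n n] by (simp add: r_def s_def b0s)
      moreover have "\<bar>b0 (\<phi> n) s\<bar> \<le> B * \<Phi> * (C * \<delta>)"
        using B \<Phi>_ge(2)[OF n] \<Phi>_ge(1) s by (intro order_trans[OF B(2)] mult_mono) auto
      moreover have "\<bar>b0 r (\<phi> n)\<bar> \<le> B * (C * \<delta>) * \<Phi>"
        using B \<Phi>_ge(2)[OF n] \<Phi>_ge(1) r \<delta> C by (intro order_trans[OF B(2)] mult_mono) auto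
      moreover have "\<bar>b0 r s\<bar> \<le> B * 1 * (C * \<delta>)"
        using B r s sm(5) by (intro order_trans[OF B(2)] mult_mono) auto
      moreover have "\<bar>b x y - b0 x y\<bar> \<le> \<delta> * (\<Phi> + 1) * (\<Phi> + 1)"
        using xn yn \<delta> \<Phi>_ge(1) by (intro order_trans[OF nearD(5)[OF nr]] mult_mono) auto
      ultimately have "1 - G * \<delta> \<le> b x y"
        by (simp add: G_def power2_eq_square algebra_simps)
      then show ?thesis using sm(6) by linarith
    qed
    obtain \<eta> m where m: "\<And>j. j \<in> {1..N} \<Longrightarrow> m j < - \<kappa>" and eig_eta: "\<And>j. j \<in> {1..N} \<Longrightarrow> \<forall>w. h (\<eta> j) w = m j * b (\<eta> j) w"
      and orth_eta: "\<And>i j. i \<in> {1..N} \<Longrightarrow> j \<in> {1..N} \<Longrightarrow> b (\<eta> i) (\<eta> j) = of_bool (i = j)"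
      using ex[OF nr \<delta>(1) sm(2)] by blast
    have "\<exists>n t. n \<in> {1..N} \<and> \<bar>m j - lam n\<bar> \<le> C * \<delta> \<and> b (t *\<^sub>R \<eta> j) (t *\<^sub>R \<eta> j) = 1 \<and>
        norm (t *\<^sub>R \<eta> j - \<phi> n) \<le> C * \<delta>" if j: "j \<in> {1..N}" for j
    proof -
      have "\<eta> j \<noteq> 0" using orth_eta[OF j j] by (auto simp: bs)
      moreover have "m j < 0" "\<not> \<bar>m j\<bar> \<le> C * \<delta>" using m[OF j] \<kappa> sm(3) by auto
      ultimately show ?thesis using loc[OF nr \<delta>(1) sm(1) _ eig_eta[OF j]] by blast
    qed
    then obtain f t where f: "\<And>j. j \<in> {1..N} \<Longrightarrow> f j \<in> {1..N}"
      and fl: "\<And>j. j \<in> {1..N} \<Longrightarrow> \<bar>m j - lam (f j)\<bar> \<le> C * \<delta>"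
      and ft: "\<And>j. j \<in> {1..N} \<Longrightarrow> b (t j *\<^sub>R \<eta> j) (t j *\<^sub>R \<eta> j) = 1"
      and fd: "\<And>j. j \<in> {1..N} \<Longrightarrow> norm (t j *\<^sub>R \<eta> j - \<phi> (f j)) \<le> C * \<delta>" by metis
    have "inj_on f {1..N}"
    proof (rule inj_onI, rule ccontr)
      fix i j assume ij: "i \<in> {1..N}" "j \<in> {1..N}" "f i = f j" "i \<noteq> j"
      have "b (t i *\<^sub>R \<eta> i) (t j *\<^sub>R \<eta> j) = 0" using orth_eta[OF ij(1,2)] ij(4) by (simp add: bs)
      then show False using not_orth[OF f[OF ij(1)] fd[OF ij(1)]] fd[OF ij(2)] ij(3) by simp
    qed
    then have fimg: "f ` {1..N} = {1..N}" using f by (intro endo_inj_surj) auto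
    define k where "k n = inv_into {1..N} f n" for n
    have k: "k n \<in> {1..N}" "f (k n) = n" if "n \<in> {1..N}" for n
      using that fimg by (auto simp: k_def f_inv_into_f inv_into_into intro!: inv_into_into[of n f "{1..N}", simplified])
    define l where "l n = m (k n)" for n
    define \<psi> where "\<psi> n = t (k n) *\<^sub>R \<eta> (k n)" for n
    have l: "l n < 0" "\<bar>l n - lam n\<bar> \<le> C * \<delta>" "\<forall>w. h (\<psi> n) w = l n * b (\<psi> n) w"
      "b (\<psi> n) (\<psi> n) = 1" "norm (\<psi> n - \<phi> n) \<le> C * \<delta>" if n: "n \<in> {1..N}" for n
      using m[OF k(1)[OF n]] fl[OF k(1)[OF n]] ft[OF k(1)[OF n]] fd[OF k(1)[OF n]]
        eig_eta[OF k(1)[OF n]] k(2)[OF n] \<kappa>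
      by (auto simp: l_def \<psi>_def hs bs)
    have mono: "strict_mono_on {1..N} l"
    proof (rule strict_mono_onI)
      fix i j assume ij: "i \<in> {1..N}" "j \<in> {1..N}" "i < j"
      show "l i < l j" using g(2)[OF ij] l(2)[OF ij(1)] l(2)[OF ij(2)] sm(4) by linarith
    qed
    have other: "\<bar>\<mu>\<bar> \<le> C * \<delta>" if \<mu>: "\<mu> < 0" "v \<noteq> 0" and ev: "\<forall>w. h v w = \<mu> * b v w"
      and nl: "\<mu> \<notin> l ` {1..N}" for \<mu> v
    proof (rule ccontr)
      assume "\<not> \<bar>\<mu>\<bar> \<le> C * \<delta>"
      with loc[OF nr \<delta>(1) sm(1) \<mu>(2) ev \<mu>(1)] obtain n s
        where n: "n \<in> {1..N}" and s: "norm (s *\<^sub>R v - \<phi> n) \<le> C * \<delta>" by blast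
      have "\<mu> * b v (\<psi> n) = h v (\<psi> n)" using ev by simp
      also have "\<dots> = l n * b v (\<psi> n)"
        using l(3)[OF n] sym_form_commute[OF hb(1), of v] sym_form_commute[OF hb(2), of v] by simp
      finally have "b v (\<psi> n) = 0" using nl n by auto
      then have "b (s *\<^sub>R v) (\<psi> n) = 0" by (simp add: bs)
      then show False using not_orth[OF n s l(5)[OF n]] by simp
    qed
    show "\<exists>l \<psi>. strict_mono_on {1..N} l \<and>
        (\<forall>n\<in>{1..N}. l n < 0 \<and> \<bar>l n - lam n\<bar> \<le> C * \<delta> \<and> (\<forall>w. h (\<psi> n) w = l n * b (\<psi> n) w) \<and>
           b (\<psi> n) (\<psi> n) = 1 \<and> norm (\<psi> n - \<phi> n) \<le> C * \<delta>) \<and>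
        (\<forall>\<mu> v. \<mu> < 0 \<longrightarrow> v \<noteq> 0 \<longrightarrow> (\<forall>w. h v w = \<mu> * b v w) \<longrightarrow> \<mu> \<notin> l ` {1..N} \<longrightarrow> \<bar>\<mu>\<bar> \<le> C * \<delta>)"
      using mono l other by (intro exI[of _ l] exI[of _ \<psi>]) blast
  qed
qed

end

section \<open>Primitives of locally integrable functions\<close>

text \<open>
\<open>primitive u g\<close> says that \<open>u\<close> is locally absolutely continuous with derivative \<open>g\<close> almost everywhere. In
this integral form the calculus of such functions needs no differentiation theorem.
\<close>
definition primitive :: "(real \<Rightarrow> real) \<Rightarrow> (real \<Rightarrow> real) \<Rightarrow> bool" where
  "primitive u g \<longleftrightarrow> locally_integrable g \<and> (\<forall>a b. a \<le> b \<longrightarrow> u b - u a = (LINT x:{a..b}|lborel. g x))"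

lemma primitiveD: "primitive u g \<Longrightarrow> a \<le> b \<Longrightarrow> u b - u a = (LINT x:{a..b}|lborel. g x)"
  by (simp add: primitive_def)

lemma primitive_locally_integrable: "primitive u g \<Longrightarrow> locally_integrable g"
  by (simp add: primitive_def)

lemma locally_integrableD: "locally_integrable g \<Longrightarrow> set_integrable lborel {a..b} g"
  by (simp add: locally_integrable_def)

lemma locally_integrable_measurable:
  fixes g :: "real \<Rightarrow> 'a::euclidean_space"
  assumes "locally_integrable g"
  shows "g \<in> borel_measurable borel"
proof (rule borel_measurable_LIMSEQ_metric[where f = "\<lambda>n x. indicator {- real n..real n} x *\<^sub>R g x"])
  fix n
  show "(\<lambda>x. indicator {- real n..real n} x *\<^sub>R g x) \<in> borel_measurable borel"
    using borel_measurable_integrable[OF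
        locally_integrableD[OF assms, of "- real n" "real n", unfolded set_integrable_def]] by simp
next
  fix x :: real
  obtain n0 :: nat where "\<bar>x\<bar> \<le> real n0" using real_arch_simple by blast
  then have "x \<in> {- real n..real n}" if "n \<ge> n0" for n using \<open>\<bar>x\<bar> \<le> real n0\<close> of_nat_mono[OF that, where 'a=real]
    unfolding atLeastAtMost_iff by linarith
  then have "eventually (\<lambda>n. indicator {- real n..real n} x *\<^sub>R g x = g x) sequentially"
    unfolding eventually_sequentially by (intro exI[of _ n0]) simp
  then show "(\<lambda>n. indicator {- real n..real n} x *\<^sub>R g x) \<longlonglongrightarrow> g x"
    by (rule tendsto_eventually)
qed

lemma integrable_locally_integrable: "integrable lborel g \<Longrightarrow> locally_integrable g"
  for g :: "real \<Rightarrow> 'a::euclidean_space"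
  unfolding locally_integrable_def set_integrable_def by (intro allI integrable_mult_indicator) auto

lemma locally_integrable_bounded_mult:
  fixes g f :: "real \<Rightarrow> real"
  assumes g: "locally_integrable g" and f[measurable]: "f \<in> borel_measurable borel"
    and bd: "\<And>a b. \<exists>C. AE x in lborel. x \<in> {a..b} \<longrightarrow> \<bar>f x\<bar> \<le> C"
  shows "locally_integrable (\<lambda>x. f x * g x)"
  unfolding locally_integrable_def
proof (intro allI)
  fix a b :: real
  have [measurable]: "g \<in> borel_measurable borel" by (rule locally_integrable_measurable[OF g])
  obtain C where C: "AE x in lborel. x \<in> {a..b} \<longrightarrow> \<bar>f x\<bar> \<le> C" using bd by blast
  show "set_integrable lborel {a..b} (\<lambda>x. f x * g x)"
  proof (rule set_integrable_bound[OF set_integrable_mult_right[of C, OF locally_integrableD[OF g]]])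
    show "AE x in lborel. x \<in> {a..b} \<longrightarrow> norm (f x * g x) \<le> norm (C * g x)"
      using C
    proof eventually_elim
      case (elim x)
      have "\<bar>f x\<bar> * \<bar>g x\<bar> \<le> \<bar>C\<bar> * \<bar>g x\<bar>" if "x \<in> {a..b}"
        using elim that by (intro mult_right_mono) auto
      then show ?case by (simp add: abs_mult)
    qed
    show "set_borel_measurable lborel {a..b} (\<lambda>x. f x * g x)"
      unfolding set_borel_measurable_def by measurable
  qed
qed

lemma locally_integrable_bounded:
  fixes f :: "real \<Rightarrow> real"
  assumes "f \<in> borel_measurable borel" "\<And>a b. \<exists>C. AE x in lborel. x \<in> {a..b} \<longrightarrow> \<bar>f x\<bar> \<le> C"
  shows "locally_integrable f"
proof -
  have "locally_integrable (\<lambda>x::real. 1::real)"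
    unfolding locally_integrable_def by (intro allI borel_integrable_atLeastAtMost' continuous_on_const)
  from locally_integrable_bounded_mult[OF this assms] show ?thesis by simp
qed

lemma continuous_bounded_interval:
  fixes f :: "real \<Rightarrow> real"
  assumes "continuous_on UNIV f"
  shows "\<exists>C. AE x in lborel. x \<in> {a..b} \<longrightarrow> \<bar>f x\<bar> \<le> C"
proof -
  have "compact (f ` {a..b})"
    using assms by (intro compact_continuous_image) (auto intro: continuous_on_subset)
  from compact_imp_bounded[OF this] obtain C where "\<forall>y\<in>f ` {a..b}. norm y \<le> C"
    unfolding bounded_iff by blast
  then show ?thesis by (intro exI[of _ C] AE_I2) simp
qed

lemma locally_integrable_continuous_mult:
  fixes g f :: "real \<Rightarrow> real"
  assumes "locally_integrable g" "continuous_on UNIV f"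
  shows "locally_integrable (\<lambda>x. f x * g x)" "locally_integrable (\<lambda>x. g x * f x)"
  using locally_integrable_bounded_mult[OF assms(1) _ continuous_bounded_interval[OF assms(2)]]
    borel_measurable_continuous_onI[OF assms(2)] by (simp_all add: mult.commute)

lemma continuous_locally_integrable: "continuous_on UNIV f \<Longrightarrow> locally_integrable (f :: real \<Rightarrow> real)"
  using locally_integrable_bounded[OF borel_measurable_continuous_onI continuous_bounded_interval] by blast

lemma locally_integrable_add:
  fixes f g :: "real \<Rightarrow> real"
  shows "locally_integrable f \<Longrightarrow> locally_integrable g \<Longrightarrow> locally_integrable (\<lambda>x. f x + g x)"
  and "locally_integrable f \<Longrightarrow> locally_integrable g \<Longrightarrow> locally_integrable (\<lambda>x. f x - g x)"
  and "locally_integrable f \<Longrightarrow> locally_integrable (\<lambda>x. c * f x)"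
  by (auto simp: locally_integrable_def)

lemma primitive_add:
  assumes "primitive u g" "primitive v h"
  shows "primitive (\<lambda>x. u x + v x) (\<lambda>x. g x + h x)"
  unfolding primitive_def
proof (intro conjI allI impI locally_integrable_add(1) assms[THEN primitive_locally_integrable])
  fix a b :: real assume ab: "a \<le> b"
  show "u b + v b - (u a + v a) = (LINT x:{a..b}|lborel. g x + h x)"
    using primitiveD[OF assms(1) ab] primitiveD[OF assms(2) ab]
      set_integral_add(2)[OF assms[THEN primitive_locally_integrable, THEN locally_integrableD, of a b]]
    by simp
qed

lemma primitive_cmult:
  assumes "primitive u g"
  shows "primitive (\<lambda>x. c * u x) (\<lambda>x. c * g x)"
  unfolding primitive_def
proof (intro conjI allI impI locally_integrable_add(3) assms[THEN primitive_locally_integrable])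
  fix a b :: real assume ab: "a \<le> b"
  show "c * u b - c * u a = (LINT x:{a..b}|lborel. c * g x)"
    using primitiveD[OF assms ab] by (simp add: right_diff_distrib[symmetric])
qed

lemma primitive_diff:
  assumes "primitive u g" "primitive v h"
  shows "primitive (\<lambda>x. u x - v x) (\<lambda>x. g x - h x)"
  using primitive_add[OF assms(1) primitive_cmult[OF assms(2), of "-1"]] by simp

lemma primitive_const: "primitive (\<lambda>x. c) (\<lambda>x. 0)"
  by (simp add: primitive_def locally_integrable_def set_integrable_def)

lemma primitive_cong_AE:
  assumes "primitive u g" "AE x in lborel. g x = h x" "h \<in> borel_measurable borel"
  shows "primitive u h"
proof -
  have [measurable]: "g \<in> borel_measurable borel" "h \<in> borel_measurable borel"
    using locally_integrable_measurable[OF primitive_locally_integrable[OF assms(1)]] assms(3) by auto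
  have "set_integrable lborel {a..b} h" for a b
    using locally_integrableD[OF primitive_locally_integrable[OF assms(1)], of a b] assms(2)
    by (subst set_integrable_cong_AE[of _ _ g]) auto
  moreover have "(LINT x:{a..b}|lborel. g x) = (LINT x:{a..b}|lborel. h x)" for a b
    using assms(2) by (intro set_lebesgue_integral_cong_AE) auto
  ultimately show ?thesis using assms(1) unfolding primitive_def locally_integrable_def by auto
qed

lemma primitive_continuous:
  assumes "primitive u g"
  shows "continuous_on UNIV u"
proof -
  have "continuous (at x) u" for x
  proof -
    have gi: "set_integrable lborel {x - 1..x + 1} g"
      using locally_integrableD[OF primitive_locally_integrable[OF assms]] .
    have "continuous_on {x - 1..x + 1} (\<lambda>y. u (x - 1) + integral {x - 1..y} g)"
      using set_borel_integral_eq_integral(1)[OF gi]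
      by (intro continuous_intros indefinite_integral_continuous_1)
    moreover have "u (x - 1) + integral {x - 1..y} g = u y" if "y \<in> {x - 1..x + 1}" for y
    proof -
      have "u y - u (x - 1) = (LINT z:{x - 1..y}|lborel. g z)" using that by (intro primitiveD[OF assms]) auto
      also have "\<dots> = integral {x - 1..y} g"
        using locally_integrableD[OF primitive_locally_integrable[OF assms]]
        by (rule set_borel_integral_eq_integral(2))
      finally show ?thesis by simp
    qed
    ultimately have "continuous_on {x - 1..x + 1} u" using continuous_on_cong by (metis (no_types, lifting))
    then have "continuous_on {x - 1<..<x + 1} u" by (rule continuous_on_subset) auto
    then show ?thesis by (simp add: continuous_on_eq_continuous_at)
  qed
  then show ?thesis by (simp add: continuous_at_imp_continuous_on)
qed

lemma primitive_of_set_integral: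
  fixes g :: "real \<Rightarrow> real"
  assumes "locally_integrable g" "\<And>x. u x = (if 0 \<le> x then (LINT t:{0..x}|lborel. g t) else - (LINT t:{x..0}|lborel. g t))"
  shows "primitive u g"
  unfolding primitive_def
proof (intro conjI allI impI assms(1))
  fix a b :: real assume ab: "a \<le> b"
  have split: "(LINT t:{a..c}|lborel. g t) = (LINT t:{a..b}|lborel. g t) + (LINT t:{b..c}|lborel. g t)"
    if "a \<le> b" "b \<le> c" for a b c
  proof -
    have "integral {a..b} g + integral {b..c} g = integral {a..c} g"
      using that set_borel_integral_eq_integral(1)[OF locally_integrableD[OF assms(1)]]
      by (intro Henstock_Kurzweil_Integration.integral_combine) auto
    then show ?thesis
      by (simp add: set_borel_integral_eq_integral(2)[OF locally_integrableD[OF assms(1)]])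
  qed
  show "u b - u a = (LINT x:{a..b}|lborel. g x)"
    using ab split[of 0 a b] split[of a 0 b] split[of a b 0] by (auto simp: assms(2))
qed

text \<open>
Intervals generate the Borel sets, so a density with vanishing interval integrals vanishes almost
everywhere.
\<close>
lemma AE_zero_of_interval_integrals:
  fixes g :: "real \<Rightarrow> real"
  assumes g: "locally_integrable g" and z: "\<And>a b. a \<le> b \<Longrightarrow> (LINT x:{a..b}|lborel. g x) = 0"
  shows "AE x in lborel. g x = 0"
proof -
  have "AE x in lborel. indicator {- real n..real n} x * g x = 0" for n :: nat
  proof -
    define f where "f x = indicator {- real n..real n} x * g x" for x
    have fi: "integrable lborel f"
      using locally_integrableD[OF g, of "- real n" "real n"] by (simp add: set_integrable_def f_def[abs_def])
    have "set_lebesgue_integral lborel A f = 0" if "A \<in> sets borel" for A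
      using that
    proof (induction A rule: borel_set_induct)
      case empty
      then show ?case by (simp add: set_lebesgue_integral_def)
    next
      case (interval a b)
      have "set_lebesgue_integral lborel {a..b} f
          = (LINT x:{max a (- real n)..min b (real n)}|lborel. g x)"
        unfolding set_lebesgue_integral_def f_def
        by (intro Bochner_Integration.integral_cong) (auto simp: indicator_def)
      also have "\<dots> = 0"
        using z by (cases "max a (- real n) \<le> min b (real n)") (auto simp: set_lebesgue_integral_def)
      finally show ?case .
    next
      case (compl A)
      have "set_lebesgue_integral lborel (A \<union> - A) f = set_lebesgue_integral lborel A f + set_lebesgue_integral lborel (- A) f"
        using compl(1) fi by (intro set_integral_Un) (auto simp: set_integrable_def intro: integrable_mult_indicator[where 'b=real, simplified])
      moreover have "set_lebesgue_integral lborel UNIV f = 0"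
        using z[of "- real n" "real n"] by (simp add: set_lebesgue_integral_def f_def)
      ultimately show ?case using compl by (simp add: Compl_partition)
    next
      case (union A)
      have "set_integrable lborel (\<Union>i. A i) f"
        using union(2) fi by (auto simp: set_integrable_def intro: integrable_mult_indicator[where 'b=real, simplified])
      then have "set_lebesgue_integral lborel (\<Union>i. A i) f = (\<Sum>i. set_lebesgue_integral lborel (A i) f)"
        using union by (intro lebesgue_integral_countable_add) (auto simp: disjoint_family_on_def)
      then show ?case using union by simp
    qed
    then show ?thesis using sigma_finite_measure.density_zero[OF lborel.sigma_finite_measure_axioms fi] by (simp add: f_def)
  qed
  then have "AE x in lborel. \<forall>n::nat. indicator {- real n..real n} x * g x = 0"
    unfolding AE_all_countable by blast
  then show ?thesis
  proof eventually_elim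
    case (elim x)
    obtain n :: nat where "\<bar>x\<bar> \<le> real n" using real_arch_simple by blast
    then show ?case using elim[rule_format, of n] by (auto simp: indicator_def split: if_splits)
  qed
qed

lemma primitive_unique:
  assumes "primitive u g" "primitive u h"
  shows "AE x in lborel. g x = h x"
proof -
  have "primitive (\<lambda>x. 0) (\<lambda>x. g x - h x)" using primitive_diff[OF assms] by simp
  then have "AE x in lborel. g x - h x = 0"
    by (intro AE_zero_of_interval_integrals) (auto simp: primitive_def)
  then show ?thesis by simp
qed

text \<open>
The product rule is Fubini's theorem for \<open>g s * k t\<close> on the triangle \<open>a \<le> t \<le> s \<le> b\<close>.
\<close>
lemma primitive_mult:
  assumes u: "primitive u g" and w: "primitive w k"
  shows "primitive (\<lambda>x. u x * w x) (\<lambda>x. g x * w x + u x * k x)"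
  unfolding primitive_def
proof (intro conjI allI impI)
  note gi = primitive_locally_integrable[OF u] and ki = primitive_locally_integrable[OF w]
  note cu = primitive_continuous[OF u] and cw = primitive_continuous[OF w]
  have li: "locally_integrable (\<lambda>x. g x * w x)" "locally_integrable (\<lambda>x. u x * k x)"
    using locally_integrable_continuous_mult gi ki cu cw by auto
  then show "locally_integrable (\<lambda>x. g x * w x + u x * k x)" by (rule locally_integrable_add)
  fix a b :: real assume ab: "a \<le> b"
  have [measurable]: "g \<in> borel_measurable borel" "k \<in> borel_measurable borel"
    using gi ki by (auto intro: locally_integrable_measurable)
  define F where "F s t = (indicator {a..b} s * g s) * (indicator {a..b} t * k t) *
      indicator {z. snd z \<le> fst z} (s, t)" for s t :: real
  have gI: "integrable lborel (\<lambda>s. indicator {a..b} s * g s)" and kI: "integrable lborel (\<lambda>s. indicator {a..b} s * k s)"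
    using locally_integrableD[OF gi, of a b] locally_integrableD[OF ki, of a b]
    by (auto simp: set_integrable_def)
  have "integrable (lborel \<Otimes>\<^sub>M lborel) (\<lambda>z. (indicator {a..b} (fst z) * g (fst z)) * (indicator {a..b} (snd z) * k (snd z)))"
  proof (rule lborel_pair.Fubini_integrable)
    have "(\<lambda>x. \<integral>y. norm (indicator {a..b} x * g x * (indicator {a..b} y * k y)) \<partial>lborel)
       = (\<lambda>x. norm (indicator {a..b} x * g x) * (\<integral>y. norm (indicator {a..b} y * k y) \<partial>lborel))"
      unfolding norm_mult by (intro ext Bochner_Integration.integral_mult_right_zero)
    then show "integrable lborel (\<lambda>x. \<integral>y. norm (indicator {a..b} (fst (x, y)) * g (fst (x, y)) *
        (indicator {a..b} (snd (x, y)) * k (snd (x, y)))) \<partial>lborel)"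
      using integrable_norm[OF gI] by simp
  qed (use kI in auto)
  then have "integrable (lborel \<Otimes>\<^sub>M lborel) (\<lambda>z. F (fst z) (snd z))"
    unfolding F_def
  proof (rule Bochner_Integration.integrable_bound)
    show "(\<lambda>z. indicator {a..b} (fst z) * g (fst z) * (indicator {a..b} (snd z) * k (snd z)) *
        indicator {z. snd z \<le> fst z} (fst z, snd z)) \<in> borel_measurable (lborel \<Otimes>\<^sub>M lborel)"
      by measurable
  qed (auto simp: indicator_def)
  then have FI: "integrable (lborel \<Otimes>\<^sub>M lborel) (\<lambda>(x, y). F x y)" by (simp add: case_prod_beta')
  have "(\<integral>s. \<integral>t. F s t \<partial>lborel \<partial>lborel) = (\<integral>t. \<integral>s. F s t \<partial>lborel \<partial>lborel)"
    using lborel_pair.Fubini_integral[OF FI] by simp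
  moreover have "(\<integral>s. \<integral>t. F s t \<partial>lborel \<partial>lborel) = (LINT s:{a..b}|lborel. g s * w s) - w a * (u b - u a)"
  proof -
    have "(\<integral>t. F s t \<partial>lborel) = indicator {a..b} s * (g s * (w s - w a))" for s
    proof (cases "s \<in> {a..b}")
      case True
      have "(\<integral>t. F s t \<partial>lborel) = (\<integral>t. g s * (indicator {a..s} t * k t) \<partial>lborel)"
        using True by (intro Bochner_Integration.integral_cong) (auto simp: F_def indicator_def)
      also have "\<dots> = g s * (LINT t:{a..s}|lborel. k t)" by (simp add: set_lebesgue_integral_def)
      also have "\<dots> = g s * (w s - w a)" using primitiveD[OF w, of a s] True by simp
      finally show ?thesis using True by simp
    qed (simp add: F_def)
    then have "(\<integral>s. \<integral>t. F s t \<partial>lborel \<partial>lborel) = (\<integral>s. indicator {a..b} s * (g s * (w s - w a)) \<partial>lborel)"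
      by presburger
    also have "\<dots> = (LINT s:{a..b}|lborel. g s * w s - w a * g s)"
      by (simp add: set_lebesgue_integral_def algebra_simps)
    also have "\<dots> = (LINT s:{a..b}|lborel. g s * w s) - w a * (LINT s:{a..b}|lborel. g s)"
      using locally_integrableD[OF li(1)] locally_integrableD[OF gi] by (subst set_integral_diff) auto
    finally show ?thesis using primitiveD[OF u ab] by simp
  qed
  moreover have "(\<integral>t. \<integral>s. F s t \<partial>lborel \<partial>lborel) = u b * (w b - w a) - (LINT t:{a..b}|lborel. u t * k t)"
  proof -
    have "(\<integral>s. F s t \<partial>lborel) = indicator {a..b} t * (k t * (u b - u t))" for t
    proof (cases "t \<in> {a..b}")
      case True
      have "(\<integral>s. F s t \<partial>lborel) = (\<integral>s. k t * (indicator {t..b} s * g s) \<partial>lborel)"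
        using True by (intro Bochner_Integration.integral_cong) (auto simp: F_def indicator_def)
      also have "\<dots> = k t * (LINT s:{t..b}|lborel. g s)" by (simp add: set_lebesgue_integral_def)
      also have "\<dots> = k t * (u b - u t)" using primitiveD[OF u, of t b] True by simp
      finally show ?thesis using True by simp
    qed (simp add: F_def)
    then have "(\<integral>t. \<integral>s. F s t \<partial>lborel \<partial>lborel) = (\<integral>t. indicator {a..b} t * (k t * (u b - u t)) \<partial>lborel)"
      by presburger
    also have "\<dots> = (LINT t:{a..b}|lborel. u b * k t - u t * k t)"
      by (simp add: set_lebesgue_integral_def algebra_simps)
    also have "\<dots> = u b * (LINT t:{a..b}|lborel. k t) - (LINT t:{a..b}|lborel. u t * k t)"
      using locally_integrableD[OF li(2)] locally_integrableD[OF ki] by (subst set_integral_diff) auto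
    finally show ?thesis using primitiveD[OF w ab] by simp
  qed
  ultimately have "(LINT s:{a..b}|lborel. g s * w s) + (LINT t:{a..b}|lborel. u t * k t) = u b * w b - u a * w a"
    by (simp add: algebra_simps)
  then show "u b * w b - u a * w a = (LINT x:{a..b}|lborel. g x * w x + u x * k x)"
    using set_integral_add(2)[OF locally_integrableD[OF li(1), of a b] locally_integrableD[OF li(2), of a b]]
    by simp
qed

lemma primitive_of_deriv:
  assumes "\<And>x. (f has_real_derivative f' x) (at x)" "continuous_on UNIV f'"
  shows "primitive f f'"
  unfolding primitive_def
proof (intro conjI allI impI)
  show li: "locally_integrable f'" using continuous_locally_integrable[OF assms(2)] .
  fix a b :: real assume "a \<le> b"
  then have "(f' has_integral (f b - f a)) {a..b}"
    by (rule fundamental_theorem_of_calculus)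
      (rule has_vector_derivative_at_within[OF assms(1)[unfolded has_real_derivative_iff_has_vector_derivative]])
  from integral_unique[OF this] show "f b - f a = (LINT x:{a..b}|lborel. f' x)"
    using set_borel_integral_eq_integral(2)[OF locally_integrableD[OF li], of a b] by simp
qed

lemma primitive_of_continuous_has_derivative:
  assumes "primitive u g" "continuous_on UNIV g"
  shows "(u has_real_derivative g x) (at x)"
proof -
  have "((\<lambda>y. integral {x - 1..y} g) has_real_derivative g x) (at x within {x - 1..x + 1})"
    by (rule integral_has_real_derivative[OF continuous_on_subset[OF assms(2)]]) simp_all
  from DERIV_add[OF DERIV_const this, of "u (x - 1)"]
  have A: "((\<lambda>y. u (x - 1) + integral {x - 1..y} g) has_real_derivative g x) (at x within {x - 1..x + 1})"
    by simp
  have B: "u (x - 1) + integral {x - 1..y} g = u y" if "y \<in> {x - 1..x + 1}" for y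
    using primitiveD[OF assms(1), of "x - 1" y] that
      set_borel_integral_eq_integral(2)[OF locally_integrableD[OF primitive_locally_integrable[OF assms(1)]], of "x - 1" y]
    by simp
  have "(u has_real_derivative g x) (at x within {x - 1..x + 1})"
    by (rule has_field_derivative_transform_within[OF A zero_less_one]) (use B in simp_all)
  moreover have "at x within {x - 1..x + 1} = at x" by (rule at_within_Icc_at) simp_all
  ultimately show ?thesis by simp
qed

section \<open>Weak derivatives are primitives\<close>

text \<open>
The antiderivative that vanishes at \<open>0\<close>.
\<close>
definition primitive0 :: "(real \<Rightarrow> real) \<Rightarrow> real \<Rightarrow> real" where
  "primitive0 g x = (if 0 \<le> x then (LINT t:{0..x}|lborel. g t) else - (LINT t:{x..0}|lborel. g t))"

lemma primitive_primitive0: "locally_integrable g \<Longrightarrow> primitive (primitive0 g) g"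
  by (rule primitive_of_set_integral) (simp_all add: primitive0_def)

lemma test_function_support:
  assumes "test_function \<phi>"
  obtains R where "0 < R" "\<And>x. R \<le> \<bar>x\<bar> \<Longrightarrow> \<phi> x = 0" "\<And>x. R \<le> \<bar>x\<bar> \<Longrightarrow> deriv \<phi> x = 0"
proof -
  have "bounded {x. \<phi> x \<noteq> 0}"
    using assms bounded_subset[OF compact_imp_bounded closure_subset] by (auto simp: test_function_def)
  then obtain R where R: "0 < R" "\<And>x. \<phi> x \<noteq> 0 \<Longrightarrow> \<bar>x\<bar> \<le> R"
    by (auto simp: bounded_pos)
  have "deriv \<phi> x = 0" if "R + 1 \<le> \<bar>x\<bar>" for x
  proof -
    have op: "open {x :: real. R < \<bar>x\<bar>}" by (intro open_Collect_less continuous_intros)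
    have "x \<in> {x. R < \<bar>x\<bar>}" using that by simp
    moreover have "0 = \<phi> y" if "y \<in> {x. R < \<bar>x\<bar>}" for y using R(2)[of y] that by fastforce
    ultimately have "(\<phi> has_real_derivative 0) (at x)"
      by (rule has_field_derivative_transform_within_open[OF DERIV_const op])
    then show ?thesis by (simp add: DERIV_imp_deriv)
  qed
  moreover have "\<phi> x = 0" if "R + 1 \<le> \<bar>x\<bar>" for x using R(2)[of x] that by fastforce
  ultimately show ?thesis using R(1) by (intro that[of "R + 1"]) auto
qed

lemma test_function_deriv:
  assumes "test_function \<phi>"
  shows "(\<phi> has_real_derivative deriv \<phi> x) (at x)" "continuous_on UNIV (deriv \<phi>)"
proof -
  obtain D where D: "\<And>x. (\<phi> has_real_derivative D x) (at x)" "continuous_on UNIV D"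
    using assms unfolding test_function_def C1_differentiable_on_def
    by (auto simp: has_real_derivative_iff_has_vector_derivative)
  then have "deriv \<phi> = D" by (auto simp: DERIV_imp_deriv)
  then show "(\<phi> has_real_derivative deriv \<phi> x) (at x)" "continuous_on UNIV (deriv \<phi>)" using D by auto
qed

lemma test_function_primitive: "test_function \<phi> \<Longrightarrow> primitive \<phi> (deriv \<phi>)"
  by (rule primitive_of_deriv) (simp_all add: test_function_deriv)

lemma test_function_continuous: "test_function \<phi> \<Longrightarrow> continuous_on UNIV \<phi>"
  using primitive_continuous test_function_primitive by blast

lemma integral_compact_support:
  fixes f :: "real \<Rightarrow> 'a::euclidean_space"
  assumes "\<And>x. x \<notin> {a..b} \<Longrightarrow> f x = 0"
  shows "(LINT x|lborel. f x) = (LINT x:{a..b}|lborel. f x)"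
    and "integrable lborel f \<longleftrightarrow> set_integrable lborel {a..b} f"
proof -
  have "f x = indicator {a..b} x *\<^sub>R f x" for x using assms[of x] by (cases "x \<in> {a..b}") auto
  then have "f = (\<lambda>x. indicator {a..b} x *\<^sub>R f x)" by blast
  then show "(LINT x|lborel. f x) = (LINT x:{a..b}|lborel. f x)"
    "integrable lborel f \<longleftrightarrow> set_integrable lborel {a..b} f"
    unfolding set_lebesgue_integral_def set_integrable_def by simp_all
qed

lemma continuous_compact_support_integrable:
  assumes "continuous_on UNIV \<phi>" "\<And>x. R \<le> \<bar>x\<bar> \<Longrightarrow> \<phi> x = 0" "locally_integrable g"
  shows "integrable lborel (\<lambda>x. \<phi> x * g x :: real)"
proof -
  have "integrable lborel (\<lambda>x. \<phi> x * g x) \<longleftrightarrow> set_integrable lborel {-R..R} (\<lambda>x. \<phi> x * g x)"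
    using assms(2) by (intro integral_compact_support) auto
  then show ?thesis
    using locally_integrableD[OF locally_integrable_continuous_mult(1)[OF assms(3,1)]] by simp
qed

lemma primitive_imp_test_identity:
  assumes "primitive u g" "test_function \<phi>"
  shows "(LINT x|lborel. deriv \<phi> x * u x) = - (LINT x|lborel. \<phi> x * g x)"
proof -
  obtain R where R: "0 < R" "\<And>x. R \<le> \<bar>x\<bar> \<Longrightarrow> \<phi> x = 0" "\<And>x. R \<le> \<bar>x\<bar> \<Longrightarrow> deriv \<phi> x = 0"
    using test_function_support[OF assms(2)] by blast
  have "primitive (\<lambda>x. \<phi> x * u x) (\<lambda>x. deriv \<phi> x * u x + \<phi> x * g x)"
    using primitive_mult[OF test_function_primitive[OF assms(2)] assms(1)] .
  from primitiveD[OF this, of "-R" R]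
  have "(LINT x:{-R..R}|lborel. deriv \<phi> x * u x + \<phi> x * g x) = 0" using R by simp
  moreover have "(LINT x|lborel. deriv \<phi> x * u x + \<phi> x * g x) = (LINT x:{-R..R}|lborel. deriv \<phi> x * u x + \<phi> x * g x)"
    using R by (intro integral_compact_support) auto
  moreover have "integrable lborel (\<lambda>x. deriv \<phi> x * u x)"
    using test_function_deriv(2)[OF assms(2)] R(3)
      continuous_locally_integrable[OF primitive_continuous[OF assms(1)]]
    by (rule continuous_compact_support_integrable)
  moreover have "integrable lborel (\<lambda>x. \<phi> x * g x)"
    using test_function_continuous[OF assms(2)] R(2) primitive_locally_integrable[OF assms(1)]
    by (rule continuous_compact_support_integrable)
  ultimately show ?thesis by simp
qed

lemma primitive_imp_weak_deriv: "primitive u g \<Longrightarrow> weak_deriv u g"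
  unfolding weak_deriv_def
  by (simp add: primitive_imp_test_identity primitive_locally_integrable
      continuous_locally_integrable primitive_continuous)

text \<open>
Continuous cutoffs decreasing to the indicator function of \<open>{a..b}\<close>, with slopes \<open>Suc n\<close>.
\<close>
definition trapezoid :: "real \<Rightarrow> real \<Rightarrow> nat \<Rightarrow> real \<Rightarrow> real" where
  "trapezoid a b n x = max 0 (1 - real (Suc n) * max 0 (max (a - x) (x - b)))"

lemma trapezoid_continuous: "continuous_on S (trapezoid a b n)"
  unfolding trapezoid_def by (intro continuous_intros)

lemma trapezoid_bounds: "0 \<le> trapezoid a b n x" "trapezoid a b n x \<le> 1"
  by (auto simp: trapezoid_def)

lemma trapezoid_inside: "x \<in> {a..b} \<Longrightarrow> trapezoid a b n x = 1"
  by (auto simp: trapezoid_def max_def)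

lemma trapezoid_outside:
  assumes "x \<notin> {a - 1..b + 1}"
  shows "trapezoid a b n x = 0"
proof -
  have "1 < max 0 (max (a - x) (x - b))" using assms by (auto simp: max_def)
  then have "1 * 1 \<le> real (Suc n) * max 0 (max (a - x) (x - b))" by (intro mult_mono) auto
  then show ?thesis by (simp add: trapezoid_def)
qed

lemma trapezoid_tendsto: "(\<lambda>n. trapezoid a b n x) \<longlonglongrightarrow> indicator {a..b} x"
proof (cases "x \<in> {a..b}")
  case True
  then show ?thesis by (simp add: trapezoid_inside)
next
  case False
  define m where "m = max 0 (max (a - x) (x - b))"
  have m: "0 < m" using False by (auto simp: m_def max_def)
  obtain k :: nat where k: "1 / m \<le> real k" using real_arch_simple by blast
  have "trapezoid a b n x = 0" if "n \<ge> k" for n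
  proof -
    have "1 \<le> real k * m" using k m by (simp add: field_simps)
    also have "\<dots> \<le> real (Suc n) * m" using that m by (intro mult_right_mono) auto
    finally show ?thesis by (simp add: trapezoid_def m_def[symmetric])
  qed
  then have "eventually (\<lambda>n. trapezoid a b n x = 0) sequentially"
    unfolding eventually_sequentially by blast
  then have "(\<lambda>n. trapezoid a b n x) \<longlonglongrightarrow> 0" by (rule tendsto_eventually)
  then show ?thesis using False by simp
qed

lemma trapezoid_integral_tendsto:
  assumes "locally_integrable g"
  shows "(\<lambda>n. LINT x|lborel. trapezoid a b n x * g x) \<longlonglongrightarrow> (LINT x:{a..b}|lborel. g x)"
    and "integrable lborel (\<lambda>x. trapezoid a b n x * g x)"
proof -
  have [measurable]: "g \<in> borel_measurable borel" by (rule locally_integrable_measurable[OF assms])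
  have [measurable]: "trapezoid a b n \<in> borel_measurable borel" for n
    by (rule borel_measurable_continuous_onI[OF trapezoid_continuous])
  have w: "integrable lborel (\<lambda>x. indicator {a - 1..b + 1} x * \<bar>g x\<bar>)"
    using set_integrable_abs[OF locally_integrableD[OF assms]] by (simp add: set_integrable_def)
  have bd: "norm (trapezoid a b n x * g x) \<le> indicator {a - 1..b + 1} x * \<bar>g x\<bar>" for n x
    using trapezoid_bounds[of a b n x] trapezoid_outside[of x a b n]
    by (cases "x \<in> {a - 1..b + 1}") (auto simp: abs_mult intro: mult_left_le_one_le)
  have lim: "(\<lambda>n. trapezoid a b n x * g x) \<longlonglongrightarrow> indicator {a..b} x *\<^sub>R g x" for x
    using tendsto_mult[OF trapezoid_tendsto tendsto_const] by simp
  show "(\<lambda>n. LINT x|lborel. trapezoid a b n x * g x) \<longlonglongrightarrow> (LINT x:{a..b}|lborel. g x)"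
    unfolding set_lebesgue_integral_def
    by (rule integral_dominated_convergence[OF _ _ w]) (use bd lim in auto)
  show "integrable lborel (\<lambda>x. trapezoid a b n x * g x)"
    by (rule Bochner_Integration.integrable_bound[OF w]) (use bd in \<open>auto simp: abs_mult\<close>)
qed

definition mass :: "real \<Rightarrow> real \<Rightarrow> nat \<Rightarrow> real" where
  "mass a b n = (LINT x|lborel. trapezoid a b n x)"

definition probe' :: "real \<Rightarrow> real \<Rightarrow> nat \<Rightarrow> real \<Rightarrow> real" where
  "probe' a b n x = trapezoid a b n x - mass a b n / mass 0 1 n * trapezoid 0 1 n x"

text \<open>
The probes are test functions whose derivative is a trapezoid on \<open>{a..b}\<close> minus the multiple of the
trapezoid on \<open>{0..1}\<close> that makes the total integral vanish. For rational endpoints there are countably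
many of them. That matters for functions of two variables whose weak identity holds for each test
function outside a null set of parameters depending on the test function.
\<close>
definition probe :: "real \<Rightarrow> real \<Rightarrow> nat \<Rightarrow> real \<Rightarrow> real" where
  "probe a b n x = primitive0 (probe' a b n) x - primitive0 (probe' a b n) (min a 0 - 1)"

lemma locally_integrable_const: "locally_integrable (\<lambda>x. c :: real)"
  by (rule continuous_locally_integrable) simp

lemma mass_tendsto: "a \<le> b \<Longrightarrow> mass a b \<longlonglongrightarrow> b - a"
  using trapezoid_integral_tendsto(1)[OF locally_integrable_const[of 1], of a b]
  by (simp add: mass_def[abs_def] set_lebesgue_integral_def)

lemma mass_unit: "1 \<le> mass 0 1 n"
proof -
  have "(LINT x|lborel. indicator {0..1::real} x) \<le> mass 0 1 n"
    unfolding mass_def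
  proof (rule integral_mono)
    show "integrable lborel (trapezoid 0 1 n)"
      using trapezoid_integral_tendsto(2)[OF locally_integrable_const[of 1]] by simp
    show "integrable lborel (indicator {0..1::real} :: real \<Rightarrow> real)" by simp
    show "indicator {0..1} x \<le> trapezoid 0 1 n x" for x :: real
      using trapezoid_inside[of x 0 1 n] trapezoid_bounds(1)[of 0 1 n x] by (cases "x \<in> {0..1}") auto
  qed
  then show ?thesis by simp
qed

lemma probe'_continuous: "continuous_on S (probe' a b n)"
  unfolding probe'_def by (intro continuous_intros trapezoid_continuous)

lemma probe_primitive: "primitive (probe a b n) (probe' a b n)"
proof -
  have "primitive (primitive0 (probe' a b n)) (probe' a b n)"
    by (rule primitive_primitive0[OF continuous_locally_integrable[OF probe'_continuous]])
  from primitive_diff[OF this primitive_const] show ?thesis by (simp add: probe_def[abs_def])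
qed

lemma probe_deriv: "(probe a b n has_real_derivative probe' a b n x) (at x)"
  by (rule primitive_of_continuous_has_derivative[OF probe_primitive probe'_continuous])

lemma deriv_probe: "deriv (probe a b n) = probe' a b n"
  using DERIV_imp_deriv[OF probe_deriv] by blast

lemma probe_test_function: "test_function (probe a b n)"
proof -
  let ?lo = "min a 0 - 1" and ?hi = "max b 1 + 1"
  have out: "probe' a b n x = 0" if "x \<notin> {?lo..?hi}" for x
  proof -
    have "x \<notin> {a - 1..b + 1}" "x \<notin> {0 - 1..1 + 1}" using that by auto
    then show ?thesis by (simp add: probe'_def trapezoid_outside)
  qed
  have total: "(LINT x|lborel. probe' a b n x) = 0"
  proof -
    have i: "integrable lborel (trapezoid a b n)" for a b
      using trapezoid_integral_tendsto(2)[OF locally_integrable_const[of 1]] by simp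
    have "(LINT x|lborel. probe' a b n x) = mass a b n - mass a b n / mass 0 1 n * mass 0 1 n"
      unfolding probe'_def mass_def using i by simp
    then show ?thesis using mass_unit[of n] by simp
  qed
  have lohi: "?lo \<le> ?hi" by linarith
  have lo0: "probe a b n ?lo = 0" by (simp add: probe_def)
  have left: "probe a b n x = 0" if "x < ?lo" for x
  proof -
    have "probe a b n ?lo - probe a b n x = (LINT t:{x..?lo}|lborel. probe' a b n t)"
      using that by (intro primitiveD[OF probe_primitive]) simp
    also have "\<dots> = (LINT t:{x..?lo}|lborel. 0)"
    proof (rule set_lebesgue_integral_cong_AE)
      have "AE t in lborel. t \<noteq> ?lo" by (rule AE_lborel_singleton)
      then show "AE t\<in>{x..?lo} in lborel. probe' a b n t = 0"
      proof eventually_elim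
        case (elim t)
        then show ?case using out[of t] by fastforce
      qed
    qed (auto intro: borel_measurable_continuous_onI[OF probe'_continuous])
    finally show ?thesis using lo0 by simp
  qed
  have right: "probe a b n x = 0" if "x > ?hi" for x
  proof -
    have "probe a b n x - probe a b n ?lo = (LINT t:{?lo..x}|lborel. probe' a b n t)"
      using that lohi by (intro primitiveD[OF probe_primitive]) linarith
    also have "\<dots> = (LINT t|lborel. probe' a b n t)"
    proof (rule integral_compact_support(1)[symmetric])
      fix t assume "t \<notin> {?lo..x}"
      then have "t \<notin> {?lo..?hi}" using that by auto
      then show "probe' a b n t = 0" by (rule out)
    qed
    finally show ?thesis using lo0 total by simp
  qed
  have "x \<in> {?lo..?hi}" if "probe a b n x \<noteq> 0" for x
    unfolding atLeastAtMost_iff using left[of x] right[of x] that by (meson not_le)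
  then have "{x. probe a b n x \<noteq> 0} \<subseteq> {?lo..?hi}" by blast
  then have "closure {x. probe a b n x \<noteq> 0} \<subseteq> {?lo..?hi}" by (simp add: closure_minimal)
  then have "compact (closure {x. probe a b n x \<noteq> 0})"
    by (meson bounded_closed_interval bounded_subset closed_closure compact_eq_bounded_closed)
  moreover have "probe a b n C1_differentiable_on UNIV"
    unfolding C1_differentiable_on_def
    using probe_deriv probe'_continuous
    by (intro exI[of _ "probe' a b n"]) (simp add: has_real_derivative_iff_has_vector_derivative)
  ultimately show ?thesis by (simp add: test_function_def)
qed

text \<open>
Probes detect weak derivatives: the identities say that \<open>d = g - primitive0 h\<close> has the same mean over
every interval \<open>{a..b}\<close> with rational endpoints as over \<open>{0..1}\<close>, in the limit of steep trapezoids.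
Hence \<open>d\<close> is constant almost everywhere.
\<close>
lemma primitive_of_probe_identities:
  assumes g: "locally_integrable g" and h: "locally_integrable h"
    and id: "\<And>a b n. a \<in> \<rat> \<Longrightarrow> b \<in> \<rat> \<Longrightarrow> a < b \<Longrightarrow>
      (LINT x|lborel. deriv (probe a b n) x * g x) = - (LINT x|lborel. probe a b n x * h x)"
  shows "AE x in lborel. g x = primitive0 h x + (LINT t:{0..1}|lborel. g t - primitive0 h t)"
proof -
  define d where "d x = g x - primitive0 h x" for x
  have Jh: "primitive (primitive0 h) h" by (rule primitive_primitive0[OF h])
  have Jl: "locally_integrable (primitive0 h)" by (rule continuous_locally_integrable[OF primitive_continuous[OF Jh]])
  have dl: "locally_integrable d" unfolding d_def by (rule locally_integrable_add(2)[OF g Jl])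
  define c where "c = (LINT t:{0..1}|lborel. d t)"
  have eq: "(LINT x:{a..b}|lborel. d x) = (b - a) * c" if ab: "a \<in> \<rat>" "b \<in> \<rat>" "a < b" for a b
  proof -
    have "(LINT x|lborel. trapezoid a b n x * d x) = mass a b n / mass 0 1 n * (LINT x|lborel. trapezoid 0 1 n x * d x)" for n
    proof -
      obtain R where R: "\<And>x. R \<le> \<bar>x\<bar> \<Longrightarrow> deriv (probe a b n) x = 0"
        using test_function_support[OF probe_test_function] by blast
      have pc: "continuous_on UNIV (deriv (probe a b n))" by (simp add: deriv_probe probe'_continuous)
      have "(LINT x|lborel. deriv (probe a b n) x * d x)
          = (LINT x|lborel. deriv (probe a b n) x * g x - deriv (probe a b n) x * primitive0 h x)"
        by (simp add: d_def right_diff_distrib)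
      also have "\<dots> = (LINT x|lborel. deriv (probe a b n) x * g x) - (LINT x|lborel. deriv (probe a b n) x * primitive0 h x)"
        by (intro Bochner_Integration.integral_diff continuous_compact_support_integrable[OF pc R] g Jl)
      also have "\<dots> = 0"
        unfolding id[OF ab] primitive_imp_test_identity[OF Jh probe_test_function] by simp
      finally have "0 = (LINT x|lborel. trapezoid a b n x * d x - mass a b n / mass 0 1 n * (trapezoid 0 1 n x * d x))"
        by (simp add: deriv_probe probe'_def left_diff_distrib mult.assoc)
      also have "\<dots> = (LINT x|lborel. trapezoid a b n x * d x) - mass a b n / mass 0 1 n * (LINT x|lborel. trapezoid 0 1 n x * d x)"
        using trapezoid_integral_tendsto(2)[OF dl]
        by (subst Bochner_Integration.integral_diff) (auto simp del: times_divide_eq_left)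
      finally show ?thesis by simp
    qed
    moreover have "(\<lambda>n. mass a b n / mass 0 1 n * (LINT x|lborel. trapezoid 0 1 n x * d x)) \<longlonglongrightarrow> (b - a) / (1 - 0) * c"
      unfolding c_def using ab(3)
      by (intro tendsto_intros mass_tendsto trapezoid_integral_tendsto[OF dl]) auto
    ultimately show ?thesis
      using LIMSEQ_unique[OF trapezoid_integral_tendsto(1)[OF dl, of a b]] by simp
  qed
  define D where "D x = primitive0 (\<lambda>x. d x - c) x" for x
  have dcl: "locally_integrable (\<lambda>x. d x - c)" by (rule locally_integrable_add(2)[OF dl locally_integrable_const])
  have Dp: "primitive D (\<lambda>x. d x - c)" unfolding D_def using primitive_primitive0[OF dcl] by simp
  have Dab: "D b - D a = 0" if ab: "a \<in> \<rat>" "b \<in> \<rat>" "a < b" for a b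
  proof -
    have "D b - D a = (LINT x:{a..b}|lborel. d x - c)" using that by (intro primitiveD[OF Dp]) simp
    also have "\<dots> = (LINT x:{a..b}|lborel. d x) - (LINT x:{a..b}|lborel. c)"
      by (intro set_integral_diff(2) locally_integrableD dl locally_integrable_const)
    also have "(LINT x:{a..b}|lborel. c) = (b - a) * c"
      using ab(3) by (simp add: set_lebesgue_integral_def)
    finally show ?thesis using eq[OF ab] by simp
  qed
  have Dr: "D x = D 0" if "x \<in> \<rat>" for x
  proof (cases x "0 :: real" rule: linorder_cases)
    case less
    then show ?thesis using Dab[OF that Rats_0] by linarith
  next
    case greater
    then show ?thesis using Dab[OF Rats_0 that] by linarith
  qed simp
  have Dc: "D x = D 0" for x
  proof (rule continuous_constant_on_closure[OF _ Dr])
    show "continuous_on (closure \<rat>) D" using primitive_continuous[OF Dp] by (simp add: Rats_closure_real)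
    show "x \<in> closure \<rat>" by (simp add: Rats_closure_real)
  qed
  have "(LINT x:{a..b}|lborel. d x - c) = 0" if "a \<le> b" for a b
    using primitiveD[OF Dp that] Dc[of a] Dc[of b] by linarith
  from AE_zero_of_interval_integrals[OF dcl this]
  have "AE x in lborel. d x - c = 0" by blast
  then show ?thesis
  proof eventually_elim
    case (elim x)
    then show ?case by (simp add: d_def c_def)
  qed
qed

lemma weak_deriv_imp_primitive:
  fixes u v :: "real \<Rightarrow> real"
  assumes "weak_deriv u v"
  shows "\<exists>w. primitive w v \<and> (AE x in lborel. u x = w x)"
proof -
  have "AE x in lborel. u x = primitive0 v x + (LINT t:{0..1}|lborel. u t - primitive0 v t)"
    using assms probe_test_function by (intro primitive_of_probe_identities) (auto simp: weak_deriv_def)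
  moreover have "primitive (\<lambda>x. primitive0 v x + (LINT t:{0..1}|lborel. u t - primitive0 v t)) (\<lambda>x. v x + 0)"
    using assms by (intro primitive_add primitive_primitive0 primitive_const) (auto simp: weak_deriv_def)
  ultimately show ?thesis by (intro exI[of _ "\<lambda>x. primitive0 v x + (LINT t:{0..1}|lborel. u t - primitive0 v t)"]) auto
qed

section \<open>Square-integrable functions and the Sobolev space\<close>

definition sq_int :: "(real \<Rightarrow> real) \<Rightarrow> bool" where
  "sq_int f \<longleftrightarrow> f \<in> borel_measurable borel \<and> integrable lborel (\<lambda>x. (f x)\<^sup>2)"

lemma sq_int_measurable: "sq_int f \<Longrightarrow> f \<in> borel_measurable borel"
  and sq_int_integrable: "sq_int f \<Longrightarrow> integrable lborel (\<lambda>x. (f x)\<^sup>2)"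
  by (auto simp: sq_int_def)

lemma abs_mult_le_squares: "\<bar>x * y :: real\<bar> \<le> (x\<^sup>2 + y\<^sup>2) / 2"
proof -
  have "0 \<le> (\<bar>x\<bar> - \<bar>y\<bar>)\<^sup>2" by simp
  then have "2 * (\<bar>x\<bar> * \<bar>y\<bar>) \<le> \<bar>x\<bar>\<^sup>2 + \<bar>y\<bar>\<^sup>2" unfolding power2_diff by linarith
  then show ?thesis by (simp add: abs_mult)
qed

lemma sq_int_mult_integrable:
  assumes "sq_int f" "sq_int g"
  shows "integrable lborel (\<lambda>x. f x * g x)"
proof (rule Bochner_Integration.integrable_bound)
  show "integrable lborel (\<lambda>x. ((f x)\<^sup>2 + (g x)\<^sup>2) / 2)" using assms by (simp add: sq_int_def)
  show "(\<lambda>x. f x * g x) \<in> borel_measurable lborel"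
    using assms[THEN sq_int_measurable] by measurable
  show "AE x in lborel. norm (f x * g x) \<le> norm (((f x)\<^sup>2 + (g x)\<^sup>2) / 2)"
    by (intro AE_I2) (use abs_mult_le_squares in \<open>simp add: abs_of_nonneg\<close>)
qed

lemma sq_int_add:
  assumes "sq_int f" "sq_int g"
  shows "sq_int (\<lambda>x. f x + g x)"
proof -
  have "integrable lborel (\<lambda>x. (f x)\<^sup>2 + (g x)\<^sup>2 + 2 * (f x * g x))"
    using assms sq_int_mult_integrable[OF assms] by (simp add: sq_int_def)
  moreover have "(\<lambda>x. (f x)\<^sup>2 + (g x)\<^sup>2 + 2 * (f x * g x)) = (\<lambda>x. (f x + g x)\<^sup>2)"
    by (auto simp: power2_sum)
  ultimately show ?thesis using assms unfolding sq_int_def by (auto intro: borel_measurable_add)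
qed

lemma sq_int_bounded_mult:
  assumes f: "sq_int f" and h: "h \<in> borel_measurable borel" "AE x in lborel. \<bar>h x\<bar> \<le> C"
  shows "sq_int (\<lambda>x. h x * f x)"
  unfolding sq_int_def
proof
  note [measurable] = sq_int_measurable[OF f] h(1)
  show "(\<lambda>x. h x * f x) \<in> borel_measurable borel" by measurable
  show "integrable lborel (\<lambda>x. (h x * f x)\<^sup>2)"
  proof (rule Bochner_Integration.integrable_bound)
    show "integrable lborel (\<lambda>x. C\<^sup>2 * (f x)\<^sup>2)" using sq_int_integrable[OF f] by simp
    show "AE x in lborel. norm ((h x * f x)\<^sup>2) \<le> norm (C\<^sup>2 * (f x)\<^sup>2)"
      using h(2)
    proof eventually_elim
      case (elim x)
      then have "(h x)\<^sup>2 \<le> C\<^sup>2" by (simp add: abs_le_square_iff[symmetric])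
      then show ?case by (simp add: power_mult_distrib mult_right_mono)
    qed
  qed measurable
qed

lemma sq_int_cmult: "sq_int f \<Longrightarrow> sq_int (\<lambda>x. c * f x)"
  by (rule sq_int_bounded_mult[of _ _ "\<bar>c\<bar>"]) auto

lemma sq_int_diff: "sq_int f \<Longrightarrow> sq_int g \<Longrightarrow> sq_int (\<lambda>x. f x - g x)"
  using sq_int_add[of f "\<lambda>x. (-1) * g x"] sq_int_cmult[of g "-1"] by simp

lemma sq_int_zero: "sq_int (\<lambda>x. 0)"
  by (simp add: sq_int_def)

lemma sq_int_indicator: "sq_int (indicator {a..b})"
proof -
  have "(\<lambda>x. (indicator {a..b} x)\<^sup>2) = (indicator {a..b} :: real \<Rightarrow> real)"
    by (auto simp: indicator_def power2_eq_square)
  moreover have "integrable lborel (indicator {a..b} :: real \<Rightarrow> real)"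
    using locally_integrableD[OF locally_integrable_const[of 1], of a b] by (simp add: set_integrable_def)
  ultimately show ?thesis unfolding sq_int_def by simp
qed

lemma sq_int_cong_AE:
  assumes "sq_int f" "AE x in lborel. f x = g x" "g \<in> borel_measurable borel"
  shows "sq_int g"
proof -
  note [measurable] = sq_int_measurable[OF assms(1)] assms(3)
  have "integrable lborel (\<lambda>x. (g x)\<^sup>2) \<longleftrightarrow> integrable lborel (\<lambda>x. (f x)\<^sup>2)"
    by (rule integrable_cong_AE) (use assms(2) in auto)
  then show ?thesis using assms by (simp add: sq_int_def)
qed

lemma sq_int_locally_integrable: "sq_int f \<Longrightarrow> locally_integrable f"
  unfolding locally_integrable_def set_integrable_def
  using sq_int_mult_integrable[OF sq_int_indicator, of f] by simp

lemma quadratic_nonneg_discriminant: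
  fixes A B C :: real
  assumes "\<And>t. 0 \<le> A * t\<^sup>2 + 2 * B * t + C" "0 \<le> A"
  shows "B\<^sup>2 \<le> A * C"
proof (cases "A = 0")
  case True
  have "B = 0"
  proof (rule ccontr)
    assume "B \<noteq> 0"
    then have "A * (- (C + 1) / (2 * B))\<^sup>2 + 2 * B * (- (C + 1) / (2 * B)) + C = -1"
      using True by simp
    then show False using assms(1)[of "- (C + 1) / (2 * B)"] by linarith
  qed
  then show ?thesis using True by simp
next
  case False
  then have A: "0 < A" using assms(2) by simp
  have "A * (- B / A)\<^sup>2 + 2 * B * (- B / A) + C = C - B\<^sup>2 / A"
    using A by (simp add: field_simps power2_eq_square)
  then have "B\<^sup>2 / A \<le> C" using assms(1)[of "- B / A"] by linarith
  then show ?thesis using A by (simp add: field_simps)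
qed

lemma cauchy_schwarz_sq_int:
  assumes "sq_int f" "sq_int g"
  shows "(LINT x|lborel. f x * g x)\<^sup>2 \<le> (LINT x|lborel. (f x)\<^sup>2) * (LINT x|lborel. (g x)\<^sup>2)"
proof (rule quadratic_nonneg_discriminant)
  note i = sq_int_integrable[OF assms(1)] sq_int_integrable[OF assms(2)] sq_int_mult_integrable[OF assms]
  fix t
  have "0 \<le> (LINT x|lborel. (t * f x + g x)\<^sup>2)" by simp
  also have "\<dots> = (LINT x|lborel. t\<^sup>2 * (f x)\<^sup>2 + (2 * t) * (f x * g x) + (g x)\<^sup>2)"
    by (intro Bochner_Integration.integral_cong) (auto simp: power2_sum power_mult_distrib)
  also have "\<dots> = t\<^sup>2 * (LINT x|lborel. (f x)\<^sup>2) + (2 * t) * (LINT x|lborel. f x * g x) + (LINT x|lborel. (g x)\<^sup>2)"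
    using i by simp
  finally show "0 \<le> (LINT x|lborel. (f x)\<^sup>2) * t\<^sup>2 + 2 * (LINT x|lborel. f x * g x) * t + (LINT x|lborel. (g x)\<^sup>2)"
    by (simp add: mult_ac)
qed simp

text \<open>
Multiplication by a strictly positive square-integrable weight \<open>w\<close> turns Cauchy sequences in \<open>L\<^sup>2\<close> into
Cauchy sequences in \<open>L\<^sup>1\<close>, which have subsequences converging almost everywhere. Fatou's lemma then
gives convergence in \<open>L\<^sup>2\<close>.
\<close>
lemma L2_complete:
  assumes f: "\<And>n. sq_int (f n)"
    and C: "\<And>e. 0 < e \<Longrightarrow> \<exists>M. \<forall>m\<ge>M. \<forall>n\<ge>M. (LINT x|lborel. (f m x - f n x)\<^sup>2) < e"
  shows "\<exists>g r. sq_int g \<and> (\<lambda>n. LINT x|lborel. (f n x - g x)\<^sup>2) \<longlonglongrightarrow> 0 \<and>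
    strict_mono r \<and> (AE x in lborel. (\<lambda>n. f (r n) x) \<longlonglongrightarrow> g x)"
proof -
  note [measurable] = sq_int_measurable[OF f]
  obtain h where h: "h \<in> borel_measurable lborel" "(\<integral>\<^sup>+x. h x \<partial>lborel) \<noteq> \<infinity>"
    "\<And>x::real. 0 < h x" "\<And>x. h x < \<infinity>"
    using sigma_finite_measure.Ex_finite_integrable_function[OF lborel.sigma_finite_measure_axioms] by auto
  note [measurable] = h(1)[unfolded measurable_lborel2]
  define w where "w x = sqrt (enn2real (h x))" for x
  have w2: "(w x)\<^sup>2 = enn2real (h x)" for x by (simp add: w_def)
  have wpos: "0 < w x" for x using h(3,4)[of x] by (simp add: w_def enn2real_positive_iff)
  have [measurable]: "w \<in> borel_measurable borel" unfolding w_def by measurable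
  have w: "sq_int w"
    unfolding sq_int_def w2
  proof
    have "(\<integral>\<^sup>+x. ennreal (enn2real (h x)) \<partial>lborel) = (\<integral>\<^sup>+x. h x \<partial>lborel)"
      using h(4) by (intro nn_integral_cong) (auto simp: ennreal_enn2real)
    then show "integrable lborel (\<lambda>x. enn2real (h x))"
      using h(2) by (intro integrableI_nonneg) (auto simp: less_top)
  qed simp
  define W where "W = (LINT x|lborel. (w x)\<^sup>2)"
  have W: "0 \<le> W" by (simp add: W_def)
  have d: "sq_int (\<lambda>x. f m x - f n x)" for m n by (rule sq_int_diff[OF f f])
  have absd: "sq_int (\<lambda>x. \<bar>f m x - f n x\<bar>)" for m n
    using d[of m n] by (simp add: sq_int_def)
  obtain r where r: "strict_mono r" "AE x in lborel. Cauchy (\<lambda>i. w x * f (r i) x)"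
  proof (rule cauchy_L1_AE_cauchy_subseq[of lborel "\<lambda>n x. w x * f n x"])
    show "integrable lborel (\<lambda>x. w x * f n x)" for n by (rule sq_int_mult_integrable[OF w f])
    fix e :: real assume e: "0 < e"
    then have "0 < e\<^sup>2 / (W + 1)" using W by simp
    from C[OF this] obtain M where M: "\<And>m n. m \<ge> M \<Longrightarrow> n \<ge> M \<Longrightarrow> (LINT x|lborel. (f m x - f n x)\<^sup>2) < e\<^sup>2 / (W + 1)"
      by blast
    have "(LINT x|lborel. norm (w x * f i x - w x * f j x)) < e" if "i \<ge> M" "j \<ge> M" for i j
    proof -
      have "(LINT x|lborel. norm (w x * f i x - w x * f j x)) = (LINT x|lborel. w x * \<bar>f i x - f j x\<bar>)"
        by (intro Bochner_Integration.integral_cong)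
          (auto simp: right_diff_distrib[symmetric] abs_mult abs_of_pos[OF wpos])
      moreover have "(LINT x|lborel. w x * \<bar>f i x - f j x\<bar>)\<^sup>2 < e\<^sup>2"
      proof -
        have "(LINT x|lborel. w x * \<bar>f i x - f j x\<bar>)\<^sup>2 \<le> W * (LINT x|lborel. (f i x - f j x)\<^sup>2)"
          using cauchy_schwarz_sq_int[OF w absd, of i j] by (simp add: W_def)
        also have "\<dots> \<le> W * (e\<^sup>2 / (W + 1))" using M[OF that] W by (intro mult_left_mono) auto
        also have "\<dots> < e\<^sup>2" using W e by (simp add: field_simps)
        finally show ?thesis .
      qed
      ultimately show ?thesis using e by (simp add: power_less_imp_less_base)
    qed
    then show "\<exists>N. \<forall>i\<ge>N. \<forall>j\<ge>N. (LINT x|lborel. norm (w x * f i x - w x * f j x)) < e" by blast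
  qed blast
  define g where "g x = lim (\<lambda>i. f (r i) x)" for x
  have [measurable]: "g \<in> borel_measurable borel" unfolding g_def by measurable
  have lim: "AE x in lborel. (\<lambda>i. f (r i) x) \<longlonglongrightarrow> g x"
    using r(2)
  proof eventually_elim
    case (elim x)
    then obtain l where "(\<lambda>i. w x * f (r i) x) \<longlonglongrightarrow> l"
      using Cauchy_convergent_iff convergent_def by blast
    then have "(\<lambda>i. w x * f (r i) x / w x) \<longlonglongrightarrow> l / w x"
      by (rule tendsto_divide) (use wpos[of x] in auto)
    moreover have "(\<lambda>i. w x * f (r i) x / w x) = (\<lambda>i. f (r i) x)"
      using wpos[of x] by auto
    ultimately have "convergent (\<lambda>i. f (r i) x)" by (auto simp: convergent_def)
    then show ?case by (simp add: g_def convergent_LIMSEQ_iff)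
  qed
  have bound: "\<exists>M. \<forall>n\<ge>M. (\<integral>\<^sup>+x. ennreal ((f n x - g x)\<^sup>2) \<partial>lborel) \<le> ennreal e" if e: "0 < e" for e
  proof -
    from C[OF e] obtain M where M: "\<And>m n. m \<ge> M \<Longrightarrow> n \<ge> M \<Longrightarrow> (LINT x|lborel. (f m x - f n x)\<^sup>2) < e"
      by blast
    have "(\<integral>\<^sup>+x. ennreal ((f n x - g x)\<^sup>2) \<partial>lborel) \<le> ennreal e" if n: "n \<ge> M" for n
    proof -
      have "(\<integral>\<^sup>+x. ennreal ((f n x - g x)\<^sup>2) \<partial>lborel)
          = (\<integral>\<^sup>+x. liminf (\<lambda>k. ennreal ((f n x - f (r k) x)\<^sup>2)) \<partial>lborel)"
      proof (rule nn_integral_cong_AE)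
        show "AE x in lborel. ennreal ((f n x - g x)\<^sup>2) = liminf (\<lambda>k. ennreal ((f n x - f (r k) x)\<^sup>2))"
          using lim
        proof eventually_elim
          case (elim x)
          have "(\<lambda>k. ennreal ((f n x - f (r k) x)\<^sup>2)) \<longlonglongrightarrow> ennreal ((f n x - g x)\<^sup>2)"
            by (intro tendsto_ennrealI tendsto_power tendsto_diff tendsto_const elim)
          then show ?case using lim_imp_Liminf[OF trivial_limit_sequentially] by metis
        qed
      qed
      also have "\<dots> \<le> liminf (\<lambda>k. \<integral>\<^sup>+x. ennreal ((f n x - f (r k) x)\<^sup>2) \<partial>lborel)"
        by (rule nn_integral_liminf) measurable
      also have "\<dots> \<le> limsup (\<lambda>k. \<integral>\<^sup>+x. ennreal ((f n x - f (r k) x)\<^sup>2) \<partial>lborel)"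
        by (rule Liminf_le_Limsup) simp
      also have "\<dots> \<le> ennreal e"
      proof (rule Limsup_bounded)
        have "(\<integral>\<^sup>+x. ennreal ((f n x - f (r k) x)\<^sup>2) \<partial>lborel) \<le> ennreal e" if "k \<ge> M" for k
        proof -
          have "r k \<ge> M" using seq_suble[OF r(1), of k] that by linarith
          from M[OF n this] show ?thesis
            using nn_integral_eq_integral[OF sq_int_integrable[OF d[of n "r k"]]] by (simp add: ennreal_leI)
        qed
        then show "\<forall>\<^sub>F k in sequentially. (\<integral>\<^sup>+x. ennreal ((f n x - f (r k) x)\<^sup>2) \<partial>lborel) \<le> ennreal e"
          unfolding eventually_sequentially by blast
      qed
      finally show ?thesis .
    qed
    then show ?thesis by blast
  qed
  have dg: "sq_int (\<lambda>x. f n x - g x)" if "(\<integral>\<^sup>+x. ennreal ((f n x - g x)\<^sup>2) \<partial>lborel) \<le> ennreal e" for n e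
    unfolding sq_int_def using that
    by (auto intro!: integrableI_nonneg simp: le_less_trans[OF _ ennreal_less_top])
  obtain M where "\<forall>n\<ge>M. (\<integral>\<^sup>+x. ennreal ((f n x - g x)\<^sup>2) \<partial>lborel) \<le> ennreal 1" using bound[of 1] by auto
  then have "sq_int (\<lambda>x. f M x - g x)" using dg by blast
  from sq_int_diff[OF f[of M] this] have g: "sq_int g" by simp
  have "(\<lambda>n. LINT x|lborel. (f n x - g x)\<^sup>2) \<longlonglongrightarrow> 0"
  proof (rule LIMSEQ_I)
    fix e :: real assume e: "0 < e"
    from bound[of "e / 2"] e obtain M where
      M: "\<And>n. n \<ge> M \<Longrightarrow> (\<integral>\<^sup>+x. ennreal ((f n x - g x)\<^sup>2) \<partial>lborel) \<le> ennreal (e / 2)" by auto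
    have "(LINT x|lborel. (f n x - g x)\<^sup>2) \<le> e / 2" if "n \<ge> M" for n
    proof -
      have "ennreal (LINT x|lborel. (f n x - g x)\<^sup>2) \<le> ennreal (e / 2)"
        using M[OF that] nn_integral_eq_integral[OF sq_int_integrable[OF sq_int_diff[OF f[of n] g]]] by simp
      then show ?thesis using e by (subst (asm) ennreal_le_iff) auto
    qed
    then show "\<exists>no. \<forall>n\<ge>no. norm ((LINT x|lborel. (f n x - g x)\<^sup>2) - 0) < e"
      using e by (intro exI[of _ M]) fastforce
  qed
  with g r(1) lim show ?thesis by blast
qed

text \<open>
At every point of a unit interval a function differs from its mean by at most its variation.
\<close>
lemma primitive_local_bound:
  assumes "primitive f f'"
  shows "\<bar>f x\<bar> \<le> (LINT t:{x..x + 1}|lborel. \<bar>f t\<bar> + \<bar>f' t\<bar>)"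
    and "\<bar>f (x + 1)\<bar> \<le> (LINT t:{x..x + 1}|lborel. \<bar>f t\<bar> + \<bar>f' t\<bar>)"
proof -
  define B where "B = (LINT t:{x..x + 1}|lborel. \<bar>f' t\<bar>)"
  note li = locally_integrableD[OF primitive_locally_integrable[OF assms]]
  note fi = locally_integrableD[OF continuous_locally_integrable[OF primitive_continuous[OF assms]]]
  have diff: "\<bar>f b - f a\<bar> \<le> B" if "x \<le> a" "a \<le> b" "b \<le> x + 1" for a b
  proof -
    have "\<bar>f b - f a\<bar> \<le> (LINT t:{a..b}|lborel. \<bar>f' t\<bar>)"
      using primitiveD[OF assms that(2)] integral_norm_bound[of lborel "\<lambda>t. indicator {a..b} t * f' t"]
      by (simp add: set_lebesgue_integral_def abs_mult)
    also have "\<dots> \<le> B"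
      unfolding B_def set_lebesgue_integral_def
      using set_integrable_abs[OF li] that
      by (intro integral_mono) (auto simp: set_integrable_def indicator_def)
    finally show ?thesis .
  qed
  have main: "\<bar>f y\<bar> \<le> (LINT t:{x..x + 1}|lborel. \<bar>f t\<bar> + \<bar>f' t\<bar>)" if y: "y = x \<or> y = x + 1" for y
  proof -
    have "\<bar>f y\<bar> = (LINT t:{x..x + 1}|lborel. \<bar>f y\<bar>)" by (simp add: set_lebesgue_integral_def)
    also have "\<dots> \<le> (LINT t:{x..x + 1}|lborel. \<bar>f t\<bar> + B)"
    proof (rule set_integral_mono)
      show "set_integrable lborel {x..x + 1} (\<lambda>t. \<bar>f y\<bar>)" by (rule locally_integrableD[OF locally_integrable_const])
      show "set_integrable lborel {x..x + 1} (\<lambda>t. \<bar>f t\<bar> + B)"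
        by (intro set_integral_add(1) set_integrable_abs fi locally_integrableD[OF locally_integrable_const])
      fix t assume "t \<in> {x..x + 1}"
      then show "\<bar>f y\<bar> \<le> \<bar>f t\<bar> + B" using diff[of x t] diff[of t "x + 1"] y by auto
    qed
    also have "\<dots> = (LINT t:{x..x + 1}|lborel. \<bar>f t\<bar>) + (LINT t:{x..x + 1}|lborel. B)"
      by (intro set_integral_add(2) set_integrable_abs fi locally_integrableD[OF locally_integrable_const])
    also have "(LINT t:{x..x + 1}|lborel. B) = B" by (simp add: set_lebesgue_integral_def)
    also have "(LINT t:{x..x + 1}|lborel. \<bar>f t\<bar>) + B = (LINT t:{x..x + 1}|lborel. \<bar>f t\<bar> + \<bar>f' t\<bar>)"
      unfolding B_def by (intro set_integral_add(2)[symmetric] set_integrable_abs fi li)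
    finally show ?thesis .
  qed
  show "\<bar>f x\<bar> \<le> (LINT t:{x..x + 1}|lborel. \<bar>f t\<bar> + \<bar>f' t\<bar>)"
    "\<bar>f (x + 1)\<bar> \<le> (LINT t:{x..x + 1}|lborel. \<bar>f t\<bar> + \<bar>f' t\<bar>)" by (auto intro: main)
qed

lemma moving_window_integral_tendsto_zero:
  assumes "integrable lborel (g :: real \<Rightarrow> real)" "filterlim (\<lambda>n. \<bar>s n\<bar>) at_top sequentially"
  shows "(\<lambda>n. LINT t:{s n..s n + 1}|lborel. g t) \<longlonglongrightarrow> 0"
proof -
  have "(\<lambda>n. LINT t|lborel. indicator {s n..s n + 1} t *\<^sub>R g t) \<longlonglongrightarrow> (LINT t::real|lborel. 0)"
  proof (rule integral_dominated_convergence[where w = "\<lambda>t. \<bar>g t\<bar>"])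
    show "AE t in lborel. (\<lambda>n. indicator {s n..s n + 1} t *\<^sub>R g t) \<longlonglongrightarrow> 0"
    proof (intro AE_I2)
      fix t :: real
      have "eventually (\<lambda>n. \<bar>t\<bar> + 1 < \<bar>s n\<bar>) sequentially"
        using assms(2) by (simp add: filterlim_at_top_dense)
      then have "eventually (\<lambda>n. indicator {s n..s n + 1} t *\<^sub>R g t = 0) sequentially"
      proof eventually_elim
        case (elim n)
        then have "t \<notin> {s n..s n + 1}" by auto
        then show ?case by simp
      qed
      then show "(\<lambda>n. indicator {s n..s n + 1} t *\<^sub>R g t) \<longlonglongrightarrow> 0" by (rule tendsto_eventually)
    qed
  qed (use assms(1) borel_measurable_integrable[OF assms(1)] in \<open>auto simp: indicator_def\<close>)
  then show ?thesis by (simp add: set_lebesgue_integral_def)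
qed

text \<open>
A function that is integrable together with its derivative tends to \<open>0\<close> at infinity along the integers,
because the integrals over unit windows do. Hence its derivative has total integral \<open>0\<close>, which is the
form of integration by parts used throughout, and the function is bounded by the \<open>L\<^sup>1\<close> norm of its
derivative.
\<close>
lemma integrable_primitive:
  assumes p: "primitive f f'" and f: "integrable lborel f" and f': "integrable lborel f'"
  shows "(LINT x|lborel. f' x) = 0" and "\<bar>f x\<bar> \<le> (LINT t|lborel. \<bar>f' t\<bar>)"
proof -
  have i: "integrable lborel (\<lambda>t. \<bar>f t\<bar> + \<bar>f' t\<bar>)" using f f' by simp
  have lim1: "filterlim (\<lambda>n. \<bar>- real n - 1\<bar>) at_top sequentially"
    "filterlim (\<lambda>n. \<bar>real n\<bar>) at_top sequentially"
  proof -
    show "filterlim (\<lambda>n. \<bar>real n\<bar>) at_top sequentially" by (simp add: filterlim_real_sequentially)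
    then show "filterlim (\<lambda>n. \<bar>- real n - 1\<bar>) at_top sequentially"
      by (rule filterlim_at_top_mono) (auto intro!: always_eventually)
  qed
  have r0: "(\<lambda>n. f (real n)) \<longlonglongrightarrow> 0"
  proof (rule Lim_null_comparison[OF _ moving_window_integral_tendsto_zero[OF i lim1(2)]])
    show "\<forall>\<^sub>F n in sequentially. norm (f (real n)) \<le> (LINT t:{real n..real n + 1}|lborel. \<bar>f t\<bar> + \<bar>f' t\<bar>)"
      using primitive_local_bound(1)[OF p] by (intro always_eventually) simp
  qed
  have l0: "(\<lambda>n. f (- real n)) \<longlonglongrightarrow> 0"
  proof (rule Lim_null_comparison[OF _ moving_window_integral_tendsto_zero[OF i lim1(1)]])
    show "\<forall>\<^sub>F n in sequentially. norm (f (- real n)) \<le> (LINT t:{- real n - 1..- real n - 1 + 1}|lborel. \<bar>f t\<bar> + \<bar>f' t\<bar>)"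
      using primitive_local_bound(2)[OF p, of "- real _ - 1"] by (intro always_eventually) simp
  qed
  have "(\<lambda>n. LINT t|lborel. indicator {- real n..real n} t *\<^sub>R f' t) \<longlonglongrightarrow> (LINT t|lborel. f' t)"
  proof (rule integral_dominated_convergence[where w = "\<lambda>t. \<bar>f' t\<bar>"])
    show "AE t in lborel. (\<lambda>n. indicator {- real n..real n} t *\<^sub>R f' t) \<longlonglongrightarrow> f' t"
    proof (intro AE_I2)
      fix t :: real
      obtain n0 :: nat where n0: "\<bar>t\<bar> \<le> real n0" using real_arch_simple by blast
      have "indicator {- real n..real n} t *\<^sub>R f' t = f' t" if "n \<ge> n0" for n
      proof -
        have "t \<in> {- real n..real n}"
          using n0 of_nat_mono[OF that, where 'a=real] unfolding atLeastAtMost_iff by linarith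
        then show ?thesis by simp
      qed
      then have "eventually (\<lambda>n. indicator {- real n..real n} t *\<^sub>R f' t = f' t) sequentially"
        unfolding eventually_sequentially by blast
      then show "(\<lambda>n. indicator {- real n..real n} t *\<^sub>R f' t) \<longlonglongrightarrow> f' t" by (rule tendsto_eventually)
    qed
  qed (use f' borel_measurable_integrable[OF f'] in \<open>auto simp: indicator_def\<close>)
  moreover have "(LINT t|lborel. indicator {- real n..real n} t *\<^sub>R f' t) = f (real n) - f (- real n)" for n
    using primitiveD[OF p, of "- real n" "real n"] by (simp add: set_lebesgue_integral_def)
  moreover have "(\<lambda>n. f (real n) - f (- real n)) \<longlonglongrightarrow> 0 - 0" by (intro tendsto_diff r0 l0)
  ultimately show "(LINT x|lborel. f' x) = 0" using LIMSEQ_unique by fastforce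
  have "(\<lambda>n. \<bar>f (- real n)\<bar> + (LINT t|lborel. \<bar>f' t\<bar>)) \<longlonglongrightarrow> 0 + (LINT t|lborel. \<bar>f' t\<bar>)"
    using tendsto_rabs[OF l0] by (intro tendsto_add tendsto_const) simp
  moreover have "\<exists>N. \<forall>n\<ge>N. \<bar>f x\<bar> \<le> \<bar>f (- real n)\<bar> + (LINT t|lborel. \<bar>f' t\<bar>)"
  proof -
    obtain N :: nat where N: "\<bar>x\<bar> \<le> real N" using real_arch_simple by blast
    have "\<bar>f x\<bar> \<le> \<bar>f (- real n)\<bar> + (LINT t|lborel. \<bar>f' t\<bar>)" if "n \<ge> N" for n
    proof -
      have "- real n \<le> x" using N of_nat_mono[OF that, where 'a=real] by linarith
      from primitiveD[OF p this] have "\<bar>f x - f (- real n)\<bar> \<le> (LINT t|lborel. \<bar>indicator {- real n..x} t * f' t\<bar>)"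
        by (simp add: set_lebesgue_integral_def)
      also have "\<dots> \<le> (LINT t|lborel. \<bar>f' t\<bar>)"
        using f' integrable_mult_indicator[of "{- real n..x}" lborel f']
        by (intro integral_mono integrable_abs) (auto simp: indicator_def)
      finally show ?thesis by linarith
    qed
    then show ?thesis by blast
  qed
  ultimately show "\<bar>f x\<bar> \<le> (LINT t|lborel. \<bar>f' t\<bar>)" using LIMSEQ_le_const by fastforce
qed

text \<open>
The real Sobolev space \<open>H\<^sup>1\<close>. Its elements are genuine functions, namely the continuous
representatives \<open>fn u\<close>; only the derivative \<open>dx u\<close> is determined up to null sets.
\<close>
typedef h1 = "{u :: real \<Rightarrow> real. sq_int u \<and> (\<exists>g. sq_int g \<and> primitive u g)}"
  morphisms fn Abs_h1
  by (rule exI[of _ "\<lambda>x. 0"]) (auto intro!: sq_int_zero exI[of _ "\<lambda>x. 0"] primitive_const)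

definition dx :: "h1 \<Rightarrow> real \<Rightarrow> real" where
  "dx u = (SOME g. sq_int g \<and> primitive (fn u) g)"

lemma sq_int_fn: "sq_int (fn u)" and dx: "sq_int (dx u)" "primitive (fn u) (dx u)"
proof -
  have "sq_int (fn u)" "\<exists>g. sq_int g \<and> primitive (fn u) g" using fn[of u] by auto
  then show "sq_int (fn u)" "sq_int (dx u)" "primitive (fn u) (dx u)"
    using someI_ex[of "\<lambda>g. sq_int g \<and> primitive (fn u) g"] by (auto simp: dx_def)
qed

lemma fn_continuous: "continuous_on UNIV (fn u)"
  using primitive_continuous dx(2) by blast

lemma fn_dx_measurable [measurable]: "fn u \<in> borel_measurable borel" "dx u \<in> borel_measurable borel"
  using sq_int_fn dx(1) by (auto simp: sq_int_def)

lemma fn_Abs_h1: "sq_int u \<Longrightarrow> sq_int g \<Longrightarrow> primitive u g \<Longrightarrow> fn (Abs_h1 u) = u"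
  by (rule Abs_h1_inverse) auto

lemma dx_unique: "primitive (fn u) g \<Longrightarrow> AE x in lborel. dx u x = g x"
  using primitive_unique dx(2) by blast

lemma h1_eqI: "(\<And>x. fn u x = fn v x) \<Longrightarrow> u = v"
  using fn_inject by blast

lemma fn_dx_integrable:
  "integrable lborel (\<lambda>x. fn u x * fn v x)" "integrable lborel (\<lambda>x. dx u x * dx v x)"
  "integrable lborel (\<lambda>x. fn u x * dx v x)" "integrable lborel (\<lambda>x. dx u x * fn v x)"
  by (intro sq_int_mult_integrable sq_int_fn dx)+

instantiation h1 :: real_vector
begin

definition zero_h1 :: h1 where "0 = Abs_h1 (\<lambda>x. 0)"
definition plus_h1 :: "h1 \<Rightarrow> h1 \<Rightarrow> h1" where "u + v = Abs_h1 (\<lambda>x. fn u x + fn v x)"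
definition scaleR_h1 :: "real \<Rightarrow> h1 \<Rightarrow> h1" where "c *\<^sub>R u = Abs_h1 (\<lambda>x. c * fn u x)"
definition uminus_h1 :: "h1 \<Rightarrow> h1" where "- u = (-1) *\<^sub>R (u :: h1)"
definition minus_h1 :: "h1 \<Rightarrow> h1 \<Rightarrow> h1" where "u - v = u + (- (v :: h1))"
lemma fn_zero: "fn 0 = (\<lambda>x. 0)"
  unfolding zero_h1_def by (rule fn_Abs_h1[OF sq_int_zero sq_int_zero primitive_const])

lemma fn_plus: "fn (u + v) = (\<lambda>x. fn u x + fn v x)"
  unfolding plus_h1_def
  by (rule fn_Abs_h1[OF sq_int_add[OF sq_int_fn sq_int_fn] sq_int_add[OF dx(1) dx(1)] primitive_add[OF dx(2) dx(2)]])

lemma fn_scaleR: "fn (c *\<^sub>R u) = (\<lambda>x. c * fn u x)"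
  unfolding scaleR_h1_def
  by (rule fn_Abs_h1[OF sq_int_cmult[OF sq_int_fn] sq_int_cmult[OF dx(1)] primitive_cmult[OF dx(2)]])

lemma fn_uminus: "fn (- u) = (\<lambda>x. - fn u x)"
  unfolding uminus_h1_def by (simp add: fn_scaleR)

lemma fn_minus: "fn (u - v) = (\<lambda>x. fn u x - fn v x)"
  unfolding minus_h1_def by (simp add: fn_plus fn_uminus)

lemmas fn_simps = fn_zero fn_plus fn_scaleR fn_uminus fn_minus

instance
proof
  fix u v w :: h1 and a b :: real
  show "u + v + w = u + (v + w)" "u + v = v + u" "0 + u = u" "- u + u = 0" "u - v = u + - v"
    "a *\<^sub>R (u + v) = a *\<^sub>R u + a *\<^sub>R v" "(a + b) *\<^sub>R u = a *\<^sub>R u + b *\<^sub>R u"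
    "a *\<^sub>R b *\<^sub>R u = (a * b) *\<^sub>R u" "1 *\<^sub>R u = u"
    by (rule h1_eqI; simp add: fn_simps algebra_simps)+
qed

end

lemma dx_plus: "AE x in lborel. dx (u + v) x = dx u x + dx v x"
  by (rule dx_unique) (use primitive_add[OF dx(2) dx(2), of u v] in \<open>simp add: fn_plus\<close>)

lemma dx_scaleR: "AE x in lborel. dx (c *\<^sub>R u) x = c * dx u x"
  by (rule dx_unique) (use primitive_cmult[OF dx(2), of c u] in \<open>simp add: fn_scaleR\<close>)

lemma dx_minus: "AE x in lborel. dx (u - v) x = dx u x - dx v x"
  by (rule dx_unique) (use primitive_diff[OF dx(2) dx(2), of u v] in \<open>simp add: fn_minus\<close>)

instantiation h1 :: real_inner
begin

definition inner_h1 :: "h1 \<Rightarrow> h1 \<Rightarrow> real" where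
  "inner_h1 u v = (LINT x|lborel. fn u x * fn v x) + (LINT x|lborel. dx u x * dx v x)"
definition norm_h1 :: "h1 \<Rightarrow> real" where "norm_h1 u = sqrt (inner u u)"
definition dist_h1 :: "h1 \<Rightarrow> h1 \<Rightarrow> real" where "dist_h1 u v = norm (u - v)"
definition sgn_h1 :: "h1 \<Rightarrow> h1" where "sgn_h1 u = u /\<^sub>R norm u"
definition uniformity_h1 :: "(h1 \<times> h1) filter" where
  "uniformity_h1 = (INF e\<in>{0 <..}. principal {(x, y). dist x y < e})"
definition open_h1 :: "h1 set \<Rightarrow> bool" where
  "open_h1 U \<longleftrightarrow> (\<forall>x\<in>U. eventually (\<lambda>(x', y). x' = x \<longrightarrow> y \<in> U) uniformity)"

text \<open>
Point evaluation is bounded because \<open>(u\<^sup>2)' = 2 * u * u'\<close> is integrable.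
\<close>
lemma fn_square_le_inner: "(fn u x)\<^sup>2 \<le> inner u u"
proof -
  have p: "primitive (\<lambda>x. fn u x * fn u x) (\<lambda>x. dx u x * fn u x + fn u x * dx u x)"
    by (rule primitive_mult[OF dx(2) dx(2)])
  have "(fn u x)\<^sup>2 \<le> (LINT t|lborel. \<bar>dx u t * fn u t + fn u t * dx u t\<bar>)"
    using integrable_primitive(2)[OF p, of x] fn_dx_integrable[of u u] by (simp add: power2_eq_square)
  also have "\<dots> \<le> (LINT t|lborel. fn u t * fn u t + dx u t * dx u t)"
  proof (rule integral_mono)
    show "\<bar>dx u t * fn u t + fn u t * dx u t\<bar> \<le> fn u t * fn u t + dx u t * dx u t" for t
      using abs_mult_le_squares[of "fn u t" "dx u t"] by (simp add: power2_eq_square mult.commute)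
  qed (use fn_dx_integrable[of u u] in auto)
  also have "\<dots> = inner u u" using fn_dx_integrable[of u u] by (simp add: inner_h1_def)
  finally show ?thesis .
qed

instance
proof
  fix u v w :: h1 and a b :: real
  show "dist u v = norm (u - v)" by (rule dist_h1_def)
  show "sgn u = u /\<^sub>R norm u" by (rule sgn_h1_def)
  show "norm u = sqrt (inner u u)" by (rule norm_h1_def)
  show "uniformity = (INF e\<in>{0 <..}. principal {(x, y). dist x (y::h1) < e})" by (rule uniformity_h1_def)
  show "open U \<longleftrightarrow> (\<forall>x\<in>U. eventually (\<lambda>(x', y). x' = x \<longrightarrow> y \<in> U) uniformity)" for U :: "h1 set"
    by (rule open_h1_def)
  show "inner u v = inner v u" by (simp add: inner_h1_def mult.commute)
  show "0 \<le> inner u u" by (simp add: inner_h1_def)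
  show "inner (u + v) w = inner u w + inner v w"
  proof -
    have "(LINT x|lborel. dx (u + v) x * dx w x) = (LINT x|lborel. dx u x * dx w x + dx v x * dx w x)"
      by (rule integral_cong_AE) (use dx_plus[of u v] in \<open>auto simp: distrib_right\<close>)
    then show ?thesis using fn_dx_integrable by (simp add: inner_h1_def fn_plus distrib_right)
  qed
  show "inner (a *\<^sub>R u) v = a * inner u v"
  proof -
    have "(LINT x|lborel. dx (a *\<^sub>R u) x * dx v x) = (LINT x|lborel. a * (dx u x * dx v x))"
      by (rule integral_cong_AE) (use dx_scaleR[of a u] in auto)
    then show ?thesis by (simp add: inner_h1_def fn_scaleR distrib_left mult.assoc)
  qed
  show "inner u u = 0 \<longleftrightarrow> u = 0"
  proof
    assume "inner u u = 0"
    then have "fn u x = 0" for x using fn_square_le_inner[of u x] by simp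
    then show "u = 0" by (intro h1_eqI) (simp add: fn_zero)
  next
    assume "u = 0"
    then have "AE x in lborel. dx u x = 0" by (intro dx_unique) (simp add: fn_zero primitive_const)
    then have "(LINT x|lborel. dx u x * dx u x) = (LINT x::real|lborel. (0 :: real))"
      by (intro integral_cong_AE) auto
    then show "inner u u = 0" using \<open>u = 0\<close> by (simp add: inner_h1_def fn_zero)
  qed
qed

end

lemma norm_h1_square: "(norm u)\<^sup>2 = (LINT x|lborel. (fn u x)\<^sup>2) + (LINT x|lborel. (dx u x)\<^sup>2)"
  unfolding power2_norm_eq_inner inner_h1_def by (simp add: power2_eq_square)

lemma abs_fn_le_norm: "\<bar>fn u x\<bar> \<le> norm u"
  using fn_square_le_inner[of u x] by (simp add: norm_eq_sqrt_inner real_le_rsqrt)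

lemma L2_le_norm: "(LINT x|lborel. (fn u x)\<^sup>2) \<le> (norm u)\<^sup>2" "(LINT x|lborel. (dx u x)\<^sup>2) \<le> (norm u)\<^sup>2"
  by (simp_all add: norm_h1_square)

text \<open>
A Cauchy sequence has limits \<open>f\<close> of its functions and \<open>g\<close> of its derivatives in \<open>L\<^sup>2\<close>. The relation
between them survives because point evaluations converge uniformly and the integrals over bounded
intervals converge.
\<close>
instance h1 :: complete_space
proof
  fix X :: "nat \<Rightarrow> h1" assume X: "Cauchy X"
  have C: "\<exists>M. \<forall>m\<ge>M. \<forall>n\<ge>M. (norm (X m - X n))\<^sup>2 < e" if "0 < e" for e
  proof -
    obtain M where M: "\<forall>m\<ge>M. \<forall>n\<ge>M. norm (X m - X n) < sqrt e"
      using CauchyD[OF X, of "sqrt e"] \<open>0 < e\<close> by auto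
    have "(norm (X m - X n))\<^sup>2 < e" if "m \<ge> M" "n \<ge> M" for m n
    proof -
      have "(norm (X m - X n))\<^sup>2 < (sqrt e)\<^sup>2"
        using M that by (intro power_strict_mono) auto
      then show ?thesis using \<open>0 < e\<close> by simp
    qed
    then show ?thesis by blast
  qed
  have dxd: "(LINT x|lborel. (dx (u - v) x)\<^sup>2) = (LINT x|lborel. (dx u x - dx v x)\<^sup>2)" for u v
    by (rule integral_cong_AE) (use dx_minus[of u v] in auto)
  have "\<exists>f r. sq_int f \<and> (\<lambda>n. LINT x|lborel. (fn (X n) x - f x)\<^sup>2) \<longlonglongrightarrow> 0 \<and>
    strict_mono r \<and> (AE x in lborel. (\<lambda>n. fn (X (r n)) x) \<longlonglongrightarrow> f x)"
  proof (rule L2_complete)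
    fix e :: real assume "0 < e"
    from C[OF this] obtain M where M: "\<And>m n. m \<ge> M \<Longrightarrow> n \<ge> M \<Longrightarrow> (norm (X m - X n))\<^sup>2 < e" by blast
    have "(LINT x|lborel. (fn (X m) x - fn (X n) x)\<^sup>2) < e" if "m \<ge> M" "n \<ge> M" for m n
      using M[OF that] L2_le_norm(1)[of "X m - X n"] by (simp add: fn_minus)
    then show "\<exists>M. \<forall>m\<ge>M. \<forall>n\<ge>M. (LINT x|lborel. (fn (X m) x - fn (X n) x)\<^sup>2) < e" by blast
  qed (rule sq_int_fn)
  then obtain f r where f: "sq_int f" "(\<lambda>n. LINT x|lborel. (fn (X n) x - f x)\<^sup>2) \<longlonglongrightarrow> 0"
    and r: "strict_mono r" "AE x in lborel. (\<lambda>n. fn (X (r n)) x) \<longlonglongrightarrow> f x" by blast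
  have "\<exists>g r. sq_int g \<and> (\<lambda>n. LINT x|lborel. (dx (X n) x - g x)\<^sup>2) \<longlonglongrightarrow> 0 \<and>
    strict_mono r \<and> (AE x in lborel. (\<lambda>n. dx (X (r n)) x) \<longlonglongrightarrow> g x)"
  proof (rule L2_complete)
    fix e :: real assume "0 < e"
    from C[OF this] obtain M where M: "\<And>m n. m \<ge> M \<Longrightarrow> n \<ge> M \<Longrightarrow> (norm (X m - X n))\<^sup>2 < e" by blast
    have "(LINT x|lborel. (dx (X m) x - dx (X n) x)\<^sup>2) < e" if "m \<ge> M" "n \<ge> M" for m n
      using M[OF that] L2_le_norm(2)[of "X m - X n"] by (simp add: dxd)
    then show "\<exists>M. \<forall>m\<ge>M. \<forall>n\<ge>M. (LINT x|lborel. (dx (X m) x - dx (X n) x)\<^sup>2) < e" by blast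
  qed (rule dx(1))
  then obtain g where g: "sq_int g" "(\<lambda>n. LINT x|lborel. (dx (X n) x - g x)\<^sup>2) \<longlonglongrightarrow> 0" by blast
  have "uniformly_convergent_on UNIV (\<lambda>n. fn (X n))"
  proof (rule Cauchy_uniformly_convergent, rule uniformly_Cauchy_onI)
    fix e :: real assume "0 < e"
    from CauchyD[OF X this] obtain M where M: "\<forall>m\<ge>M. \<forall>n\<ge>M. norm (X m - X n) < e" by blast
    have "dist (fn (X m) x) (fn (X n) x) < e" if "m \<ge> M" "n \<ge> M" for m n x
      using M that abs_fn_le_norm[of "X m - X n" x] by (force simp: fn_minus dist_real_def)
    then show "\<exists>M. \<forall>x\<in>UNIV. \<forall>m\<ge>M. \<forall>n\<ge>M. dist (fn (X m) x) (fn (X n) x) < e" by blast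
  qed
  then obtain u where "uniform_limit UNIV (\<lambda>n. fn (X n)) u sequentially"
    by (auto simp: uniformly_convergent_on_def)
  then have u: "(\<lambda>n. fn (X n) x) \<longlonglongrightarrow> u x" for x by (rule tendsto_uniform_limitI) simp
  have p: "primitive u g"
    unfolding primitive_def
  proof (intro conjI allI impI)
    show "locally_integrable g" by (rule sq_int_locally_integrable[OF g(1)])
    fix a b :: real assume ab: "a \<le> b"
    have "(\<lambda>n. LINT x:{a..b}|lborel. dx (X n) x - g x) \<longlonglongrightarrow> 0"
    proof (rule Lim_null_comparison)
      show "\<forall>\<^sub>F n in sequentially. norm (LINT x:{a..b}|lborel. dx (X n) x - g x)
          \<le> sqrt ((b - a) * (LINT x|lborel. (dx (X n) x - g x)\<^sup>2))"
      proof (intro always_eventually allI)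
        fix n
        have "(LINT x|lborel. indicator {a..b} x * (dx (X n) x - g x))\<^sup>2
            \<le> (LINT x|lborel. (indicator {a..b} x)\<^sup>2) * (LINT x|lborel. (dx (X n) x - g x)\<^sup>2)"
          by (rule cauchy_schwarz_sq_int[OF sq_int_indicator sq_int_diff[OF dx(1) g(1)]])
        also have "(LINT x|lborel. (indicator {a..b} x :: real)\<^sup>2) = (LINT x|lborel. indicator {a..b} x)"
          by (intro Bochner_Integration.integral_cong) (auto simp: indicator_def)
        also have "\<dots> = b - a" using ab by simp
        finally show "norm (LINT x:{a..b}|lborel. dx (X n) x - g x)
          \<le> sqrt ((b - a) * (LINT x|lborel. (dx (X n) x - g x)\<^sup>2))"
          by (simp add: set_lebesgue_integral_def real_le_rsqrt)
      qed
      have "(\<lambda>n. sqrt ((b - a) * (LINT x|lborel. (dx (X n) x - g x)\<^sup>2))) \<longlonglongrightarrow> sqrt ((b - a) * 0)"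
        by (intro tendsto_intros g)
      then show "(\<lambda>n. sqrt ((b - a) * (LINT x|lborel. (dx (X n) x - g x)\<^sup>2))) \<longlonglongrightarrow> 0" by simp
    qed
    moreover have "(LINT x:{a..b}|lborel. dx (X n) x - g x) = fn (X n) b - fn (X n) a - (LINT x:{a..b}|lborel. g x)" for n
      unfolding primitiveD[OF dx(2) ab]
      by (intro set_integral_diff(2) locally_integrableD sq_int_locally_integrable dx g)
    moreover have "(\<lambda>n. fn (X n) b - fn (X n) a - (LINT x:{a..b}|lborel. g x)) \<longlonglongrightarrow> u b - u a - (LINT x:{a..b}|lborel. g x)"
      by (intro tendsto_intros u)
    ultimately have "u b - u a - (LINT x:{a..b}|lborel. g x) = 0" using LIMSEQ_unique by fastforce
    then show "u b - u a = (LINT x:{a..b}|lborel. g x)" by simp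
  qed
  have um: "u \<in> borel_measurable borel" by (rule borel_measurable_continuous_onI[OF primitive_continuous[OF p]])
  have uf: "AE x in lborel. f x = u x"
    using r(2)
  proof eventually_elim
    case (elim x)
    show ?case using LIMSEQ_unique[OF elim LIMSEQ_subseq_LIMSEQ[OF u r(1), unfolded o_def]] .
  qed
  have su: "sq_int u" by (rule sq_int_cong_AE[OF f(1) uf um])
  define U where "U = Abs_h1 u"
  have fU: "fn U = u" unfolding U_def by (rule fn_Abs_h1[OF su g(1) p])
  have dU: "AE x in lborel. dx U x = g x" by (rule dx_unique) (use p fU in simp)
  have gm: "g \<in> borel_measurable borel" by (rule sq_int_measurable[OF g(1)])
  have fm: "f \<in> borel_measurable borel" by (rule sq_int_measurable[OF f(1)])
  have nrm: "(norm (X n - U))\<^sup>2 = (LINT x|lborel. (fn (X n) x - f x)\<^sup>2) + (LINT x|lborel. (dx (X n) x - g x)\<^sup>2)" for n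
  proof -
    have "(LINT x|lborel. (fn (X n - U) x)\<^sup>2) = (LINT x|lborel. (fn (X n) x - f x)\<^sup>2)"
      by (rule integral_cong_AE) (use uf fm um in \<open>auto simp: fn_minus fU\<close>)
    moreover have "(LINT x|lborel. (dx (X n - U) x)\<^sup>2) = (LINT x|lborel. (dx (X n) x - g x)\<^sup>2)"
      unfolding dxd by (rule integral_cong_AE) (use dU gm in auto)
    ultimately show ?thesis by (simp add: norm_h1_square)
  qed
  have "(\<lambda>n. sqrt ((norm (X n - U))\<^sup>2)) \<longlonglongrightarrow> sqrt (0 + 0)"
    unfolding nrm by (intro tendsto_intros f g)
  then have "(\<lambda>n. norm (X n - U)) \<longlonglongrightarrow> 0" by simp
  then have "X \<longlonglongrightarrow> U" by (simp add: tendsto_norm_zero_iff LIM_zero_iff)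
  then show "convergent X" by (auto simp: convergent_def)
qed

section \<open>Schroedinger operators in weak form\<close>

lemma sq_int_triple_integrable:
  assumes "sq_int f" "sq_int g" "h \<in> borel_measurable borel" "AE x in lborel. \<bar>h x\<bar> \<le> C"
  shows "integrable lborel (\<lambda>x. h x * (f x * g x))"
  using sq_int_mult_integrable[OF sq_int_bounded_mult[OF assms(1,3,4)] assms(2)] by (simp add: mult.assoc)

lemma abs_integral_triple_le:
  assumes f: "sq_int f" and g: "sq_int g" and h: "h \<in> borel_measurable borel" "AE x in lborel. \<bar>h x\<bar> \<le> C"
    and F: "(LINT x|lborel. (f x)\<^sup>2) \<le> F\<^sup>2" "0 \<le> F" and G: "(LINT x|lborel. (g x)\<^sup>2) \<le> G\<^sup>2" "0 \<le> G"
    and C: "0 \<le> C"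
  shows "\<bar>LINT x|lborel. h x * (f x * g x)\<bar> \<le> C * F * G"
proof -
  have hf: "sq_int (\<lambda>x. h x * f x)" by (rule sq_int_bounded_mult[OF f h])
  have "(LINT x|lborel. (h x * f x)\<^sup>2) \<le> (LINT x|lborel. C\<^sup>2 * (f x)\<^sup>2)"
  proof (rule integral_mono_AE)
    show "AE x in lborel. (h x * f x)\<^sup>2 \<le> C\<^sup>2 * (f x)\<^sup>2"
      using h(2)
    proof eventually_elim
      case (elim x)
      then have "(h x)\<^sup>2 \<le> C\<^sup>2" using C by (simp add: abs_le_square_iff[symmetric])
      then show ?case by (simp add: power_mult_distrib mult_right_mono)
    qed
  qed (use sq_int_integrable[OF hf] sq_int_integrable[OF f] in auto)
  also have "\<dots> \<le> C\<^sup>2 * F\<^sup>2" using F by (simp add: mult_left_mono)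
  finally have 1: "(LINT x|lborel. (h x * f x)\<^sup>2) \<le> C\<^sup>2 * F\<^sup>2" .
  have "(LINT x|lborel. (h x * f x) * g x)\<^sup>2 \<le> (C\<^sup>2 * F\<^sup>2) * G\<^sup>2"
    by (rule order_trans[OF cauchy_schwarz_sq_int[OF hf g]]) (intro mult_mono 1 G, auto)
  also have "\<dots> = (C * F * G)\<^sup>2" by (simp add: power_mult_distrib)
  finally have "(LINT x|lborel. h x * (f x * g x))\<^sup>2 \<le> (C * F * G)\<^sup>2" by (simp add: mult.assoc)
  then show ?thesis using C F G by (simp add: abs_le_square_iff[symmetric])
qed

lemma abs_integral_product_le:
  assumes "sq_int f" "sq_int g"
    and "(LINT x|lborel. (f x)\<^sup>2) \<le> F\<^sup>2" "0 \<le> F" "(LINT x|lborel. (g x)\<^sup>2) \<le> G\<^sup>2" "0 \<le> G"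
  shows "\<bar>LINT x|lborel. f x * g x\<bar> \<le> F * G"
  using abs_integral_triple_le[OF assms(1,2), of "\<lambda>x. 1" 1 F G] assms by simp

lemma sym_formI:
  fixes B :: "'a::real_normed_vector \<Rightarrow> 'a \<Rightarrow> real"
  assumes "\<And>u v w. B (u + v) w = B u w + B v w" "\<And>c u w. B (c *\<^sub>R u) w = c * B u w"
    and sym: "\<And>u w. B u w = B w u" and bd: "\<And>u w. \<bar>B u w\<bar> \<le> M * norm u * norm w"
  shows "sym_form B"
  unfolding sym_form_def
proof (intro conjI allI bounded_bilinear.intro exI[of _ M] sym)
  show "B (u + v) w = B u w + B v w" "B (c *\<^sub>R u) w = c *\<^sub>R B u w" for u v w c using assms by auto
  show "B u (v + w) = B u v + B u w" "B u (c *\<^sub>R w) = c *\<^sub>R B u w" for u v w c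
    using assms(1)[of v w u] assms(2)[of c w u] sym[of u] by auto
  show "norm (B u w) \<le> norm u * norm w * M" for u w using bd[of u w] by (simp add: mult_ac)
qed

text \<open>
The inner product of \<open>L\<^sup>2\<close> and the quadratic form of \<open>D\<^sup>2 + V\<close>, both on \<open>H\<^sup>1\<close>.
\<close>
definition L2_form :: "h1 \<Rightarrow> h1 \<Rightarrow> real" where
  "L2_form u w = (LINT x|lborel. fn u x * fn w x)"

definition energy_form :: "(real \<Rightarrow> real) \<Rightarrow> h1 \<Rightarrow> h1 \<Rightarrow> real" where
  "energy_form V u w = (LINT x|lborel. dx u x * dx w x) + (LINT x|lborel. V x * (fn u x * fn w x))"

lemma L_inftyE:
  fixes V :: "real \<Rightarrow> real"
  assumes "L_infty V"
  obtains C where "0 \<le> C" "V \<in> borel_measurable borel" "AE x in lborel. \<bar>V x\<bar> \<le> C"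
proof -
  obtain C where C: "V \<in> borel_measurable borel" "AE x in lborel. \<bar>V x\<bar> \<le> C"
    using assms by (auto simp: L_infty_def)
  have "AE x in lborel. \<bar>V x\<bar> \<le> max C 0" using C(2) by eventually_elim simp
  then show ?thesis using C(1) that[of "max C 0"] by simp
qed

lemma L_infty_integrable: "L_infty V \<Longrightarrow> integrable lborel (\<lambda>x. V x * (fn u x * fn w x))"
  by (erule L_inftyE) (rule sq_int_triple_integrable[OF sq_int_fn sq_int_fn])

lemma sym_form_L2: "sym_form L2_form"
proof (rule sym_formI[of _ 1])
  show "\<bar>L2_form u w\<bar> \<le> 1 * norm u * norm w" for u w
    unfolding L2_form_def using abs_integral_product_le[OF sq_int_fn sq_int_fn L2_le_norm(1) _ L2_le_norm(1)]
    by simp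
qed (simp_all add: L2_form_def fn_simps distrib_right fn_dx_integrable mult.assoc, simp add: mult.commute)

text \<open>
The antiderivative of \<open>f\<close> is constant, so its classical derivative \<open>f\<close> vanishes.
\<close>
lemma continuous_AE_zero:
  fixes f :: "real \<Rightarrow> real"
  assumes f: "continuous_on UNIV f" and z: "AE x in lborel. f x = 0"
  shows "f x = 0"
proof -
  have Jp: "primitive (primitive0 f) f" by (rule primitive_primitive0[OF continuous_locally_integrable[OF f]])
  have p: "primitive (primitive0 f) (\<lambda>x. 0)" using primitive_cong_AE[OF Jp z] by simp
  have "(primitive0 f has_real_derivative f x) (at x)" by (rule primitive_of_continuous_has_derivative[OF Jp f])
  moreover have "(primitive0 f has_real_derivative 0) (at x)"
    by (rule primitive_of_continuous_has_derivative[OF p]) simp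
  ultimately show ?thesis using DERIV_unique by blast
qed

lemma h1_AE_eqI: "AE x in lborel. fn u x = fn v x \<Longrightarrow> u = v"
  using continuous_AE_zero[of "\<lambda>x. fn u x - fn v x"]
  by (intro h1_eqI) (auto intro!: continuous_intros fn_continuous)

lemma L2_form_pos: "v \<noteq> 0 \<Longrightarrow> 0 < L2_form v v"
proof -
  assume v: "v \<noteq> 0"
  have "0 \<le> L2_form v v" by (simp add: L2_form_def)
  moreover have False if z: "L2_form v v = 0"
  proof -
    have "AE x in lborel. fn v x * fn v x = 0"
      using z integral_nonneg_eq_0_iff_AE[of lborel "\<lambda>x. fn v x * fn v x"] fn_dx_integrable(1)[of v v]
      by (simp add: L2_form_def)
    then have "AE x in lborel. fn v x = fn 0 x" by eventually_elim (simp add: fn_zero)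
    then show False using v h1_AE_eqI by blast
  qed
  ultimately show ?thesis by fastforce
qed

lemma sym_form_energy:
  assumes V: "L_infty V"
  shows "sym_form (energy_form V)"
proof -
  obtain C where C: "0 \<le> C" "V \<in> borel_measurable borel" "AE x in lborel. \<bar>V x\<bar> \<le> C"
    using V by (rule L_inftyE)
  show ?thesis
  proof (rule sym_formI[of _ "1 + C"])
    fix u v w :: h1 and c :: real
    show "energy_form V (u + v) w = energy_form V u w + energy_form V v w"
    proof -
      have "(LINT x|lborel. dx (u + v) x * dx w x) = (LINT x|lborel. dx u x * dx w x + dx v x * dx w x)"
        by (rule integral_cong_AE) (use dx_plus[of u v] in \<open>auto simp: distrib_right\<close>)
      then show ?thesis using fn_dx_integrable L_infty_integrable[OF V]
        by (simp add: energy_form_def fn_plus distrib_right distrib_left)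
    qed
    show "energy_form V (c *\<^sub>R u) w = c * energy_form V u w"
    proof -
      have "(LINT x|lborel. dx (c *\<^sub>R u) x * dx w x) = (LINT x|lborel. c * (dx u x * dx w x))"
        by (rule integral_cong_AE) (use dx_scaleR[of c u] in auto)
      moreover have "(LINT x|lborel. V x * (fn (c *\<^sub>R u) x * fn w x)) = (LINT x|lborel. c * (V x * (fn u x * fn w x)))"
        by (intro Bochner_Integration.integral_cong) (auto simp: fn_scaleR)
      ultimately show ?thesis by (simp add: energy_form_def distrib_left)
    qed
    show "energy_form V u w = energy_form V w u" by (simp add: energy_form_def mult.commute)
    have "\<bar>LINT x|lborel. dx u x * dx w x\<bar> \<le> norm u * norm w"
      by (rule abs_integral_product_le[OF dx(1) dx(1) L2_le_norm(2) _ L2_le_norm(2)]) auto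
    moreover have "\<bar>LINT x|lborel. V x * (fn u x * fn w x)\<bar> \<le> C * norm u * norm w"
      by (rule abs_integral_triple_le[OF sq_int_fn sq_int_fn C(2,3) L2_le_norm(1) _ L2_le_norm(1) _ C(1)]) auto
    ultimately show "\<bar>energy_form V u w\<bar> \<le> (1 + C) * norm u * norm w"
      unfolding energy_form_def by (simp add: algebra_simps)
  qed
qed

definition eigenvector :: "(real \<Rightarrow> real) \<Rightarrow> real \<Rightarrow> h1 \<Rightarrow> bool" where
  "eigenvector V \<mu> u \<longleftrightarrow> (\<forall>w. energy_form V u w = \<mu> * L2_form u w)"

lemma eigenvector_scaleR: "L_infty V \<Longrightarrow> eigenvector V \<mu> u \<Longrightarrow> eigenvector V \<mu> (c *\<^sub>R u)"
  using sym_form_simps(7)[OF sym_form_energy] sym_form_simps(7)[OF sym_form_L2] by (simp add: eigenvector_def)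

lemma eigenvector_diff: "L_infty V \<Longrightarrow> eigenvector V \<mu> u \<Longrightarrow> eigenvector V \<mu> v \<Longrightarrow> eigenvector V \<mu> (u - v)"
  using sym_form_simps(3)[OF sym_form_energy] sym_form_simps(3)[OF sym_form_L2]
  by (simp add: eigenvector_def right_diff_distrib)

lemma test_function_in_h1:
  assumes "test_function \<phi>"
  obtains w where "fn w = \<phi>" "AE x in lborel. dx w x = deriv \<phi> x"
proof -
  obtain R where R: "0 < R" "\<And>x. R \<le> \<bar>x\<bar> \<Longrightarrow> \<phi> x = 0" "\<And>x. R \<le> \<bar>x\<bar> \<Longrightarrow> deriv \<phi> x = 0"
    using test_function_support[OF assms] by blast
  have sq: "sq_int f" if "continuous_on UNIV f" "\<And>x. R \<le> \<bar>x\<bar> \<Longrightarrow> f x = 0" for f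
    using continuous_compact_support_integrable[OF that continuous_locally_integrable[OF that(1)]]
      borel_measurable_continuous_onI[OF that(1)] by (simp add: sq_int_def power2_eq_square)
  have p: "primitive \<phi> (deriv \<phi>)" by (rule test_function_primitive[OF assms])
  have "sq_int \<phi>" "sq_int (deriv \<phi>)"
    using sq[OF test_function_continuous[OF assms] R(2)] sq[OF test_function_deriv(2)[OF assms] R(3)] by auto
  then have "fn (Abs_h1 \<phi>) = \<phi>" using p by (rule fn_Abs_h1)
  moreover from this have "AE x in lborel. dx (Abs_h1 \<phi>) x = deriv \<phi> x" using p by (intro dx_unique) simp
  ultimately show ?thesis by (rule that)
qed

lemma L_infty_shift: "L_infty V \<Longrightarrow> L_infty (\<lambda>x::real. V x - \<mu>)"
proof -
  assume "L_infty V"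
  then obtain C where C: "V \<in> borel_measurable borel" "AE x in lborel. \<bar>V x\<bar> \<le> C" by (rule L_inftyE)
  have "AE x in lborel. \<bar>V x - \<mu>\<bar> \<le> C + \<bar>\<mu>\<bar>" using C(2) by eventually_elim linarith
  then show ?thesis using C(1) by (auto simp: L_infty_def)
qed

lemma sq_int_L_infty_mult: "L_infty V \<Longrightarrow> sq_int f \<Longrightarrow> sq_int (\<lambda>x. V x * f x)"
  by (erule L_inftyE) (rule sq_int_bounded_mult)

lemma eigenvector_weak_second_deriv:
  assumes V: "L_infty V" and u: "eigenvector V \<mu> u"
  shows "weak_deriv (dx u) (\<lambda>x. (V x - \<mu>) * fn u x)"
proof -
  have [measurable]: "V \<in> borel_measurable borel" using V by (simp add: L_infty_def)
  have "(LINT x|lborel. deriv \<phi> x *\<^sub>R dx u x) = - (LINT x|lborel. \<phi> x *\<^sub>R ((V x - \<mu>) * fn u x))"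
    if \<phi>: "test_function \<phi>" for \<phi>
  proof -
    obtain w where w: "fn w = \<phi>" "AE x in lborel. dx w x = deriv \<phi> x" using test_function_in_h1[OF \<phi>] by blast
    have [measurable]: "deriv \<phi> \<in> borel_measurable borel"
      by (rule borel_measurable_continuous_onI[OF test_function_deriv(2)[OF \<phi>]])
    have "(LINT x|lborel. deriv \<phi> x *\<^sub>R dx u x) = (LINT x|lborel. dx u x * dx w x)"
      by (rule integral_cong_AE) (use w(2) in auto)
    also have "\<dots> = \<mu> * L2_form u w - (LINT x|lborel. V x * (fn u x * fn w x))"
      using u unfolding eigenvector_def energy_form_def by (metis add_diff_cancel_right')
    also have "\<dots> = - (LINT x|lborel. V x * (fn u x * fn w x) - \<mu> * (fn u x * fn w x))"
      using L_infty_integrable[OF V] fn_dx_integrable(1) by (simp add: L2_form_def)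
    also have "(LINT x|lborel. V x * (fn u x * fn w x) - \<mu> * (fn u x * fn w x)) = (LINT x|lborel. \<phi> x *\<^sub>R ((V x - \<mu>) * fn u x))"
      by (intro Bochner_Integration.integral_cong) (auto simp: w(1) algebra_simps)
    finally show ?thesis .
  qed
  then show ?thesis
    unfolding weak_deriv_def
    using sq_int_locally_integrable[OF dx(1)]
      sq_int_locally_integrable[OF sq_int_L_infty_mult[OF L_infty_shift[OF V] sq_int_fn]] by blast
qed

text \<open>
Eigenvectors satisfy the differential equation as a first-order system of absolutely continuous
functions; this makes Wronskian arguments available.
\<close>
lemma eigenvector_classical:
  assumes V: "L_infty V" and u: "eigenvector V \<mu> u"
  obtains g where "primitive (fn u) g" "primitive g (\<lambda>x. (V x - \<mu>) * fn u x)" "sq_int g"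
proof -
  obtain g where g: "primitive g (\<lambda>x. (V x - \<mu>) * fn u x)" "AE x in lborel. dx u x = g x"
    using weak_deriv_imp_primitive[OF eigenvector_weak_second_deriv[OF V u]] by blast
  have gm: "g \<in> borel_measurable borel" by (rule borel_measurable_continuous_onI[OF primitive_continuous[OF g(1)]])
  show ?thesis
    by (rule that[OF primitive_cong_AE[OF dx(2) g(2) gm] g(1) sq_int_cong_AE[OF dx(1) g(2) gm]])
qed

lemma h1_integration_by_parts:
  assumes "primitive g g'" "sq_int g" "sq_int g'"
  shows "(LINT x|lborel. g x * dx w x) = - (LINT x|lborel. g' x * fn w x)"
proof -
  have i: "integrable lborel (\<lambda>x. g' x * fn w x)" "integrable lborel (\<lambda>x. g x * dx w x)"
    "integrable lborel (\<lambda>x. g x * fn w x)"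
    by (intro sq_int_mult_integrable assms sq_int_fn dx)+
  have "(LINT x|lborel. g' x * fn w x + g x * dx w x) = 0"
    using i by (intro integrable_primitive(1)[OF primitive_mult[OF assms(1) dx(2)]]) auto
  then show ?thesis using i by simp
qed

lemma eigenvector_of_weak_derivs:
  assumes V: "L_infty V" and sq: "sq_int a" "sq_int a'" "sq_int a''"
    and wd: "weak_deriv a a'" "weak_deriv a' a''"
    and eq: "AE x in lborel. \<mu> * a x = - a'' x + V x * a x"
  shows "\<exists>v. eigenvector V \<mu> v \<and> (AE x in lborel. a x = fn v x)"
proof -
  have Vm[measurable]: "V \<in> borel_measurable borel" using V by (simp add: L_infty_def)
  obtain f where f: "primitive f a'" "AE x in lborel. a x = f x" using weak_deriv_imp_primitive[OF wd(1)] by blast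
  obtain g where g: "primitive g a''" "AE x in lborel. a' x = g x" using weak_deriv_imp_primitive[OF wd(2)] by blast
  have fm: "f \<in> borel_measurable borel" by (rule borel_measurable_continuous_onI[OF primitive_continuous[OF f(1)]])
  have gm: "g \<in> borel_measurable borel" by (rule borel_measurable_continuous_onI[OF primitive_continuous[OF g(1)]])
  note [measurable] = fm gm sq[THEN sq_int_measurable]
  define v where "v = Abs_h1 f"
  have fv: "fn v = f" unfolding v_def by (rule fn_Abs_h1[OF sq_int_cong_AE[OF sq(1) f(2) fm] sq(2) f(1)])
  have dv: "AE x in lborel. dx v x = a' x" by (rule dx_unique) (use f(1) fv in simp)
  have "energy_form V v w = \<mu> * L2_form v w" for w
  proof -
    have "(LINT x|lborel. dx v x * dx w x) = (LINT x|lborel. g x * dx w x)"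
      by (rule integral_cong_AE) (use dv g(2) in auto)
    also have "\<dots> = - (LINT x|lborel. a'' x * fn w x)"
      by (rule h1_integration_by_parts[OF g(1) sq_int_cong_AE[OF sq(2) g(2) gm] sq(3)])
    also have "(LINT x|lborel. a'' x * fn w x) = (LINT x|lborel. V x * (fn v x * fn w x) - \<mu> * (fn v x * fn w x))"
    proof (rule integral_cong_AE)
      show "AE x in lborel. a'' x * fn w x = V x * (fn v x * fn w x) - \<mu> * (fn v x * fn w x)"
        using eq f(2)
      proof eventually_elim
        case (elim x)
        then have "a'' x = V x * f x - \<mu> * f x" by simp
        then have "a'' x * fn w x = (V x * f x - \<mu> * f x) * fn w x" by (rule arg_cong)
        then show ?case by (simp add: fv left_diff_distrib mult.assoc)
      qed
    qed measurable
    also have "\<dots> = (LINT x|lborel. V x * (fn v x * fn w x)) - \<mu> * L2_form v w"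
      using L_infty_integrable[OF V] fn_dx_integrable(1) by (simp add: L2_form_def)
    finally show ?thesis by (simp add: energy_form_def)
  qed
  then show ?thesis using f(2) fv by (auto simp: eigenvector_def)
qed

text \<open>
The energy \<open>E = f\<^sup>2 + g\<^sup>2\<close> satisfies \<open>\<bar>E'\<bar> \<le> k * E\<close>, so \<open>exp (- k * x) * E x\<close> decreases and
\<open>exp (k * x) * E x\<close> increases. As \<open>E\<close> vanishes at \<open>x0\<close>, it vanishes on both sides.
\<close>
lemma gronwall_zero:
  assumes f: "primitive f g" and g: "primitive g (\<lambda>x. p x * f x)"
    and p: "p \<in> borel_measurable borel" "AE x in lborel. \<bar>p x\<bar> \<le> C"
    and x0: "f x0 = 0" "g x0 = 0"
  shows "f x = 0"
proof -
  define k where "k = 1 + \<bar>C\<bar>"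
  define E where "E x = f x * f x + g x * g x" for x
  define E' where "E' x = (g x * f x + f x * g x) + (p x * f x * g x + g x * (p x * f x))" for x
  have E: "primitive E E'"
    unfolding E_def E'_def by (intro primitive_add primitive_mult f g)
  have bd: "AE x in lborel. \<bar>E' x\<bar> \<le> k * E x"
    using p(2)
  proof eventually_elim
    case (elim x)
    have "E' x = 2 * (1 + p x) * (f x * g x)" by (simp add: E'_def algebra_simps)
    also have "\<dots> = (1 + p x) * (2 * (f x * g x))" by simp
    finally have "\<bar>E' x\<bar> = \<bar>1 + p x\<bar> * (2 * \<bar>f x * g x\<bar>)" by (simp only: abs_mult abs_numeral)
    also have "\<dots> \<le> k * E x"
      using elim abs_mult_le_squares[of "f x" "g x"]
      by (intro mult_mono) (auto simp: k_def E_def power2_eq_square)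
    finally show ?case .
  qed
  have ex: "primitive (\<lambda>x. exp (s * x)) (\<lambda>x. s * exp (s * x))" for s :: real
    by (rule primitive_of_deriv) (auto intro!: derivative_eq_intros continuous_intros)
  have mono: "exp (s * b) * E b - exp (s * a) * E a = (LINT x:{a..b}|lborel. exp (s * x) * (s * E x + E' x))"
    if "a \<le> b" for s a b
    using primitiveD[OF primitive_mult[OF ex[of s] E] that] by (simp add: algebra_simps)
  have Enn: "0 \<le> E x" for x by (simp add: E_def)
  have E0: "E x0 = 0" by (simp add: E_def x0)
  have "E x \<le> 0"
  proof (cases "x0 \<le> x")
    case True
    have "(LINT x:{x0..x}|lborel. exp (- k * x) * (- k * E x + E' x)) \<le> 0"
    proof -
      have "0 \<le> (LINT y|lborel. - (indicator {x0..x} y *\<^sub>R (exp (- k * y) * (- k * E y + E' y))))"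
      proof (rule integral_nonneg_AE)
        show "AE y in lborel. 0 \<le> - (indicator {x0..x} y *\<^sub>R (exp (- k * y) * (- k * E y + E' y)))"
          using bd
        proof eventually_elim
          case (elim y)
          have "exp (- k * y) * (- k * E y + E' y) \<le> 0"
            using elim by (intro mult_nonneg_nonpos) auto
          then show ?case by (auto simp: indicator_def)
        qed
      qed
      then show ?thesis unfolding set_lebesgue_integral_def by simp
    qed
    then have "exp (- k * x) * E x \<le> 0" using mono[OF True, of "-k"] E0 by simp
    then show ?thesis using exp_gt_zero[of "- k * x"] by (metis mult_le_0_iff not_le)
  next
    case False
    then have le: "x \<le> x0" by simp
    have "0 \<le> (LINT x:{x..x0}|lborel. exp (k * x) * (k * E x + E' x))"
      unfolding set_lebesgue_integral_def
    proof (rule integral_nonneg_AE)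
      show "AE y in lborel. 0 \<le> indicator {x..x0} y *\<^sub>R (exp (k * y) * (k * E y + E' y))"
        using bd
      proof eventually_elim
        case (elim y)
        have "0 \<le> exp (k * y) * (k * E y + E' y)"
          using elim by (intro mult_nonneg_nonneg) auto
        then show ?case by (auto simp: indicator_def)
      qed
    qed
    then have "exp (k * x) * E x \<le> 0" using mono[OF le, of k] E0 by simp
    then show ?thesis using exp_gt_zero[of "k * x"] by (metis mult_le_0_iff not_le)
  qed
  then have "E x = 0" using Enn[of x] by simp
  then show ?thesis by (simp add: E_def sum_squares_eq_zero_iff)
qed

text \<open>
Some combination \<open>z\<close> of two eigenvectors vanishes at a point \<open>x0\<close> where \<open>u\<close> does not. The Wronskian of
\<open>u\<close> and \<open>z\<close> is constant and integrable, hence zero, so \<open>z\<close> has vanishing Cauchy data at \<open>x0\<close>.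
\<close>
lemma eigenvector_simple:
  assumes V: "L_infty V" and u: "eigenvector V \<mu> u" "u \<noteq> 0" and v: "eigenvector V \<mu> v"
  shows "\<exists>c. v = c *\<^sub>R u"
proof -
  obtain C where C: "V \<in> borel_measurable borel" "AE x in lborel. \<bar>V x\<bar> \<le> C" using V by (rule L_inftyE)
  have "\<exists>x0. fn u x0 \<noteq> 0" using u(2) h1_eqI[of u 0] by (auto simp: fn_zero)
  then obtain x0 where x0: "fn u x0 \<noteq> 0" by blast
  define c where "c = fn v x0 / fn u x0"
  define z where "z = v - c *\<^sub>R u"
  have z: "eigenvector V \<mu> z" unfolding z_def by (intro eigenvector_diff eigenvector_scaleR V u v)
  have z0: "fn z x0 = 0" using x0 by (simp add: z_def fn_simps c_def)
  obtain g where g: "primitive (fn u) g" "primitive g (\<lambda>x. (V x - \<mu>) * fn u x)" "sq_int g"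
    using eigenvector_classical[OF V u(1)] by blast
  obtain k where k: "primitive (fn z) k" "primitive k (\<lambda>x. (V x - \<mu>) * fn z x)" "sq_int k"
    using eigenvector_classical[OF V z] by blast
  \<comment> \<open>the Wronskian of \<open>u\<close> and \<open>z\<close>\<close>
  have W: "primitive (\<lambda>x. fn u x * k x - g x * fn z x) (\<lambda>x. 0)"
    using primitive_diff[OF primitive_mult[OF g(1) k(2)] primitive_mult[OF g(2) k(1)]]
    by (simp add: algebra_simps)
  have "\<bar>fn u x0 * k x0 - g x0 * fn z x0\<bar> \<le> (LINT t::real|lborel. \<bar>0\<bar>)"
    by (intro integrable_primitive(2)[OF W] Bochner_Integration.integrable_diff sq_int_mult_integrable
        sq_int_fn g k) simp
  then have k0: "k x0 = 0" using z0 x0 by simp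
  have Cm: "AE x in lborel. \<bar>V x - \<mu>\<bar> \<le> C + \<bar>\<mu>\<bar>" using C(2) by eventually_elim linarith
  have "fn z x = 0" for x
    by (rule gronwall_zero[OF k(1,2) _ Cm z0 k0]) (use C(1) in measurable)
  then have "z = 0" by (intro h1_eqI) (simp add: fn_zero)
  then show ?thesis by (auto simp: z_def)
qed

section \<open>Rescaling\<close>

lemma AE_lborel_scale:
  fixes s :: real
  assumes "AE x in lborel. P x" "s \<noteq> 0"
  shows "AE x in lborel. P (s * x)"
proof -
  have "AE x in density (distr lborel borel (\<lambda>x. 0 + s * x)) (\<lambda>_. ennreal \<bar>s\<bar>). P x"
    using assms by (subst lborel_real_affine[symmetric]) auto
  then have "AE x in distr lborel borel (\<lambda>x. 0 + s * x). P x"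
    using assms(2) by (subst (asm) AE_density) auto
  then show ?thesis using AE_distrD[of "\<lambda>x. 0 + s * x" lborel borel P] by simp
qed

lemma primitive_scale:
  assumes p: "primitive u g" and s: "0 < s"
  shows "primitive (\<lambda>x. u (s * x)) (\<lambda>x. s * g (s * x))"
  unfolding primitive_def locally_integrable_def
proof (intro conjI allI impI)
  fix a b :: real
  have ind: "indicator {s * a..s * b} (s * x) = (indicator {a..b} x :: real)" for x
    using s by (auto simp: indicator_def)
  have "integrable lborel (\<lambda>x. indicator {s * a..s * b} x * g x)"
    using locally_integrableD[OF primitive_locally_integrable[OF p], of "s * a" "s * b"] by (simp add: set_integrable_def)
  from lborel_integrable_real_affine[OF this, of s 0]
  show "set_integrable lborel {a..b} (\<lambda>x. s * g (s * x))"
    using s by (simp add: ind set_integrable_def mult.left_commute)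
  assume "a \<le> b"
  then have "u (s * b) - u (s * a) = (LINT x|lborel. indicator {s * a..s * b} x * g x)"
    using primitiveD[OF p, of "s * a" "s * b"] s by (simp add: set_lebesgue_integral_def)
  also have "\<dots> = s * (LINT x|lborel. indicator {a..b} x * g (s * x))"
    using lborel_integral_real_affine[of s "\<lambda>x. indicator {s * a..s * b} x * g x" 0] s by (simp add: ind)
  finally show "u (s * b) - u (s * a) = (LINT x:{a..b}|lborel. s * g (s * x))"
    by (simp add: set_lebesgue_integral_def mult.left_commute)
qed

lemma sq_int_scale: "sq_int f \<Longrightarrow> s \<noteq> 0 \<Longrightarrow> sq_int (\<lambda>x. f (s * x))"
  using lborel_integrable_real_affine[of "\<lambda>x. (f x)\<^sup>2" s 0]
  by (auto simp: sq_int_def)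

lemma L_infty_scale:
  assumes "L_infty V" "s \<noteq> 0"
  shows "L_infty (\<lambda>x::real. c * V (s * x) :: real)"
proof -
  obtain C where C: "V \<in> borel_measurable borel" "AE x in lborel. \<bar>V x\<bar> \<le> C" using assms by (auto elim: L_inftyE)
  note [measurable] = C(1)
  have "AE x in lborel. \<bar>c * V (s * x)\<bar> \<le> \<bar>c\<bar> * C"
    using AE_lborel_scale[OF C(2) assms(2)] by eventually_elim (simp add: abs_mult mult_left_mono)
  moreover have "(\<lambda>x. c * V (s * x)) \<in> borel_measurable borel" by measurable
  ultimately show ?thesis by (auto simp: L_infty_def)
qed

lemma eigenvector_scale:
  assumes V: "L_infty V" and v: "eigenvector V \<mu> v" and s: "0 < s"
  shows "\<exists>w. eigenvector (\<lambda>x. s\<^sup>2 * V (s * x)) (s\<^sup>2 * \<mu>) w \<and> (\<forall>x. fn w x = fn v (s * x))"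
proof -
  obtain g where g: "primitive (fn v) g" "primitive g (\<lambda>x. (V x - \<mu>) * fn v x)" "sq_int g"
    using eigenvector_classical[OF V v] by blast
  have sq2: "sq_int (\<lambda>x. (V x - \<mu>) * fn v x)" by (rule sq_int_L_infty_mult[OF L_infty_shift[OF V] sq_int_fn])
  have 1: "primitive (\<lambda>x. fn v (s * x)) (\<lambda>x. s * g (s * x))" by (rule primitive_scale[OF g(1) s])
  have 2: "primitive (\<lambda>x. s * g (s * x)) (\<lambda>x. s * (s * ((V (s * x) - \<mu>) * fn v (s * x))))"
    by (rule primitive_cmult[OF primitive_scale[OF g(2) s]])
  have "\<exists>w. eigenvector (\<lambda>x. s\<^sup>2 * V (s * x)) (s\<^sup>2 * \<mu>) w \<and> (AE x in lborel. fn v (s * x) = fn w x)"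
  proof (rule eigenvector_of_weak_derivs[OF L_infty_scale[OF V] _ _ _ primitive_imp_weak_deriv[OF 1]
        primitive_imp_weak_deriv[OF 2]])
    show "sq_int (\<lambda>x. fn v (s * x))" by (rule sq_int_scale[OF sq_int_fn]) (use s in simp)
    show "sq_int (\<lambda>x. s * g (s * x))" by (rule sq_int_cmult[OF sq_int_scale[OF g(3)]]) (use s in simp)
    show "sq_int (\<lambda>x. s * (s * ((V (s * x) - \<mu>) * fn v (s * x))))"
      by (intro sq_int_cmult, rule sq_int_scale[OF sq2]) (use s in simp)
    show "AE x in lborel. s\<^sup>2 * \<mu> * fn v (s * x) = - (s * (s * ((V (s * x) - \<mu>) * fn v (s * x)))) + s\<^sup>2 * V (s * x) * fn v (s * x)"
      by (intro AE_I2) (simp add: power2_eq_square algebra_simps)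
  qed (use s in simp)
  then obtain w where w: "eigenvector (\<lambda>x. s\<^sup>2 * V (s * x)) (s\<^sup>2 * \<mu>) w" "AE x in lborel. fn v (s * x) = fn w x" by blast
  have "fn v (s * x) - fn w x = 0" for x
    by (rule continuous_AE_zero[of "\<lambda>x. fn v (s * x) - fn w x"])
      (use w(2) in \<open>auto intro!: continuous_intros continuous_on_compose2[OF fn_continuous] fn_continuous\<close>)
  then show ?thesis using w(1) by auto
qed

section \<open>Complex eigenfunctions\<close>

lemma L2_sq_int:
  assumes "L2 u"
  shows "sq_int (\<lambda>x. Re (u x))" "sq_int (\<lambda>x. Im (u x))"
proof -
  have m[measurable]: "u \<in> borel_measurable borel" and i: "integrable lborel (\<lambda>x. (cmod (u x))\<^sup>2)"
    using assms by (auto simp: L2_def)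
  have "integrable lborel (\<lambda>x. (Re (u x))\<^sup>2)"
    by (rule Bochner_Integration.integrable_bound[OF i]) (auto simp: cmod_power2)
  moreover have "integrable lborel (\<lambda>x. (Im (u x))\<^sup>2)"
    by (rule Bochner_Integration.integrable_bound[OF i]) (auto simp: cmod_power2)
  ultimately show "sq_int (\<lambda>x. Re (u x))" "sq_int (\<lambda>x. Im (u x))" by (simp_all add: sq_int_def)
qed

lemma weak_deriv_Re_Im:
  assumes "weak_deriv u v"
  shows "weak_deriv (\<lambda>x. Re (u x)) (\<lambda>x. Re (v x))" "weak_deriv (\<lambda>x. Im (u x)) (\<lambda>x. Im (v x))"
proof -
  have lu: "locally_integrable u" and lv: "locally_integrable v"
    and id: "\<And>\<phi>. test_function \<phi> \<Longrightarrow> (LINT x|lborel. deriv \<phi> x *\<^sub>R u x) = - (LINT x|lborel. \<phi> x *\<^sub>R v x)"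
    using assms by (auto simp: weak_deriv_def)
  have li: "locally_integrable (\<lambda>x. Re (w x))" "locally_integrable (\<lambda>x. Im (w x))" "locally_integrable (\<lambda>x. norm (w x))"
    if "locally_integrable w" for w :: "real \<Rightarrow> complex"
    unfolding locally_integrable_def
    using locally_integrableD[OF that] integrable_Re integrable_Im integrable_norm
    by (fastforce simp: set_integrable_def)+
  have int: "integrable lborel (\<lambda>x. f x *\<^sub>R w x)"
    if f: "continuous_on UNIV f" "\<And>x. R \<le> \<bar>x\<bar> \<Longrightarrow> f x = 0" and w: "locally_integrable w" for f R and w :: "real \<Rightarrow> complex"
  proof -
    have [measurable]: "f \<in> borel_measurable borel" "w \<in> borel_measurable borel"
      using borel_measurable_continuous_onI[OF f(1)] locally_integrable_measurable[OF w] by auto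
    have i: "integrable lborel (\<lambda>x. f x * norm (w x))"
      by (rule continuous_compact_support_integrable[OF f(1) f(2) li(3)[OF w]])
    show ?thesis
    proof (rule Bochner_Integration.integrable_bound[OF i])
      show "AE x in lborel. norm (f x *\<^sub>R w x) \<le> norm (f x * norm (w x))"
        by (intro AE_I2) (simp add: abs_mult)
    qed measurable
  qed
  have main: "(LINT x|lborel. deriv \<phi> x * Re (u x)) = - (LINT x|lborel. \<phi> x * Re (v x)) \<and>
      (LINT x|lborel. deriv \<phi> x * Im (u x)) = - (LINT x|lborel. \<phi> x * Im (v x))"
    if \<phi>: "test_function \<phi>" for \<phi>
  proof -
    obtain R where "0 < R" and R: "\<And>x. R \<le> \<bar>x\<bar> \<Longrightarrow> \<phi> x = 0" "\<And>x. R \<le> \<bar>x\<bar> \<Longrightarrow> deriv \<phi> x = 0"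
      using test_function_support[OF \<phi>] by blast
    have i: "integrable lborel (\<lambda>x. deriv \<phi> x *\<^sub>R u x)" "integrable lborel (\<lambda>x. \<phi> x *\<^sub>R v x)"
      using int[OF test_function_deriv(2)[OF \<phi>] R(2) lu] int[OF test_function_continuous[OF \<phi>] R(1) lv] by auto
    have "Re (LINT x|lborel. deriv \<phi> x *\<^sub>R u x) = Re (- (LINT x|lborel. \<phi> x *\<^sub>R v x))"
      "Im (LINT x|lborel. deriv \<phi> x *\<^sub>R u x) = Im (- (LINT x|lborel. \<phi> x *\<^sub>R v x))"
      using id[OF \<phi>] by simp_all
    then show ?thesis using integral_Re[OF i(1)] integral_Re[OF i(2)] integral_Im[OF i(1)] integral_Im[OF i(2)] by simp
  qed
  show "weak_deriv (\<lambda>x. Re (u x)) (\<lambda>x. Re (v x))" "weak_deriv (\<lambda>x. Im (u x)) (\<lambda>x. Im (v x))"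
    unfolding weak_deriv_def using li[OF lu] li[OF lv] main by auto
qed

text \<open>
The potential is real, so real and imaginary parts of a complex eigenfunction are again
solutions, and the problem reduces to the real space \<open>h1\<close>.
\<close>
lemma eigenfunction_components:
  assumes V: "L_infty V" and u: "eigenfunction V \<mu> u"
  obtains v w where "eigenvector V \<mu> v" "eigenvector V \<mu> w" "AE x in lborel. u x = Complex (fn v x) (fn w x)"
    "v \<noteq> 0 \<or> w \<noteq> 0"
proof -
  obtain u' u'' where L: "L2 u" "L2 u'" "L2 u''" and wd: "weak_deriv u u'" "weak_deriv u' u''"
    and eq: "AE x in lborel. of_real \<mu> * u x = - u'' x + of_real (V x) * u x"
    and nz: "\<not> (AE x in lborel. u x = 0)"
    using u unfolding eigenfunction_def schroedinger_def by blast
  have "AE x in lborel. \<mu> * Re (u x) = - Re (u'' x) + V x * Re (u x)"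
    using eq
  proof eventually_elim
    case (elim x)
    from arg_cong[OF this, of Re] show ?case by simp
  qed
  from eigenvector_of_weak_derivs[OF V L2_sq_int(1)[OF L(1)] L2_sq_int(1)[OF L(2)] L2_sq_int(1)[OF L(3)]
      weak_deriv_Re_Im(1)[OF wd(1)] weak_deriv_Re_Im(1)[OF wd(2)] this]
  obtain v where v: "eigenvector V \<mu> v" "AE x in lborel. Re (u x) = fn v x" by blast
  have "AE x in lborel. \<mu> * Im (u x) = - Im (u'' x) + V x * Im (u x)"
    using eq
  proof eventually_elim
    case (elim x)
    from arg_cong[OF this, of Im] show ?case by simp
  qed
  from eigenvector_of_weak_derivs[OF V L2_sq_int(2)[OF L(1)] L2_sq_int(2)[OF L(2)] L2_sq_int(2)[OF L(3)]
      weak_deriv_Re_Im(2)[OF wd(1)] weak_deriv_Re_Im(2)[OF wd(2)] this]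
  obtain w where w: "eigenvector V \<mu> w" "AE x in lborel. Im (u x) = fn w x" by blast
  have eqc: "AE x in lborel. u x = Complex (fn v x) (fn w x)"
    using v(2) w(2) by eventually_elim (simp add: complex_eq_iff)
  have "v \<noteq> 0 \<or> w \<noteq> 0"
  proof (rule ccontr)
    assume "\<not> (v \<noteq> 0 \<or> w \<noteq> 0)"
    then have "AE x in lborel. u x = 0" using eqc by (auto simp: fn_zero Complex_eq_0)
    then show False using nz by simp
  qed
  then show ?thesis using that v(1) w(1) eqc by blast
qed

lemma locally_integrable_of_real:
  "locally_integrable f \<Longrightarrow> locally_integrable (\<lambda>x. c * complex_of_real (f x))"
  unfolding locally_integrable_def set_integrable_def
proof (intro allI)
  fix a b assume "\<forall>a b. integrable lborel (\<lambda>x. indicat_real {a..b} x *\<^sub>R f x)"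
  then have "integrable lborel (\<lambda>x. c * complex_of_real (indicat_real {a..b} x * f x))"
    by (intro integrable_mult_right integrable_of_real) simp
  then show "integrable lborel (\<lambda>x. indicat_real {a..b} x *\<^sub>R (c * complex_of_real (f x)))"
    by (simp add: scaleR_conv_of_real mult.left_commute)
qed

lemma weak_deriv_of_real:
  assumes "weak_deriv f g"
  shows "weak_deriv (\<lambda>x. c * complex_of_real (f x)) (\<lambda>x. c * complex_of_real (g x))"
  unfolding weak_deriv_def
proof (intro conjI allI impI locally_integrable_of_real)
  show "locally_integrable f" "locally_integrable g" using assms by (auto simp: weak_deriv_def)
  have eq: "(LINT x|lborel. \<phi> x *\<^sub>R (c * complex_of_real (h x))) = c * complex_of_real (LINT x|lborel. \<phi> x * h x)"
    for \<phi> h :: "real \<Rightarrow> real"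
  proof -
    have "(LINT x|lborel. \<phi> x *\<^sub>R (c * complex_of_real (h x))) = (LINT x|lborel. c * complex_of_real (\<phi> x * h x))"
      by (intro Bochner_Integration.integral_cong) (auto simp: scaleR_conv_of_real)
    then show ?thesis by (simp only: integral_mult_right_zero integral_complex_of_real)
  qed
  fix \<phi> assume "test_function \<phi>"
  then show "(LINT x|lborel. deriv \<phi> x *\<^sub>R (c * complex_of_real (f x))) = - (LINT x|lborel. \<phi> x *\<^sub>R (c * complex_of_real (g x)))"
    using assms unfolding eq by (simp add: weak_deriv_def)
qed

lemma L2_of_sq_int: "sq_int f \<Longrightarrow> L2 (\<lambda>x. c * complex_of_real (f x))"
  by (auto simp: sq_int_def L2_def norm_mult power_mult_distrib)

lemma L2_norm_of_real: "L2_norm (\<lambda>x. c * complex_of_real (fn v x)) = cmod c * sqrt (L2_form v v)"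
proof -
  have "(LINT x|lborel. (cmod (c * complex_of_real (fn v x)))\<^sup>2) = (cmod c)\<^sup>2 * L2_form v v"
  proof -
    have "(cmod (c * complex_of_real (fn v x)))\<^sup>2 = (cmod c)\<^sup>2 * (fn v x * fn v x)" for x
      by (simp add: norm_mult power_mult_distrib power2_eq_square[of "fn v x"])
    then show ?thesis by (simp only: L2_form_def integral_mult_right_zero)
  qed
  then show ?thesis by (simp add: L2_norm_def real_sqrt_mult)
qed

lemma eigenvector_imp_eigenfunction:
  assumes V: "L_infty V" and v: "eigenvector V \<mu> v" "v \<noteq> 0" and c: "c \<noteq> 0"
  shows "eigenfunction V \<mu> (\<lambda>x. c * complex_of_real (fn v x))"
proof -
  have [measurable]: "V \<in> borel_measurable borel" using V by (simp add: L_infty_def)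
  have "\<not> (AE x in lborel. c * complex_of_real (fn v x) = 0)"
  proof
    assume "AE x in lborel. c * complex_of_real (fn v x) = 0"
    then have "AE x in lborel. fn v x = fn 0 x" by eventually_elim (use c in \<open>simp add: fn_zero\<close>)
    then show False using v(2) h1_AE_eqI by blast
  qed
  moreover have "schroedinger V (\<lambda>x. c * complex_of_real (fn v x)) (\<lambda>x. of_real \<mu> * (c * complex_of_real (fn v x)))"
    unfolding schroedinger_def
  proof (intro exI conjI)
    show "weak_deriv (\<lambda>x. c * complex_of_real (fn v x)) (\<lambda>x. c * complex_of_real (dx v x))"
      by (rule weak_deriv_of_real[OF primitive_imp_weak_deriv[OF dx(2)]])
    show "weak_deriv (\<lambda>x. c * complex_of_real (dx v x)) (\<lambda>x. c * complex_of_real ((V x - \<mu>) * fn v x))"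
      by (rule weak_deriv_of_real[OF eigenvector_weak_second_deriv[OF V v(1)]])
    show "L2 (\<lambda>x. c * complex_of_real ((V x - \<mu>) * fn v x))"
      by (rule L2_of_sq_int[OF sq_int_L_infty_mult[OF L_infty_shift[OF V] sq_int_fn]])
    show "L2 (\<lambda>x. of_real \<mu> * (c * complex_of_real (fn v x)))"
      using L2_of_sq_int[OF sq_int_fn, of "of_real \<mu> * c" v] by (simp add: mult.assoc)
  qed (auto intro!: L2_of_sq_int sq_int_fn dx AE_I2 simp: algebra_simps)
  ultimately show ?thesis by (simp add: eigenfunction_def)
qed

lemma negative_eigenvalues_iff:
  assumes "L_infty V"
  shows "\<mu> \<in> negative_eigenvalues V \<longleftrightarrow> \<mu> < 0 \<and> (\<exists>v. v \<noteq> 0 \<and> eigenvector V \<mu> v)"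
proof
  assume "\<mu> \<in> negative_eigenvalues V"
  then obtain u where "\<mu> < 0" "eigenfunction V \<mu> u" unfolding negative_eigenvalues_def by blast
  obtain v w where vw: "eigenvector V \<mu> v" "eigenvector V \<mu> w" "v \<noteq> 0 \<or> w \<noteq> 0"
    by (rule eigenfunction_components[OF assms \<open>eigenfunction V \<mu> u\<close>])
  show "\<mu> < 0 \<and> (\<exists>v. v \<noteq> 0 \<and> eigenvector V \<mu> v)"
  proof (cases "v = 0")
    case True
    then have "w \<noteq> 0" using vw(3) by simp
    then show ?thesis using vw(2) \<open>\<mu> < 0\<close> by (intro conjI exI[of _ w])
  next
    case False
    then show ?thesis using vw(1) \<open>\<mu> < 0\<close> by (intro conjI exI[of _ v])
  qed
next
  assume "\<mu> < 0 \<and> (\<exists>v. v \<noteq> 0 \<and> eigenvector V \<mu> v)"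
  then obtain v where "\<mu> < 0" "v \<noteq> 0" "eigenvector V \<mu> v" by blast
  from this(1) eigenvector_imp_eigenfunction[OF assms this(3,2) one_neq_zero]
  show "\<mu> \<in> negative_eigenvalues V" unfolding negative_eigenvalues_def by blast
qed

section \<open>The negative spectrum of a Schroedinger operator with decaying potential\<close>

lemma bounded_linear_fn: "bounded_linear (\<lambda>v. fn v x)"
  by (rule bounded_linear_intro[of _ 1]) (auto simp: fn_simps abs_fn_le_norm)

lemma abs_diff_fn_le:
  assumes "a \<le> b"
  shows "(fn v b - fn v a)\<^sup>2 \<le> (b - a) * (LINT x|lborel. (dx v x)\<^sup>2)"
proof -
  have "(LINT x|lborel. indicator {a..b} x * dx v x)\<^sup>2
      \<le> (LINT x|lborel. (indicator {a..b} x)\<^sup>2) * (LINT x|lborel. (dx v x)\<^sup>2)"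
    by (rule cauchy_schwarz_sq_int[OF sq_int_indicator dx(1)])
  also have "(LINT x|lborel. (indicator {a..b} x :: real)\<^sup>2) = (LINT x|lborel. indicator {a..b} x)"
    by (intro Bochner_Integration.integral_cong) (auto simp: indicator_def)
  also have "\<dots> = b - a" using assms by simp
  finally show ?thesis using primitiveD[OF dx(2) assms] by (simp add: set_lebesgue_integral_def)
qed

lemma abs_fn_square_le_anchor:
  "(fn v x)\<^sup>2 \<le> 2 * (fn v p)\<^sup>2 + 2 * \<bar>x - p\<bar> * (LINT x|lborel. (dx v x)\<^sup>2)"
proof -
  have "(fn v x - fn v p)\<^sup>2 \<le> \<bar>x - p\<bar> * (LINT x|lborel. (dx v x)\<^sup>2)"
    using abs_diff_fn_le[of p x v] abs_diff_fn_le[of x p v] by (cases "p \<le> x") (auto simp: power2_commute)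
  moreover have "(fn v x)\<^sup>2 \<le> 2 * (fn v p)\<^sup>2 + 2 * (fn v x - fn v p)\<^sup>2"
    using zero_le_power2[of "fn v x - 2 * fn v p"] by (simp add: power2_eq_square algebra_simps)
  ultimately show ?thesis by simp
qed

text \<open>
A nearby point of a finite grid: \<open>x\<close> is clipped to \<open>{-n..n}\<close> and rounded down to a multiple of \<open>1 / n\<close>.
\<close>
definition anchor :: "nat \<Rightarrow> real \<Rightarrow> real" where
  "anchor n x = of_int \<lfloor>real n * max (- real n) (min (real n) x)\<rfloor> / real n"

lemma anchor_range: "finite (range (anchor n))"
proof -
  have "range (anchor n) \<subseteq> (\<lambda>k. of_int k / real n) ` {- (int n * int n)..int n * int n}"
  proof
    fix y assume "y \<in> range (anchor n)"
    then obtain x where y: "y = anchor n x" by blast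
    let ?z = "max (- real n) (min (real n) x)"
    have "\<bar>?z\<bar> \<le> real n" by auto
    then have "\<bar>real n * ?z\<bar> \<le> real n * real n" unfolding abs_mult by (intro mult_mono) auto
    then have "- (real n * real n) \<le> real n * ?z" "real n * ?z \<le> real n * real n" by auto
    then have "\<lfloor>real n * ?z\<rfloor> \<in> {- (int n * int n)..int n * int n}"
      by (auto simp: le_floor_iff floor_le_iff intro: le_less_trans)
    then show "y \<in> (\<lambda>k. of_int k / real n) ` {- (int n * int n)..int n * int n}"
      unfolding y anchor_def by blast
  qed
  then show ?thesis by (rule finite_subset) simp
qed

lemma anchor_close: "\<bar>x\<bar> \<le> real n \<Longrightarrow> 0 < n \<Longrightarrow> \<bar>x - anchor n x\<bar> \<le> 1 / real n"
proof -
  assume x: "\<bar>x\<bar> \<le> real n" "0 < n"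
  then have "max (- real n) (min (real n) x) = x" by auto
  then have a: "anchor n x = of_int \<lfloor>real n * x\<rfloor> / real n" by (simp add: anchor_def)
  have "x - anchor n x = (real n * x - of_int \<lfloor>real n * x\<rfloor>) / real n" using x(2) by (simp add: a field_simps)
  then have "\<bar>x - anchor n x\<bar> = \<bar>real n * x - of_int \<lfloor>real n * x\<rfloor>\<bar> / real n" by simp
  also have "\<dots> \<le> 1 / real n" by (intro divide_right_mono) linarith+
  finally show ?thesis .
qed

text \<open>
The bound is uniform in \<open>n\<close>, which provides a dominating function for \<open>bargmann\<close>.
\<close>
lemma anchor_bound: "0 < n \<Longrightarrow> \<bar>x - anchor n x\<bar> \<le> 1 + \<bar>x\<bar>"
proof -
  assume n: "0 < n"
  have nn: "anchor n (real n) = real n" "anchor n (- real n) = - real n"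
  proof -
    have "\<lfloor>real n * real n\<rfloor> = int n * int n" using floor_of_int[of "int n * int n", where 'a = real] by (simp only: of_int_mult of_int_of_nat_eq)
    moreover have "\<lfloor>real n * - real n\<rfloor> = - (int n * int n)"
      using floor_of_int[of "- (int n * int n)", where 'a = real]
      by (simp only: of_int_mult of_int_of_nat_eq of_int_minus mult_minus_right)
    ultimately show "anchor n (real n) = real n" "anchor n (- real n) = - real n"
      using n unfolding anchor_def by (simp_all add: max_def min_def)
  qed
  have inv: "1 / real n \<le> 1" using n by simp
  consider "\<bar>x\<bar> \<le> real n" | "real n < x" | "x < - real n" by linarith
  then show ?thesis
  proof cases
    case 1
    show ?thesis using anchor_close[OF 1 n] inv abs_ge_zero[of x] by linarith
  next
    case 2
    then have "max (- real n) (min (real n) x) = max (- real n) (min (real n) (real n))" by simp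
    then have "anchor n x = real n" using nn(1) unfolding anchor_def by (simp only:)
    then show ?thesis using 2 by simp
  next
    case 3
    then have "max (- real n) (min (real n) x) = max (- real n) (min (real n) (- real n))" by simp
    then have "anchor n x = - real n" using nn(2) unfolding anchor_def by (simp only:)
    then show ?thesis using 3 by simp
  qed
qed

text \<open>
By Cauchy-Schwarz, \<open>(v x)\<^sup>2 \<le> 2 * (v a)\<^sup>2 + 2 * \<bar>x - a\<bar> * \<integral> v'\<^sup>2\<close> for every anchor point \<open>a\<close>.
Integrated against \<open>\<bar>V\<bar>\<close>, the last term has the factor \<open>\<integral> \<bar>V x\<bar> * \<bar>x - anchor n x\<bar>\<close>, which tends
to \<open>0\<close> as the grid is refined and enlarged, by dominated convergence with majorant \<open>(1 + \<bar>x\<bar>) * \<bar>V x\<bar>\<close>.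
\<close>
lemma bargmann:
  assumes V: "V \<in> borel_measurable borel" and i: "integrable lborel (\<lambda>x. (1 + \<bar>x\<bar>) * V x)"
    and Vb: "L_infty V"
  shows "\<exists>P D. finite P \<and> 0 \<le> D \<and> (\<forall>v. (LINT x|lborel. \<bar>V x\<bar> * (fn v x * fn v x))
      \<le> 1 / 2 * (LINT x|lborel. (dx v x)\<^sup>2) + D * (\<Sum>x\<in>P. (fn v x)\<^sup>2))"
proof -
  note [measurable] = V
  have [measurable]: "anchor n \<in> borel_measurable borel" for n unfolding anchor_def by measurable
  have w: "integrable lborel (\<lambda>x. (1 + \<bar>x\<bar>) * \<bar>V x\<bar>)"
    using integrable_abs[OF i] by (simp add: abs_mult)
  have Vi: "integrable lborel (\<lambda>x. \<bar>V x\<bar>)"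
    by (rule Bochner_Integration.integrable_bound[OF w])
      (auto simp: mult_le_cancel_right1 abs_mult intro!: AE_I2)
  have bd: "\<bar>V x\<bar> * \<bar>x - anchor (Suc n) x\<bar> \<le> (1 + \<bar>x\<bar>) * \<bar>V x\<bar>" for x n
    using mult_right_mono[OF anchor_bound[of "Suc n" x], of "\<bar>V x\<bar>"] by (simp add: mult.commute)
  have gi: "integrable lborel (\<lambda>x. \<bar>V x\<bar> * \<bar>x - anchor (Suc n) x\<bar>)" for n
    by (rule Bochner_Integration.integrable_bound[OF w]) (use bd in \<open>auto simp: abs_mult intro!: AE_I2\<close>)
  have "(\<lambda>n. LINT x|lborel. \<bar>V x\<bar> * \<bar>x - anchor (Suc n) x\<bar>) \<longlonglongrightarrow> (LINT x::real|lborel. 0)"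
  proof (rule integral_dominated_convergence[OF _ _ w])
    show "AE x in lborel. (\<lambda>n. \<bar>V x\<bar> * \<bar>x - anchor (Suc n) x\<bar>) \<longlonglongrightarrow> 0"
    proof (intro AE_I2)
      fix x :: real
      have "(\<lambda>n. \<bar>x - anchor (Suc n) x\<bar>) \<longlonglongrightarrow> 0"
      proof (rule Lim_null_comparison[OF _ LIMSEQ_inverse_real_of_nat])
        obtain n0 :: nat where n0: "\<bar>x\<bar> \<le> real n0" using real_arch_simple by blast
        have "norm \<bar>x - anchor (Suc n) x\<bar> \<le> inverse (real (Suc n))" if "n \<ge> n0" for n
        proof -
          have "\<bar>x\<bar> \<le> real (Suc n)" using n0 of_nat_mono[OF that, where 'a=real] by simp
          from anchor_close[OF this] show ?thesis by (simp add: inverse_eq_divide)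
        qed
        then show "\<forall>\<^sub>F n in sequentially. norm \<bar>x - anchor (Suc n) x\<bar> \<le> inverse (real (Suc n))"
          unfolding eventually_sequentially by blast
      qed
      from tendsto_mult_left[OF this, of "\<bar>V x\<bar>"]
      show "(\<lambda>n. \<bar>V x\<bar> * \<bar>x - anchor (Suc n) x\<bar>) \<longlonglongrightarrow> 0" by simp
    qed
    show "AE x in lborel. norm (\<bar>V x\<bar> * \<bar>x - anchor (Suc n) x\<bar>) \<le> (1 + \<bar>x\<bar>) * \<bar>V x\<bar>" for n
      using bd by (auto intro!: AE_I2)
  qed measurable
  \<comment> \<open>the value \<open>1 / 4\<close>, doubled, leaves half of \<open>\<integral> v'\<^sup>2\<close> for coercivity\<close>
  from order_tendstoD(2)[OF this, of "1 / 4"] obtain n where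
    n: "(LINT x|lborel. \<bar>V x\<bar> * \<bar>x - anchor (Suc n) x\<bar>) < 1 / 4"
    by (auto simp: eventually_sequentially)
  define P where "P = range (anchor (Suc n))"
  define D where "D = 2 * (LINT x|lborel. \<bar>V x\<bar>)"
  have "(LINT x|lborel. \<bar>V x\<bar> * (fn v x * fn v x))
      \<le> 1 / 2 * (LINT x|lborel. (dx v x)\<^sup>2) + D * (\<Sum>x\<in>P. (fn v x)\<^sup>2)" for v
  proof -
    define S where "S = (\<Sum>x\<in>P. (fn v x)\<^sup>2)"
    define G where "G = (LINT x|lborel. (dx v x)\<^sup>2)"
    have G: "0 \<le> G" by (simp add: G_def)
    have "(LINT x|lborel. \<bar>V x\<bar> * (fn v x * fn v x))
        \<le> (LINT x|lborel. 2 * S * \<bar>V x\<bar> + 2 * G * (\<bar>V x\<bar> * \<bar>x - anchor (Suc n) x\<bar>))"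
    proof (rule integral_mono)
      have "integrable lborel (\<lambda>x. \<bar>V x * (fn v x * fn v x)\<bar>)" by (rule integrable_abs[OF L_infty_integrable[OF Vb]])
      then show "integrable lborel (\<lambda>x. \<bar>V x\<bar> * (fn v x * fn v x))" by (simp add: abs_mult)
      show "integrable lborel (\<lambda>x. 2 * S * \<bar>V x\<bar> + 2 * G * (\<bar>V x\<bar> * \<bar>x - anchor (Suc n) x\<bar>))"
        by (intro Bochner_Integration.integrable_add integrable_mult_right Vi gi)
      fix x
      have "(fn v (anchor (Suc n) x))\<^sup>2 \<le> S"
        unfolding S_def P_def by (rule member_le_sum) (auto simp: anchor_range)
      then have "(fn v x)\<^sup>2 \<le> 2 * S + 2 * \<bar>x - anchor (Suc n) x\<bar> * G"
        using abs_fn_square_le_anchor[of v x "anchor (Suc n) x"] by (simp add: G_def)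
      from mult_left_mono[OF this, of "\<bar>V x\<bar>"]
      show "\<bar>V x\<bar> * (fn v x * fn v x) \<le> 2 * S * \<bar>V x\<bar> + 2 * G * (\<bar>V x\<bar> * \<bar>x - anchor (Suc n) x\<bar>)"
        by (simp add: power2_eq_square algebra_simps)
    qed
    also have "\<dots> = 2 * S * (LINT x|lborel. \<bar>V x\<bar>) + 2 * G * (LINT x|lborel. \<bar>V x\<bar> * \<bar>x - anchor (Suc n) x\<bar>)"
      using Vi gi by simp
    also have "\<dots> \<le> 2 * S * (LINT x|lborel. \<bar>V x\<bar>) + 2 * G * (1 / 4)"
      using n G by (intro add_left_mono mult_left_mono) auto
    finally show ?thesis by (simp add: D_def S_def G_def mult_ac)
  qed
  moreover have "finite P" "0 \<le> D" by (auto simp: P_def D_def anchor_range)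
  ultimately show ?thesis by blast
qed

text \<open>
Finiteness comes from \<open>bargmann\<close>, since the form is nonnegative on functions vanishing at the anchor
points. Negative directions orthogonal to all eigenvectors would produce, by minimization, a negative
eigenvalue with an eigenvector orthogonal to the one already chosen, contradicting simplicity.
\<close>
theorem spectral_decomposition:
  assumes V: "L_infty V" and i: "integrable lborel (\<lambda>x. (1 + \<bar>x\<bar>) * V x)"
  shows "finite (negative_eigenvalues V) \<and> (\<exists>\<phi> K (P :: real set).
    negative_eigenpairs (energy_form V) L2_form \<phi> (nth_negative_eigenvalue V) (card (negative_eigenvalues V)) K 1 P (\<lambda>x v. fn v x))"
proof -
  obtain C where C: "0 \<le> C" "V \<in> borel_measurable borel" "AE x in lborel. \<bar>V x\<bar> \<le> C" using V by (rule L_inftyE)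
  note [measurable] = C(2)
  obtain P D where P: "finite P" "0 \<le> D" and barg: "\<And>v. (LINT x|lborel. \<bar>V x\<bar> * (fn v x * fn v x))
      \<le> 1 / 2 * (LINT x|lborel. (dx v x)\<^sup>2) + D * (\<Sum>x\<in>P. (fn v x)\<^sup>2)"
    using bargmann[OF C(2) i V] by blast
  note h = sym_form_energy[OF V] and b = sym_form_L2
  have hV: "(LINT x|lborel. (dx v x)\<^sup>2) - (LINT x|lborel. \<bar>V x\<bar> * (fn v x * fn v x)) \<le> energy_form V v v" for v
  proof -
    have "integrable lborel (\<lambda>x. \<bar>V x * (fn v x * fn v x)\<bar>)" by (rule integrable_abs[OF L_infty_integrable[OF V]])
    then have iV: "integrable lborel (\<lambda>x. \<bar>V x\<bar> * (fn v x * fn v x))" by (simp add: abs_mult)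
    have "0 \<le> (LINT x|lborel. V x * (fn v x * fn v x) + \<bar>V x\<bar> * (fn v x * fn v x))"
      by (intro integral_nonneg_AE AE_I2) (simp add: distrib_right[symmetric])
    also have "\<dots> = (LINT x|lborel. V x * (fn v x * fn v x)) + (LINT x|lborel. \<bar>V x\<bar> * (fn v x * fn v x))"
      using iV L_infty_integrable[OF V] by simp
    finally show ?thesis by (simp add: energy_form_def power2_eq_square)
  qed
  have below: "1 / 2 * (LINT x|lborel. (dx v x)\<^sup>2) - D * (\<Sum>x\<in>P. (fn v x)\<^sup>2) \<le> energy_form V v v" for v
    using hV[of v] barg[of v] by linarith
  have below0: "- D * (\<Sum>x\<in>P. (fn v x)\<^sup>2) \<le> energy_form V v v" for v
  proof -
    have "0 \<le> (LINT x|lborel. (dx v x)\<^sup>2)" by simp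
    then show ?thesis using below[of v] by linarith
  qed
  have garding: "1 * (norm v)\<^sup>2 - (1 + C) * L2_form v v \<le> energy_form V v v" for v
  proof -
    have "integrable lborel (\<lambda>x. \<bar>V x * (fn v x * fn v x)\<bar>)" by (rule integrable_abs[OF L_infty_integrable[OF V]])
    then have iV: "integrable lborel (\<lambda>x. \<bar>V x\<bar> * (fn v x * fn v x))" by (simp add: abs_mult)
    have "(LINT x|lborel. \<bar>V x\<bar> * (fn v x * fn v x)) \<le> (LINT x|lborel. C * (fn v x * fn v x))"
    proof (rule integral_mono_AE[OF iV])
      show "AE x in lborel. \<bar>V x\<bar> * (fn v x * fn v x) \<le> C * (fn v x * fn v x)"
        using C(3) by eventually_elim (simp add: mult_right_mono)
    qed (use fn_dx_integrable in simp)
    then have "(LINT x|lborel. \<bar>V x\<bar> * (fn v x * fn v x)) \<le> C * L2_form v v" by (simp add: L2_form_def)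
    moreover have "L2_form v v = (LINT x|lborel. (fn v x)\<^sup>2)" by (simp add: L2_form_def power2_eq_square)
    ultimately show ?thesis using hV[of v] by (simp add: norm_h1_square distrib_right)
  qed
  \<comment> \<open>half of the kinetic energy is left over, and \<open>- E\<close> supplies the \<open>L\<^sup>2\<close> norm\<close>
  have coer: "\<exists>k>0. \<exists>D. \<forall>v. k * (norm v)\<^sup>2 - D * (\<Sum>x\<in>P. (fn v x)\<^sup>2) \<le> energy_form V v v - E * L2_form v v"
    if E: "E < 0" for E
  proof -
    obtain k :: real where k: "0 < k" "k \<le> 1 / 2" "k \<le> - E"
      using E by (intro that[of "min (1 / 2) (- E)"]) auto
    have "k * (norm v)\<^sup>2 - D * (\<Sum>x\<in>P. (fn v x)\<^sup>2) \<le> energy_form V v v - E * L2_form v v" for v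
    proof -
      have "k * (LINT x|lborel. (dx v x)\<^sup>2) \<le> 1 / 2 * (LINT x|lborel. (dx v x)\<^sup>2)"
        by (intro mult_right_mono k) auto
      moreover have "k * (LINT x|lborel. (fn v x)\<^sup>2) \<le> - E * (LINT x|lborel. (fn v x)\<^sup>2)"
        by (intro mult_right_mono k) auto
      moreover have "E * L2_form v v = E * (LINT x|lborel. (fn v x)\<^sup>2)" by (simp add: L2_form_def power2_eq_square)
      ultimately show ?thesis using below[of v] unfolding norm_h1_square distrib_left by linarith
    qed
    then show ?thesis using k(1) by blast
  qed
  have ne: "\<mu> < 0 \<and> (\<exists>v. v \<noteq> 0 \<and> (\<forall>w. energy_form V v w = \<mu> * L2_form v w))" if "\<mu> \<in> negative_eigenvalues V" for \<mu>
    using that unfolding negative_eigenvalues_iff[OF V] eigenvector_def .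
  have fin: "finite (negative_eigenvalues V)"
  proof (rule ccontr)
    assume "infinite (negative_eigenvalues V)"
    then obtain M where M: "M \<subseteq> negative_eigenvalues V" "finite M" "card M = Suc (card P)"
      using infinite_arbitrarily_large by blast
    have "card M \<le> card P"
    proof (rule card_negative_eigenvalues_le[OF h b L2_form_pos P(1) _ below0 M(2)])
      show "linear (\<lambda>v. fn v x)" for x by (rule bounded_linear.linear[OF bounded_linear_fn])
    qed (use ne M(1) in auto)
    then show False using M(3) by simp
  qed
  define N where "N = card (negative_eigenvalues V)"
  define lam where "lam = nth_negative_eigenvalue V"
  define xs where "xs = sorted_list_of_set (negative_eigenvalues V)"
  have len: "length xs = N" by (simp add: xs_def N_def)
  have setxs: "set xs = negative_eigenvalues V" using fin by (simp add: xs_def)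
  have lam: "lam n = xs ! (n - 1)" for n by (simp add: lam_def nth_negative_eigenvalue_def xs_def)
  have lam_in: "lam n \<in> negative_eigenvalues V" if "n \<in> {1..N}" for n
  proof -
    have "n - 1 < length xs" using that unfolding len by auto
    from nth_mem[OF this] show ?thesis unfolding lam setxs .
  qed
  have lam_mono: "strict_mono_on {1..N} lam"
  proof (rule strict_mono_onI)
    fix i j assume "i \<in> {1..N}" "j \<in> {1..N}" "i < j"
    moreover have "sorted_wrt (<) xs" by (simp add: xs_def)
    ultimately show "lam i < lam j" unfolding lam
      by (intro sorted_wrt_nth_less[of "(<)" xs "i - 1" "j - 1"]) (auto simp: len)
  qed
  have lam_surj: "\<exists>n\<in>{1..N}. lam n = \<mu>" if \<mu>: "\<mu> \<in> negative_eigenvalues V" for \<mu>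
  proof -
    obtain k where "k < N" "xs ! k = \<mu>" using \<mu> unfolding setxs[symmetric] in_set_conv_nth len by blast
    then show ?thesis by (intro bexI[of _ "Suc k"]) (auto simp: lam)
  qed
  have "\<forall>n\<in>{1..N}. \<exists>v. L2_form v v = 1 \<and> eigenvector V (lam n) v"
  proof
    fix n assume "n \<in> {1..N}"
    then obtain v where v: "v \<noteq> 0" "eigenvector V (lam n) v"
      using lam_in negative_eigenvalues_iff[OF V] by blast
    have "L2_form ((1 / sqrt (L2_form v v)) *\<^sub>R v) ((1 / sqrt (L2_form v v)) *\<^sub>R v) = 1"
      using L2_form_pos[OF v(1)] by (simp add: sym_form_simps[OF b])
    then show "\<exists>v. L2_form v v = 1 \<and> eigenvector V (lam n) v"
      using eigenvector_scaleR[OF V v(2)] by blast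
  qed
  then obtain \<phi> where \<phi>: "\<And>n. n \<in> {1..N} \<Longrightarrow> L2_form (\<phi> n) (\<phi> n) = 1" "\<And>n. n \<in> {1..N} \<Longrightarrow> eigenvector V (lam n) (\<phi> n)"
    by metis
  have eig: "energy_form V (\<phi> n) w = lam n * L2_form (\<phi> n) w" if "n \<in> {1..N}" for n w
    using \<phi>(2)[OF that] by (simp add: eigenvector_def)
  have orth: "L2_form (\<phi> m) (\<phi> n) = of_bool (m = n)" if mn: "m \<in> {1..N}" "n \<in> {1..N}" for m n
  proof (cases "m = n")
    case False
    have "lam m * L2_form (\<phi> m) (\<phi> n) = lam n * L2_form (\<phi> m) (\<phi> n)"
      using eig[OF mn(1), of "\<phi> n"] eig[OF mn(2), of "\<phi> m"] sym_form_commute[OF h] sym_form_commute[OF b] by metis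
    moreover have "lam m \<noteq> lam n"
      using strict_mono_on_eqD[OF lam_mono _ mn] False by auto
    ultimately show ?thesis using False by simp
  qed (use \<phi>(1) mn in simp)
  have nonneg: "0 \<le> energy_form V v v" if vo: "\<And>n. n \<in> {1..N} \<Longrightarrow> L2_form v (\<phi> n) = 0" for v
  proof (rule ccontr)
    assume "\<not> ?thesis"
    then have neg: "energy_form V v v < 0" by simp
    then have "v \<noteq> 0" by (auto simp: sym_form_simps[OF h])
    note bv = L2_form_pos[OF this]
    \<comment> \<open>half the Rayleigh quotient of \<open>v\<close> lies strictly between that quotient and \<open>0\<close>\<close>
    define E where "E = energy_form V v v / (2 * L2_form v v)"
    have E: "E < 0" using neg bv by (simp add: E_def divide_neg_pos)
    have vE: "energy_form V v v < E * L2_form v v" using neg bv by (simp add: E_def field_simps)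
    obtain k D' where k: "0 < k" "\<And>v. k * (norm v)\<^sup>2 - D' * (\<Sum>x\<in>P. (fn v x)\<^sup>2) \<le> energy_form V v v - E * L2_form v v"
      using coer[OF E] by blast
    have low: "- (1 + C) * L2_form v v \<le> energy_form V v v" for v
    proof -
      have "0 \<le> (norm v)\<^sup>2" by simp
      then show ?thesis using garding[of v] by linarith
    qed
    have "\<exists>m u. m < E \<and> u \<noteq> 0 \<and> (\<forall>n\<in>{1..N}. L2_form u (\<phi> n) = 0) \<and> (\<forall>w. energy_form V u w = m * L2_form u w)"
      by (rule eigenvector_by_minimization[OF h b L2_form_pos low P(1) bounded_linear_fn k
            finite_atLeastAtMost eig orth vo vE])
    then obtain m u where u: "m < E" "u \<noteq> 0" "\<And>n. n \<in> {1..N} \<Longrightarrow> L2_form u (\<phi> n) = 0" "eigenvector V m u"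
      unfolding eigenvector_def by blast
    have "m \<in> negative_eigenvalues V" unfolding negative_eigenvalues_iff[OF V] using u E by (intro conjI exI[of _ u]) auto
    then obtain n where n: "n \<in> {1..N}" "lam n = m" using lam_surj by blast
    have "\<phi> n \<noteq> 0" using \<phi>(1)[OF n(1)] by (auto simp: sym_form_simps[OF b])
    then obtain c where "u = c *\<^sub>R \<phi> n" using eigenvector_simple[OF V \<phi>(2)[OF n(1)]] u(4) n(2) by blast
    then have "c = 0" using u(3)[OF n(1)] \<phi>(1)[OF n(1)] by (simp add: sym_form_simps[OF b])
    then show False using u(2) \<open>u = c *\<^sub>R \<phi> n\<close> by simp
  qed
  have "negative_eigenpairs (energy_form V) L2_form \<phi> lam N (1 + C) 1 P (\<lambda>x v. fn v x)"
  proof (rule negative_eigenpairs.intro[OF h b eig orth lam_mono _ nonneg zero_less_one _ garding P(1)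
        bounded_linear_fn coer])
    show "lam n < 0" if "n \<in> {1..N}" for n using ne[OF lam_in[OF that]] by blast
  qed (use C in auto)
  then show ?thesis using fin unfolding N_def lam_def by blast
qed

section \<open>Mean-zero antiderivatives on the torus\<close>

definition bounded_periodic :: "(real \<Rightarrow> real) \<Rightarrow> bool" where
  "bounded_periodic f \<longleftrightarrow> f \<in> borel_measurable borel \<and> periodic1 f \<and> (\<exists>C. AE y in lborel. \<bar>f y\<bar> \<le> C)"

lemma bounded_periodic_locally_integrable: "bounded_periodic f \<Longrightarrow> locally_integrable f"
  unfolding bounded_periodic_def
proof (elim conjE exE)
  fix C assume m: "f \<in> borel_measurable borel" and C: "AE y in lborel. \<bar>f y\<bar> \<le> C"
  show "locally_integrable f"
  proof (rule locally_integrable_bounded[OF m])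
    show "\<exists>C. AE y in lborel. y \<in> {a..b} \<longrightarrow> \<bar>f y\<bar> \<le> C" for a b
      by (rule exI[of _ C]) (use C in eventually_elim, simp)
  qed
qed

text \<open>
The inverse of \<open>d/dy\<close> on periodic functions with mean zero; for other \<open>f\<close> the result is not periodic.
\<close>
definition mean_zero_primitive :: "(real \<Rightarrow> real) \<Rightarrow> real \<Rightarrow> real" where
  "mean_zero_primitive f y = primitive0 f y - torus_integral (primitive0 f)"

lemma torus_integral_add:
  "locally_integrable f \<Longrightarrow> locally_integrable g \<Longrightarrow> torus_integral (\<lambda>y. f y + g y) = torus_integral f + torus_integral g"
  and torus_integral_diff:
  "locally_integrable f \<Longrightarrow> locally_integrable g \<Longrightarrow> torus_integral (\<lambda>y. f y - g y) = torus_integral f - torus_integral g"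
  and torus_integral_cmult: "torus_integral (\<lambda>y. c * f y) = c * torus_integral f"
  and torus_integral_const: "torus_integral (\<lambda>y. c) = c"
  unfolding torus_integral_def
  by (simp_all add: set_integral_add(2) set_integral_diff(2) locally_integrableD)
    (simp add: set_lebesgue_integral_def)

lemma abs_interval_integral_le:
  assumes f: "locally_integrable f" and K: "AE y in lborel. \<bar>f y\<bar> \<le> K" and ab: "a \<le> b"
  shows "\<bar>LINT y:{a..b}|lborel. f y :: real\<bar> \<le> K * (b - a)"
proof -
  have fi: "integrable lborel (\<lambda>y. indicator {a..b} y * f y)"
    using locally_integrableD[OF f] by (simp add: set_integrable_def)
  have "\<bar>LINT y:{a..b}|lborel. f y\<bar> \<le> (LINT y|lborel. \<bar>indicator {a..b} y * f y\<bar>)"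
    by (simp add: set_lebesgue_integral_def)
  also have "\<dots> \<le> (LINT y|lborel. indicator {a..b} y * K)"
  proof (rule integral_mono_AE[OF integrable_abs[OF fi]])
    show "integrable lborel (\<lambda>y. indicator {a..b} y * K)"
      using locally_integrableD[OF locally_integrable_const[of K]] by (simp add: set_integrable_def)
    show "AE y in lborel. \<bar>indicator {a..b} y * f y\<bar> \<le> indicator {a..b} y * K"
      using K by eventually_elim (simp add: indicator_def)
  qed
  also have "\<dots> = K * (b - a)" using ab by simp
  finally show ?thesis .
qed

lemma abs_torus_integral_le:
  "locally_integrable f \<Longrightarrow> AE y in lborel. \<bar>f y\<bar> \<le> K \<Longrightarrow> \<bar>torus_integral f\<bar> \<le> K"
  unfolding torus_integral_def using abs_interval_integral_le[of f K 0 1] by simp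

lemma primitive_mean_zero_primitive: "locally_integrable f \<Longrightarrow> primitive (mean_zero_primitive f) f"
  using primitive_diff[OF primitive_primitive0 primitive_const[of "torus_integral (primitive0 f)"], of f]
  by (simp add: mean_zero_primitive_def[abs_def])

lemma primitive0_continuous: "locally_integrable f \<Longrightarrow> continuous_on UNIV (primitive0 f)"
  by (rule primitive_continuous[OF primitive_primitive0])

lemma mean_zero_primitive_continuous: "locally_integrable f \<Longrightarrow> continuous_on UNIV (mean_zero_primitive f)"
  by (rule primitive_continuous[OF primitive_mean_zero_primitive])

lemma mean_zero_primitive_mean_zero: "locally_integrable f \<Longrightarrow> torus_integral (mean_zero_primitive f) = 0"
  unfolding mean_zero_primitive_def
  by (simp add: torus_integral_diff torus_integral_const locally_integrable_const
      continuous_locally_integrable primitive0_continuous)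

text \<open>
The two intervals by which \<open>{a..a + 1}\<close> and \<open>{0..1}\<close> differ are translates of each other by \<open>1\<close>.
\<close>
lemma periodic_interval_integral:
  assumes f: "locally_integrable f" and per: "periodic1 f"
  shows "(LINT y:{a..a + 1}|lborel. f y) = torus_integral f"
proof -
  have shift: "(LINT y:{a + 1..b + 1}|lborel. f y) = (LINT y:{a..b}|lborel. f y)" for a b
  proof -
    have "(LINT y|lborel. indicator {a + 1..b + 1} y * f y) = (LINT y|lborel. indicator {a + 1..b + 1} (1 + 1 * y) * f (1 + 1 * y))"
      using lborel_integral_real_affine[of 1 "\<lambda>y. indicator {a + 1..b + 1} y * f y" 1] by simp
    also have "\<dots> = (LINT y|lborel. indicator {a..b} y * f y)"
      using per by (intro Bochner_Integration.integral_cong) (auto simp: indicator_def periodic1_def add.commute)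
    finally show ?thesis by (simp add: set_lebesgue_integral_def)
  qed
  have Jd: "primitive0 f b - primitive0 f a = (LINT y:{a..b}|lborel. f y)" if "a \<le> b" for a b
    by (rule primitiveD[OF primitive_primitive0[OF f] that])
  have "primitive0 f (a + 1) - primitive0 f 1 = primitive0 f a - primitive0 f 0"
    using Jd[of 0 a] Jd[of 1 "a + 1"] Jd[of a 0] Jd[of "a + 1" 1] shift[of 0 a] shift[of a 0]
    by (cases "0 \<le> a") auto
  then show ?thesis using Jd[of a "a + 1"] Jd[of 0 1] by (simp add: torus_integral_def)
qed

lemma mean_zero_primitive_periodic:
  assumes "locally_integrable f" "periodic1 f" "torus_integral f = 0"
  shows "periodic1 (mean_zero_primitive f)"
  unfolding periodic1_def
  using primitiveD[OF primitive_mean_zero_primitive[OF assms(1)], of _ "_ + 1"] periodic_interval_integral[OF assms(1,2)] assms(3)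
  by (metis add.commute diff_eq_eq add_0 le_add_same_cancel1 zero_le_one)

lemma periodic_reduce:
  assumes "periodic1 f"
  shows "\<exists>z\<in>{0..1}. f y = f z"
proof -
  have n: "f (x + real n) = f x" for x n
    by (induction n) (use assms in \<open>auto simp: periodic1_def add.assoc[symmetric] add.commute[of 1]\<close>)
  have "f (y - of_int \<lfloor>y\<rfloor>) = f y"
  proof (cases "0 \<le> \<lfloor>y\<rfloor>")
    case True
    then show ?thesis using n[of "y - of_int \<lfloor>y\<rfloor>" "nat \<lfloor>y\<rfloor>"] by simp
  next
    case False
    then show ?thesis using n[of y "nat (- \<lfloor>y\<rfloor>)"] by simp
  qed
  moreover have "y - of_int \<lfloor>y\<rfloor> \<in> {0..1}" unfolding atLeastAtMost_iff by linarith
  ultimately show ?thesis by metis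
qed

text \<open>
The antiderivative vanishing at \<open>0\<close> and its mean over a period are both at most \<open>K\<close>.
\<close>
lemma mean_zero_primitive_bound:
  assumes f: "locally_integrable f" "periodic1 f" "torus_integral f = 0" and K: "AE y in lborel. \<bar>f y\<bar> \<le> K"
  shows "\<bar>mean_zero_primitive f y\<bar> \<le> 2 * K"
proof -
  obtain z where z: "z \<in> {0..1}" "mean_zero_primitive f y = mean_zero_primitive f z" using periodic_reduce[OF mean_zero_primitive_periodic[OF f]] by blast
  have K0: "0 \<le> K"
    using abs_torus_integral_le[OF f(1) K] by linarith
  have Jb: "\<bar>primitive0 f x\<bar> \<le> K" if "x \<in> {0..1}" for x
  proof -
    have "\<bar>primitive0 f x\<bar> \<le> K * (x - 0)"
      using abs_interval_integral_le[OF f(1) K, of 0 x] that by (simp add: primitive0_def)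
    also have "\<dots> \<le> K" using that K0 by (simp add: mult_left_le)
    finally show ?thesis .
  qed
  have Jl: "locally_integrable (primitive0 f)" by (rule continuous_locally_integrable[OF primitive0_continuous[OF f(1)]])
  have "\<bar>torus_integral (primitive0 f)\<bar> \<le> K"
  proof -
    have "torus_integral (primitive0 f) = torus_integral (\<lambda>y. max (- K) (min K (primitive0 f y)))"
      unfolding torus_integral_def
    proof (rule set_lebesgue_integral_cong)
      show "\<forall>x. x \<in> {0..1} \<longrightarrow> primitive0 f x = max (- K) (min K (primitive0 f x))"
      proof (intro allI impI)
        fix x :: real assume "x \<in> {0..1}"
        from Jb[OF this] have "- K \<le> primitive0 f x" "primitive0 f x \<le> K" by linarith+
        then show "primitive0 f x = max (- K) (min K (primitive0 f x))" by simp
      qed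
    qed simp
    also have "\<bar>\<dots>\<bar> \<le> K"
    proof (rule abs_torus_integral_le)
      show "locally_integrable (\<lambda>y. max (- K) (min K (primitive0 f y)))"
        by (intro continuous_locally_integrable continuous_intros primitive0_continuous f)
      show "AE y in lborel. \<bar>max (- K) (min K (primitive0 f y))\<bar> \<le> K"
        using K0 by (intro AE_I2) (auto simp: max_def min_def abs_if)
    qed
    finally show ?thesis .
  qed
  then show ?thesis using Jb[OF z(1)] unfolding z(2) unfolding mean_zero_primitive_def by linarith
qed

lemma mean_zero_primitive_lipschitz:
  assumes f: "locally_integrable f" and K: "AE y in lborel. \<bar>f y\<bar> \<le> K"
  shows "\<bar>mean_zero_primitive f y' - mean_zero_primitive f y\<bar> \<le> K * \<bar>y' - y\<bar>"
proof -
  have "\<bar>mean_zero_primitive f b - mean_zero_primitive f a\<bar> \<le> K * (b - a)" if "a \<le> b" for a b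
    unfolding primitiveD[OF primitive_mean_zero_primitive[OF f] that] by (rule abs_interval_integral_le[OF f K that])
  from this[of y y'] this[of y' y] show ?thesis by (cases "y \<le> y'") auto
qed

lemma primitive0_add_cmult:
  assumes "locally_integrable f" "locally_integrable g"
  shows "primitive0 (\<lambda>y. f y + c * g y) y = primitive0 f y + c * primitive0 g y"
  unfolding primitive0_def
  using set_integral_add(2)[OF locally_integrableD[OF assms(1)] locally_integrableD[OF locally_integrable_add(3)[OF assms(2)]], of _ _ c]
  by auto

lemma mean_zero_primitive_add_cmult:
  assumes f: "locally_integrable f" and g: "locally_integrable g"
  shows "mean_zero_primitive (\<lambda>y. f y + c * g y) y = mean_zero_primitive f y + c * mean_zero_primitive g y"
proof -
  have "torus_integral (primitive0 (\<lambda>y. f y + c * g y)) = torus_integral (\<lambda>y. primitive0 f y + c * primitive0 g y)"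
    using primitive0_add_cmult[OF f g] by presburger
  also have "\<dots> = torus_integral (primitive0 f) + c * torus_integral (primitive0 g)"
    using torus_integral_add[OF continuous_locally_integrable[OF primitive0_continuous[OF f]]
        locally_integrable_add(3)[OF continuous_locally_integrable[OF primitive0_continuous[OF g]]]]
    by (simp add: torus_integral_cmult)
  finally show ?thesis unfolding mean_zero_primitive_def using primitive0_add_cmult[OF f g] by (simp add: algebra_simps)
qed

section \<open>Families that are smooth in the slow variable\<close>

text \<open>
\<open>f1\<close> is the derivative of \<open>f\<close> in the first variable, at the fixed parameter \<open>y\<close>, with a quadratic
Taylor remainder. Stating differentiability through the remainder makes it stable under integration in
\<open>y\<close>, and one constant \<open>C\<close> controls everything.
\<close>
definition slow_C1 :: "real \<Rightarrow> (real \<Rightarrow> real \<Rightarrow> real) \<Rightarrow> (real \<Rightarrow> real \<Rightarrow> real) \<Rightarrow> real \<Rightarrow> bool" where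
  "slow_C1 C f f1 y \<longleftrightarrow> (\<forall>X X'. \<bar>f X y\<bar> \<le> C \<and> \<bar>f1 X y\<bar> \<le> C \<and>
     \<bar>f X' y - f X y\<bar> \<le> C * \<bar>X' - X\<bar> \<and> \<bar>f1 X' y - f1 X y\<bar> \<le> C * \<bar>X' - X\<bar> \<and>
     \<bar>f X' y - f X y - (X' - X) * f1 X y\<bar> \<le> C * (X' - X)\<^sup>2)"

lemma slow_C1D:
  assumes "slow_C1 C f f1 y"
  shows "\<bar>f X y\<bar> \<le> C" "\<bar>f1 X y\<bar> \<le> C" "\<bar>f X' y - f X y\<bar> \<le> C * \<bar>X' - X\<bar>"
    "\<bar>f1 X' y - f1 X y\<bar> \<le> C * \<bar>X' - X\<bar>" "\<bar>f X' y - f X y - (X' - X) * f1 X y\<bar> \<le> C * (X' - X)\<^sup>2"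
  using assms unfolding slow_C1_def by blast+

lemma slow_C1_nonneg: "slow_C1 C f f1 y \<Longrightarrow> 0 \<le> C"
  using slow_C1D(1)[of C f f1 y 0] by linarith

lemma slow_C1_mono:
  assumes "slow_C1 C f f1 y" "C \<le> D"
  shows "slow_C1 D f f1 y"
  unfolding slow_C1_def
proof (intro allI conjI)
  fix X X'
  have le: "C * t \<le> D * t" if "0 \<le> t" for t using assms(2) that by (rule mult_right_mono)
  note d = slow_C1D[OF assms(1)]
  show "\<bar>f X y\<bar> \<le> D" "\<bar>f1 X y\<bar> \<le> D" using d(1,2)[of X] assms(2) by linarith+
  show "\<bar>f X' y - f X y\<bar> \<le> D * \<bar>X' - X\<bar>" using d(3)[of X' X] le[of "\<bar>X' - X\<bar>"] by linarith
  show "\<bar>f1 X' y - f1 X y\<bar> \<le> D * \<bar>X' - X\<bar>" using d(4)[of X' X] le[of "\<bar>X' - X\<bar>"] by linarith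
  show "\<bar>f X' y - f X y - (X' - X) * f1 X y\<bar> \<le> D * (X' - X)\<^sup>2"
    using d(5)[of X' X] le[OF zero_le_power2[of "X' - X"]] by linarith
qed

lemma slow_C1_add:
  assumes "slow_C1 C f f1 y" "slow_C1 D g g1 y"
  shows "slow_C1 (C + D) (\<lambda>X y. f X y + g X y) (\<lambda>X y. f1 X y + g1 X y) y"
  unfolding slow_C1_def
proof (intro allI conjI)
  fix X X'
  note d = slow_C1D[OF assms(1)] and e = slow_C1D[OF assms(2)]
  show "\<bar>f X y + g X y\<bar> \<le> C + D" using d(1)[of X] e(1)[of X] by linarith
  show "\<bar>f1 X y + g1 X y\<bar> \<le> C + D" using d(2)[of X] e(2)[of X] by linarith
  show "\<bar>f X' y + g X' y - (f X y + g X y)\<bar> \<le> (C + D) * \<bar>X' - X\<bar>"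
    using d(3)[of X' X] e(3)[of X' X] unfolding distrib_right by linarith
  show "\<bar>f1 X' y + g1 X' y - (f1 X y + g1 X y)\<bar> \<le> (C + D) * \<bar>X' - X\<bar>"
    using d(4)[of X' X] e(4)[of X' X] unfolding distrib_right by linarith
  show "\<bar>f X' y + g X' y - (f X y + g X y) - (X' - X) * (f1 X y + g1 X y)\<bar> \<le> (C + D) * (X' - X)\<^sup>2"
    using d(5)[of X' X] e(5)[of X' X] unfolding distrib_right distrib_left by linarith
qed

lemma slow_C1_cmult:
  assumes "slow_C1 C f f1 y"
  shows "slow_C1 (\<bar>c\<bar> * C) (\<lambda>X y. c * f X y) (\<lambda>X y. c * f1 X y) y"
proof -
  have le: "\<bar>c * a\<bar> \<le> \<bar>c\<bar> * C * t" if "\<bar>a\<bar> \<le> C * t" for a t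
    using mult_left_mono[OF that, of "\<bar>c\<bar>"] by (simp add: abs_mult mult.assoc)
  note d = slow_C1D[OF assms]
  show ?thesis
    unfolding slow_C1_def
  proof (intro allI conjI)
    fix X X'
    show "\<bar>c * f X y\<bar> \<le> \<bar>c\<bar> * C" using le[of "f X y" 1] d(1) by simp
    show "\<bar>c * f1 X y\<bar> \<le> \<bar>c\<bar> * C" using le[of "f1 X y" 1] d(2) by simp
    show "\<bar>c * f X' y - c * f X y\<bar> \<le> \<bar>c\<bar> * C * \<bar>X' - X\<bar>" using le[OF d(3)[of X' X]] by (simp add: right_diff_distrib)
    show "\<bar>c * f1 X' y - c * f1 X y\<bar> \<le> \<bar>c\<bar> * C * \<bar>X' - X\<bar>" using le[OF d(4)[of X' X]] by (simp add: right_diff_distrib)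
    show "\<bar>c * f X' y - c * f X y - (X' - X) * (c * f1 X y)\<bar> \<le> \<bar>c\<bar> * C * (X' - X)\<^sup>2"
      using le[OF d(5)[of X' X]] by (simp add: right_diff_distrib mult.left_commute)
  qed
qed

lemma abs_product_diff_le:
  fixes a b a' b' :: real
  assumes "\<bar>a\<bar> \<le> A" "\<bar>b'\<bar> \<le> B" "\<bar>a' - a\<bar> \<le> A * t" "\<bar>b' - b\<bar> \<le> B * t"
  shows "\<bar>a' * b' - a * b\<bar> \<le> 2 * A * B * t"
proof -
  have A: "0 \<le> A" using assms(1) by linarith
  have "a' * b' - a * b = (a' - a) * b' + a * (b' - b)" by (simp add: algebra_simps)
  then have "\<bar>a' * b' - a * b\<bar> \<le> \<bar>(a' - a) * b'\<bar> + \<bar>a * (b' - b)\<bar>" by linarith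
  also have "\<bar>(a' - a) * b'\<bar> \<le> (A * t) * B"
    unfolding abs_mult using assms by (intro mult_mono order_trans[OF abs_ge_zero assms(3)]) auto
  also have "\<bar>a * (b' - b)\<bar> \<le> A * (B * t)"
    unfolding abs_mult using assms A by (intro mult_mono) auto
  finally show ?thesis by (simp add: algebra_simps)
qed

lemma slow_C1_mult:
  assumes f: "slow_C1 C f f1 y" and g: "slow_C1 D g g1 y"
  shows "slow_C1 (4 * C * D) (\<lambda>X y. f X y * g X y) (\<lambda>X y. f1 X y * g X y + f X y * g1 X y) y"
proof -
  note d = slow_C1D[OF f] and e = slow_C1D[OF g]
  have C: "0 \<le> C" and D: "0 \<le> D" using slow_C1_nonneg f g by auto
  have CD: "0 \<le> C * D" using C D by simp
  have prod: "\<bar>a * b\<bar> \<le> C * D" if "\<bar>a\<bar> \<le> C" "\<bar>b\<bar> \<le> D" for a b :: real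
    unfolding abs_mult using that C by (intro mult_mono) auto
  show ?thesis
    unfolding slow_C1_def
  proof (intro allI conjI)
    fix X X'
    show "\<bar>f X y * g X y\<bar> \<le> 4 * C * D" using prod[OF d(1)[of X] e(1)[of X]] CD by linarith
    show "\<bar>f1 X y * g X y + f X y * g1 X y\<bar> \<le> 4 * C * D"
      using prod[OF d(2)[of X] e(1)[of X]] prod[OF d(1)[of X] e(2)[of X]] CD by linarith
    have "\<bar>f X' y * g X' y - f X y * g X y\<bar> \<le> 2 * C * D * \<bar>X' - X\<bar>"
      by (rule abs_product_diff_le[OF d(1) e(1) d(3) e(3)])
    moreover have "0 \<le> C * D * \<bar>X' - X\<bar>" using CD by simp
    ultimately show "\<bar>f X' y * g X' y - f X y * g X y\<bar> \<le> 4 * C * D * \<bar>X' - X\<bar>" by linarith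
    have "\<bar>f1 X' y * g X' y - f1 X y * g X y\<bar> \<le> 2 * C * D * \<bar>X' - X\<bar>"
      by (rule abs_product_diff_le[OF d(2) e(1) d(4) e(3)])
    moreover have "\<bar>f X' y * g1 X' y - f X y * g1 X y\<bar> \<le> 2 * C * D * \<bar>X' - X\<bar>"
      by (rule abs_product_diff_le[OF d(1) e(2) d(3) e(4)])
    ultimately show "\<bar>f1 X' y * g X' y + f X' y * g1 X' y - (f1 X y * g X y + f X y * g1 X y)\<bar> \<le> 4 * C * D * \<bar>X' - X\<bar>"
      by linarith
    \<comment> \<open>Taylor remainder of the product: two remainders and the product of the increments\<close>
    have "f X' y * g X' y - f X y * g X y - (X' - X) * (f1 X y * g X y + f X y * g1 X y)
      = (f X' y - f X y - (X' - X) * f1 X y) * g X y + f X y * (g X' y - g X y - (X' - X) * g1 X y)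
        + (f X' y - f X y) * (g X' y - g X y)" by (simp add: algebra_simps)
    then have "\<bar>f X' y * g X' y - f X y * g X y - (X' - X) * (f1 X y * g X y + f X y * g1 X y)\<bar>
      \<le> \<bar>(f X' y - f X y - (X' - X) * f1 X y) * g X y\<bar> + \<bar>f X y * (g X' y - g X y - (X' - X) * g1 X y)\<bar>
        + \<bar>(f X' y - f X y) * (g X' y - g X y)\<bar>" by linarith
    also have "\<bar>(f X' y - f X y - (X' - X) * f1 X y) * g X y\<bar> \<le> (C * (X' - X)\<^sup>2) * D"
      unfolding abs_mult using d(5) e(1) C by (intro mult_mono) auto
    also have "\<bar>f X y * (g X' y - g X y - (X' - X) * g1 X y)\<bar> \<le> C * (D * (X' - X)\<^sup>2)"
      unfolding abs_mult using d(1) e(5) C by (intro mult_mono) auto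
    also have "\<bar>(f X' y - f X y) * (g X' y - g X y)\<bar> \<le> (C * \<bar>X' - X\<bar>) * (D * \<bar>X' - X\<bar>)"
      unfolding abs_mult using d(3) e(3) C by (intro mult_mono) auto
    also have "(C * (X' - X)\<^sup>2) * D + C * (D * (X' - X)\<^sup>2) + (C * \<bar>X' - X\<bar>) * (D * \<bar>X' - X\<bar>) = 3 * (C * D * (X' - X)\<^sup>2)"
      by (simp add: power2_eq_square algebra_simps abs_mult_self_eq flip: abs_mult)
    also have "\<dots> \<le> 4 * C * D * (X' - X)\<^sup>2"
      using mult_nonneg_nonneg[OF CD zero_le_power2[of "X' - X"]] by simp
    finally show "\<bar>f X' y * g X' y - f X y * g X y - (X' - X) * (f1 X y * g X y + f X y * g1 X y)\<bar> \<le> 4 * C * D * (X' - X)\<^sup>2"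
      by simp
  qed
qed

text \<open>
The bounds hold for almost every \<open>y\<close>, with one exceptional null set for all \<open>X\<close>.
\<close>
definition slow_family :: "real \<Rightarrow> (real \<Rightarrow> real \<Rightarrow> real) \<Rightarrow> (real \<Rightarrow> real \<Rightarrow> real) \<Rightarrow> bool" where
  "slow_family C f f1 \<longleftrightarrow> (\<forall>X. f X \<in> borel_measurable borel \<and> f1 X \<in> borel_measurable borel \<and>
     periodic1 (f X) \<and> periodic1 (f1 X)) \<and> (AE y in lborel. slow_C1 C f f1 y)"

lemma slow_familyD:
  assumes "slow_family C f f1"
  shows "f X \<in> borel_measurable borel" "f1 X \<in> borel_measurable borel" "periodic1 (f X)" "periodic1 (f1 X)"
    "AE y in lborel. slow_C1 C f f1 y"
    "AE y in lborel. \<bar>f X y\<bar> \<le> C" "AE y in lborel. \<bar>f1 X y\<bar> \<le> C"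
    "locally_integrable (f X)" "locally_integrable (f1 X)"
proof -
  show m: "f X \<in> borel_measurable borel" "f1 X \<in> borel_measurable borel" "periodic1 (f X)" "periodic1 (f1 X)"
    and ae: "AE y in lborel. slow_C1 C f f1 y" using assms unfolding slow_family_def by blast+
  have b1: "AE y in lborel. \<bar>f X y\<bar> \<le> C" using ae by eventually_elim (erule slow_C1D)
  have b2: "AE y in lborel. \<bar>f1 X y\<bar> \<le> C" using ae by eventually_elim (erule slow_C1D)
  note b = b1 b2
  show "AE y in lborel. \<bar>f X y\<bar> \<le> C" "AE y in lborel. \<bar>f1 X y\<bar> \<le> C" by (rule b1, rule b2)
  show "locally_integrable (f X)" "locally_integrable (f1 X)"
    using m b1 b2 bounded_periodic_locally_integrable unfolding bounded_periodic_def by blast+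
qed

lemma slow_familyD_increments:
  assumes "slow_family C f f1"
  shows "AE y in lborel. \<bar>f X' y - f X y\<bar> \<le> C * \<bar>X' - X\<bar>"
    "AE y in lborel. \<bar>f1 X' y - f1 X y\<bar> \<le> C * \<bar>X' - X\<bar>"
    "AE y in lborel. \<bar>f X' y - f X y - (X' - X) * f1 X y\<bar> \<le> C * (X' - X)\<^sup>2"
  by (rule eventually_mono[OF slow_familyD(5)[OF assms]], erule slow_C1D)+

lemma slow_family_nonneg:
  assumes "slow_family C f f1"
  shows "0 \<le> C"
  using abs_torus_integral_le[OF slow_familyD(8)[OF assms, of 0] slow_familyD(6)[OF assms, of 0]] by linarith

lemma slow_family_torus_integral:
  assumes F: "slow_family C f f1"
  shows "slow_C1 C (\<lambda>X y. torus_integral (f X)) (\<lambda>X y. torus_integral (f1 X)) y"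
proof -
  note d = slow_familyD[OF F] and di = slow_familyD_increments[OF F]
  have bound: "\<bar>torus_integral u\<bar> \<le> K" if "locally_integrable u" "AE y in lborel. \<bar>u y\<bar> \<le> K" for u K
    using that by (rule abs_torus_integral_le)
  show ?thesis
    unfolding slow_C1_def
  proof (intro allI conjI)
    fix X X'
    show "\<bar>torus_integral (f X)\<bar> \<le> C" "\<bar>torus_integral (f1 X)\<bar> \<le> C" by (intro bound d)+
    have "\<bar>torus_integral (\<lambda>y. f X' y - f X y)\<bar> \<le> C * \<bar>X' - X\<bar>"
      by (intro bound locally_integrable_add d di)
    then show "\<bar>torus_integral (f X') - torus_integral (f X)\<bar> \<le> C * \<bar>X' - X\<bar>" by (simp add: torus_integral_diff d)
    have "\<bar>torus_integral (\<lambda>y. f1 X' y - f1 X y)\<bar> \<le> C * \<bar>X' - X\<bar>"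
      by (intro bound locally_integrable_add d di)
    then show "\<bar>torus_integral (f1 X') - torus_integral (f1 X)\<bar> \<le> C * \<bar>X' - X\<bar>" by (simp add: torus_integral_diff d)
    have "\<bar>torus_integral (\<lambda>y. f X' y - f X y - (X' - X) * f1 X y)\<bar> \<le> C * (X' - X)\<^sup>2"
      by (intro bound locally_integrable_add d di)
    then show "\<bar>torus_integral (f X') - torus_integral (f X) - (X' - X) * torus_integral (f1 X)\<bar> \<le> C * (X' - X)\<^sup>2"
      by (simp add: torus_integral_diff torus_integral_cmult locally_integrable_add d)
  qed
qed

text \<open>
The mean of \<open>f1\<close> is the derivative of the mean of \<open>f\<close>.
\<close>
lemma slow_family_deriv_mean_zero:
  assumes F: "slow_family C f f1" and z: "\<And>X. torus_integral (f X) = 0"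
  shows "torus_integral (f1 X) = 0"
proof -
  have C: "0 \<le> C" by (rule slow_family_nonneg[OF F])
  have le: "\<bar>torus_integral (f1 X)\<bar> \<le> C * h" if h: "0 < h" for h
  proof -
    have "\<bar>torus_integral (f (X + h)) - torus_integral (f X) - (X + h - X) * torus_integral (f1 X)\<bar> \<le> C * (X + h - X)\<^sup>2"
      by (rule slow_C1D(5)[OF slow_family_torus_integral[OF F]])
    then have "\<bar>torus_integral (f1 X)\<bar> * h \<le> (C * h) * h" using h by (simp add: z abs_mult power2_eq_square mult.commute)
    then show ?thesis using h by (simp only: mult_le_cancel_right_pos)
  qed
  have "\<bar>torus_integral (f1 X)\<bar> \<le> 0"
  proof (rule field_le_epsilon)
    fix e :: real assume e: "0 < e"
    have "C * (e / (C + 1)) \<le> e" using C e by (simp add: field_simps)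
    moreover have "0 < e / (C + 1)" using C e by simp
    ultimately show "\<bar>torus_integral (f1 X)\<bar> \<le> 0 + e" using le[of "e / (C + 1)"] by linarith
  qed
  then show ?thesis by simp
qed

text \<open>
Taking antiderivatives in \<open>y\<close> is linear and bounded by \<open>mean_zero_primitive_bound\<close>, so it commutes with
differentiation in \<open>X\<close>, upgrades bounds for almost every \<open>y\<close> to bounds for every \<open>y\<close>, and adds
Lipschitz continuity in \<open>y\<close>.
\<close>
lemma slow_family_mean_zero_primitive:
  assumes F: "slow_family C f f1" and z: "\<And>X. torus_integral (f X) = 0"
  shows "slow_C1 (2 * C) (\<lambda>X. mean_zero_primitive (f X)) (\<lambda>X. mean_zero_primitive (f1 X)) y"
    and "slow_family (2 * C) (\<lambda>X. mean_zero_primitive (f X)) (\<lambda>X. mean_zero_primitive (f1 X))"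
    and "torus_integral (mean_zero_primitive (f X)) = 0"
    and "\<bar>mean_zero_primitive (f X) y' - mean_zero_primitive (f X) y\<bar> \<le> C * \<bar>y' - y\<bar>" "\<bar>mean_zero_primitive (f1 X) y' - mean_zero_primitive (f1 X) y\<bar> \<le> C * \<bar>y' - y\<bar>"
proof -
  note d = slow_familyD[OF F] and di = slow_familyD_increments[OF F]
  have z1: "torus_integral (f1 X) = 0" for X by (rule slow_family_deriv_mean_zero[OF F z])
  have per: "periodic1 (mean_zero_primitive (f X))" "periodic1 (mean_zero_primitive (f1 X))" for X by (intro mean_zero_primitive_periodic d z z1)+
  have diff: "\<bar>mean_zero_primitive u y - mean_zero_primitive v y\<bar> \<le> 2 * K"
    if "locally_integrable u" "locally_integrable v" "periodic1 u" "periodic1 v" "torus_integral u = 0"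
      "torus_integral v = 0" "AE y in lborel. \<bar>u y - v y\<bar> \<le> K" for u v K y
  proof -
    have "\<bar>mean_zero_primitive (\<lambda>y. u y + (-1) * v y) y\<bar> \<le> 2 * K"
    proof (rule mean_zero_primitive_bound)
      show "locally_integrable (\<lambda>y. u y + - 1 * v y)" by (intro locally_integrable_add that)
      show "periodic1 (\<lambda>y. u y + - 1 * v y)" using that(3,4) by (simp add: periodic1_def)
      show "torus_integral (\<lambda>y. u y + - 1 * v y) = 0" using that by (simp add: torus_integral_diff)
      show "AE y in lborel. \<bar>u y + - 1 * v y\<bar> \<le> K" using that(7) by simp
    qed
    then show ?thesis unfolding mean_zero_primitive_add_cmult[OF that(1,2)] by simp
  qed
  show s: "slow_C1 (2 * C) (\<lambda>X. mean_zero_primitive (f X)) (\<lambda>X. mean_zero_primitive (f1 X)) y" for y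
    unfolding slow_C1_def
  proof (intro allI conjI)
    fix X X'
    show "\<bar>mean_zero_primitive (f X) y\<bar> \<le> 2 * C" "\<bar>mean_zero_primitive (f1 X) y\<bar> \<le> 2 * C" by (intro mean_zero_primitive_bound d z z1)+
    have "\<bar>mean_zero_primitive (f X') y - mean_zero_primitive (f X) y\<bar> \<le> 2 * (C * \<bar>X' - X\<bar>)"
      by (rule diff[OF d(8) d(8) d(3) d(3) z z di(1)])
    then show "\<bar>mean_zero_primitive (f X') y - mean_zero_primitive (f X) y\<bar> \<le> 2 * C * \<bar>X' - X\<bar>" by simp
    have "\<bar>mean_zero_primitive (f1 X') y - mean_zero_primitive (f1 X) y\<bar> \<le> 2 * (C * \<bar>X' - X\<bar>)"
      by (rule diff[OF d(9) d(9) d(4) d(4) z1 z1 di(2)])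
    then show "\<bar>mean_zero_primitive (f1 X') y - mean_zero_primitive (f1 X) y\<bar> \<le> 2 * C * \<bar>X' - X\<bar>" by simp
    have "\<bar>mean_zero_primitive (f X') y - mean_zero_primitive (\<lambda>y. f X y + (X' - X) * f1 X y) y\<bar> \<le> 2 * (C * (X' - X)\<^sup>2)"
    proof (rule diff[OF d(8) _ d(3) _ z])
      show "locally_integrable (\<lambda>y. f X y + (X' - X) * f1 X y)" by (intro locally_integrable_add d)
      show "periodic1 (\<lambda>y. f X y + (X' - X) * f1 X y)" using d(3,4)[of X] by (simp add: periodic1_def)
      show "torus_integral (\<lambda>y. f X y + (X' - X) * f1 X y) = 0"
        by (simp add: torus_integral_add torus_integral_cmult locally_integrable_add d z z1)
      show "AE y in lborel. \<bar>f X' y - (f X y + (X' - X) * f1 X y)\<bar> \<le> C * (X' - X)\<^sup>2"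
        using d(5)
      proof eventually_elim
        case (elim y)
        from slow_C1D(5)[OF this, of X' X] show ?case by (simp add: algebra_simps)
      qed
    qed
    then show "\<bar>mean_zero_primitive (f X') y - mean_zero_primitive (f X) y - (X' - X) * mean_zero_primitive (f1 X) y\<bar> \<le> 2 * C * (X' - X)\<^sup>2"
      unfolding mean_zero_primitive_add_cmult[OF d(8,9)] by (simp add: algebra_simps)
  qed
  show "slow_family (2 * C) (\<lambda>X. mean_zero_primitive (f X)) (\<lambda>X. mean_zero_primitive (f1 X))"
    unfolding slow_family_def
    using s per borel_measurable_continuous_onI[OF mean_zero_primitive_continuous[OF d(8)]]
      borel_measurable_continuous_onI[OF mean_zero_primitive_continuous[OF d(9)]] by simp
  show "torus_integral (mean_zero_primitive (f X)) = 0" by (rule mean_zero_primitive_mean_zero[OF d(8)])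
  show "\<bar>mean_zero_primitive (f X) y' - mean_zero_primitive (f X) y\<bar> \<le> C * \<bar>y' - y\<bar>" by (rule mean_zero_primitive_lipschitz[OF d(8,6)])
  show "\<bar>mean_zero_primitive (f1 X) y' - mean_zero_primitive (f1 X) y\<bar> \<le> C * \<bar>y' - y\<bar>" by (rule mean_zero_primitive_lipschitz[OF d(9,7)])
qed

section \<open>Chain rule along the curve of fast and slow variables\<close>

text \<open>
This replaces differentiation theorems in the proofs of chain rules: it suffices to compare increments
over short intervals up to a quadratic error.
\<close>
lemma constant_of_quadratic_increments:
  fixes D :: "real \<Rightarrow> real"
  assumes "\<And>a b. a \<le> b \<Longrightarrow> \<bar>D b - D a\<bar> \<le> K * (b - a)\<^sup>2"
  shows "D x = D y"
proof -
  have "(D has_real_derivative 0) (at x)" for x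
  proof -
    have "((\<lambda>h. (D (x + h) - D x) / h) \<longlongrightarrow> 0) (at 0)"
    proof (rule Lim_null_comparison)
      show "\<forall>\<^sub>F h in at 0. norm ((D (x + h) - D x) / h) \<le> \<bar>K\<bar> * \<bar>h\<bar>"
      proof (rule eventually_at_filter[THEN iffD2], intro always_eventually allI impI)
        fix h :: real assume h: "h \<noteq> 0"
        have "\<bar>D (x + h) - D x\<bar> \<le> K * h\<^sup>2"
          using assms[of x "x + h"] assms[of "x + h" x] by (cases "0 \<le> h") auto
        also have "\<dots> \<le> \<bar>K\<bar> * h\<^sup>2" by (intro mult_right_mono) auto
        also have "\<dots> = \<bar>K\<bar> * \<bar>h\<bar> * \<bar>h\<bar>" by (simp add: power2_eq_square mult.assoc)
        finally show "norm ((D (x + h) - D x) / h) \<le> \<bar>K\<bar> * \<bar>h\<bar>"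
          using h by (simp add: pos_divide_le_eq)
      qed
      have "((\<lambda>h. \<bar>K\<bar> * \<bar>h\<bar>) \<longlongrightarrow> \<bar>K\<bar> * \<bar>0\<bar>) (at (0::real))" by (intro tendsto_intros)
      then show "((\<lambda>h. \<bar>K\<bar> * \<bar>h\<bar>) \<longlongrightarrow> 0) (at (0::real))" by simp
    qed
    then show ?thesis by (simp add: DERIV_def)
  qed
  then show ?thesis using DERIV_isconst_all by blast
qed

text \<open>
The chain rule \<open>d/dt F (t, t / \<delta>) = (\<partial>\<^sub>X F + \<partial>\<^sub>y F / \<delta>) (t, t / \<delta>)\<close>, where \<open>\<partial>\<^sub>y F = f\<close> is only
measurable in \<open>y\<close>. An increment over \<open>{a..b}\<close> is split into a slow step at the fixed fast variable
\<open>b / \<delta>\<close> and a fast step at the fixed slow variable \<open>a\<close>; both agree with the integral of the claimed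
derivative up to \<open>O((b - a)\<^sup>2)\<close>.
\<close>
lemma primitive_along_curve:
  assumes \<delta>: "0 < \<delta>"
    and F: "\<And>X X' y. \<bar>F X' y - F X y - (X' - X) * F1 X y\<bar> \<le> C * (X' - X)\<^sup>2"
    and F1: "\<And>X X' y. \<bar>F1 X' y - F1 X y\<bar> \<le> C * \<bar>X' - X\<bar>" "\<And>X y y'. \<bar>F1 X y' - F1 X y\<bar> \<le> C * \<bar>y' - y\<bar>"
    and p: "\<And>X. primitive (F X) (f X)"
    and f: "AE y in lborel. \<forall>X X'. \<bar>f X' y - f X y\<bar> \<le> C * \<bar>X' - X\<bar>"
    and li: "locally_integrable (\<lambda>t. F1 t (t / \<delta>))" "locally_integrable (\<lambda>t. f t (t / \<delta>))"
  shows "primitive (\<lambda>t. F t (t / \<delta>)) (\<lambda>t. F1 t (t / \<delta>) + 1 / \<delta> * f t (t / \<delta>))"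
proof -
  define g where "g t = F1 t (t / \<delta>) + 1 / \<delta> * f t (t / \<delta>)" for t
  have gl: "locally_integrable g" unfolding g_def by (intro locally_integrable_add li)
  have "C * \<bar>1 - 0 :: real\<bar> = C" by simp
  then have C: "0 \<le> C" using F1(2)[of 0 1 0] abs_ge_zero[of "F1 0 1 - F1 0 0"] by linarith
  \<comment> \<open>the defect of the chain rule, to be shown constant\<close>
  define D where "D t = F t (t / \<delta>) - primitive0 g t" for t
  define K where "K = C + C * (1 + 1 / \<delta>) + C / \<delta>"
  have f\<delta>: "AE t in lborel. \<forall>X X'. \<bar>f X' (t / \<delta>) - f X (t / \<delta>)\<bar> \<le> C * \<bar>X' - X\<bar>"
    using AE_lborel_scale[OF f, of "1 / \<delta>"] \<delta> by simp
  have "\<bar>D b - D a\<bar> \<le> K * (b - a)\<^sup>2" if ab: "a \<le> b" for a b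
  proof -
    have fast: "primitive (\<lambda>t. F a (t / \<delta>)) (\<lambda>t. 1 / \<delta> * f a (t / \<delta>))"
      using primitive_scale[OF p[of a], of "1 / \<delta>"] \<delta> by simp
    note fl = primitive_locally_integrable[OF fast]
    have cl: "locally_integrable (\<lambda>t. F1 a (b / \<delta>))" by (rule locally_integrable_const)
    have "primitive0 g b - primitive0 g a = (LINT t:{a..b}|lborel. g t)" by (rule primitiveD[OF primitive_primitive0[OF gl] ab])
    moreover have "F a (b / \<delta>) - F a (a / \<delta>) = (LINT t:{a..b}|lborel. 1 / \<delta> * f a (t / \<delta>))"
      by (rule primitiveD[OF fast ab])
    moreover have "(b - a) * F1 a (b / \<delta>) = (LINT t:{a..b}|lborel. F1 a (b / \<delta>))"
      using ab by (simp add: set_lebesgue_integral_def)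
    moreover have "(LINT t:{a..b}|lborel. (F1 a (b / \<delta>) + 1 / \<delta> * f a (t / \<delta>)) - g t)
        = (LINT t:{a..b}|lborel. F1 a (b / \<delta>)) + (LINT t:{a..b}|lborel. 1 / \<delta> * f a (t / \<delta>)) - (LINT t:{a..b}|lborel. g t)"
      using set_integral_diff(2)[OF locally_integrableD[OF locally_integrable_add(1)[OF cl fl]] locally_integrableD[OF gl], of a b]
        set_integral_add(2)[OF locally_integrableD[OF cl] locally_integrableD[OF fl], of a b] by simp
    ultimately have "D b - D a = (F b (b / \<delta>) - F a (b / \<delta>) - (b - a) * F1 a (b / \<delta>))
        + (LINT t:{a..b}|lborel. (F1 a (b / \<delta>) + 1 / \<delta> * f a (t / \<delta>)) - g t)"
      unfolding D_def by linarith
    moreover have "\<bar>LINT t:{a..b}|lborel. (F1 a (b / \<delta>) + 1 / \<delta> * f a (t / \<delta>)) - g t\<bar>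
        \<le> ((C * (1 + 1 / \<delta>) + C / \<delta>) * (b - a)) * (b - a)"
    proof -
      have dl: "locally_integrable (\<lambda>t. (F1 a (b / \<delta>) + 1 / \<delta> * f a (t / \<delta>)) - g t)"
        by (intro locally_integrable_add(1,2) cl fl gl)
      define dd where "dd t = indicator {a..b} t * ((F1 a (b / \<delta>) + 1 / \<delta> * f a (t / \<delta>)) - g t)" for t
      have ddl: "locally_integrable dd"
      proof -
        have "integrable lborel dd" using locally_integrableD[OF dl, of a b] by (simp add: set_integrable_def dd_def[abs_def])
        then show ?thesis by (rule integrable_locally_integrable)
      qed
      have "AE t in lborel. \<bar>dd t\<bar> \<le> (C * (1 + 1 / \<delta>) + C / \<delta>) * (b - a)"
        using f\<delta>
      proof eventually_elim
        case (elim t)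
        show ?case
        proof (cases "t \<in> {a..b}")
          case True
          have "\<bar>F1 t (t / \<delta>) - F1 a (t / \<delta>)\<bar> \<le> C * (b - a)"
            using F1(1)[of t "t / \<delta>" a] mult_left_mono[of "\<bar>t - a\<bar>" "b - a" C] True C by auto
          moreover have "\<bar>F1 a (t / \<delta>) - F1 a (b / \<delta>)\<bar> \<le> C * (1 / \<delta> * (b - a))"
          proof -
            have "\<bar>t / \<delta> - b / \<delta>\<bar> = 1 / \<delta> * \<bar>t - b\<bar>" using \<delta> by (simp add: diff_divide_distrib[symmetric])
            also have "\<dots> \<le> 1 / \<delta> * (b - a)" using True \<delta> by (intro mult_left_mono) auto
            finally show ?thesis using F1(2)[of a "t / \<delta>" "b / \<delta>"] C mult_left_mono order_trans by blast
          qed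
          moreover have "\<bar>1 / \<delta> * f t (t / \<delta>) - 1 / \<delta> * f a (t / \<delta>)\<bar> \<le> 1 / \<delta> * (C * (b - a))"
          proof -
            have "\<bar>f t (t / \<delta>) - f a (t / \<delta>)\<bar> \<le> C * \<bar>t - a\<bar>" using elim by blast
            also have "\<dots> \<le> C * (b - a)" using True C by (intro mult_left_mono) auto
            finally have "1 / \<delta> * \<bar>f t (t / \<delta>) - f a (t / \<delta>)\<bar> \<le> 1 / \<delta> * (C * (b - a))"
              using \<delta> by (intro mult_left_mono) auto
            moreover have "\<bar>1 / \<delta> * (f t (t / \<delta>) - f a (t / \<delta>))\<bar> = 1 / \<delta> * \<bar>f t (t / \<delta>) - f a (t / \<delta>)\<bar>"
              using \<delta> by (simp only: abs_mult) simp
            ultimately show ?thesis unfolding right_diff_distrib by simp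
          qed
          moreover have "(C * (1 + 1 / \<delta>) + C / \<delta>) * (b - a) = C * (b - a) + C * (1 / \<delta> * (b - a)) + 1 / \<delta> * (C * (b - a))"
            by (simp add: distrib_left distrib_right)
          moreover have "dd t = (F1 a (b / \<delta>) + 1 / \<delta> * f a (t / \<delta>)) - (F1 t (t / \<delta>) + 1 / \<delta> * f t (t / \<delta>))"
            using True by (simp add: dd_def g_def)
          ultimately show ?thesis by linarith
        next
          case False
          then show ?thesis using C \<delta> ab by (simp add: dd_def)
        qed
      qed
      from abs_interval_integral_le[OF ddl this ab]
      have "\<bar>LINT t:{a..b}|lborel. dd t\<bar> \<le> ((C * (1 + 1 / \<delta>) + C / \<delta>) * (b - a)) * (b - a)" .
      moreover have "(LINT t:{a..b}|lborel. dd t) = (LINT t:{a..b}|lborel. (F1 a (b / \<delta>) + 1 / \<delta> * f a (t / \<delta>)) - g t)"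
        by (rule set_lebesgue_integral_cong) (auto simp: dd_def)
      ultimately show ?thesis by simp
    qed
    ultimately have "\<bar>D b - D a\<bar> \<le> C * (b - a)\<^sup>2 + ((C * (1 + 1 / \<delta>) + C / \<delta>) * (b - a)) * (b - a)"
      using F[of b "b / \<delta>" a] by linarith
    also have "\<dots> = K * (b - a)\<^sup>2" by (simp add: K_def power2_eq_square distrib_left distrib_right)
    finally show ?thesis .
  qed
  then have D: "D x = D y" for x y by (rule constant_of_quadratic_increments)
  show ?thesis
    unfolding g_def[symmetric] primitive_def
  proof (intro conjI allI impI gl)
    fix a b :: real assume "a \<le> b"
    then have "primitive0 g b - primitive0 g a = (LINT t:{a..b}|lborel. g t)" by (rule primitiveD[OF primitive_primitive0[OF gl]])
    then show "F b (b / \<delta>) - F a (a / \<delta>) = (LINT t:{a..b}|lborel. g t)" using D[of b a] by (simp add: D_def)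
  qed
qed

section \<open>Regularity of the potential in the slow variable\<close>

lemma continuous_AE_bound:
  fixes f :: "real \<Rightarrow> real"
  assumes f: "continuous_on UNIV f" and C: "AE x in lborel. \<bar>f x\<bar> \<le> C"
  shows "\<bar>f x\<bar> \<le> C"
proof -
  have "max (\<bar>f x\<bar> - C) 0 = 0"
  proof (rule continuous_AE_zero[of "\<lambda>x. max (\<bar>f x\<bar> - C) 0"])
    show "continuous_on UNIV (\<lambda>x. max (\<bar>f x\<bar> - C) 0)" by (intro continuous_intros f)
    show "AE x in lborel. max (\<bar>f x\<bar> - C) 0 = 0" using C by eventually_elim simp
  qed
  then show ?thesis by linarith
qed

lemma primitive_lipschitz:
  assumes p: "primitive w h" and C: "AE x in lborel. \<bar>h x\<bar> \<le> C"
  shows "\<bar>w x' - w x\<bar> \<le> C * \<bar>x' - x\<bar>"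
proof -
  have "\<bar>w b - w a\<bar> \<le> C * (b - a)" if "a \<le> b" for a b
    unfolding primitiveD[OF p that] by (rule abs_interval_integral_le[OF primitive_locally_integrable[OF p] C that])
  from this[of x x'] this[of x' x] show ?thesis by (cases "x \<le> x'") auto
qed

lemma primitive_of_weak_identities:
  assumes g: "g \<in> borel_measurable borel" "AE x in lborel. \<bar>g x\<bar> \<le> C"
    and h: "h \<in> borel_measurable borel" "AE x in lborel. \<bar>h x\<bar> \<le> C"
    and id: "\<And>a b n. a \<in> \<rat> \<Longrightarrow> b \<in> \<rat> \<Longrightarrow>
      (LINT x|lborel. deriv (probe a b n) x * g x) = - (LINT x|lborel. probe a b n x * h x)"
  obtains w where "primitive w h" "AE x in lborel. g x = w x"
proof -
  have bl: "locally_integrable f" if "f \<in> borel_measurable borel" "AE x in lborel. \<bar>f x\<bar> \<le> C" for f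
  proof (rule locally_integrable_bounded[OF that(1)])
    show "\<exists>C. AE x in lborel. x \<in> {a..b} \<longrightarrow> \<bar>f x\<bar> \<le> C" for a b
      by (intro exI[of _ C] eventually_mono[OF that(2)]) simp
  qed
  have "AE x in lborel. g x = primitive0 h x + (LINT t:{0..1}|lborel. g t - primitive0 h t)"
    by (rule primitive_of_probe_identities[OF bl[OF g] bl[OF h] id])
  moreover have "primitive (\<lambda>x. primitive0 h x + (LINT t:{0..1}|lborel. g t - primitive0 h t)) h"
    using primitive_add[OF primitive_primitive0[OF bl[OF h]] primitive_const] by simp
  ultimately show ?thesis using that by blast
qed

text \<open>
Each weak derivative agrees almost everywhere with an absolutely continuous function; substituting these
into each other gives classical derivatives. Three weak derivatives yield two classical ones
and a Lipschitz bound for the second.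
\<close>
lemma classical_derivs_of_weak_identities:
  fixes g :: "nat \<Rightarrow> real \<Rightarrow> real"
  assumes m: "\<And>l. l \<le> 3 \<Longrightarrow> g l \<in> borel_measurable borel" "\<And>l. l \<le> 3 \<Longrightarrow> AE x in lborel. \<bar>g l x\<bar> \<le> C"
    and id: "\<And>l a b n. l < 3 \<Longrightarrow> a \<in> \<rat> \<Longrightarrow> b \<in> \<rat> \<Longrightarrow>
      (LINT x|lborel. deriv (probe a b n) x * g l x) = - (LINT x|lborel. probe a b n x * g (Suc l) x)"
    and c: "continuous_on UNIV (g 0)"
  shows "\<exists>a1 a2. (\<forall>x. (g 0 has_real_derivative a1 x) (at x)) \<and> (\<forall>x. (a1 has_real_derivative a2 x) (at x)) \<and>
    (\<forall>x. \<bar>g 0 x\<bar> \<le> C) \<and> (\<forall>x. \<bar>a1 x\<bar> \<le> C) \<and> (\<forall>x. \<bar>a2 x\<bar> \<le> C) \<and> (\<forall>x x'. \<bar>a2 x' - a2 x\<bar> \<le> C * \<bar>x' - x\<bar>)"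
proof -
  have ex: "\<exists>w. primitive w (g (Suc l)) \<and> (AE x in lborel. g l x = w x)" if "l < 3" for l
  proof -
    have l: "l \<le> 3" "Suc l \<le> 3" using that by auto
    show ?thesis
      using primitive_of_weak_identities[OF m(1)[OF l(1)] m(2)[OF l(1)] m(1)[OF l(2)] m(2)[OF l(2)] id[OF that]]
      by blast
  qed
  obtain w2 where w2: "primitive w2 (g 3)" "AE x in lborel. g 2 x = w2 x" using ex[of 2] by (auto simp: numeral_3_eq_3 numeral_2_eq_2)
  obtain w1 where w1: "primitive w1 (g 2)" "AE x in lborel. g 1 x = w1 x" using ex[of 1] by (auto simp: numeral_2_eq_2)
  obtain w0 where w0: "primitive w0 (g 1)" "AE x in lborel. g 0 x = w0 x" using ex[of 0] by auto
  note cw = primitive_continuous[OF w0(1)] primitive_continuous[OF w1(1)] primitive_continuous[OF w2(1)]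
  have b: "\<bar>w x\<bar> \<le> C" if "continuous_on UNIV w" "AE x in lborel. g l x = w x" "l \<le> 3" for w l x
    by (rule continuous_AE_bound[OF that(1)]) (use m(2)[OF that(3)] that(2) in eventually_elim, simp)
  have "g 0 x - w0 x = 0" for x
    by (rule continuous_AE_zero[of "\<lambda>x. g 0 x - w0 x"])
      (auto intro!: continuous_intros c cw eventually_mono[OF w0(2)])
  then have w0e: "w0 = g 0" by (intro ext) simp
  have p1: "primitive w1 w2"
    by (rule primitive_cong_AE[OF w1(1) w2(2) borel_measurable_continuous_onI[OF cw(3)]])
  have p0: "primitive (g 0) w1"
    using primitive_cong_AE[OF w0(1) w1(2) borel_measurable_continuous_onI[OF cw(2)]] unfolding w0e .
  show ?thesis
  proof (intro exI conjI allI)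
    show "(g 0 has_real_derivative w1 x) (at x)" for x by (rule primitive_of_continuous_has_derivative[OF p0 cw(2)])
    show "(w1 has_real_derivative w2 x) (at x)" for x by (rule primitive_of_continuous_has_derivative[OF p1 cw(3)])
    show "\<bar>g 0 x\<bar> \<le> C" for x by (rule b[OF c, of 0]) auto
    show "\<bar>w1 x\<bar> \<le> C" for x by (rule b[OF cw(2) w1(2)]) simp
    show "\<bar>w2 x\<bar> \<le> C" for x by (rule b[OF cw(3) w2(2)]) simp
    show "\<bar>w2 x' - w2 x\<bar> \<le> C * \<bar>x' - x\<bar>" for x x' by (rule primitive_lipschitz[OF w2(1) m(2)]) simp
  qed
qed

lemma derivative_lipschitz:
  assumes d: "\<And>x. (f has_real_derivative f' x) (at x)" and C: "\<And>x. \<bar>f' x\<bar> \<le> C"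
  shows "\<bar>f y - f x\<bar> \<le> C * \<bar>y - x\<bar>"
proof -
  have main: "\<exists>z. f b - f a = (b - a) * f' z" if "a < b" for a b
    using MVT2[OF that d] by blast
  have "\<exists>z. f y - f x = (y - x) * f' z"
  proof (cases x y rule: linorder_cases)
    case less
    then show ?thesis by (rule main)
  next
    case greater
    then obtain z where "f x - f y = (x - y) * f' z" using main by blast
    then have "f y - f x = (y - x) * f' z" by (simp add: algebra_simps)
    then show ?thesis ..
  qed simp
  then obtain z where "f y - f x = (y - x) * f' z" ..
  then have "\<bar>f y - f x\<bar> = \<bar>f' z\<bar> * \<bar>y - x\<bar>" by (simp add: abs_mult)
  then show ?thesis using mult_right_mono[OF C[of z] abs_ge_zero[of "y - x"]] by simp
qed

lemma derivative_taylor: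
  assumes d: "\<And>x. (f has_real_derivative f' x) (at x)" and L: "\<And>x x'. \<bar>f' x' - f' x\<bar> \<le> C * \<bar>x' - x\<bar>"
  shows "\<bar>f y - f x - (y - x) * f' x\<bar> \<le> C * (y - x)\<^sup>2"
proof -
  have C: "0 \<le> C" using L[of 0 1] abs_ge_zero[of "f' 1 - f' 0"] by simp
  have main: "\<exists>z. \<bar>z - x\<bar> \<le> \<bar>y - x\<bar> \<and> f y - f x = (y - x) * f' z"
  proof (cases x y rule: linorder_cases)
    case less
    from MVT2[OF this d] obtain z where "x < z" "z < y" "f y - f x = (y - x) * f' z" by blast
    then show ?thesis by (intro exI[of _ z]) auto
  next
    case greater
    from MVT2[OF this d] obtain z where z: "y < z" "z < x" "f x - f y = (x - y) * f' z" by blast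
    then have "f y - f x = (y - x) * f' z" by (simp add: algebra_simps)
    then show ?thesis using z by (intro exI[of _ z]) auto
  qed auto
  then obtain z where z: "\<bar>z - x\<bar> \<le> \<bar>y - x\<bar>" "f y - f x = (y - x) * f' z" by blast
  have "\<bar>f y - f x - (y - x) * f' x\<bar> = \<bar>y - x\<bar> * \<bar>f' z - f' x\<bar>"
    unfolding z(2) by (simp add: abs_mult[symmetric] right_diff_distrib)
  also have "\<dots> \<le> \<bar>y - x\<bar> * (C * \<bar>y - x\<bar>)"
    using L[of z x] mult_left_mono[OF z(1) C] by (intro mult_left_mono) auto
  finally show ?thesis by (simp add: power2_eq_square mult.left_commute flip: abs_mult)
qed

text \<open>
The derivative in \<open>X\<close> as a limit along one sequence, which is measurable in \<open>y\<close> and periodic for every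
\<open>q\<close>, also at the exceptional \<open>y\<close> where \<open>q\<close> is not differentiable.
\<close>
definition slow_deriv :: "(real \<Rightarrow> real \<Rightarrow> real) \<Rightarrow> real \<Rightarrow> real \<Rightarrow> real" where
  "slow_deriv q X y = lim (\<lambda>n. (q (X + inverse (real (Suc n))) y - q X y) / inverse (real (Suc n)))"

lemma slow_deriv_eq:
  assumes "((\<lambda>X. q X y) has_real_derivative a) (at X)"
  shows "slow_deriv q X y = a"
proof -
  have "((\<lambda>h. (q (X + h) y - q X y) / h) \<longlongrightarrow> a) (at 0)" using assms by (simp add: DERIV_def)
  moreover have "filterlim (\<lambda>n. inverse (real (Suc n))) (at 0) sequentially"
    unfolding filterlim_at using LIMSEQ_inverse_real_of_nat by simp
  ultimately have "(\<lambda>n. (q (X + inverse (real (Suc n))) y - q X y) / inverse (real (Suc n))) \<longlonglongrightarrow> a"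
    by (rule filterlim_compose)
  then show ?thesis unfolding slow_deriv_def by (rule limI)
qed

lemma slow_deriv_measurable: "(\<And>X. q X \<in> borel_measurable borel) \<Longrightarrow> slow_deriv q X \<in> borel_measurable borel"
  unfolding slow_deriv_def
  by (intro borel_measurable_lim_metric borel_measurable_divide borel_measurable_diff borel_measurable_const)

lemma slow_deriv_periodic: "(\<And>X. periodic1 (q X)) \<Longrightarrow> periodic1 (slow_deriv q X)"
  by (simp add: periodic1_def slow_deriv_def)

lemma L_infty_sections:
  assumes "L_infty (\<lambda>(X, y). g X y :: real)"
  shows "\<exists>C. (AE y in lborel. AE X in lborel. \<bar>g X y\<bar> \<le> C) \<and> (\<forall>y. (\<lambda>X. g X y) \<in> borel_measurable borel)
    \<and> (\<forall>X. g X \<in> borel_measurable borel)"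
proof -
  obtain C where m: "(\<lambda>(X, y). g X y) \<in> borel_measurable borel" and C: "AE z in lborel. \<bar>(\<lambda>(X, y). g X y) z\<bar> \<le> C"
    using assms by (auto simp: L_infty_def)
  have m'[measurable]: "(\<lambda>(X, y). g X y) \<in> borel_measurable (borel \<Otimes>\<^sub>M borel)" using m by (simp add: borel_prod)
  have "AE z in lborel \<Otimes>\<^sub>M lborel. \<bar>g (fst z) (snd z)\<bar> \<le> C"
    using C unfolding lborel_prod by (simp add: case_prod_beta)
  from lborel_pair.AE_pair[OF this] have "AE X in lborel. AE y in lborel. \<bar>g X y\<bar> \<le> C" by simp
  moreover have "{z \<in> space (lborel \<Otimes>\<^sub>M lborel). \<bar>g (fst z) (snd z)\<bar> \<le> C} \<in> sets (lborel \<Otimes>\<^sub>M lborel)"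
    by measurable
  ultimately have "AE y in lborel. AE X in lborel. \<bar>g X y\<bar> \<le> C"
    using lborel_pair.AE_commute[of "\<lambda>X y. \<bar>g X y\<bar> \<le> C"] by simp
  moreover have "(\<lambda>X. g X y) \<in> borel_measurable borel" for y by measurable
  moreover have "g X \<in> borel_measurable borel" for X by measurable
  ultimately show ?thesis by blast
qed

text \<open>
For almost every \<open>y\<close> all the weak identities with probes hold simultaneously, as there are only countably
many probes, and then \<open>classical_derivs_of_weak_identities\<close> applies to the function \<open>X \<mapsto> q X y\<close>.
\<close>
lemma slow_families:
  assumes W: "W_infty 5 q" and c: "continuous_in_X q"
  shows "\<exists>C. slow_family C q (slow_deriv q) \<and> slow_family C (slow_deriv q) (slow_deriv (slow_deriv q))"
proof -
  obtain g where g0: "g 0 = q" and gp: "\<And>l. l \<le> 5 \<Longrightarrow> (\<forall>X. periodic1 (g l X)) \<and> L_infty (\<lambda>(X, y). g l X y)"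
    and gw: "\<And>l. l < 5 \<Longrightarrow> weak_deriv_X (g l) (g (Suc l))"
    using W unfolding W_infty_def by blast
  have "\<exists>C. (AE y in lborel. AE X in lborel. \<bar>g l X y\<bar> \<le> C) \<and> (\<forall>y. (\<lambda>X. g l X y) \<in> borel_measurable borel)
    \<and> (\<forall>X. g l X \<in> borel_measurable borel)" if "l \<le> 3" for l
  proof -
    have "L_infty (\<lambda>(X, y). g l X y)" using gp[of l] that by auto
    then show ?thesis by (rule L_infty_sections)
  qed
  then obtain B where B: "\<And>l. l \<le> 3 \<Longrightarrow> AE y in lborel. AE X in lborel. \<bar>g l X y\<bar> \<le> B l"
    and mX: "\<And>l y. l \<le> 3 \<Longrightarrow> (\<lambda>X. g l X y) \<in> borel_measurable borel"
    and my: "\<And>l X. l \<le> 3 \<Longrightarrow> g l X \<in> borel_measurable borel" by metis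
  define C where "C = Max (B ` {..3})"
  have CB: "B l \<le> C" if "l \<le> 3" for l unfolding C_def using that by (intro Max_ge) auto
  have bd: "AE y in lborel. \<forall>l\<in>{..3}. AE X in lborel. \<bar>g l X y\<bar> \<le> C"
  proof (rule AE_finite_allI)
    fix l :: nat assume "l \<in> {..3}"
    then have l: "l \<le> 3" by simp
    show "AE y in lborel. AE X in lborel. \<bar>g l X y\<bar> \<le> C"
      using B[OF l]
    proof eventually_elim
      case (elim y)
      then show ?case using CB[OF l] by (elim eventually_mono) linarith
    qed
  qed simp
  have ids: "AE y in lborel. \<forall>l\<in>{..<3}. \<forall>a\<in>\<rat>. \<forall>b\<in>\<rat>. \<forall>n. (LINT X|lborel. deriv (probe a b n) X * g l X y)
      = - (LINT X|lborel. probe a b n X * g (Suc l) X y)"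
  proof (rule AE_finite_allI)
    fix l :: nat assume "l \<in> {..<3}"
    then have l: "l < 5" by simp
    have one: "AE y in lborel. (LINT X|lborel. deriv (probe a b n) X * g l X y) = - (LINT X|lborel. probe a b n X * g (Suc l) X y)"
      for a b n using gw[OF l] probe_test_function unfolding weak_deriv_X_def by blast
    have "AE y in lborel. \<forall>z\<in>(\<rat> \<times> \<rat> \<times> (UNIV :: nat set)). (case z of (a, b, n) \<Rightarrow>
       (LINT X|lborel. deriv (probe a b n) X * g l X y) = - (LINT X|lborel. probe a b n X * g (Suc l) X y))"
      using one by (subst AE_ball_countable) (auto intro!: countable_SIGMA countable_rat)
    then show "AE y in lborel. \<forall>a\<in>\<rat>. \<forall>b\<in>\<rat>. \<forall>n. (LINT X|lborel. deriv (probe a b n) X * g l X y)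
      = - (LINT X|lborel. probe a b n X * g (Suc l) X y)"
      by eventually_elim blast
  qed simp
  have "AE y in lborel. slow_C1 C q (slow_deriv q) y \<and> slow_C1 C (slow_deriv q) (slow_deriv (slow_deriv q)) y"
    using bd ids c[unfolded continuous_in_X_def]
  proof eventually_elim
    case (elim y)
    have "\<exists>a1 a2. (\<forall>x. ((\<lambda>X. g 0 X y) has_real_derivative a1 x) (at x)) \<and> (\<forall>x. (a1 has_real_derivative a2 x) (at x)) \<and>
      (\<forall>x. \<bar>g 0 x y\<bar> \<le> C) \<and> (\<forall>x. \<bar>a1 x\<bar> \<le> C) \<and> (\<forall>x. \<bar>a2 x\<bar> \<le> C) \<and> (\<forall>x x'. \<bar>a2 x' - a2 x\<bar> \<le> C * \<bar>x' - x\<bar>)"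
    proof (rule classical_derivs_of_weak_identities[of "\<lambda>l X. g l X y" C])
      show "(\<lambda>X. g l X y) \<in> borel_measurable borel" if "l \<le> 3" for l by (rule mX[OF that])
      show "AE X in lborel. \<bar>g l X y\<bar> \<le> C" if "l \<le> 3" for l using elim(1) that by blast
      show "(LINT X|lborel. deriv (probe a b n) X * g l X y) = - (LINT X|lborel. probe a b n X * g (Suc l) X y)"
        if "l < 3" "a \<in> \<rat>" "b \<in> \<rat>" for l a b n using elim(2) that by blast
      show "continuous_on UNIV (\<lambda>X. g 0 X y)" using elim(3) unfolding g0 .
    qed
    then obtain a1 a2 where a: "\<And>x. ((\<lambda>X. g 0 X y) has_real_derivative a1 x) (at x)" "\<And>x. (a1 has_real_derivative a2 x) (at x)"
      "\<And>x. \<bar>g 0 x y\<bar> \<le> C" "\<And>x. \<bar>a1 x\<bar> \<le> C" "\<And>x. \<bar>a2 x\<bar> \<le> C" "\<And>x x'. \<bar>a2 x' - a2 x\<bar> \<le> C * \<bar>x' - x\<bar>"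
      by blast
    have q1: "slow_deriv q X y = a1 X" for X by (rule slow_deriv_eq) (use a(1) g0 in simp)
    have q2: "slow_deriv (slow_deriv q) X y = a2 X" for X by (rule slow_deriv_eq) (use a(2) q1 in simp)
    have da: "((\<lambda>X. q X y) has_real_derivative a1 x) (at x)" for x using a(1) unfolding g0 .
    show ?case
      unfolding slow_C1_def q1 q2
      using a(3)[unfolded g0] a(4,5,6) derivative_lipschitz[OF da a(4)] derivative_lipschitz[OF a(2,5)]
        derivative_taylor[OF da derivative_lipschitz[OF a(2,5)]] derivative_taylor[OF a(2,6)]
      by blast
  qed
  then have "AE y in lborel. slow_C1 C q (slow_deriv q) y" "AE y in lborel. slow_C1 C (slow_deriv q) (slow_deriv (slow_deriv q)) y"
    by auto
  moreover have qm: "q X \<in> borel_measurable borel" for X using my[of 0] g0 by simp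
  moreover have qp: "periodic1 (q X)" for X using gp[of 0] g0 by simp
  moreover have m1: "slow_deriv q X \<in> borel_measurable borel" for X by (rule slow_deriv_measurable) (rule qm)
  moreover have p1: "periodic1 (slow_deriv q X)" for X by (rule slow_deriv_periodic) (rule qp)
  moreover have "slow_deriv (slow_deriv q) X \<in> borel_measurable borel" for X
    by (rule slow_deriv_measurable) (rule m1)
  moreover have "periodic1 (slow_deriv (slow_deriv q) X)" for X by (rule slow_deriv_periodic) (rule p1)
  ultimately show ?thesis unfolding slow_family_def by blast
qed

section \<open>The corrector\<close>

text \<open>
The difference of two solutions has a constant derivative \<open>c\<close>; periodicity gives \<open>c = 0\<close>, and the
normalization of the mean removes the remaining constant.
\<close>
lemma cell_solution_unique:
  assumes u: "cell_solution f u" and v: "cell_solution f v"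
  shows "u = v"
proof -
  obtain p w where pw: "weak_deriv u p" "weak_deriv p w" "AE y in lborel. - w y = - f y"
    and uc: "periodic1 u" "continuous_on UNIV u" "torus_integral u = 0" using u unfolding cell_solution_def by blast
  obtain p' w' where pw': "weak_deriv v p'" "weak_deriv p' w'" "AE y in lborel. - w' y = - f y"
    and vc: "periodic1 v" "continuous_on UNIV v" "torus_integral v = 0" using v unfolding cell_solution_def by blast
  have rep: "primitive a b" if ab: "weak_deriv a b" "continuous_on UNIV a" for a b :: "real \<Rightarrow> real"
  proof -
    obtain c where c: "primitive c b" "AE x in lborel. a x = c x" using weak_deriv_imp_primitive[OF ab(1)] by blast
    have "a x - c x = 0" for x
      by (rule continuous_AE_zero[of "\<lambda>x. a x - c x"])
        (auto intro!: continuous_intros ab(2) primitive_continuous[OF c(1)] eventually_mono[OF c(2)])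
    then have "a = c" by (intro ext) simp
    then show ?thesis using c(1) by simp
  qed
  have d1: "primitive (\<lambda>x. u x - v x) (\<lambda>x. p x - p' x)"
    by (intro primitive_diff rep pw(1) uc(2) pw'(1) vc(2))
  obtain P where P: "primitive P w" "AE x in lborel. p x = P x" using weak_deriv_imp_primitive[OF pw(2)] by blast
  obtain P' where P': "primitive P' w'" "AE x in lborel. p' x = P' x" using weak_deriv_imp_primitive[OF pw'(2)] by blast
  have "AE x in lborel. w x - w' x = 0" using pw(3) pw'(3) by eventually_elim simp
  from primitive_cong_AE[OF primitive_diff[OF P(1) P'(1)] this] have d2: "primitive (\<lambda>x. P x - P' x) (\<lambda>x. 0)" by simp
  define c where "c = P 0 - P' 0"
  have Pc: "P x - P' x = c" for x
    using primitiveD[OF d2, of 0 x] primitiveD[OF d2, of x 0] by (cases "0 \<le> x") (auto simp: c_def)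
  have "AE x in lborel. p x - p' x = c" using P(2) P'(2) by eventually_elim (simp add: Pc)
  from primitive_cong_AE[OF d1 this] have d3: "primitive (\<lambda>x. u x - v x) (\<lambda>x. c)" by simp
  have "(u 1 - v 1) - (u 0 - v 0) = (LINT x:{0..1::real}|lborel. c)" by (rule primitiveD[OF d3]) simp
  moreover have "u 1 = u 0" "v 1 = v 0" using uc(1) vc(1) unfolding periodic1_def by (metis add_0)+
  ultimately have "c = 0" by (simp add: set_lebesgue_integral_def)
  define e where "e = u 0 - v 0"
  have e: "u x - v x = e" for x
    using primitiveD[OF d3, of 0 x] primitiveD[OF d3, of x 0] \<open>c = 0\<close> by (cases "0 \<le> x") (auto simp: e_def)
  have "torus_integral (\<lambda>x. u x - v x) = 0"
    using torus_integral_diff[OF continuous_locally_integrable[OF uc(2)] continuous_locally_integrable[OF vc(2)]] uc(3) vc(3) by simp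
  then have "e = 0" unfolding e torus_integral_const .
  then show "u = v" using e by (intro ext) simp
qed

lemma cell_solution_mean_zero_primitive:
  assumes "locally_integrable f" "periodic1 f" "torus_integral f = 0"
  shows "cell_solution f (mean_zero_primitive (mean_zero_primitive f))"
proof -
  note c = continuous_locally_integrable[OF mean_zero_primitive_continuous[OF assms(1)]]
  show ?thesis
    unfolding cell_solution_def
  proof (intro conjI exI)
    show "periodic1 (mean_zero_primitive (mean_zero_primitive f))" by (intro mean_zero_primitive_periodic mean_zero_primitive_mean_zero c assms)
    show "continuous_on UNIV (mean_zero_primitive (mean_zero_primitive f))" by (rule mean_zero_primitive_continuous[OF c])
    show "weak_deriv (mean_zero_primitive (mean_zero_primitive f)) (mean_zero_primitive f)" by (rule primitive_imp_weak_deriv[OF primitive_mean_zero_primitive[OF c]])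
    show "weak_deriv (mean_zero_primitive f) f" by (rule primitive_imp_weak_deriv[OF primitive_mean_zero_primitive[OF assms(1)]])
    show "torus_integral (mean_zero_primitive (mean_zero_primitive f)) = 0" by (rule mean_zero_primitive_mean_zero[OF c])
  qed simp
qed

text \<open>
The corrector is the twice iterated antiderivative of \<open>q X\<close>, and its derivative in \<open>y\<close> is the first one.
\<close>
lemma V0_eq:
  assumes "locally_integrable (q X)" "periodic1 (q X)" "torus_integral (q X) = 0"
  shows "V0 q X = - torus_integral (\<lambda>y. mean_zero_primitive (q X) y * mean_zero_primitive (q X) y)"
proof -
  have "corrector q X = mean_zero_primitive (mean_zero_primitive (q X))"
    unfolding corrector_def using cell_solution_mean_zero_primitive[OF assms] cell_solution_unique by (intro the_equality) auto
  moreover have "deriv (mean_zero_primitive (mean_zero_primitive (q X))) y = mean_zero_primitive (q X) y" for y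
    by (rule DERIV_imp_deriv, rule primitive_of_continuous_has_derivative[OF primitive_mean_zero_primitive[OF
          continuous_locally_integrable[OF mean_zero_primitive_continuous[OF assms(1)]]] mean_zero_primitive_continuous[OF assms(1)]])
  ultimately show ?thesis by (simp add: V0_def power2_eq_square)
qed

section \<open>Comparison of the oscillating form with the effective form\<close>

text \<open>
The chain rule for the composition with a function that has a quadratic Taylor remainder on a set
containing the range of \<open>u\<close>, by comparison of increments.
\<close>
lemma primitive_compose:
  assumes u: "primitive u g" and g: "AE x in lborel. \<bar>g x\<bar> \<le> G" and S: "\<And>x. u x \<in> S"
    and \<phi>: "\<And>x x'. x \<in> S \<Longrightarrow> x' \<in> S \<Longrightarrow> \<bar>\<phi> x' - \<phi> x - (x' - x) * \<phi>' x\<bar> \<le> C * (x' - x)\<^sup>2"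
    and \<phi>': "\<And>x x'. x \<in> S \<Longrightarrow> x' \<in> S \<Longrightarrow> \<bar>\<phi>' x' - \<phi>' x\<bar> \<le> C * \<bar>x' - x\<bar>"
    and c: "continuous_on UNIV (\<lambda>t. \<phi>' (u t))" and C: "0 \<le> C"
  shows "primitive (\<lambda>t. \<phi> (u t)) (\<lambda>t. \<phi>' (u t) * g t)"
proof -
  have gl: "locally_integrable g" by (rule primitive_locally_integrable[OF u])
  have G0: "0 \<le> G" using abs_torus_integral_le[OF gl g] by linarith
  have li: "locally_integrable (\<lambda>t. \<phi>' (u t) * g t)" by (rule locally_integrable_continuous_mult(1)[OF gl c])
  have lip: "\<bar>u b - u a\<bar> \<le> G * \<bar>b - a\<bar>" for a b by (rule primitive_lipschitz[OF u g])
  define D where "D t = \<phi> (u t) - primitive0 (\<lambda>t. \<phi>' (u t) * g t) t" for t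
  have "\<bar>D b - D a\<bar> \<le> (2 * C * G\<^sup>2) * (b - a)\<^sup>2" if ab: "a \<le> b" for a b
  proof -
    have cl: "locally_integrable (\<lambda>t. \<phi>' (u a) * g t)" by (rule locally_integrable_add(3)[OF gl])
    have "(u b - u a) * \<phi>' (u a) = (LINT t:{a..b}|lborel. \<phi>' (u a) * g t)"
      using primitiveD[OF u ab] by simp
    moreover have "primitive0 (\<lambda>t. \<phi>' (u t) * g t) b - primitive0 (\<lambda>t. \<phi>' (u t) * g t) a = (LINT t:{a..b}|lborel. \<phi>' (u t) * g t)"
      by (rule primitiveD[OF primitive_primitive0[OF li] ab])
    moreover have "(LINT t:{a..b}|lborel. \<phi>' (u a) * g t - \<phi>' (u t) * g t)
        = (LINT t:{a..b}|lborel. \<phi>' (u a) * g t) - (LINT t:{a..b}|lborel. \<phi>' (u t) * g t)"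
      by (rule set_integral_diff(2)[OF locally_integrableD[OF cl] locally_integrableD[OF li]])
    ultimately have eq: "D b - D a = (\<phi> (u b) - \<phi> (u a) - (u b - u a) * \<phi>' (u a))
        + (LINT t:{a..b}|lborel. \<phi>' (u a) * g t - \<phi>' (u t) * g t)"
      unfolding D_def by linarith
    have "\<bar>\<phi> (u b) - \<phi> (u a) - (u b - u a) * \<phi>' (u a)\<bar> \<le> C * (u b - u a)\<^sup>2" by (rule \<phi>[OF S S])
    also have "(u b - u a)\<^sup>2 \<le> (G * (b - a))\<^sup>2"
      using lip[of b a] ab G0 by (intro power2_le_iff_abs_le[THEN iffD2]) auto
    finally have 1: "\<bar>\<phi> (u b) - \<phi> (u a) - (u b - u a) * \<phi>' (u a)\<bar> \<le> C * (G * (b - a))\<^sup>2"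
      using C by (simp add: mult_left_mono)
    define dd where "dd t = indicator {a..b} t * (\<phi>' (u a) * g t - \<phi>' (u t) * g t)" for t
    have "locally_integrable (\<lambda>t. \<phi>' (u a) * g t - \<phi>' (u t) * g t)" by (rule locally_integrable_add(2)[OF cl li])
    from locally_integrableD[OF this, of a b] have "integrable lborel dd" by (simp add: set_integrable_def dd_def[abs_def])
    then have ddl: "locally_integrable dd" by (rule integrable_locally_integrable)
    have ddb: "AE t in lborel. \<bar>dd t\<bar> \<le> C * (G * (b - a)) * G"
      using g
    proof eventually_elim
      case (elim t)
      show ?case
      proof (cases "t \<in> {a..b}")
        case True
        have "\<bar>\<phi>' (u a) - \<phi>' (u t)\<bar> \<le> C * \<bar>u a - u t\<bar>" by (rule \<phi>'[OF S S])
        also have "\<dots> \<le> C * (G * (b - a))"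
        proof (intro mult_left_mono C)
          have "G * \<bar>a - t\<bar> \<le> G * (b - a)" using True G0 by (intro mult_left_mono) auto
          then show "\<bar>u a - u t\<bar> \<le> G * (b - a)" using lip[of a t] by linarith
        qed
        finally have "\<bar>\<phi>' (u a) - \<phi>' (u t)\<bar> * \<bar>g t\<bar> \<le> C * (G * (b - a)) * G"
          using elim C G0 ab by (intro mult_mono) auto
        then show ?thesis using True by (simp add: dd_def left_diff_distrib[symmetric] abs_mult)
      qed (use C G0 ab in \<open>simp add: dd_def\<close>)
    qed
    have "(LINT t:{a..b}|lborel. dd t) = (LINT t:{a..b}|lborel. \<phi>' (u a) * g t - \<phi>' (u t) * g t)"
      by (rule set_lebesgue_integral_cong) (auto simp: dd_def)
    then have "\<bar>LINT t:{a..b}|lborel. \<phi>' (u a) * g t - \<phi>' (u t) * g t\<bar> \<le> C * (G * (b - a)) * G * (b - a)"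
      using abs_interval_integral_le[OF ddl ddb ab] by simp
    then have "\<bar>D b - D a\<bar> \<le> C * (G * (b - a))\<^sup>2 + C * (G * (b - a)) * G * (b - a)" using eq 1 by linarith
    also have "\<dots> = (2 * C * G\<^sup>2) * (b - a)\<^sup>2"
      unfolding power_mult_distrib by (simp add: power2_eq_square)
    finally show ?thesis .
  qed
  then have D: "D x = D y" for x y by (rule constant_of_quadratic_increments)
  show ?thesis
    unfolding primitive_def
  proof (intro conjI allI impI li)
    fix a b :: real assume "a \<le> b"
    then have "primitive0 (\<lambda>t. \<phi>' (u t) * g t) b - primitive0 (\<lambda>t. \<phi>' (u t) * g t) a = (LINT t:{a..b}|lborel. \<phi>' (u t) * g t)"
      by (rule primitiveD[OF primitive_primitive0[OF li]])
    then show "\<phi> (u b) - \<phi> (u a) = (LINT t:{a..b}|lborel. \<phi>' (u t) * g t)" using D[of b a] by (simp add: D_def)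
  qed
qed

text \<open>
The case needed to invert the multiplier \<open>m\<close>, whose values lie between \<open>1 / 2\<close> and \<open>2\<close>.
\<close>
lemma inverse_taylor_bounds:
  fixes x x' :: real
  assumes x: "1 / 2 \<le> x" "x \<le> 2" and x': "1 / 2 \<le> x'" "x' \<le> 2"
  shows "\<bar>1 / x' - 1 / x - (x' - x) * (- (1 / (x * x)))\<bar> \<le> 64 * (x' - x)\<^sup>2"
    and "\<bar>- (1 / (x' * x')) - (- (1 / (x * x)))\<bar> \<le> 64 * \<bar>x' - x\<bar>"
proof -
  have i: "1 / x \<le> 2" "1 / x' \<le> 2" "0 \<le> 1 / x" "0 \<le> 1 / x'" using x x' by (simp_all add: field_simps)
  have "1 / x' - 1 / x - (x' - x) * (- (1 / (x * x))) = (1 / x') * ((1 / x) * (1 / x)) * (x' - x)\<^sup>2"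
    using x x' by (simp add: field_simps power2_eq_square)
  moreover have "(1 / x') * ((1 / x) * (1 / x)) \<le> 2 * (2 * 2)" using i by (intro mult_mono) auto
  ultimately show "\<bar>1 / x' - 1 / x - (x' - x) * (- (1 / (x * x)))\<bar> \<le> 64 * (x' - x)\<^sup>2"
    using i x x' by (simp only: abs_mult abs_of_nonneg[OF zero_le_power2]) (intro mult_right_mono, auto simp: abs_of_nonneg)
  have "- (1 / (x' * x')) - (- (1 / (x * x))) = ((1 / x) * (1 / x)) * ((1 / x') * (1 / x')) * (x + x') * (x' - x)"
    using x x' by (simp add: field_simps)
  moreover have "((1 / x) * (1 / x)) * ((1 / x') * (1 / x')) * (x + x') \<le> (2 * 2) * (2 * 2) * 4"
    using i x x' by (intro mult_mono) auto
  moreover have "0 \<le> ((1 / x) * (1 / x)) * ((1 / x') * (1 / x')) * (x + x')" using i x x' by simp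
  ultimately show "\<bar>- (1 / (x' * x')) - (- (1 / (x * x)))\<bar> \<le> 64 * \<bar>x' - x\<bar>"
    by (simp only: abs_mult) (intro mult_right_mono, auto)
qed

lemma sq_int_bdd_mult:
  "h \<in> borel_measurable borel \<Longrightarrow> (\<And>x. \<bar>h x\<bar> \<le> B) \<Longrightarrow> sq_int f \<Longrightarrow> sq_int (\<lambda>x. h x * f x)"
  by (rule sq_int_bounded_mult[of _ _ B]) auto

lemma mult_in_h1:
  assumes m: "primitive m s" and bm: "\<And>x. \<bar>m x\<bar> \<le> B" and s: "s \<in> borel_measurable borel" "\<And>x. \<bar>s x\<bar> \<le> B"
  shows "\<exists>w. fn w = (\<lambda>x. m x * fn v x) \<and> (AE x in lborel. dx w x = s x * fn v x + m x * dx v x)"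
proof -
  have mm: "m \<in> borel_measurable borel" by (rule borel_measurable_continuous_onI[OF primitive_continuous[OF m]])
  have p: "primitive (\<lambda>x. m x * fn v x) (\<lambda>x. s x * fn v x + m x * dx v x)" by (rule primitive_mult[OF m dx(2)])
  have "fn (Abs_h1 (\<lambda>x. m x * fn v x)) = (\<lambda>x. m x * fn v x)"
    by (rule fn_Abs_h1[OF sq_int_bdd_mult[OF mm bm sq_int_fn] _ p])
      (intro sq_int_add sq_int_bdd_mult[OF s sq_int_fn] sq_int_bdd_mult[OF mm bm dx(1)])
  moreover from this have "AE x in lborel. dx (Abs_h1 (\<lambda>x. m x * fn v x)) x = s x * fn v x + m x * dx v x"
    using p by (intro dx_unique) simp
  ultimately show ?thesis by blast
qed

text \<open>
Functions of \<open>X\<close> obtained by restriction to the curve \<open>y = X / \<delta>\<close>: \<open>qd\<close> is the potential \<open>q\<close>, \<open>Q\<close> the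
corrector, \<open>p = \<partial>\<^sub>y Q\<close>, and \<open>Z\<close> the antiderivative in \<open>y\<close> of \<open>\<partial>\<^sub>X p + p\<^sup>2 + V\<close>. A final \<open>1\<close>
denotes the restriction of the derivative in \<open>X\<close>. The three assumptions on primitives are the chain rule.
\<close>
locale two_scale =
  fixes \<delta> C :: real and qd V Q Q1 p p1 Z Z1 :: "real \<Rightarrow> real"
  assumes \<delta>: "0 < \<delta>" "\<delta> \<le> 1" "\<delta> * C \<le> 1 / 2" and C: "1 \<le> C"
    and meas [measurable]: "qd \<in> borel_measurable borel" "V \<in> borel_measurable borel" "Q1 \<in> borel_measurable borel"
      "p1 \<in> borel_measurable borel" "Z1 \<in> borel_measurable borel"
    and bounds: "\<And>x. \<bar>V x\<bar> \<le> C" "\<And>x. \<bar>Q x\<bar> \<le> C" "\<And>x. \<bar>Q1 x\<bar> \<le> C" "\<And>x. \<bar>p x\<bar> \<le> C" "\<And>x. \<bar>p1 x\<bar> \<le> C"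
      "\<And>x. \<bar>Z x\<bar> \<le> C" "\<And>x. \<bar>Z1 x\<bar> \<le> C"
    and qd: "AE x in lborel. \<bar>qd x\<bar> \<le> C"
    and pQ: "primitive Q (\<lambda>t. Q1 t + 1 / \<delta> * p t)"
    and pp: "primitive p (\<lambda>t. p1 t + 1 / \<delta> * qd t)"
    and pZ: "primitive Z (\<lambda>t. Z1 t + 1 / \<delta> * (p1 t + p t * p t + V t))"
begin

lemma QpZ_measurable [measurable]: "Q \<in> borel_measurable borel" "p \<in> borel_measurable borel" "Z \<in> borel_measurable borel"
  using pQ pp pZ by (auto intro: borel_measurable_continuous_onI primitive_continuous)

text \<open>
\<open>W\<close> is the potential of the rescaled operator, \<open>m\<close> the multiplier, and \<open>s\<close> its derivative.
\<close>
definition W :: "real \<Rightarrow> real" where "W t = 1 / \<delta> * qd t"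

definition m :: "real \<Rightarrow> real" where "m t = 1 + \<delta> * Q t"

definition s :: "real \<Rightarrow> real" where "s t = p t + \<delta> * Q1 t"

lemma mult_bound: "\<bar>a\<bar> \<le> A \<Longrightarrow> \<bar>b\<bar> \<le> B \<Longrightarrow> \<bar>a * b :: real\<bar> \<le> A * B"
  unfolding abs_mult by (intro mult_mono) auto

lemma \<delta>Q_bound: "\<bar>\<delta> * Q t\<bar> \<le> 1 / 2" "\<bar>\<delta> * Q t\<bar> \<le> C * \<delta>" "\<bar>\<delta> * Q1 t\<bar> \<le> C * \<delta>" "\<bar>\<delta> * Q1 t\<bar> \<le> C"
proof -
  have "\<bar>\<delta> * Q t\<bar> \<le> \<delta> * C" "\<bar>\<delta> * Q1 t\<bar> \<le> \<delta> * C"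
    using bounds(2,3)[of t] \<delta>(1) by (intro mult_bound; simp)+
  moreover have "\<delta> * C \<le> 1 * C" using \<delta> C by (intro mult_right_mono) auto
  ultimately show "\<bar>\<delta> * Q t\<bar> \<le> 1 / 2" "\<bar>\<delta> * Q t\<bar> \<le> C * \<delta>" "\<bar>\<delta> * Q1 t\<bar> \<le> C * \<delta>" "\<bar>\<delta> * Q1 t\<bar> \<le> C"
    using \<delta>(3) by (simp_all add: mult.commute)
qed

lemma m_bounds: "1 / 2 \<le> m t" "m t \<le> 2" "\<bar>m t\<bar> \<le> 2" "\<bar>m t - 1\<bar> \<le> C * \<delta>"
  using \<delta>Q_bound(1,2)[of t] by (auto simp: m_def)

lemma s_bounds: "\<bar>s t\<bar> \<le> 2 * C"
  using \<delta>Q_bound(4)[of t] bounds(4)[of t] by (simp add: s_def)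

lemma ms_measurable [measurable]: "m \<in> borel_measurable borel" "s \<in> borel_measurable borel" "W \<in> borel_measurable borel"
  unfolding m_def s_def W_def by measurable

lemma primitive_m: "primitive m s"
proof -
  have "primitive (\<lambda>t. 1 + \<delta> * Q t) (\<lambda>t. 0 + \<delta> * (Q1 t + 1 / \<delta> * p t))"
    by (intro primitive_add primitive_const primitive_cmult pQ)
  moreover have "(\<lambda>t. 0 + \<delta> * (Q1 t + 1 / \<delta> * p t)) = s" using \<delta>(1) by (auto simp: s_def field_simps)
  moreover have "(\<lambda>t. 1 + \<delta> * Q t) = m" by (auto simp: m_def)
  ultimately show ?thesis by simp
qed

lemma primitive_inverse_m: "primitive (\<lambda>t. 1 / m t) (\<lambda>t. - (1 / (m t * m t)) * s t)"
proof (rule primitive_compose[where \<phi> = "\<lambda>x. 1 / x" and \<phi>' = "\<lambda>x. - (1 / (x * x))" and S = "{1 / 2..2}" and C = 64, OF primitive_m])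
  show "AE x in lborel. \<bar>s x\<bar> \<le> 2 * C" using s_bounds by simp
  have "m t \<noteq> 0" for t using m_bounds(1)[of t] by linarith
  then show "continuous_on UNIV (\<lambda>t. - (1 / (m t * m t)))"
    by (intro continuous_intros primitive_continuous[OF primitive_m]) auto
  show "\<bar>1 / x' - 1 / x - (x' - x) * - (1 / (x * x))\<bar> \<le> 64 * (x' - x)\<^sup>2"
    if "x \<in> {1 / 2..2}" "x' \<in> {1 / 2..2}" for x x' :: real using inverse_taylor_bounds(1)[of x x'] that by simp
  show "\<bar>- (1 / (x' * x')) - - (1 / (x * x))\<bar> \<le> 64 * \<bar>x' - x\<bar>"
    if "x \<in> {1 / 2..2}" "x' \<in> {1 / 2..2}" for x x' :: real using inverse_taylor_bounds(2)[of x x'] that by simp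
qed (use m_bounds in auto)

text \<open>
The substitution \<open>v \<mapsto> m v\<close>, an automorphism of \<open>H\<^sup>1\<close>.
\<close>
definition M :: "h1 \<Rightarrow> h1" where "M v = Abs_h1 (\<lambda>t. m t * fn v t)"

lemma M: "fn (M v) = (\<lambda>t. m t * fn v t)" "AE t in lborel. dx (M v) t = s t * fn v t + m t * dx v t"
proof -
  have "\<bar>m t\<bar> \<le> 2 * C" for t using m_bounds(3)[of t] C by linarith
  from mult_in_h1[OF primitive_m this ms_measurable(2) s_bounds]
  obtain w where w: "fn w = (\<lambda>t. m t * fn v t)" "AE t in lborel. dx w t = s t * fn v t + m t * dx v t" by blast
  then have "M v = w" unfolding M_def by (metis fn_inverse)
  then show "fn (M v) = (\<lambda>t. m t * fn v t)" "AE t in lborel. dx (M v) t = s t * fn v t + m t * dx v t" using w by auto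
qed

lemma M_add: "M (u + v) = M u + M v" and M_scaleR: "M (c *\<^sub>R v) = c *\<^sub>R M v"
  by (rule h1_eqI; simp add: M(1) fn_simps algebra_simps)+

lemma M_eq_0: "M v = 0 \<Longrightarrow> v = 0"
proof (rule h1_eqI)
  fix x assume "M v = 0"
  then have "m x * fn v x = 0" using M(1)[of v] by (metis fn_zero)
  then show "fn v x = fn 0 x" using m_bounds(1)[of x] by (simp add: fn_zero)
qed

lemma M_surj: "\<exists>v. M v = u"
proof -
  have im: "\<bar>1 / m t\<bar> \<le> 8 * C" for t
  proof -
    have "\<bar>1 / m t\<bar> \<le> 2" using m_bounds(1)[of t] by (simp add: field_simps)
    then show ?thesis using C by linarith
  qed
  have "\<bar>- (1 / (m t * m t)) * s t\<bar> \<le> 8 * C" for t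
  proof -
    have "\<bar>1 / m t\<bar> \<le> 2" using m_bounds(1)[of t] by (simp add: field_simps)
    from mult_bound[OF mult_bound[OF this this] s_bounds[of t]] show ?thesis by simp
  qed
  from mult_in_h1[OF primitive_inverse_m im _ this, of u]
  obtain v where v: "fn v = (\<lambda>t. 1 / m t * fn u t)" by auto
  have "m t \<noteq> 0" for t using m_bounds(1)[of t] by linarith
  then have "M v = u" by (intro h1_eqI) (simp add: M(1) v)
  then show ?thesis ..
qed

lemma W_L_infty: "L_infty W"
proof -
  have "AE x in lborel. \<bar>W x\<bar> \<le> 1 / \<delta> * C"
    using qd
  proof eventually_elim
    case (elim x)
    then have "1 / \<delta> * \<bar>qd x\<bar> \<le> 1 / \<delta> * C" using \<delta>(1) by (intro mult_left_mono) auto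
    then show ?case using \<delta>(1) by (simp add: W_def abs_mult)
  qed
  then show ?thesis using ms_measurable(3) by (auto simp: L_infty_def)
qed

lemma V_L_infty: "L_infty V"
  unfolding L_infty_def using meas(2) bounds(1) by (auto intro!: exI[of _ C])

text \<open>
\<open>A\<close>, \<open>B\<close> and \<open>E\<close> are the coefficients of \<open>v' w'\<close>, of \<open>(v w)'\<close> and of \<open>v w\<close> in the difference of the two
forms after both integrations by parts. In \<open>E\<close>, the term \<open>p t * p t\<close> and the correction by \<open>1\<close> in
the last factor of \<open>p1\<close> come from subtracting the mean-zero function \<open>p1 + p\<^sup>2 + V\<close>.
\<close>
definition A :: "real \<Rightarrow> real" where "A t = m t * m t - 1"

definition B :: "real \<Rightarrow> real" where "B t = m t * (s t - p t * m t) + \<delta> * Z t"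

definition E :: "real \<Rightarrow> real" where
  "E t = s t * s t - 2 * (p t * (m t * s t)) + p t * p t - p1 t * (m t * m t - 1) + \<delta> * Z1 t"

text \<open>
All three vanish to first order in \<open>\<delta>\<close>: \<open>s = p + \<delta> * Q1\<close> and \<open>m = 1 + \<delta> * Q\<close> give
\<open>s - p * m = O(\<delta>)\<close>, and \<open>s\<^sup>2 - 2 * p * m * s + p\<^sup>2 = (\<delta> * Q1)\<^sup>2 - 2 * p * s * \<delta> * Q\<close>.
\<close>
lemma coefficient_bounds: "\<bar>A t\<bar> \<le> 12 * C ^ 3 * \<delta>" "\<bar>B t\<bar> \<le> 12 * C ^ 3 * \<delta>" "\<bar>E t\<bar> \<le> 12 * C ^ 3 * \<delta>"
proof -
  have pw: "C \<le> C ^ 3" "C * C \<le> C ^ 3" "C * C * C = C ^ 3"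
  proof -
    show "C \<le> C ^ 3" using power_increasing[of 1 3 C] C by simp
    show "C * C \<le> C ^ 3" using power_increasing[of 2 3 C] C by (simp add: power2_eq_square)
    show "C * C * C = C ^ 3" by (simp add: power3_eq_cube)
  qed
  have c: "C * \<delta> \<le> C ^ 3 * \<delta>" "C * C * \<delta> \<le> C ^ 3 * \<delta>" using pw \<delta>(1) by (simp_all add: mult_right_mono)
  have c3: "C * C * C * \<delta> = C ^ 3 * \<delta>" using pw(3) by simp
  have nn: "0 \<le> C ^ 3 * \<delta>" using C \<delta>(1) by simp
  have m1: "\<bar>m t * m t - 1\<bar> \<le> 3 * (C * \<delta>)"
  proof -
    have "m t * m t - 1 = (m t + 1) * (m t - 1)" by (simp add: algebra_simps)
    moreover have "\<bar>m t + 1\<bar> \<le> 3" using m_bounds(3)[of t] by linarith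
    ultimately show ?thesis using mult_bound[of "m t + 1" 3 "m t - 1" "C * \<delta>"] m_bounds(4)[of t] by simp
  qed
  then show "\<bar>A t\<bar> \<le> 12 * C ^ 3 * \<delta>" unfolding A_def using c nn by linarith
  have \<delta>Z: "\<bar>\<delta> * Z t\<bar> \<le> C * \<delta>" "\<bar>\<delta> * Z1 t\<bar> \<le> C * \<delta>"
    using mult_bound[of \<delta> \<delta> "Z t" C] mult_bound[of \<delta> \<delta> "Z1 t" C] bounds(6,7)[of t] \<delta>(1) by (simp_all add: mult.commute)
  have "s t - p t * m t = \<delta> * Q1 t - p t * (\<delta> * Q t)" by (simp add: s_def m_def algebra_simps)
  then have "\<bar>s t - p t * m t\<bar> \<le> C * \<delta> + C * (C * \<delta>)"
    using \<delta>Q_bound(3)[of t] mult_bound[OF bounds(4)[of t] \<delta>Q_bound(2)[of t]] by linarith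
  from mult_bound[OF m_bounds(3)[of t] this]
  show "\<bar>B t\<bar> \<le> 12 * C ^ 3 * \<delta>" unfolding B_def using \<delta>Z c nn by (simp add: mult.assoc)
  have e: "E t = (\<delta> * Q1 t) * (\<delta> * Q1 t) - 2 * (p t * s t * (\<delta> * Q t)) - p1 t * (m t * m t - 1) + \<delta> * Z1 t"
    by (simp add: E_def s_def m_def algebra_simps)
  have 1: "\<bar>(\<delta> * Q1 t) * (\<delta> * Q1 t)\<bar> \<le> C * (C * \<delta>)" by (rule mult_bound[OF \<delta>Q_bound(4) \<delta>Q_bound(3)])
  have 2: "\<bar>p t * s t * (\<delta> * Q t)\<bar> \<le> C * (2 * C) * (C * \<delta>)"
    by (rule mult_bound[OF mult_bound[OF bounds(4) s_bounds] \<delta>Q_bound(2)])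
  have 3: "\<bar>p1 t * (m t * m t - 1)\<bar> \<le> C * (3 * (C * \<delta>))" by (rule mult_bound[OF bounds(5) m1])
  have "\<bar>E t\<bar> \<le> C * (C * \<delta>) + 2 * (C * (2 * C) * (C * \<delta>)) + C * (3 * (C * \<delta>)) + C * \<delta>"
    unfolding e using 1 2 3 \<delta>Z by linarith
  also have "\<dots> = 4 * (C * C * \<delta>) + 4 * (C * C * C * \<delta>) + C * \<delta>" by (simp add: algebra_simps)
  also have "\<dots> \<le> 12 * C ^ 3 * \<delta>" unfolding c3 using c nn by linarith
  finally show "\<bar>E t\<bar> \<le> 12 * C ^ 3 * \<delta>" .
qed

lemma ABE_measurable [measurable]: "A \<in> borel_measurable borel" "B \<in> borel_measurable borel" "E \<in> borel_measurable borel"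
  unfolding A_def B_def E_def by measurable

text \<open>
The total derivatives \<open>R1\<close> of \<open>p * m\<^sup>2 * v * w\<close> and \<open>R2\<close> of \<open>Z * v * w\<close> have integral zero. Subtracting
\<open>R1\<close> removes the potential \<open>W\<close>, and adding \<open>\<delta> * R2\<close> removes the oscillating part of \<open>- (p1 + p\<^sup>2)\<close>;
what is left is an identity of integrands.
\<close>
lemma energy_form_difference:
  "energy_form W (M v) (M w) - energy_form V v w = (LINT t|lborel. A t * (dx v t * dx w t))
     + ((LINT t|lborel. B t * (dx v t * fn w t)) + (LINT t|lborel. B t * (fn v t * dx w t)))
     + (LINT t|lborel. E t * (fn v t * fn w t))"
proof -
  define k where "k t = fn v t * fn w t" for t
  define k' where "k' t = dx v t * fn w t + fn v t * dx w t" for t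
  have pk: "primitive k k'" unfolding k_def k'_def by (rule primitive_mult[OF dx(2) dx(2)])
  have int: "integrable lborel (\<lambda>t. h t * (f t * g t))"
    if "sq_int f" "sq_int g" "h \<in> borel_measurable borel" "\<And>t. \<bar>h t\<bar> \<le> K" for f g h K
    by (rule sq_int_triple_integrable[OF that(1-3)]) (use that(4) in auto)
  have intk: "integrable lborel (\<lambda>t. h t * k t)" "integrable lborel (\<lambda>t. h t * k' t)" "integrable lborel (\<lambda>t. h t * (dx v t * dx w t))"
    if "h \<in> borel_measurable borel" "\<And>t. \<bar>h t\<bar> \<le> K" for h K
    unfolding k_def k'_def distrib_left
    by (intro Bochner_Integration.integrable_add int[OF _ _ that] sq_int_fn dx(1))+
  have intW: "integrable lborel (\<lambda>t. W t * (h t * k t))" if "h \<in> borel_measurable borel" "\<And>t. \<bar>h t\<bar> \<le> K" for h K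
  proof -
    have "integrable lborel (\<lambda>t. W t * ((h t * fn v t) * fn w t))"
      using W_L_infty by (elim L_inftyE, intro sq_int_triple_integrable sq_int_bdd_mult[OF that] sq_int_fn)
    then show ?thesis by (simp add: k_def mult.assoc)
  qed
  have mm: "\<bar>m t * m t\<bar> \<le> 4" for t using mult_bound[OF m_bounds(3)[of t] m_bounds(3)[of t]] by simp
  define R1 where "R1 t = (p1 t + 1 / \<delta> * qd t) * ((m t * m t) * k t) + p t * ((s t * m t + m t * s t) * k t + (m t * m t) * k' t)" for t
  have pR1: "primitive (\<lambda>t. p t * ((m t * m t) * k t)) R1"
    unfolding R1_def by (intro primitive_mult pp primitive_m pk)
  have R1e: "R1 = (\<lambda>t. W t * ((m t * m t) * k t) + (p1 t * (m t * m t) + p t * (s t * m t + m t * s t)) * k t + (p t * (m t * m t)) * k' t)"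
    by (auto simp: R1_def W_def algebra_simps)
  have b1: "\<bar>p1 t * (m t * m t) + p t * (s t * m t + m t * s t)\<bar> \<le> C * 4 + C * (2 * C * 2 + 2 * (2 * C))" for t
    by (intro order_trans[OF abs_triangle_ineq] add_mono mult_bound bounds mm s_bounds m_bounds)
  have b2: "\<bar>p t * (m t * m t)\<bar> \<le> C * 4" for t by (intro mult_bound bounds mm)
  have iR1: "integrable lborel R1"
    unfolding R1e by (intro Bochner_Integration.integrable_add intW[of _ 4] intk[OF _ b1] intk[OF _ b2] mm) measurable
  have "integrable lborel (\<lambda>t. p t * (m t * m t) * k t)" by (rule intk(1)[OF _ b2]) measurable
  then have iP: "integrable lborel (\<lambda>t. p t * ((m t * m t) * k t))" by (simp add: mult.assoc)
  have R1z: "(LINT t|lborel. R1 t) = 0" by (rule integrable_primitive(1)[OF pR1 iP iR1])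
  define R2 where "R2 t = (Z1 t + 1 / \<delta> * (p1 t + p t * p t + V t)) * k t + Z t * k' t" for t
  have pR2: "primitive (\<lambda>t. Z t * k t) R2" unfolding R2_def by (intro primitive_mult pZ pk)
  have b3: "\<bar>Z1 t + 1 / \<delta> * (p1 t + p t * p t + V t)\<bar> \<le> C + 1 / \<delta> * (C + C * C + C)" for t
    by (intro order_trans[OF abs_triangle_ineq] add_mono mult_bound bounds) (use \<delta>(1) in simp)
  have iR2: "integrable lborel R2"
    unfolding R2_def by (intro Bochner_Integration.integrable_add intk[OF _ b3] intk[OF _ bounds(6)]) measurable
  have R2z: "(LINT t|lborel. R2 t) = 0"
    by (rule integrable_primitive(1)[OF pR2 intk(1)[OF _ bounds(6)] iR2]) measurable
  have bA: "\<And>t. \<bar>A t\<bar> \<le> 12 * C ^ 3 * \<delta>" and bB: "\<And>t. \<bar>B t\<bar> \<le> 12 * C ^ 3 * \<delta>" and bE: "\<And>t. \<bar>E t\<bar> \<le> 12 * C ^ 3 * \<delta>"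
    by (rule coefficient_bounds)+
  have i1: "integrable lborel (\<lambda>t. dx (M v) t * dx (M w) t)" "integrable lborel (\<lambda>t. dx v t * dx w t)" by (rule fn_dx_integrable)+
  have i2: "integrable lborel (\<lambda>t. W t * (fn (M v) t * fn (M w) t))" by (rule L_infty_integrable[OF W_L_infty])
  have i3: "integrable lborel (\<lambda>t. V t * (fn v t * fn w t))" by (rule L_infty_integrable[OF V_L_infty])
  have "energy_form W (M v) (M w) - energy_form V v w
      = (LINT t|lborel. dx (M v) t * dx (M w) t + W t * (fn (M v) t * fn (M w) t)
          - (dx v t * dx w t + V t * (fn v t * fn w t)) - R1 t + \<delta> * R2 t)"
    using i1 i2 i3 iR1 iR2 R1z R2z by (simp add: energy_form_def)
  also have "\<dots> = (LINT t|lborel. A t * (dx v t * dx w t) + (B t * (dx v t * fn w t) + B t * (fn v t * dx w t)) + E t * (fn v t * fn w t))"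
  proof (rule integral_cong_AE)
    show "(\<lambda>t. dx (M v) t * dx (M w) t + W t * (fn (M v) t * fn (M w) t)
          - (dx v t * dx w t + V t * (fn v t * fn w t)) - R1 t + \<delta> * R2 t) \<in> borel_measurable lborel"
      using borel_measurable_integrable[OF iR1] borel_measurable_integrable[OF iR2] by simp
    show "AE t in lborel. dx (M v) t * dx (M w) t + W t * (fn (M v) t * fn (M w) t)
          - (dx v t * dx w t + V t * (fn v t * fn w t)) - R1 t + \<delta> * R2 t
        = A t * (dx v t * dx w t) + (B t * (dx v t * fn w t) + B t * (fn v t * dx w t)) + E t * (fn v t * fn w t)"
      using M(2)[of v] M(2)[of w]
    proof eventually_elim
      case (elim t)
      have R2e: "\<delta> * R2 t = \<delta> * Z1 t * k t + (p1 t + p t * p t + V t) * k t + \<delta> * Z t * k' t"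
        using \<delta>(1) by (simp add: R2_def field_simps)
      show ?case
        unfolding elim M(1) R2e R1e k_def k'_def A_def B_def E_def by (simp add: algebra_simps)
    qed
  qed measurable
  also have "\<dots> = (LINT t|lborel. A t * (dx v t * dx w t))
     + ((LINT t|lborel. B t * (dx v t * fn w t)) + (LINT t|lborel. B t * (fn v t * dx w t)))
     + (LINT t|lborel. E t * (fn v t * fn w t))"
    using int[OF dx(1) dx(1) ABE_measurable(1) bA] int[OF dx(1) sq_int_fn ABE_measurable(2) bB]
      int[OF sq_int_fn dx(1) ABE_measurable(2) bB] int[OF sq_int_fn sq_int_fn ABE_measurable(3) bE] by simp
  finally show ?thesis .
qed

text \<open>
The factor \<open>48\<close> collects four integrals, each with a coefficient bounded by \<open>12 * C ^ 3 * \<delta>\<close>.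
\<close>
lemma form_comparison:
  "\<bar>energy_form W (M v) (M w) - energy_form V v w\<bar> \<le> 48 * C ^ 3 * \<delta> * norm v * norm w"
  "\<bar>L2_form (M v) (M w) - L2_form v w\<bar> \<le> 48 * C ^ 3 * \<delta> * norm v * norm w"
proof -
  define K where "K = 12 * C ^ 3 * \<delta>"
  have K: "0 \<le> K" using C \<delta>(1) by (simp add: K_def)
  have Knn: "0 \<le> K * norm v * norm w" using K by simp
  have bd: "\<bar>LINT t|lborel. h t * (f t * g t)\<bar> \<le> K * norm v * norm w"
    if "sq_int f" "sq_int g" "h \<in> borel_measurable borel" "\<And>t. \<bar>h t\<bar> \<le> K"
      "(LINT x|lborel. (f x)\<^sup>2) \<le> (norm v)\<^sup>2" "(LINT x|lborel. (g x)\<^sup>2) \<le> (norm w)\<^sup>2" for f g h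
    by (rule abs_integral_triple_le[OF that(1-3) _ that(5) norm_ge_zero that(6) norm_ge_zero K]) (use that(4) in auto)
  note cb = coefficient_bounds[folded K_def]
  show "\<bar>energy_form W (M v) (M w) - energy_form V v w\<bar> \<le> 48 * C ^ 3 * \<delta> * norm v * norm w"
    unfolding energy_form_difference
    using bd[OF dx(1) dx(1) ABE_measurable(1) cb(1) L2_le_norm(2) L2_le_norm(2)]
      bd[OF dx(1) sq_int_fn ABE_measurable(2) cb(2) L2_le_norm(2) L2_le_norm(1)]
      bd[OF sq_int_fn dx(1) ABE_measurable(2) cb(2) L2_le_norm(1) L2_le_norm(2)]
      bd[OF sq_int_fn sq_int_fn ABE_measurable(3) cb(3) L2_le_norm(1) L2_le_norm(1)]
    by (simp add: K_def)
  have i: "integrable lborel (\<lambda>t. A t * (fn v t * fn w t))"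
    by (rule sq_int_triple_integrable[OF sq_int_fn sq_int_fn ABE_measurable(1), of K]) (use cb(1) in auto)
  have "L2_form (M v) (M w) - L2_form v w = (LINT t|lborel. A t * (fn v t * fn w t))"
  proof -
    have "L2_form (M v) (M w) = (LINT t|lborel. A t * (fn v t * fn w t) + fn v t * fn w t)"
      unfolding L2_form_def M(1) by (intro Bochner_Integration.integral_cong) (auto simp: A_def algebra_simps)
    then show ?thesis using i fn_dx_integrable(1) by (simp add: L2_form_def)
  qed
  then show "\<bar>L2_form (M v) (M w) - L2_form v w\<bar> \<le> 48 * C ^ 3 * \<delta> * norm v * norm w"
    using bd[OF sq_int_fn sq_int_fn ABE_measurable(1) cb(1) L2_le_norm(1) L2_le_norm(1)] Knn by (simp add: K_def)
qed

lemma M_sym_forms: "sym_form (\<lambda>v w. energy_form W (M v) (M w))" "sym_form (\<lambda>v w. L2_form (M v) (M w))"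
proof -
  have main: "sym_form (\<lambda>v w. g (M v) (M w))"
    if g: "sym_form g" and g0: "sym_form g0"
      and d: "\<And>v w. \<bar>g (M v) (M w) - g0 v w\<bar> \<le> 48 * C ^ 3 * \<delta> * norm v * norm w" for g g0
  proof -
    obtain K where K: "\<And>v w. \<bar>g0 v w\<bar> \<le> K * norm v * norm w" using sym_form_bound[OF g0] by metis
    show ?thesis
    proof (rule sym_formI[of _ "K + 48 * C ^ 3 * \<delta>"])
      show "\<bar>g (M v) (M w)\<bar> \<le> (K + 48 * C ^ 3 * \<delta>) * norm v * norm w" for v w
        using d[of v w] K[of v w] unfolding distrib_right by linarith
    qed (simp_all add: M_add M_scaleR sym_form_simps[OF g] sym_form_commute[OF g])
  qed
  show "sym_form (\<lambda>v w. energy_form W (M v) (M w))"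
    by (rule main[OF sym_form_energy[OF W_L_infty] sym_form_energy[OF V_L_infty] form_comparison(1)])
  show "sym_form (\<lambda>v w. L2_form (M v) (M w))"
    by (rule main[OF sym_form_L2 sym_form_L2 form_comparison(2)])
qed

text \<open>
The substitution moves functions by \<open>O(\<delta>)\<close> in \<open>L\<^sup>2\<close>, so closeness in \<open>H\<^sup>1\<close> before the substitution
implies closeness in \<open>L\<^sup>2\<close> after it.
\<close>
lemma M_close:
  "(LINT t|lborel. (fn (M v) t - fn u t)\<^sup>2) \<le> 2 * (C * \<delta>)\<^sup>2 * (norm v)\<^sup>2 + 2 * (norm (v - u))\<^sup>2"
proof -
  have m1: "(\<lambda>t. m t - 1) \<in> borel_measurable borel" by measurable
  have sq: "sq_int (\<lambda>t. (m t - 1) * fn v t)" by (rule sq_int_bdd_mult[OF m1 m_bounds(4) sq_int_fn])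
  have i: "integrable lborel (\<lambda>t. ((m t - 1) * fn v t)\<^sup>2)" "integrable lborel (\<lambda>t. (fn (v - u) t)\<^sup>2)"
    "integrable lborel (\<lambda>t. (fn v t)\<^sup>2)" "integrable lborel (\<lambda>t. (fn (M v) t - fn u t)\<^sup>2)"
    using sq_int_integrable[OF sq] sq_int_integrable[OF sq_int_fn] sq_int_integrable[OF sq_int_diff[OF sq_int_fn sq_int_fn]] by auto
  have "(LINT t|lborel. (fn (M v) t - fn u t)\<^sup>2) \<le> (LINT t|lborel. 2 * ((m t - 1) * fn v t)\<^sup>2 + 2 * (fn (v - u) t)\<^sup>2)"
  proof (rule integral_mono)
    show "(fn (M v) t - fn u t)\<^sup>2 \<le> 2 * ((m t - 1) * fn v t)\<^sup>2 + 2 * (fn (v - u) t)\<^sup>2" for t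
    proof -
      have "fn (M v) t - fn u t = (m t - 1) * fn v t + fn (v - u) t" by (simp add: M(1) fn_simps algebra_simps)
      moreover have "(a + b)\<^sup>2 \<le> 2 * a\<^sup>2 + 2 * b\<^sup>2" for a b :: real
        using zero_le_power2[of "a - b"] by (simp add: power2_sum power2_diff)
      ultimately show ?thesis by metis
    qed
  qed (use i in auto)
  also have "\<dots> = 2 * (LINT t|lborel. ((m t - 1) * fn v t)\<^sup>2) + 2 * (LINT t|lborel. (fn (v - u) t)\<^sup>2)" using i by simp
  also have "(LINT t|lborel. ((m t - 1) * fn v t)\<^sup>2) \<le> (LINT t|lborel. (C * \<delta>)\<^sup>2 * (fn v t)\<^sup>2)"
  proof (rule integral_mono)
    show "((m t - 1) * fn v t)\<^sup>2 \<le> (C * \<delta>)\<^sup>2 * (fn v t)\<^sup>2" for t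
    proof -
      have "(m t - 1)\<^sup>2 \<le> (C * \<delta>)\<^sup>2" using power_mono[OF m_bounds(4)[of t] abs_ge_zero, of 2] by simp
      then show ?thesis unfolding power_mult_distrib by (intro mult_right_mono) auto
    qed
  qed (use i in auto)
  also have "\<dots> = (C * \<delta>)\<^sup>2 * (LINT t|lborel. (fn v t)\<^sup>2)" by simp
  also have "\<dots> \<le> (C * \<delta>)\<^sup>2 * (norm v)\<^sup>2" by (intro mult_left_mono L2_le_norm) simp
  also have "(LINT t|lborel. (fn (v - u) t)\<^sup>2) \<le> (norm (v - u))\<^sup>2" by (rule L2_le_norm)
  finally show ?thesis by simp
qed

end

section \<open>Correctors for the oscillating potential\<close>

lemma curve_continuous:
  fixes g :: "real \<Rightarrow> real \<Rightarrow> real"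
  assumes \<delta>: "0 < \<delta>" and X: "\<And>X X' y. \<bar>g X' y - g X y\<bar> \<le> C * \<bar>X' - X\<bar>"
    and Y: "\<And>X y y'. \<bar>g X y' - g X y\<bar> \<le> C * \<bar>y' - y\<bar>"
  shows "continuous_on UNIV (\<lambda>t. g t (t / \<delta>))"
proof (rule lipschitz_on_continuous_on[of "C + C / \<delta>"], rule lipschitz_onI)
  have C: "0 \<le> C" using X[of 1 0 0] abs_ge_zero[of "g 1 0 - g 0 0"] by simp
  then show "0 \<le> C + C / \<delta>" using \<delta> by simp
  fix t t' :: real
  have "\<bar>t / \<delta> - t' / \<delta>\<bar> = \<bar>t - t'\<bar> / \<delta>" using \<delta> by (simp add: diff_divide_distrib[symmetric])
  then have "\<bar>g t' (t / \<delta>) - g t' (t' / \<delta>)\<bar> \<le> C * (\<bar>t - t'\<bar> / \<delta>)" using Y[of t' "t / \<delta>" "t' / \<delta>"] by simp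
  then have "\<bar>g t (t / \<delta>) - g t' (t' / \<delta>)\<bar> \<le> C * \<bar>t - t'\<bar> + C * (\<bar>t - t'\<bar> / \<delta>)"
    using X[of t "t / \<delta>" t'] by linarith
  also have "\<dots> = (C + C / \<delta>) * \<bar>t - t'\<bar>" by (simp add: distrib_right)
  finally show "dist (g t (t / \<delta>)) (g t' (t' / \<delta>)) \<le> (C + C / \<delta>) * dist t t'" by (simp add: dist_real_def)
qed

text \<open>
All functions are iterated antiderivatives in \<open>y\<close> of \<open>q\<close>, its first two slow derivatives \<open>q1\<close> and \<open>q2\<close>,
and \<open>p\<^sup>2\<close>. The second one enters because \<open>Z\<close> contains an antiderivative of \<open>\<partial>\<^sub>X p\<close> and has itself to
be differentiated in \<open>X\<close>.
\<close>
lemma two_scale_correctors: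
  assumes W: "W_infty 5 q" and c: "continuous_in_X q" and z: "\<And>X. torus_integral (q X) = 0"
  shows "\<exists>C\<ge>1. L_infty (V0 q) \<and> (\<forall>\<delta>. 0 < \<delta> \<longrightarrow> \<delta> \<le> 1 \<longrightarrow> \<delta> * C \<le> 1 / 2 \<longrightarrow>
    (\<exists>Q Q1 p p1 Z Z1. two_scale \<delta> C (\<lambda>t. q t (t / \<delta>)) (V0 q) Q Q1 p p1 Z Z1))"
proof -
  define q1 where "q1 = slow_deriv q"
  define q2 where "q2 = slow_deriv q1"
  obtain C0 where f0: "slow_family C0 q q1" and f1: "slow_family C0 q1 q2"
    using slow_families[OF W c] unfolding q1_def q2_def by blast
  have C0: "0 \<le> C0" by (rule slow_family_nonneg[OF f0])
  have z1: "torus_integral (q1 X) = 0" for X by (rule slow_family_deriv_mean_zero[OF f0 z])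
  define p where "p X = mean_zero_primitive (q X)" for X
  define p1 where "p1 X = mean_zero_primitive (q1 X)" for X
  define p2 where "p2 X = mean_zero_primitive (q2 X)" for X
  note mp = slow_family_mean_zero_primitive[OF f0 z, folded p_def p1_def]
  note mp1 = slow_family_mean_zero_primitive[OF f1 z1, folded p1_def p2_def]
  define V where "V X = - torus_integral (\<lambda>y. p X y * p X y)" for X
  have V0: "V0 q = V"
    unfolding V_def p_def using V0_eq[of q] slow_familyD(8,3)[OF f0] z by blast
  define S where "S X y = p X y * p X y" for X y
  define S1 where "S1 X y = p1 X y * p X y + p X y * p1 X y" for X y
  define CS where "CS = 4 * (2 * C0) * (2 * C0)"
  have sS: "slow_C1 CS S S1 y" for y
    unfolding S_def[abs_def] S1_def[abs_def] CS_def by (rule slow_C1_mult[OF mp(1) mp(1)])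
  have fS: "slow_family CS S S1"
    unfolding slow_family_def
  proof (intro conjI allI AE_I2 sS)
    fix X
    note [measurable] = slow_familyD(1,2)[OF mp(2), of X]
    show "S X \<in> borel_measurable borel" unfolding S_def[abs_def] by measurable
    show "S1 X \<in> borel_measurable borel" unfolding S1_def[abs_def] by measurable
    show "periodic1 (S X)" "periodic1 (S1 X)"
      using slow_familyD(3,4)[OF mp(2), of X] by (simp_all add: periodic1_def S_def S1_def)
  qed
  \<comment> \<open>the mean-zero function \<open>\<partial>\<^sub>X p + p\<^sup>2 + V0\<close>, with the mean of \<open>p\<^sup>2\<close> written out so that it
    inherits the bounds of \<open>slow_family_torus_integral\<close>\<close>
  define F where "F X y = p1 X y + (S X y + - 1 * torus_integral (S X))" for X y
  define F1 where "F1 X y = p2 X y + (S1 X y + - 1 * torus_integral (S1 X))" for X y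
  define CF where "CF = 2 * C0 + (CS + \<bar>- 1\<bar> * CS)"
  have sF: "slow_C1 CF F F1 y" for y
    unfolding F_def[abs_def] F1_def[abs_def] CF_def
    by (rule slow_C1_add[OF mp1(1) slow_C1_add[OF sS slow_C1_cmult[OF slow_family_torus_integral[OF fS]]]])
  have fF: "slow_family CF F F1"
    unfolding slow_family_def
  proof (intro conjI allI AE_I2 sF)
    fix X
    note [measurable] = slow_familyD(1,2)[OF mp1(2), of X] slow_familyD(1,2)[OF fS, of X]
    show "F X \<in> borel_measurable borel" unfolding F_def[abs_def] by measurable
    show "F1 X \<in> borel_measurable borel" unfolding F1_def[abs_def] by measurable
    show "periodic1 (F X)" "periodic1 (F1 X)"
      using slow_familyD(3,4)[OF mp1(2), of X] slow_familyD(3,4)[OF fS, of X] by (simp_all add: periodic1_def F_def F1_def)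
  qed
  have Fe: "F X y = p1 X y + p X y * p X y + V X" for X y by (simp add: F_def S_def[abs_def] V_def)
  have zF: "torus_integral (F X) = 0" for X
  proof -
    have "torus_integral (F X) = torus_integral (p1 X) + (torus_integral (S X) + torus_integral (\<lambda>y. - 1 * torus_integral (S X)))"
      unfolding F_def[abs_def] torus_integral_add[OF slow_familyD(8)[OF mp1(2)]
          locally_integrable_add(1)[OF slow_familyD(8)[OF fS] locally_integrable_const]]
        torus_integral_add[OF slow_familyD(8)[OF fS] locally_integrable_const] ..
    also have "torus_integral (\<lambda>y. - 1 * torus_integral (S X)) = - torus_integral (S X)"
      by (simp add: torus_integral_const)
    also have "torus_integral (p1 X) = 0" by (rule mp1(3))
    finally show ?thesis by simp
  qed
  define Q where "Q X = mean_zero_primitive (p X)" for X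
  define Q1 where "Q1 X = mean_zero_primitive (p1 X)" for X
  define Z where "Z X = mean_zero_primitive (F X)" for X
  define Z1 where "Z1 X = mean_zero_primitive (F1 X)" for X
  note mQ = slow_family_mean_zero_primitive[OF mp(2) mp(3), folded Q_def Q1_def]
  note mZ = slow_family_mean_zero_primitive[OF fF zF, folded Z_def Z1_def]
  have CS: "0 \<le> CS" and CF: "0 \<le> CF" using C0 by (simp_all add: CS_def CF_def)
  define C where "C = 1 + 4 * C0 + CS + 2 * CF"
  have CC: "1 \<le> C" "C0 \<le> C" "2 * C0 \<le> C" "2 * (2 * C0) \<le> C" "CS \<le> C" "CF \<le> C" "2 * CF \<le> C"
    using C0 CS CF by (simp_all add: C_def)
  have sQ: "slow_C1 C Q Q1 y" and sp: "slow_C1 C p p1 y" and sp1: "slow_C1 C p1 p2 y" and sZ: "slow_C1 C Z Z1 y"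
    and sF': "slow_C1 C F F1 y" for y
    by (rule slow_C1_mono[OF mQ(1) CC(4)] slow_C1_mono[OF mp(1) CC(3)] slow_C1_mono[OF mp1(1) CC(3)]
        slow_C1_mono[OF mZ(1) CC(7)] slow_C1_mono[OF sF CC(6)])+
  have up: "\<bar>a\<bar> \<le> C * \<bar>t\<bar>" if "\<bar>a\<bar> \<le> K * \<bar>t\<bar>" "K \<le> C" for a t K :: real
    using that(1) mult_right_mono[OF that(2) abs_ge_zero[of t]] by linarith
  have yQ: "\<bar>Q X y' - Q X y\<bar> \<le> C * \<bar>y' - y\<bar>" "\<bar>Q1 X y' - Q1 X y\<bar> \<le> C * \<bar>y' - y\<bar>" for X y y'
    using up[OF mQ(4) CC(3)] up[OF mQ(5) CC(3)] by auto
  have yp: "\<bar>p X y' - p X y\<bar> \<le> C * \<bar>y' - y\<bar>" "\<bar>p1 X y' - p1 X y\<bar> \<le> C * \<bar>y' - y\<bar>" for X y y'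
    using up[OF mp(4) CC(2)] up[OF mp(5) CC(2)] by auto
  have yZ: "\<bar>Z X y' - Z X y\<bar> \<le> C * \<bar>y' - y\<bar>" "\<bar>Z1 X y' - Z1 X y\<bar> \<le> C * \<bar>y' - y\<bar>" for X y y'
    using up[OF mZ(4) CC(6)] up[OF mZ(5) CC(6)] by auto
  have sV: "slow_C1 CS (\<lambda>X y. torus_integral (S X)) (\<lambda>X y. torus_integral (S1 X)) y" for y
    by (rule slow_family_torus_integral[OF fS])
  have Vb: "\<bar>V X\<bar> \<le> C" for X
    using slow_C1D(1)[OF sV, of X] CC(5) by (simp add: V_def S_def[abs_def])
  have Vc: "continuous_on UNIV V"
  proof (rule lipschitz_on_continuous_on[of CS], rule lipschitz_onI)
    show "dist (V X') (V X) \<le> CS * dist X' X" for X' X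
      using slow_C1D(3)[OF sV, of X' X] by (simp add: V_def S_def[abs_def] dist_real_def)
  qed (rule CS)
  have Vm: "V \<in> borel_measurable borel" by (rule borel_measurable_continuous_onI[OF Vc])
  have VL: "L_infty (V0 q)" unfolding V0 L_infty_def using Vm Vb by (auto intro!: exI[of _ C])
  have qj: "(\<lambda>(X, y). q X y) \<in> borel_measurable borel"
    using W unfolding W_infty_def L_infty_def by (metis le0)
  have "\<exists>Q Q1 p p1 Z Z1. two_scale \<delta> C (\<lambda>t. q t (t / \<delta>)) (V0 q) Q Q1 p p1 Z Z1"
    if \<delta>: "0 < \<delta>" "\<delta> \<le> 1" "\<delta> * C \<le> 1 / 2" for \<delta>
  proof -
    have cQ1: "continuous_on UNIV (\<lambda>t. Q1 t (t / \<delta>))" by (rule curve_continuous[OF \<delta>(1) slow_C1D(4)[OF sQ] yQ(2)])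
    have cp: "continuous_on UNIV (\<lambda>t. p t (t / \<delta>))" by (rule curve_continuous[OF \<delta>(1) slow_C1D(3)[OF sp] yp(1)])
    have cp1: "continuous_on UNIV (\<lambda>t. p1 t (t / \<delta>))" by (rule curve_continuous[OF \<delta>(1) slow_C1D(4)[OF sp] yp(2)])
    have cZ1: "continuous_on UNIV (\<lambda>t. Z1 t (t / \<delta>))" by (rule curve_continuous[OF \<delta>(1) slow_C1D(4)[OF sZ] yZ(2)])
    have cF: "continuous_on UNIV (\<lambda>t. F t (t / \<delta>))" unfolding Fe by (intro continuous_intros cp cp1 Vc)
    have "(\<lambda>t. (\<lambda>(X, y). q X y) (t, t / \<delta>)) \<in> borel_measurable borel"
      by (rule measurable_compose[OF _ qj]) measurable
    then have qm: "(\<lambda>t. q t (t / \<delta>)) \<in> borel_measurable borel" by simp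
    have "AE y in lborel. \<forall>X. \<bar>q X y\<bar> \<le> C"
      using slow_familyD(5)[OF f0]
    proof eventually_elim
      case (elim y)
      show ?case
      proof
        fix X show "\<bar>q X y\<bar> \<le> C" using slow_C1D(1)[OF elim, of X] CC(2) by linarith
      qed
    qed
    then have "AE t in lborel. \<forall>X. \<bar>q X (1 / \<delta> * t)\<bar> \<le> C" by (rule AE_lborel_scale) (use \<delta>(1) in simp)
    then have qb: "AE t in lborel. \<bar>q t (t / \<delta>)\<bar> \<le> C" by eventually_elim simp
    have ql: "locally_integrable (\<lambda>t. q t (t / \<delta>))"
    proof (rule locally_integrable_bounded[OF qm])
      show "\<exists>C. AE x in lborel. x \<in> {a..b} \<longrightarrow> \<bar>q x (x / \<delta>)\<bar> \<le> C" for a b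
        by (intro exI[of _ C] eventually_mono[OF qb]) simp
    qed
    have qLip: "AE y in lborel. \<forall>X X'. \<bar>q X' y - q X y\<bar> \<le> C * \<bar>X' - X\<bar>"
      using slow_familyD(5)[OF f0] by eventually_elim (intro allI up[OF slow_C1D(3) CC(2)])
    have PQ: "primitive (\<lambda>t. Q t (t / \<delta>)) (\<lambda>t. Q1 t (t / \<delta>) + 1 / \<delta> * p t (t / \<delta>))"
    proof (rule primitive_along_curve[OF \<delta>(1) slow_C1D(5)[OF sQ] slow_C1D(4)[OF sQ] yQ(2)])
      show "primitive (Q X) (p X)" for X unfolding Q_def by (rule primitive_mean_zero_primitive[OF slow_familyD(8)[OF mp(2)]])
      show "AE y in lborel. \<forall>X X'. \<bar>p X' y - p X y\<bar> \<le> C * \<bar>X' - X\<bar>" using slow_C1D(3)[OF sp] by simp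
    qed (intro continuous_locally_integrable cQ1 cp)+
    have Pp: "primitive (\<lambda>t. p t (t / \<delta>)) (\<lambda>t. p1 t (t / \<delta>) + 1 / \<delta> * q t (t / \<delta>))"
    proof (rule primitive_along_curve[OF \<delta>(1) slow_C1D(5)[OF sp] slow_C1D(4)[OF sp] yp(2) _ qLip _ ql])
      show "primitive (p X) (q X)" for X unfolding p_def by (rule primitive_mean_zero_primitive[OF slow_familyD(8)[OF f0]])
    qed (intro continuous_locally_integrable cp1)
    have PZ: "primitive (\<lambda>t. Z t (t / \<delta>)) (\<lambda>t. Z1 t (t / \<delta>) + 1 / \<delta> * F t (t / \<delta>))"
    proof (rule primitive_along_curve[OF \<delta>(1) slow_C1D(5)[OF sZ] slow_C1D(4)[OF sZ] yZ(2)])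
      show "primitive (Z X) (F X)" for X unfolding Z_def by (rule primitive_mean_zero_primitive[OF slow_familyD(8)[OF fF]])
      show "AE y in lborel. \<forall>X X'. \<bar>F X' y - F X y\<bar> \<le> C * \<bar>X' - X\<bar>" using slow_C1D(3)[OF sF'] by simp
    qed (intro continuous_locally_integrable cZ1 cF)+
    have "two_scale \<delta> C (\<lambda>t. q t (t / \<delta>)) (V0 q) (\<lambda>t. Q t (t / \<delta>)) (\<lambda>t. Q1 t (t / \<delta>)) (\<lambda>t. p t (t / \<delta>))
      (\<lambda>t. p1 t (t / \<delta>)) (\<lambda>t. Z t (t / \<delta>)) (\<lambda>t. Z1 t (t / \<delta>))"
      unfolding V0
    proof (rule two_scale.intro[OF \<delta> CC(1) qm Vm])
      show "(\<lambda>t. Q1 t (t / \<delta>)) \<in> borel_measurable borel" "(\<lambda>t. p1 t (t / \<delta>)) \<in> borel_measurable borel"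
        "(\<lambda>t. Z1 t (t / \<delta>)) \<in> borel_measurable borel"
        by (intro borel_measurable_continuous_onI cQ1 cp1 cZ1)+
      show "primitive (\<lambda>t. Z t (t / \<delta>)) (\<lambda>t. Z1 t (t / \<delta>) + 1 / \<delta> * (p1 t (t / \<delta>) + p t (t / \<delta>) * p t (t / \<delta>) + V t))"
        using PZ unfolding Fe .
    qed (use Vb slow_C1D(1,2)[OF sQ] slow_C1D(1,2)[OF sp] slow_C1D(1,2)[OF sZ] qb PQ Pp in auto)
    then show ?thesis by blast
  qed
  with VL CC(1) show ?thesis by blast
qed

section \<open>Eigenfunctions of the oscillating operator\<close>

text \<open>
By simplicity, a complex eigenfunction is a unimodular multiple of the real one. The multiple carries
over to the perturbed eigenfunction and fixes its sign, or phase.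
\<close>
lemma normalized_eigenfunction_multiple:
  assumes V: "L_infty V" and v: "eigenvector V \<mu> v" "L2_form v v = 1"
    and \<phi>: "normalized_eigenfunction V \<mu> \<phi>"
  shows "\<exists>c. cmod c = 1 \<and> (AE x in lborel. \<phi> x = c * complex_of_real (fn v x)) \<and> ((\<forall>x. \<phi> x \<in> \<real>) \<longrightarrow> c \<in> \<real>)"
proof -
  have v0: "v \<noteq> 0" using v(2) by (auto simp: sym_form_simps[OF sym_form_L2])
  have ef: "eigenfunction V \<mu> \<phi>" and n: "L2_norm \<phi> = 1" using \<phi> by (auto simp: normalized_eigenfunction_def)
  have \<phi>m: "\<phi> \<in> borel_measurable borel"
    using ef unfolding eigenfunction_def schroedinger_def L2_def by blast
  obtain a b where ab: "eigenvector V \<mu> a" "eigenvector V \<mu> b" and eq: "AE x in lborel. \<phi> x = Complex (fn a x) (fn b x)"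
    by (rule eigenfunction_components[OF V ef])
  obtain \<alpha> where \<alpha>: "a = \<alpha> *\<^sub>R v" using eigenvector_simple[OF V v(1) v0 ab(1)] by blast
  obtain \<beta> where \<beta>: "b = \<beta> *\<^sub>R v" using eigenvector_simple[OF V v(1) v0 ab(2)] by blast
  define c where "c = Complex \<alpha> \<beta>"
  have \<phi>c: "AE x in lborel. \<phi> x = c * complex_of_real (fn v x)"
    using eq by eventually_elim (simp add: \<alpha> \<beta> fn_simps c_def complex_eq_iff)
  have "L2_norm \<phi> = L2_norm (\<lambda>x. c * complex_of_real (fn v x))"
    unfolding L2_norm_def by (rule arg_cong[where f = sqrt], rule integral_cong_AE) (use \<phi>m \<phi>c in auto)
  then have "cmod c = 1" using n v(2) by (simp add: L2_norm_of_real)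
  moreover have "c \<in> \<real>" if r: "\<forall>x. \<phi> x \<in> \<real>"
  proof -
    have "AE x in lborel. fn b x = fn 0 x"
      using eq
    proof eventually_elim
      case (elim x)
      then have "Im (\<phi> x) = fn b x" by simp
      then show ?case using r complex_is_Real_iff by (simp add: fn_zero)
    qed
    then have "b = 0" by (rule h1_AE_eqI)
    then have "\<beta> = 0" using v0 \<beta> by simp
    then show ?thesis by (simp add: c_def complex_is_Real_iff)
  qed
  ultimately show ?thesis using \<phi>c by blast
qed

text \<open>
The factor \<open>sqrt \<epsilon>\<close> makes the rescaling unitary.
\<close>
lemma rescaled_eigenfunction:
  assumes V: "L_infty V" and u: "eigenvector V l u" "L2_form u u = 1" and \<epsilon>: "0 < \<epsilon>" and c: "cmod c = 1"
    and \<phi>: "AE x in lborel. \<phi> x = c * complex_of_real (fn v x)" "\<phi> \<in> borel_measurable borel"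
  shows "normalized_eigenfunction (\<lambda>x. \<epsilon>\<^sup>2 * V (\<epsilon> * x)) (\<epsilon>\<^sup>2 * l) (\<lambda>x. c * complex_of_real (sqrt \<epsilon> * fn u (\<epsilon> * x)))"
    and "L2_norm (\<lambda>x. c * complex_of_real (sqrt \<epsilon> * fn u (\<epsilon> * x)) - of_real (\<epsilon> powr (1 / 2)) * \<phi> (\<epsilon> * x))
      = sqrt (LINT t|lborel. (fn u t - fn v t)\<^sup>2)"
proof -
  have scale: "\<epsilon> * (LINT x|lborel. g (\<epsilon> * x)) = (LINT t|lborel. g t)" for g :: "real \<Rightarrow> real"
    using lborel_integral_real_affine[of \<epsilon> g 0] \<epsilon> by simp
  obtain w where w: "eigenvector (\<lambda>x. \<epsilon>\<^sup>2 * V (\<epsilon> * x)) (\<epsilon>\<^sup>2 * l) w" "\<And>x. fn w x = fn u (\<epsilon> * x)"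
    using eigenvector_scale[OF V u(1) \<epsilon>] by blast
  define y where "y = sqrt \<epsilon> *\<^sub>R w"
  have y: "fn y x = sqrt \<epsilon> * fn u (\<epsilon> * x)" for x by (simp add: y_def fn_simps w)
  have VL: "L_infty (\<lambda>x. \<epsilon>\<^sup>2 * V (\<epsilon> * x))" using L_infty_scale[OF V] \<epsilon> by simp
  have ye: "eigenvector (\<lambda>x. \<epsilon>\<^sup>2 * V (\<epsilon> * x)) (\<epsilon>\<^sup>2 * l) y" unfolding y_def by (rule eigenvector_scaleR[OF VL w(1)])
  have "L2_form y y = (LINT x|lborel. \<epsilon> * (fn u (\<epsilon> * x) * fn u (\<epsilon> * x)))"
    unfolding L2_form_def y
  proof (rule Bochner_Integration.integral_cong[OF refl])
    fix x
    have "sqrt \<epsilon> * sqrt \<epsilon> = \<epsilon>" using \<epsilon> by simp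
    then show "sqrt \<epsilon> * fn u (\<epsilon> * x) * (sqrt \<epsilon> * fn u (\<epsilon> * x)) = \<epsilon> * (fn u (\<epsilon> * x) * fn u (\<epsilon> * x))"
      by (metis mult.assoc mult.left_commute)
  qed
  also have "\<dots> = L2_form u u"
    using scale[of "\<lambda>t. fn u t * fn u t"] by (simp only: L2_form_def integral_mult_right_zero)
  finally have by1: "L2_form y y = 1" using u(2) by simp
  have y0: "y \<noteq> 0" using by1 by (auto simp: sym_form_simps[OF sym_form_L2])
  have "c \<noteq> 0" using c by auto
  from eigenvector_imp_eigenfunction[OF VL ye y0 this]
  show "normalized_eigenfunction (\<lambda>x. \<epsilon>\<^sup>2 * V (\<epsilon> * x)) (\<epsilon>\<^sup>2 * l) (\<lambda>x. c * complex_of_real (sqrt \<epsilon> * fn u (\<epsilon> * x)))"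
    unfolding normalized_eigenfunction_def using L2_norm_of_real[of c y] c by1 unfolding y by simp
  have pw: "\<epsilon> powr (1 / 2) = sqrt \<epsilon>" using \<epsilon> by (simp add: powr_half_sqrt)
  have "AE x in lborel. \<phi> (\<epsilon> * x) = c * complex_of_real (fn v (\<epsilon> * x))"
    using AE_lborel_scale[OF \<phi>(1)] \<epsilon> by simp
  then have ae: "AE x in lborel. (cmod (c * complex_of_real (sqrt \<epsilon> * fn u (\<epsilon> * x)) - of_real (\<epsilon> powr (1 / 2)) * \<phi> (\<epsilon> * x)))\<^sup>2
      = \<epsilon> * (fn u (\<epsilon> * x) - fn v (\<epsilon> * x))\<^sup>2"
  proof eventually_elim
    case (elim x)
    have "c * complex_of_real (sqrt \<epsilon> * fn u (\<epsilon> * x)) - of_real (\<epsilon> powr (1 / 2)) * \<phi> (\<epsilon> * x)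
        = c * complex_of_real (sqrt \<epsilon> * (fn u (\<epsilon> * x) - fn v (\<epsilon> * x)))"
      unfolding elim pw by (simp add: algebra_simps)
    then have "cmod (c * complex_of_real (sqrt \<epsilon> * fn u (\<epsilon> * x)) - of_real (\<epsilon> powr (1 / 2)) * \<phi> (\<epsilon> * x))
        = \<bar>sqrt \<epsilon> * (fn u (\<epsilon> * x) - fn v (\<epsilon> * x))\<bar>" by (simp only: norm_mult c norm_of_real mult_1)
    then show ?case using \<epsilon> by (simp add: power_mult_distrib)
  qed
  note [measurable] = \<phi>(2)
  have "(LINT x|lborel. (cmod (c * complex_of_real (sqrt \<epsilon> * fn u (\<epsilon> * x)) - of_real (\<epsilon> powr (1 / 2)) * \<phi> (\<epsilon> * x)))\<^sup>2)
      = (LINT x|lborel. \<epsilon> * (fn u (\<epsilon> * x) - fn v (\<epsilon> * x))\<^sup>2)"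
    by (rule integral_cong_AE[OF _ _ ae]) measurable
  also have "\<dots> = (LINT t|lborel. (fn u t - fn v t)\<^sup>2)"
    using scale[of "\<lambda>t. (fn u t - fn v t)\<^sup>2"] by (simp only: integral_mult_right_zero)
  finally show "L2_norm (\<lambda>x. c * complex_of_real (sqrt \<epsilon> * fn u (\<epsilon> * x)) - of_real (\<epsilon> powr (1 / 2)) * \<phi> (\<epsilon> * x))
      = sqrt (LINT t|lborel. (fn u t - fn v t)\<^sup>2)" by (simp add: L2_norm_def)
qed

theorem proposition1p10:
  fixes q :: "real \<Rightarrow> real \<Rightarrow> real" and N :: nat
  assumes "\<forall>X. periodic1 (q X)"
    and "W_infty 5 q"
    and "continuous_in_X q"
    and "\<forall>X. torus_integral (q X) = 0"
    and "L_infty (\<lambda>X. japanese_bracket X * deriv (V0 q) X)"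
    and "L_infty (\<lambda>X. japanese_bracket X * deriv (V1 q) X)"
    and "(V0 q \<longlongrightarrow> 0) at_infinity"
    and "(V1 q \<longlongrightarrow> 0) at_infinity"
    and "\<not> (AE X in lborel. V0 q X = 0)"
    and "integrable lborel (\<lambda>X. (1 + \<bar>X\<bar>) * V0 q X)"
    and "N = card (negative_eigenvalues (V0 q))"
  shows "finite (negative_eigenvalues (V0 q)) \<and>
    (\<exists>\<epsilon>\<^sub>0>0. \<exists>C::real. \<forall>\<epsilon>\<in>{0<..<\<epsilon>\<^sub>0}. \<exists>l :: nat \<Rightarrow> real.
       strict_mono_on {1..N} l \<and>
       (\<forall>n\<in>{1..N}.
          l n \<in> negative_eigenvalues (oscillating_potential q \<epsilon> 1) \<and>
          \<bar>l n - \<epsilon>\<^sup>2 * nth_negative_eigenvalue (V0 q) n\<bar> \<le> C * \<epsilon> ^ 4 \<and>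
          (\<forall>\<phi>. normalized_eigenfunction (V0 q) (nth_negative_eigenvalue (V0 q) n) \<phi> \<longrightarrow>
             (\<exists>\<psi>. normalized_eigenfunction (oscillating_potential q \<epsilon> 1) (l n) \<psi> \<and>
                  ((\<forall>x. \<phi> x \<in> \<real>) \<longrightarrow> (\<forall>x. \<psi> x \<in> \<real>)) \<and>
                  L2_norm (\<lambda>x. \<psi> x - of_real (\<epsilon> powr (1 / 2)) * \<phi> (\<epsilon> * x)) \<le> C * \<epsilon>\<^sup>2))) \<and>
       (\<forall>\<mu>\<in>negative_eigenvalues (oscillating_potential q \<epsilon> 1) - l ` {1..N}. \<bar>\<mu>\<bar> \<le> C * \<epsilon> ^ 4))"
proof -
  obtain C1 where C1: "1 \<le> C1" and VL: "L_infty (V0 q)"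
    and ts: "\<And>\<delta>. 0 < \<delta> \<Longrightarrow> \<delta> \<le> 1 \<Longrightarrow> \<delta> * C1 \<le> 1 / 2 \<Longrightarrow>
      \<exists>Q Q1 p p1 Z Z1. two_scale \<delta> C1 (\<lambda>t. q t (t / \<delta>)) (V0 q) Q Q1 p p1 Z Z1"
    using two_scale_correctors[OF assms(2,3)] assms(4) by blast
  define lam where "lam = nth_negative_eigenvalue (V0 q)"
  have fin: "finite (negative_eigenvalues (V0 q))"
    using spectral_decomposition[OF VL assms(10)] by blast
  obtain \<phi>0 K and P :: "real set" where sd: "negative_eigenpairs (energy_form (V0 q)) L2_form \<phi>0 lam N K 1 P (\<lambda>x v. fn v x)"
    using spectral_decomposition[OF VL assms(10)] unfolding lam_def assms(11) by blast
  interpret S: negative_eigenpairs "energy_form (V0 q)" L2_form \<phi>0 lam N K 1 P "\<lambda>x v. fn v x" by (rule sd)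
  obtain C2 \<delta>2 where C2: "0 < C2" and \<delta>2: "0 < \<delta>2" and pert: "\<And>\<delta> h b. S.near \<delta> h b \<Longrightarrow> 0 < \<delta> \<Longrightarrow> \<delta> < \<delta>2 \<Longrightarrow>
     (\<exists>l \<psi>. strict_mono_on {1..N} l \<and>
        (\<forall>n\<in>{1..N}. l n < 0 \<and> \<bar>l n - lam n\<bar> \<le> C2 * \<delta> \<and> (\<forall>w. h (\<psi> n) w = l n * b (\<psi> n) w) \<and>
           b (\<psi> n) (\<psi> n) = 1 \<and> norm (\<psi> n - \<phi>0 n) \<le> C2 * \<delta>) \<and>
        (\<forall>\<mu> v. \<mu> < 0 \<longrightarrow> v \<noteq> 0 \<longrightarrow> (\<forall>w. h v w = \<mu> * b v w) \<longrightarrow> \<mu> \<notin> l ` {1..N} \<longrightarrow> \<bar>\<mu>\<bar> \<le> C2 * \<delta>))"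
    using S.perturbation by metis
  define c1 where "c1 = 48 * C1 ^ 3"
  have c1: "0 < c1" using C1 by (simp add: c1_def)
  define C3 where "C3 = C2 * c1"
  have C3: "0 < C3" using C2 c1 by (simp add: C3_def)
  \<comment> \<open>\<open>C3\<close> bounds the error in \<open>H\<^sup>1\<close> before the substitution, \<open>C4\<close> the error in \<open>L\<^sup>2\<close> after it\<close>
  define C4 where "C4 = 2 * (C1 * (S.\<Phi> + C3) + C3)"
  have \<Phi>1: "1 \<le> S.\<Phi>" by (rule S.\<Phi>_ge(1))
  define C where "C = C3 + C4"
  have C4: "0 \<le> C4" using C1 C3 \<Phi>1 by (simp add: C4_def)
  \<comment> \<open>the two bounds make \<open>\<delta> * C1 \<le> 1 / 2\<close>, so that the multiplier is invertible, and \<open>c1 * \<delta> < \<delta>2\<close>\<close>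
  define \<epsilon>0 where "\<epsilon>0 = sqrt (min (1 / (2 * C1)) (\<delta>2 / c1))"
  have \<epsilon>0: "0 < \<epsilon>0" using C1 c1 \<delta>2 by (simp add: \<epsilon>0_def)
  show ?thesis
  proof (intro conjI fin, rule exI[of _ \<epsilon>0], intro conjI \<epsilon>0, rule exI[of _ C], rule ballI)
    fix \<epsilon> assume "\<epsilon> \<in> {0<..<\<epsilon>0}"
    then have \<epsilon>: "0 < \<epsilon>" "\<epsilon> < \<epsilon>0" by auto
    define \<delta> where "\<delta> = \<epsilon>\<^sup>2"
    have \<delta>: "0 < \<delta>" using \<epsilon> by (simp add: \<delta>_def)
    have "\<delta> < \<epsilon>0\<^sup>2" unfolding \<delta>_def using \<epsilon> by (intro power_strict_mono) auto
    also have "\<epsilon>0\<^sup>2 = min (1 / (2 * C1)) (\<delta>2 / c1)" using C1 c1 \<delta>2 by (simp add: \<epsilon>0_def)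
    finally have \<delta>s: "\<delta> < 1 / (2 * C1)" "\<delta> < \<delta>2 / c1" by auto
    have \<delta>C: "\<delta> * C1 \<le> 1 / 2" using \<delta>s(1) C1 by (simp add: field_simps)
    have \<delta>1: "\<delta> \<le> 1"
    proof -
      have "\<delta> * 1 \<le> \<delta> * C1" using C1 \<delta> by (intro mult_left_mono) auto
      then show ?thesis using \<delta>C by linarith
    qed
    have c\<delta>: "0 < c1 * \<delta>" "c1 * \<delta> < \<delta>2" using c1 \<delta> \<delta>s(2) by (simp_all add: field_simps)
    obtain Q Q1 p p1 Z Z1 where "two_scale \<delta> C1 (\<lambda>t. q t (t / \<delta>)) (V0 q) Q Q1 p p1 Z Z1" using ts[OF \<delta> \<delta>1 \<delta>C] by blast
    then interpret T: two_scale \<delta> C1 "\<lambda>t. q t (t / \<delta>)" "V0 q" Q Q1 p p1 Z Z1 .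
    define h where "h v w = energy_form T.W (T.M v) (T.M w)" for v w
    define b where "b v w = L2_form (T.M v) (T.M w)" for v w
    have near: "S.near (c1 * \<delta>) h b"
      unfolding S.near_def
    proof (intro conjI allI impI)
      show "sym_form h" "sym_form b" using T.M_sym_forms unfolding h_def[abs_def] b_def[abs_def] .
      show "0 < b v v" if "v \<noteq> 0" for v unfolding b_def by (rule L2_form_pos) (use T.M_eq_0 that in blast)
      show "\<bar>h v w - energy_form (V0 q) v w\<bar> \<le> c1 * \<delta> * norm v * norm w" for v w
        unfolding h_def c1_def by (rule T.form_comparison(1))
      show "\<bar>b v w - L2_form v w\<bar> \<le> c1 * \<delta> * norm v * norm w" for v w
        unfolding b_def c1_def by (rule T.form_comparison(2))
    qed
    obtain l \<psi> where mono: "strict_mono_on {1..N} l"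
      and all: "\<forall>n\<in>{1..N}. l n < 0 \<and> \<bar>l n - lam n\<bar> \<le> C2 * (c1 * \<delta>) \<and> (\<forall>w. h (\<psi> n) w = l n * b (\<psi> n) w) \<and>
           b (\<psi> n) (\<psi> n) = 1 \<and> norm (\<psi> n - \<phi>0 n) \<le> C2 * (c1 * \<delta>)"
      and oth: "\<forall>\<mu> v. \<mu> < 0 \<longrightarrow> v \<noteq> 0 \<longrightarrow> (\<forall>w. h v w = \<mu> * b v w) \<longrightarrow> \<mu> \<notin> l ` {1..N} \<longrightarrow> \<bar>\<mu>\<bar> \<le> C2 * (c1 * \<delta>)"
      using pert[OF near c\<delta>] by (elim exE conjE)
    have l: "\<And>n. n \<in> {1..N} \<Longrightarrow> l n < 0" "\<And>n. n \<in> {1..N} \<Longrightarrow> \<bar>l n - lam n\<bar> \<le> C2 * (c1 * \<delta>)"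
      and ev: "\<And>n w. n \<in> {1..N} \<Longrightarrow> h (\<psi> n) w = l n * b (\<psi> n) w"
      and bn: "\<And>n. n \<in> {1..N} \<Longrightarrow> b (\<psi> n) (\<psi> n) = 1"
      and close: "\<And>n. n \<in> {1..N} \<Longrightarrow> norm (\<psi> n - \<phi>0 n) \<le> C2 * (c1 * \<delta>)"
      and other: "\<And>\<mu> v. \<mu> < 0 \<Longrightarrow> v \<noteq> 0 \<Longrightarrow> (\<forall>w. h v w = \<mu> * b v w) \<Longrightarrow> \<mu> \<notin> l ` {1..N} \<Longrightarrow> \<bar>\<mu>\<bar> \<le> C2 * (c1 * \<delta>)"
      using all oth by blast+
    have C3\<delta>: "C2 * (c1 * \<delta>) = C3 * \<delta>" by (simp add: C3_def)
    \<comment> \<open>eigenvectors of the transformed forms are those of the oscillating form, as \<open>T.M\<close> is onto\<close>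
    have evM: "eigenvector T.W (l n) (T.M (\<psi> n))" if "n \<in> {1..N}" for n
      unfolding eigenvector_def
    proof
      fix w
      obtain w' where "T.M w' = w" using T.M_surj by blast
      then show "energy_form T.W (T.M (\<psi> n)) w = l n * L2_form (T.M (\<psi> n)) w" using ev[OF that, of w'] by (simp add: h_def b_def)
    qed
    have osc: "oscillating_potential q \<epsilon> 1 = (\<lambda>x. \<epsilon>\<^sup>2 * T.W (\<epsilon> * x))"
    proof
      fix x
      have "\<epsilon>\<^sup>2 * (1 / \<delta>) = 1" "\<epsilon> * x / \<delta> = x / \<epsilon>" using \<epsilon> by (simp_all add: \<delta>_def power2_eq_square)
      then have "\<epsilon>\<^sup>2 * (1 / \<delta>) * q (\<epsilon> * x) (\<epsilon> * x / \<delta>) = oscillating_potential q \<epsilon> 1 x"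
        using \<epsilon> by (simp only: oscillating_potential_def powr_one mult_1)
      then show "oscillating_potential q \<epsilon> 1 x = \<epsilon>\<^sup>2 * T.W (\<epsilon> * x)" by (simp only: T.W_def mult.assoc)
    qed
    have oL: "L_infty (oscillating_potential q \<epsilon> 1)" unfolding osc using L_infty_scale[OF T.W_L_infty] \<epsilon> by simp
    define L where "L n = \<epsilon>\<^sup>2 * l n" for n
    have \<epsilon>4: "\<epsilon>\<^sup>2 * \<delta> = \<epsilon> ^ 4" by (simp add: \<delta>_def power_add[symmetric] flip: power_add)
    have up: "C3 * x \<le> C * x" "C4 * x \<le> C * x" if "0 \<le> x" for x
      using C3 C4 that by (simp_all add: C_def mult_right_mono)
    show "\<exists>l :: nat \<Rightarrow> real.
       strict_mono_on {1..N} l \<and>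
       (\<forall>n\<in>{1..N}.
          l n \<in> negative_eigenvalues (oscillating_potential q \<epsilon> 1) \<and>
          \<bar>l n - \<epsilon>\<^sup>2 * nth_negative_eigenvalue (V0 q) n\<bar> \<le> C * \<epsilon> ^ 4 \<and>
          (\<forall>\<phi>. normalized_eigenfunction (V0 q) (nth_negative_eigenvalue (V0 q) n) \<phi> \<longrightarrow>
             (\<exists>\<psi>. normalized_eigenfunction (oscillating_potential q \<epsilon> 1) (l n) \<psi> \<and>
                  ((\<forall>x. \<phi> x \<in> \<real>) \<longrightarrow> (\<forall>x. \<psi> x \<in> \<real>)) \<and>
                  L2_norm (\<lambda>x. \<psi> x - of_real (\<epsilon> powr (1 / 2)) * \<phi> (\<epsilon> * x)) \<le> C * \<epsilon>\<^sup>2))) \<and>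
       (\<forall>\<mu>\<in>negative_eigenvalues (oscillating_potential q \<epsilon> 1) - l ` {1..N}. \<bar>\<mu>\<bar> \<le> C * \<epsilon> ^ 4)"
    proof (rule exI[of _ L], intro conjI ballI allI impI)
      show "strict_mono_on {1..N} L"
      proof (rule strict_mono_onI)
        fix i j assume "i \<in> {1..N}" "j \<in> {1..N}" "i < j"
        then have "l i < l j" using strict_mono_onD[OF mono] by blast
        then show "L i < L j" using \<epsilon> by (simp add: L_def)
      qed
    next
      fix n assume n: "n \<in> {1..N}"
      have M0: "T.M (\<psi> n) \<noteq> 0" using bn[OF n] by (auto simp: b_def sym_form_simps[OF sym_form_L2])
      obtain w where w: "eigenvector (oscillating_potential q \<epsilon> 1) (L n) w" "\<And>x. fn w x = fn (T.M (\<psi> n)) (\<epsilon> * x)"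
        using eigenvector_scale[OF T.W_L_infty evM[OF n] \<epsilon>(1)] unfolding osc L_def by blast
      have "w \<noteq> 0"
      proof
        assume "w = 0"
        then have "fn (T.M (\<psi> n)) (\<epsilon> * (t / \<epsilon>)) = 0" for t using w(2) by (metis fn_zero)
        then have "T.M (\<psi> n) = 0" using \<epsilon> by (intro h1_eqI) (simp add: fn_zero)
        then show False using M0 by simp
      qed
      moreover have "L n < 0" using l(1)[OF n] \<epsilon> by (simp add: L_def mult_pos_neg)
      ultimately show "L n \<in> negative_eigenvalues (oscillating_potential q \<epsilon> 1)"
        unfolding negative_eigenvalues_iff[OF oL] using w(1) by blast
      have "\<bar>L n - \<epsilon>\<^sup>2 * lam n\<bar> = \<epsilon>\<^sup>2 * \<bar>l n - lam n\<bar>"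
        unfolding L_def right_diff_distrib[symmetric] abs_mult by simp
      also have "\<dots> \<le> \<epsilon>\<^sup>2 * (C3 * \<delta>)" using l(2)[OF n] unfolding C3\<delta> by (intro mult_left_mono) auto
      also have "\<dots> = C3 * \<epsilon> ^ 4" using \<epsilon>4 by (simp add: mult.left_commute)
      also have "\<dots> \<le> C * \<epsilon> ^ 4" using \<epsilon> by (intro up) simp
      finally show "\<bar>L n - \<epsilon>\<^sup>2 * nth_negative_eigenvalue (V0 q) n\<bar> \<le> C * \<epsilon> ^ 4" by (simp add: lam_def)
      fix \<phi> assume \<phi>: "normalized_eigenfunction (V0 q) (nth_negative_eigenvalue (V0 q) n) \<phi>"
      have \<phi>m: "\<phi> \<in> borel_measurable borel"
        using \<phi> unfolding normalized_eigenfunction_def eigenfunction_def schroedinger_def L2_def by blast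
      have e0: "eigenvector (V0 q) (lam n) (\<phi>0 n)" unfolding eigenvector_def using S.eig[OF n] by blast
      have b0: "L2_form (\<phi>0 n) (\<phi>0 n) = 1" using S.orth[OF n n] by simp
      obtain c where c: "cmod c = 1" "AE x in lborel. \<phi> x = c * complex_of_real (fn (\<phi>0 n) x)"
        "(\<forall>x. \<phi> x \<in> \<real>) \<longrightarrow> c \<in> \<real>"
        using normalized_eigenfunction_multiple[OF VL e0 b0 \<phi>[folded lam_def]] by blast
      note re = rescaled_eigenfunction[OF T.W_L_infty evM[OF n] bn[OF n, unfolded b_def] \<epsilon>(1) c(1,2) \<phi>m]
      show "\<exists>\<psi>. normalized_eigenfunction (oscillating_potential q \<epsilon> 1) (L n) \<psi> \<and>
                  ((\<forall>x. \<phi> x \<in> \<real>) \<longrightarrow> (\<forall>x. \<psi> x \<in> \<real>)) \<and>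
                  L2_norm (\<lambda>x. \<psi> x - of_real (\<epsilon> powr (1 / 2)) * \<phi> (\<epsilon> * x)) \<le> C * \<epsilon>\<^sup>2"
      proof (intro exI conjI)
        show "normalized_eigenfunction (oscillating_potential q \<epsilon> 1) (L n)
            (\<lambda>x. c * complex_of_real (sqrt \<epsilon> * fn (T.M (\<psi> n)) (\<epsilon> * x)))"
          unfolding osc L_def by (rule re(1))
        show "(\<forall>x. \<phi> x \<in> \<real>) \<longrightarrow> (\<forall>x. c * complex_of_real (sqrt \<epsilon> * fn (T.M (\<psi> n)) (\<epsilon> * x)) \<in> \<real>)"
          using c(3) Reals_mult Reals_of_real by blast
        have d: "norm (\<psi> n - \<phi>0 n) \<le> C3 * \<delta>" using close[OF n] unfolding C3\<delta> .
        have "C3 * \<delta> \<le> C3 * 1" using \<delta>1 C3 by (intro mult_left_mono) auto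
        then have nn: "norm (\<psi> n) \<le> S.\<Phi> + C3"
          using norm_triangle_ineq[of "\<psi> n - \<phi>0 n" "\<phi>0 n"] S.\<Phi>_ge(2)[OF n] d by simp
        have "(LINT t|lborel. (fn (T.M (\<psi> n)) t - fn (\<phi>0 n) t)\<^sup>2) \<le> 2 * (C1 * \<delta>)\<^sup>2 * (norm (\<psi> n))\<^sup>2 + 2 * (norm (\<psi> n - \<phi>0 n))\<^sup>2"
          by (rule T.M_close)
        also have "\<dots> \<le> 2 * (C1 * \<delta>)\<^sup>2 * (S.\<Phi> + C3)\<^sup>2 + 2 * (C3 * \<delta>)\<^sup>2"
          using nn d by (intro add_mono mult_left_mono power_mono) auto
        also have "\<dots> = 2 * ((C1 * (S.\<Phi> + C3))\<^sup>2 + C3\<^sup>2) * \<delta>\<^sup>2"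
          unfolding power_mult_distrib by (simp only: distrib_left distrib_right mult_ac)
        also have "\<dots> \<le> (C4 * \<delta>)\<^sup>2"
        proof -
          have "0 \<le> C1 * (S.\<Phi> + C3)" using C1 C3 \<Phi>1 by simp
          then have "0 \<le> C1 * (S.\<Phi> + C3) * C3" using C3 by simp
          then have "(C1 * (S.\<Phi> + C3))\<^sup>2 + C3\<^sup>2 \<le> (C1 * (S.\<Phi> + C3) + C3)\<^sup>2"
            unfolding power2_sum by linarith
          then have "2 * ((C1 * (S.\<Phi> + C3))\<^sup>2 + C3\<^sup>2) \<le> 2 * (C1 * (S.\<Phi> + C3) + C3)\<^sup>2" by simp
          also have "\<dots> \<le> C4\<^sup>2" unfolding C4_def power_mult_distrib by simp
          finally show ?thesis unfolding power_mult_distrib by (intro mult_right_mono) auto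
        qed
        finally have "sqrt (LINT t|lborel. (fn (T.M (\<psi> n)) t - fn (\<phi>0 n) t)\<^sup>2) \<le> C4 * \<delta>"
          using C4 \<delta> by (intro real_le_lsqrt) auto
        also have "\<dots> \<le> C * \<epsilon>\<^sup>2" unfolding \<delta>_def by (intro up) simp
        finally show "L2_norm (\<lambda>x. c * complex_of_real (sqrt \<epsilon> * fn (T.M (\<psi> n)) (\<epsilon> * x)) - of_real (\<epsilon> powr (1 / 2)) * \<phi> (\<epsilon> * x)) \<le> C * \<epsilon>\<^sup>2"
          unfolding re(2) .
      qed
    next
      fix \<mu> assume \<mu>: "\<mu> \<in> negative_eigenvalues (oscillating_potential q \<epsilon> 1) - L ` {1..N}"
      then have "\<mu> \<in> negative_eigenvalues (oscillating_potential q \<epsilon> 1)" by (rule DiffD1)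
      then have "\<mu> < 0 \<and> (\<exists>v. v \<noteq> 0 \<and> eigenvector (oscillating_potential q \<epsilon> 1) \<mu> v)"
        unfolding negative_eigenvalues_iff[OF oL] .
      then obtain u where u: "\<mu> < 0" "u \<noteq> 0" "eigenvector (oscillating_potential q \<epsilon> 1) \<mu> u" by (elim conjE exE)
      define \<nu> where "\<nu> = (1 / \<epsilon>)\<^sup>2 * \<mu>"
      have \<mu>\<nu>: "\<mu> = \<epsilon>\<^sup>2 * \<nu>" using \<epsilon> by (simp add: \<nu>_def power_divide)
      have pot: "(\<lambda>x. (1 / \<epsilon>)\<^sup>2 * oscillating_potential q \<epsilon> 1 (1 / \<epsilon> * x)) = T.W"
        unfolding osc using \<epsilon> by (auto simp: power_divide)
      obtain w where w: "eigenvector T.W \<nu> w" "\<And>x. fn w x = fn u (1 / \<epsilon> * x)"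
      proof -
        have "0 < 1 / \<epsilon>" using \<epsilon> by simp
        from eigenvector_scale[OF oL u(3) this] obtain w where "eigenvector T.W \<nu> w" "\<forall>x. fn w x = fn u (1 / \<epsilon> * x)"
          unfolding pot \<nu>_def[symmetric] by (elim exE conjE)
        then show ?thesis by (intro that[of w]) simp_all
      qed
      obtain v where v: "T.M v = w" using T.M_surj by blast
      have "v \<noteq> 0"
      proof
        assume "v = 0"
        then have "w = 0" using T.M_scaleR[of 0 v] v by simp
        then have "fn u (1 / \<epsilon> * (\<epsilon> * t)) = 0" for t using w(2) by (metis fn_zero)
        then have "u = 0" using \<epsilon> by (intro h1_eqI) (simp add: fn_zero)
        then show False using u(2) by simp
      qed
      moreover have "\<forall>w'. h v w' = \<nu> * b v w'" using w(1) unfolding eigenvector_def h_def b_def v by blast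
      moreover have "\<nu> < 0" using u(1) \<epsilon> by (simp add: \<nu>_def mult_pos_neg)
      moreover have "\<nu> \<notin> l ` {1..N}" using \<mu> unfolding \<mu>\<nu> L_def by blast
      ultimately have "\<bar>\<nu>\<bar> \<le> C3 * \<delta>" using other[of \<nu> v] unfolding C3\<delta> by (simp only: simp_thms)
      then have "\<epsilon>\<^sup>2 * \<bar>\<nu>\<bar> \<le> \<epsilon>\<^sup>2 * (C3 * \<delta>)" by (intro mult_left_mono) auto
      also have "\<dots> = C3 * \<epsilon> ^ 4" using \<epsilon>4 by (simp add: mult.left_commute)
      also have "\<dots> \<le> C * \<epsilon> ^ 4" using \<epsilon> by (intro up) simp
      finally show "\<bar>\<mu>\<bar> \<le> C * \<epsilon> ^ 4" unfolding \<mu>\<nu> abs_mult by simp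
    qed
  qed
qed

end
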